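(* Let $\omega$ be a bounded polygonal domain of $\mathbb{R}^2$, let $\omega_\varepsilon=\varepsilon\omega$ for $\varepsilon>0$, and let $\mathbf{B}\in\mathbb{R}^3\setminus\{0\}$ be a constant magnetic field. (a) Let $\varepsilon_0>0$ and let $(\Omega(\varepsilon))_{0<\varepsilon<\varepsilon_0}$ be a family of bounded 3D corner domains such that (i) one of the vertices $\mathbf{v}(\varepsilon)$ of $\Omega(\varepsilon)$ satisfies $\Pi_{\mathbf{v}(\varepsilon)}=\mathcal{C}_{\omega_\varepsilon}$; (ii) the edge openings $\alpha_{\mathbf{x}}$ of all domains $\Omega(\varepsilon)$ satisfy the uniform bounds $$\beta_0\le\alpha_{\mathbf{x}}\le2\pi-\beta_0\qquad\text{for every edge point }\mathbf{x}\text{ of }\Omega(\varepsilon)\text{ and every }\varepsilon\in(0,\varepsilon_0),$$ with a positive constant $\beta_0$. Then, for $\varepsilon$ small enough, $$\inf_{\mathbf{x}\in\overline{\Omega(\varepsilon)}}E(\mathbf{B},\Pi_{\mathbf{x}})<\inf_{\mathbf{x}\in\overline{\Omega(\varepsilon)}\setminus\mathfrak{V}(\varepsilon)}E(\mathbf{B},\Pi_{\mathbf{x}}),$$ where $\mathfrak{V}(\varepsilon)$ is the set of vertices of $\Omega(\varepsilon)$ and $\Pi_{\mathbf{x}}$ is the tangent cone to $\Omega(\varepsilon)$ at $\mathbf{x}$. (b) There exist $\varepsilon_0>0$, a constant $\beta_0>0$ and a family $(\Omega(\varepsilon))_{0<\varepsilon<\varepsilon_0}$ of bounded 3D corner domains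 such that, for every $\varepsilon\in(0,\varepsilon_0)$, one of the vertices $\mathbf{v}(\varepsilon)$ of $\Omega(\varepsilon)$ satisfies $\Pi_{\mathbf{v}(\varepsilon)}=\mathcal{C}_{\omega_\varepsilon}$, and the edge openings satisfy $\beta_0\le\alpha_{\mathbf{x}}\le2\pi-\beta_0$ for every edge point $\mathbf{x}$ of $\Omega(\varepsilon)$.
   Context: A bounded polygonal domain $\omega\subset\mathbb{R}^2$ is a bounded connected open set whose boundary is a finite union of smooth arcs (the sides) such that the tangents to two neighboring sides at their common end (a vertex) are not colinear. The cone associated with $\omega$ is $$\mathcal{C}_\omega=\{(x_1,x_2,x_3)\in\mathbb{R}^3:\ x_3>0,\ (x_1/x_3,\,x_2/x_3)\in\omega\}.$$ Cones and corner domains. A cone is an open subset $\Pi$ of $\mathbb{R}^n$ invariant under all dilations $\mathbf{x}\mapsto\rho\mathbf{x}$, $\rho>0$; its section is $\Pi\cap\mathbb{S}^{n-1}$ (with $\mathbb{S}^0=\{-1,1\}$). Let $\Omega$ be an open subset of $M=\mathbb{R}^n$ or $\mathbb{S}^n$ and $\mathbf{x}_0\in\overline\Omega$. The cone $\Pi_{\mathbf{x}_0}\subset\mathbb{R}^n$ is tangent to $\Omega$ at $\mathbf{x}_0$ if there is a $C^\infty$ diffeomorphism $U$ from a neighborhood $\mathcal{U}$ of $\mathbf{x}_0$ in $M$ onto a neighborhood $\mathcal{V}$ of $0$ in $\mathbb{R}^n$ with $U(\mathbf{x}_0)=0$, $U(\mathcal{U}\cap\Omega)=\mathcal{V}\cap\Pi_{\mathbf{x}_0}$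 and $U(\mathcal{U}\cap\partial\Omega)=\mathcal{V}\cap\partial\Pi_{\mathbf{x}_0}$; for $M=\mathbb{R}^n$ it is normalized so that the differential of $U$ at $\mathbf{x}_0$ is the identity, so that $\Pi_{\mathbf{x}_0}$ is uniquely determined. The classes $\mathfrak{P}_n$ of tangent cones and $\mathfrak{D}(M)$ of corner domains are defined recursively: $\mathfrak{P}_0=\{\{0\}\}$, $\mathfrak{D}(\mathbb{S}^0)$ consists of all subsets of $\mathbb{S}^0$; for $n\ge1$, $\Pi\in\mathfrak{P}_n$ iff its section belongs to $\mathfrak{D}(\mathbb{S}^{n-1})$, and $\Omega\in\mathfrak{D}(M)$ ($M=\mathbb{R}^n$ or $\mathbb{S}^n$) iff for every $\mathbf{x}_0\in\overline\Omega$ there is a tangent cone $\Pi_{\mathbf{x}_0}\in\mathfrak{P}_n$ to $\Omega$ at $\mathbf{x}_0$. A 3D corner domain is an element of $\mathfrak{D}(\mathbb{R}^3)$. For a 3D corner domain $\Omega$ and $\mathbf{x}\in\overline\Omega$: if $\mathbf{x}$ is an interior point, $\Pi_{\mathbf{x}}=\mathbb{R}^3$; if $\mathbf{x}$ belongs to a face (a connected component of the smooth part of $\partial\Omega$), $\Pi_{\mathbf{x}}$ is a half-space; if $\mathbf{x}$ is an edge point, $\Pi_{\mathbf{x}}$ is an infinite wedge (isometric to the product of a plane sector of opening $\alpha_{\mathbf{x}}\in(0,2\pi)$, $\alpha_{\mathbf{x}}\neq\pi$, with $\mathbb{R}$; $\alpha_{\mathbf{x}}$ is the edge opening at $\mathbf{x}$);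 if $\mathbf{x}$ is a vertex, $\Pi_{\mathbf{x}}$ is an infinite cone that is none of the preceding. Energies. For a cone $\Pi\subset\mathbb{R}^3$ and a linear potential $\mathbf{A}$ with $\operatorname{curl}\mathbf{A}=\mathbf{B}$, $$E(\mathbf{B},\Pi)=\inf_{u\ne0}\frac{\int_\Pi|(-i\nabla+\mathbf{A})u|^2\,d\mathbf{x}}{\|u\|_{L^2(\Pi)}^2},$$ the infimum being over $u\in L^2(\Pi)$ with $(-i\nabla+\mathbf{A})u\in L^2(\Pi)$; it depends only on $\mathbf{B}$ and $\Pi$. *)

theory Defs
  imports "HOL-Analysis.Analysis"
begin

text \<open>Smooth maps. The predicates \<open>Ck_on\<close> and \<open>smooth_on\<close> are meant for open sets;
  \<open>smooth_map_on\<close> covers arbitrary sets, such as relatively open subsets of a sphere,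
  by smooth extension to an open neighbourhood in the ambient space.\<close>

primrec Ck_on ::
  "nat \<Rightarrow> ('a::real_normed_vector \<Rightarrow> 'b::real_normed_vector) \<Rightarrow> 'a set \<Rightarrow> bool" where
  "Ck_on 0 f S \<longleftrightarrow> continuous_on S f"
| "Ck_on (Suc k) f S \<longleftrightarrow>
     (\<forall>x\<in>S. f differentiable (at x)) \<and> (\<forall>v. Ck_on k (\<lambda>x. frechet_derivative f (at x) v) S)"

definition smooth_on :: "'a::euclidean_space set \<Rightarrow> ('a \<Rightarrow> 'b::euclidean_space) \<Rightarrow> bool" where
  "smooth_on S f \<longleftrightarrow> (\<forall>k. Ck_on k f S)"

definition smooth_map_on :: "'a::euclidean_space set \<Rightarrow> ('a \<Rightarrow> 'b::euclidean_space) \<Rightarrow> bool" where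
  "smooth_map_on A f \<longleftrightarrow> (\<exists>T g. open T \<and> A \<subseteq> T \<and> smooth_on T g \<and> (\<forall>x\<in>A. g x = f x))"

definition diffeomorphism_between ::
  "'a::euclidean_space set \<Rightarrow> 'b::euclidean_space set \<Rightarrow> ('a \<Rightarrow> 'b) \<Rightarrow> bool" where
  "diffeomorphism_between A B f \<longleftrightarrow>
     bij_betw f A B \<and> smooth_map_on A f \<and> smooth_map_on B (inv_into A f)"


section \<open>Polygonal domains and their cones\<close>

text \<open>A side is smooth up to its ends. It may be a loop with a corner at its base point.\<close>

definition smooth_side :: "(real \<Rightarrow> real^2) \<Rightarrow> bool" where
  "smooth_side \<gamma> \<longleftrightarrow> simple_path \<gamma> \<and> (\<exists>T. open T \<and> {0..1} \<subseteq> T \<and> smooth_on T \<gamma>) \<and>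
     (\<forall>t\<in>{0..1}. vector_derivative \<gamma> (at t) \<noteq> 0)"

text \<open>The pair \<open>(\<gamma>, s)\<close> with \<open>s \<in> {0, 1}\<close> stands for an end of the side \<open>\<gamma>\<close>. Sides meet only at
  ends, each end is shared with exactly one other end, and the two tangents there are not
  colinear (so that interior angles \<open>0\<close>, \<open>\<pi>\<close> and \<open>2\<pi>\<close> do not occur).\<close>

definition polygonal_domain :: "(real^2) set \<Rightarrow> bool" where
  "polygonal_domain \<omega> \<longleftrightarrow> open \<omega> \<and> connected \<omega> \<and> \<omega> \<noteq> {} \<and>
     (\<exists>S. finite S \<and> (\<forall>\<gamma>\<in>S. smooth_side \<gamma>) \<and> frontier \<omega> = (\<Union>\<gamma>\<in>S. path_image \<gamma>) \<and>
       (\<forall>\<gamma>\<in>S. \<forall>\<delta>\<in>S. \<gamma> \<noteq> \<delta> \<longrightarrow> path_image \<gamma> \<inter> path_image \<delta> \<subseteq> {\<gamma> 0, \<gamma> 1} \<inter> {\<delta> 0, \<delta> 1}) \<and>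
       (\<forall>(\<gamma>, s)\<in>S \<times> {0, 1}. \<exists>!(\<delta>, t). (\<delta>, t) \<in> S \<times> {0, 1} \<and> (\<delta>, t) \<noteq> (\<gamma>, s) \<and> \<delta> t = \<gamma> s) \<and>
       (\<forall>(\<gamma>, s)\<in>S \<times> {0, 1}. \<forall>(\<delta>, t)\<in>S \<times> {0, 1}. (\<delta>, t) \<noteq> (\<gamma>, s) \<and> \<delta> t = \<gamma> s \<longrightarrow>
          \<not> collinear {0, vector_derivative \<gamma> (at s), vector_derivative \<delta> (at t)}))"

definition cone_of :: "(real^2) set \<Rightarrow> (real^3) set" where
  "cone_of \<omega> = {x. x $ 3 > 0 \<and> vector [x $ 1 / x $ 3, x $ 2 / x $ 3] \<in> \<omega>}"


section \<open>Tangent cones and corner domains\<close>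

text \<open>The library predicates \<open>cone\<close> and \<open>conic\<close> also include dilation by \<open>0\<close>, hence cannot be used.\<close>

definition open_cone :: "'a::real_normed_vector set \<Rightarrow> bool" where
  "open_cone C \<longleftrightarrow> open C \<and> (\<forall>\<rho>>0. \<forall>x\<in>C. \<rho> *\<^sub>R x \<in> C)"

text \<open>\<open>M\<close> is the whole space or the unit sphere; boundary and closure are taken in \<open>M\<close>.\<close>

definition cone_chart ::
  "'b::euclidean_space set \<Rightarrow> 'b set \<Rightarrow> 'b \<Rightarrow> 'a::euclidean_space set \<Rightarrow> ('b \<Rightarrow> 'a) \<Rightarrow> bool" where
  "cone_chart M \<Omega> x C U \<longleftrightarrow>
     (\<exists>N V. openin (top_of_set M) N \<and> x \<in> N \<and> open V \<and> 0 \<in> V \<and>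
        diffeomorphism_between N V U \<and> U x = 0 \<and>
        U ` (N \<inter> \<Omega>) = V \<inter> C \<and>
        U ` (N \<inter> (top_of_set M frontier_of \<Omega>)) = V \<inter> frontier C)"

definition is_tangent_cone :: "'a::euclidean_space set \<Rightarrow> 'a \<Rightarrow> 'a set \<Rightarrow> bool" where
  "is_tangent_cone \<Omega> x C \<longleftrightarrow>
     open_cone C \<and> (\<exists>U. cone_chart UNIV \<Omega> x C U \<and> (U has_derivative (\<lambda>h. h)) (at x))"

definition is_tangent_cone_sphere ::
  "'b::euclidean_space set \<Rightarrow> 'b \<Rightarrow> 'a::euclidean_space set \<Rightarrow> bool" where
  "is_tangent_cone_sphere \<Omega> x C \<longleftrightarrow> open_cone C \<and> (\<exists>U. cone_chart (sphere 0 1) \<Omega> x C U)"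

text \<open>One step of the recursion defining tangent cones and corner domains: \<open>cones_over\<close> passes from
  corner domains of the sphere \<open>S^(n-1)\<close> to tangent cones in dimension \<open>n\<close>; \<open>corner_domains_sphere\<close>
  and \<open>corner_domains\<close> pass from the latter to corner domains of \<open>S^n\<close> and of \<open>R^n\<close>. The dimension is
  carried by the type, so the recursion is unrolled up to dimension 3.\<close>

definition cones_over :: "'a::euclidean_space set set \<Rightarrow> 'a set set" where
  "cones_over D = {C. open_cone C \<and> C \<inter> sphere 0 1 \<in> D}"

definition corner_domains_sphere :: "'a::euclidean_space set set \<Rightarrow> 'b::euclidean_space set set" where
  "corner_domains_sphere P = {\<Omega>. openin (top_of_set (sphere 0 1)) \<Omega> \<and>
     (\<forall>x \<in> top_of_set (sphere 0 1) closure_of \<Omega>. \<exists>C\<in>P. is_tangent_cone_sphere \<Omega> x C)}"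

definition corner_domains :: "'a::euclidean_space set set \<Rightarrow> 'a set set" where
  "corner_domains P = {\<Omega>. open \<Omega> \<and> (\<forall>x \<in> closure \<Omega>. \<exists>C\<in>P. is_tangent_cone \<Omega> x C)}"

definition tangent_cones_1 :: "(real^1) set set" where
  "tangent_cones_1 = cones_over (Pow (sphere 0 1))"

definition tangent_cones_2 :: "(real^2) set set" where
  "tangent_cones_2 = cones_over (corner_domains_sphere tangent_cones_1)"

definition tangent_cones_3 :: "(real^3) set set" where
  "tangent_cones_3 = cones_over (corner_domains_sphere tangent_cones_2)"

definition corner_domain_3D :: "(real^3) set \<Rightarrow> bool" where
  "corner_domain_3D \<Omega> \<longleftrightarrow> \<Omega> \<in> corner_domains tangent_cones_3"

definition tangent_cone :: "'a::euclidean_space set \<Rightarrow> 'a \<Rightarrow> 'a set" where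
  "tangent_cone \<Omega> x = (THE C. is_tangent_cone \<Omega> x C)"


section \<open>Faces, edges and vertices\<close>

definition half_space :: "(real^3) set \<Rightarrow> bool" where
  "half_space C \<longleftrightarrow> (\<exists>n. n \<noteq> 0 \<and> C = {x. n \<bullet> x > 0})"

definition model_wedge :: "real \<Rightarrow> (real^3) set" where
  "model_wedge \<alpha> =
     {x. \<exists>r>0. \<exists>\<theta>. 0 < \<theta> \<and> \<theta> < \<alpha> \<and> x $ 1 = r * cos \<theta> \<and> x $ 2 = r * sin \<theta>}"

text \<open>A tangent cone has its apex at \<open>0\<close>, so linear isometries suffice.\<close>

definition wedge_of_opening :: "real \<Rightarrow> (real^3) set \<Rightarrow> bool" where
  "wedge_of_opening \<alpha> C \<longleftrightarrow> 0 < \<alpha> \<and> \<alpha> < 2 * pi \<and> \<alpha> \<noteq> pi \<and>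
     (\<exists>f. orthogonal_transformation f \<and> C = f ` model_wedge \<alpha>)"

definition is_edge_opening :: "(real^3) set \<Rightarrow> real^3 \<Rightarrow> real \<Rightarrow> bool" where
  "is_edge_opening \<Omega> x \<alpha> \<longleftrightarrow> x \<in> closure \<Omega> \<and> wedge_of_opening \<alpha> (tangent_cone \<Omega> x)"

definition vertices :: "(real^3) set \<Rightarrow> (real^3) set" where
  "vertices \<Omega> = {x \<in> closure \<Omega>. tangent_cone \<Omega> x \<noteq> UNIV \<and> \<not> half_space (tangent_cone \<Omega> x) \<and>
     (\<forall>\<alpha>. \<not> wedge_of_opening \<alpha> (tangent_cone \<Omega> x))}"


section \<open>Magnetic energies\<close>

definition curl :: "(real^3 \<Rightarrow> real^3) \<Rightarrow> real^3 \<Rightarrow> real^3" where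
  "curl A x = (let D = (\<lambda>j k. frechet_derivative A (at x) (axis j 1) $ k) in
     vector [D 2 3 - D 3 2, D 3 1 - D 1 3, D 1 2 - D 2 1])"

definition L2_on :: "(real^3) set \<Rightarrow> (real^3 \<Rightarrow> 'b::euclidean_space) \<Rightarrow> bool" where
  "L2_on C u \<longleftrightarrow> set_borel_measurable lebesgue C u \<and> set_integrable lebesgue C (\<lambda>x. (norm (u x))\<^sup>2)"

definition L2_norm_sq :: "(real^3) set \<Rightarrow> (real^3 \<Rightarrow> 'b::euclidean_space) \<Rightarrow> real" where
  "L2_norm_sq C u = set_lebesgue_integral lebesgue C (\<lambda>x. (norm (u x))\<^sup>2)"

definition test_function :: "(real^3) set \<Rightarrow> (real^3 \<Rightarrow> real) \<Rightarrow> bool" where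
  "test_function C \<phi> \<longleftrightarrow> smooth_on UNIV \<phi> \<and> (\<exists>K. compact K \<and> K \<subseteq> C \<and> (\<forall>x. x \<notin> K \<longrightarrow> \<phi> x = 0))"

text \<open>The function \<open>f\<close> represents \<open>(-i\<nabla> + A) u\<close> on \<open>C\<close> in the sense of distributions. The derivative is
  moved onto the test function by \<open>\<integral> (-i \<partial>\<^sub>j u) \<phi> = \<integral> u (i \<partial>\<^sub>j \<phi>)\<close>.\<close>

definition magnetic_gradient ::
  "(real^3 \<Rightarrow> real^3) \<Rightarrow> (real^3) set \<Rightarrow> (real^3 \<Rightarrow> complex) \<Rightarrow> (real^3 \<Rightarrow> complex^3) \<Rightarrow> bool" where
  "magnetic_gradient A C u f \<longleftrightarrow> (\<forall>\<phi>. test_function C \<phi> \<longrightarrow> (\<forall>j.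
     set_lebesgue_integral lebesgue C (\<lambda>x. u x *
        (\<i> * complex_of_real (frechet_derivative \<phi> (at x) (axis j 1)) + complex_of_real (A x $ j * \<phi> x)))
     = set_lebesgue_integral lebesgue C (\<lambda>x. f x $ j * complex_of_real (\<phi> x))))"

definition ground_energy :: "(real^3 \<Rightarrow> real^3) \<Rightarrow> (real^3) set \<Rightarrow> real" where
  "ground_energy A C = Inf {L2_norm_sq C f / L2_norm_sq C u | u f.
     L2_on C u \<and> L2_norm_sq C u \<noteq> 0 \<and> L2_on C f \<and> magnetic_gradient A C u f}"

end

theory Submission
  imports Defs
begin

text \<open>Away from the vertices the tangent cones are the whole space, half-spaces and wedges of opening in
  \<open>[\<beta>\<^sub>0, 2 \<pi> - \<beta>\<^sub>0]\<close>. If \<open>C\<close> is stable under positive translations along \<open>p\<close> and \<open>q\<close>, and the magnetic flux through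
  the parallelogram on \<open>p\<close>, \<open>q\<close> is \<open>\<plusminus>\<pi>\<close>, then the parallel transports along \<open>p\<close> and \<open>q\<close> anticommute; as each differs
  from the identity by at most the magnetic gradient times a length, \<open>\<parallel>u\<parallel> \<le> (|p| + |q|) \<parallel>(-i\<nabla> + A) u\<parallel>\<close> on \<open>C\<close>. A
  wedge contains two such directions, or is a union of two half-spaces, so its energy is bounded below by a positive
  constant depending only on \<open>B\<close> and \<open>\<beta>\<^sub>0\<close>. On the cone over \<open>\<epsilon> \<omega>\<close> a profile in \<open>x\<^sub>3\<close>, written in a gauge that is
  small near the axis, has energy \<open>O(\<epsilon>)\<close>, so the vertex wins for small \<open>\<epsilon>\<close>.

  The spindles \<open>{x. 0 < x\<^sub>3 < 1, (x\<^sub>1, x\<^sub>2) \<in> x\<^sub>3 (1 - x\<^sub>3) \<epsilon> \<omega>}\<close> have uniform edge openings: both apexes are cones over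
  \<open>\<epsilon> \<omega>\<close>, and the tangent cone at a lateral point is a sheared product of a tangent cone of \<open>\<omega>\<close> with a line, where the
  shear is bounded. That \<open>\<omega>\<close> has a tangent cone at each boundary point means that it lies locally on exactly one
  side of its boundary; this holds because every side belongs to a Jordan curve of sides.\<close>

section \<open>Calculus of smooth maps\<close>

text \<open>No boundary condition and no regularity is available for \<open>u\<close>: it is only
  square integrable with a weak magnetic gradient. So nothing is done to \<open>u\<close> itself.
  The transports act on test functions, and the norm of \<open>u\<close> is recovered by duality.
  Transport along \<open>p\<close> moves supports by \<open>p\<close>, so translations in one sense
  only must preserve \<open>C\<close>; a wedge, invariant both ways only along its edge, thus has
  enough directions. One fixed pair of directions could span a plane containing \<open>B\<close>,
  with zero flux. Hence three directions are used, of which some pair sees a definite fraction of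
  \<open>B\<close>; how large a fraction depends on the opening alone.

  For (b), the definition of a polygonal domain speaks of sides and ends only, so that the domain
  has another side at each boundary point is a theorem, obtained by counting ends modulo 2 and then
  from the Jordan curve theorem. Uniformity in \<epsilon> is obtained by measuring an opening
  through the radius of a ball inside the cone and of one outside it. Dilation of the plane domain
  leaves its tangent cones unchanged, and a shear of bounded size shrinks such a ball by a bounded
  factor.\<close>

text \<open>On an open set, agreement on the set is agreement near each point, so derivatives agree
  too. The induction runs over all pairs of functions because directional derivatives form the next
  pair.\<close>

lemma Ck_on_cong:
  assumes "open S" "\<And>x. x \<in> S \<Longrightarrow> f x = g x"
  shows "Ck_on k f S \<longleftrightarrow> Ck_on k g S"
  using assms(2)
proof (induction k arbitrary: f g)
  case 0
  then show ?case by (simp cong: continuous_on_cong)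
next
  case (Suc k)
  have ev: "\<forall>\<^sub>F y in at x. f y = g y" "f x = g x" if "x \<in> S" for x
    using Suc.prems that assms(1) eventually_at_topological by blast+
  have d: "f differentiable at x \<longleftrightarrow> g differentiable at x" if "x \<in> S" for x
    unfolding differentiable_def
    using has_derivative_transform_eventually[of f _ x UNIV g] has_derivative_transform_eventually[of g _ x UNIV f]
      ev[OF that] by (auto simp: eq_commute)
  have "frechet_derivative f (at x) = frechet_derivative g (at x)" if "x \<in> S" for x
  proof -
    have "(f has_derivative D) (at x) \<longleftrightarrow> (g has_derivative D) (at x)" for D
      using has_derivative_transform_eventually[of f _ x UNIV g] has_derivative_transform_eventually[of g _ x UNIV f]
      ev[OF that] by (auto simp: eq_commute)
    then show ?thesis by (simp add: frechet_derivative_def)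
  qed
  then have "Ck_on k (\<lambda>x. frechet_derivative f (at x) v) S \<longleftrightarrow> Ck_on k (\<lambda>x. frechet_derivative g (at x) v) S" for v
    by (intro Suc.IH) simp
  with d show ?case by simp
qed

lemma Ck_on_subset: "Ck_on k f T \<Longrightarrow> S \<subseteq> T \<Longrightarrow> Ck_on k f S"
  by (induction k arbitrary: f) (auto intro: continuous_on_subset)

lemma Ck_on_SucI:
  assumes "open S" "\<And>x. x \<in> S \<Longrightarrow> (f has_derivative D x) (at x)" "\<And>v. Ck_on k (\<lambda>x. D x v) S"
  shows "Ck_on (Suc k) f S"
proof -
  have "frechet_derivative f (at x) = D x" if "x \<in> S" for x
    using assms(2)[OF that] by (metis frechet_derivative_at)
  then have "Ck_on k (\<lambda>x. frechet_derivative f (at x) v) S" for v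
    using assms(3)[of v] Ck_on_cong[OF assms(1), of "\<lambda>x. frechet_derivative f (at x) v" "\<lambda>x. D x v"] by simp
  then show ?thesis using assms(2) by (auto simp: differentiable_def)
qed

lemma Ck_on_SucD:
  assumes "Ck_on (Suc k) f S" "x \<in> S"
  shows "(f has_derivative frechet_derivative f (at x)) (at x)"
  using assms by (simp flip: frechet_derivative_works)

lemma Ck_on_continuous: "Ck_on k f S \<Longrightarrow> continuous_on S f"
  by (cases k) (auto simp: continuous_at_imp_continuous_on differentiable_imp_continuous_within)

lemma Ck_on_Suc_imp: "Ck_on (Suc k) f S \<Longrightarrow> Ck_on k f S"
proof (induction k arbitrary: f)
  case 0
  then show ?case using Ck_on_continuous[of "Suc 0" f S] by simp
next
  case (Suc k)
  then show ?case by (metis Ck_on.simps(2))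
qed

lemma Ck_on_const: "open S \<Longrightarrow> Ck_on k (\<lambda>x. c) S"
  by (induction k arbitrary: c) (auto simp del: Ck_on.simps(2) intro!: Ck_on_SucI[where D = "\<lambda>x v. 0"])

lemma Ck_on_bounded_linear: "open S \<Longrightarrow> bounded_linear f \<Longrightarrow> Ck_on k f S"
  by (cases k) (auto simp del: Ck_on.simps(2) simp: Ck_on_const linear_continuous_on bounded_linear_imp_has_derivative
     intro!: Ck_on_SucI[where D = "\<lambda>x v. f v"])

lemma Ck_on_add:
  assumes "open S" "Ck_on k f S" "Ck_on k g S"
  shows "Ck_on k (\<lambda>x. f x + g x) S"
  using assms(2,3)
proof (induction k arbitrary: f g)
  case 0
  then show ?case by (auto intro: continuous_intros)
next
  case (Suc k)
  show ?case
  proof (rule Ck_on_SucI[OF assms(1), where D = "\<lambda>x v. frechet_derivative f (at x) v + frechet_derivative g (at x) v"])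
    show "((\<lambda>x. f x + g x) has_derivative (\<lambda>v. frechet_derivative f (at x) v + frechet_derivative g (at x) v)) (at x)"
      if "x \<in> S" for x
      using Ck_on_SucD[OF Suc.prems(1) that] Ck_on_SucD[OF Suc.prems(2) that] by (rule has_derivative_add)
  qed (use Suc in auto)
qed

lemma (in bounded_bilinear) Ck_on:
  assumes "open S" "Ck_on k f S" "Ck_on k g S"
  shows "Ck_on k (\<lambda>x. prod (f x) (g x)) S"
  using assms(2,3)
proof (induction k arbitrary: f g)
  case 0
  then show ?case by (auto intro: continuous_on)
next
  case (Suc k)
  show ?case
  proof (rule Ck_on_SucI[OF assms(1), where D = "\<lambda>x v. prod (f x) (frechet_derivative g (at x) v) + prod (frechet_derivative f (at x) v) (g x)"])
    show "((\<lambda>x. prod (f x) (g x)) has_derivative (\<lambda>v. prod (f x) (frechet_derivative g (at x) v) + prod (frechet_derivative f (at x) v) (g x))) (at x)"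
      if "x \<in> S" for x
      using FDERIV[OF Ck_on_SucD[OF Suc.prems(1) that] Ck_on_SucD[OF Suc.prems(2) that]] .
    show "Ck_on k (\<lambda>x. prod (f x) (frechet_derivative g (at x) v) + prod (frechet_derivative f (at x) v) (g x)) S" for v
      by (intro Ck_on_add assms Suc.IH) (use Suc.prems Ck_on_Suc_imp in auto)
  qed
qed

lemma Ck_on_sum:
  assumes "open S" "\<And>i. i \<in> I \<Longrightarrow> Ck_on k (f i) S"
  shows "Ck_on k (\<lambda>x. \<Sum>i\<in>I. f i x) S"
  using assms(2) by (induction I rule: infinite_finite_induct) (auto simp: Ck_on_const assms(1) intro!: Ck_on_add)

lemma Ck_on_compose:
  fixes f :: "'a::real_normed_vector \<Rightarrow> 'b::euclidean_space" and g :: "'b \<Rightarrow> 'c::real_normed_vector"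
  assumes "open S" "Ck_on k f S" "Ck_on k g T" "f ` S \<subseteq> T"
  shows "Ck_on k (\<lambda>x. g (f x)) S"
  using assms(2,3)
proof (induction k arbitrary: g)
  case 0
  then show ?case using continuous_on_compose2[of T g S f] assms(4) by auto
next
  case (Suc k)
  let ?D = "\<lambda>x v. frechet_derivative g (at (f x)) (frechet_derivative f (at x) v)"
  show ?case
  proof (rule Ck_on_SucI[OF assms(1), where D = ?D])
    show "((\<lambda>x. g (f x)) has_derivative ?D x) (at x)" if "x \<in> S" for x
      using diff_chain_at[OF Ck_on_SucD[OF Suc.prems(1) that] Ck_on_SucD[OF Suc.prems(2)]] that assms(4)
      by (force simp: o_def)
    fix v
    have lin: "linear (frechet_derivative g (at (f x)))" if "x \<in> S" for x
      using Suc.prems(2) that assms(4) by (intro linear_frechet_derivative) auto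
    \<comment> \<open>The chain rule applies the derivative of \<open>g\<close> to a direction that
      moves with \<open>x\<close>. Expansion in a basis leaves derivatives of \<open>g\<close> in
      fixed directions, to which the induction hypothesis applies.\<close>
    have "?D x v = (\<Sum>b\<in>Basis. (frechet_derivative f (at x) v \<bullet> b) *\<^sub>R frechet_derivative g (at (f x)) b)"
      if "x \<in> S" for x
      by (subst euclidean_representation[symmetric, of "frechet_derivative f (at x) v"])
         (simp add: linear_sum[OF lin[OF that]] linear_cmul[OF lin[OF that]])
    moreover have "Ck_on k (\<lambda>x. (\<Sum>b\<in>Basis. (frechet_derivative f (at x) v \<bullet> b) *\<^sub>R frechet_derivative g (at (f x)) b)) S"
    proof (intro Ck_on_sum assms bounded_bilinear.Ck_on[OF bounded_bilinear_scaleR])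
      fix b :: 'b
      show "Ck_on k (\<lambda>x. frechet_derivative f (at x) v \<bullet> b) S"
        by (intro bounded_bilinear.Ck_on[OF bounded_bilinear_inner] assms Ck_on_const) (use Suc.prems in auto)
      show "Ck_on k (\<lambda>x. frechet_derivative g (at (f x)) b) S"
        by (rule Suc.IH[of "\<lambda>y. frechet_derivative g (at y) b"]) (use Suc.prems Ck_on_Suc_imp in auto)
    qed
    ultimately show "Ck_on k (\<lambda>x. ?D x v) S"
      by (subst Ck_on_cong[OF assms(1)])
  qed
qed

lemma Ck_on_real:
  fixes f :: "real \<Rightarrow> 'b::real_normed_vector"
  assumes "open S" "\<And>x. x \<in> S \<Longrightarrow> (f has_vector_derivative f' x) (at x)" "Ck_on k f' S"
  shows "Ck_on (Suc k) f S"
  by (rule Ck_on_SucI[where D = "\<lambda>x v. v *\<^sub>R f' x"])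
     (use assms in \<open>auto simp: has_vector_derivative_def intro!: bounded_bilinear.Ck_on[OF bounded_bilinear_scaleR] Ck_on_const\<close>)

lemma smooth_on_Ck: "smooth_on S f \<Longrightarrow> Ck_on k f S"
  by (simp add: smooth_on_def)

lemma smooth_on_cong:
  assumes "open S" "\<And>x. x \<in> S \<Longrightarrow> f x = g x"
  shows "smooth_on S f \<longleftrightarrow> smooth_on S g"
  unfolding smooth_on_def using Ck_on_cong[OF assms] by auto

lemma smooth_on_subset: "smooth_on T f \<Longrightarrow> S \<subseteq> T \<Longrightarrow> smooth_on S f"
  unfolding smooth_on_def using Ck_on_subset by blast

lemma smooth_on_continuous: "smooth_on S f \<Longrightarrow> continuous_on S f"
  using smooth_on_Ck Ck_on_continuous by blast

lemma smooth_on_differentiable: "smooth_on S f \<Longrightarrow> x \<in> S \<Longrightarrow> f differentiable (at x)"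
  using smooth_on_Ck[of S f "Suc 0"] by auto

lemma smooth_on_has_derivative:
  "smooth_on S f \<Longrightarrow> x \<in> S \<Longrightarrow> (f has_derivative frechet_derivative f (at x)) (at x)"
  using smooth_on_differentiable frechet_derivative_works by blast

lemma smooth_on_frechet: "smooth_on S f \<Longrightarrow> smooth_on S (\<lambda>x. frechet_derivative f (at x) v)"
  unfolding smooth_on_def by (metis Ck_on.simps(2))

lemma smooth_on_vector_derivative:
  assumes "open S" "smooth_on S f" shows "smooth_on S (\<lambda>t::real. vector_derivative f (at t))"
proof -
  have "frechet_derivative f (at t) 1 = vector_derivative f (at t)" if "t \<in> S" for t
    using frechet_derivative_eq_vector_derivative[OF smooth_on_differentiable[OF assms(2) that]] by simp
  then show ?thesis
    using smooth_on_frechet[OF assms(2), of 1]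
      smooth_on_cong[OF assms(1), of "\<lambda>t. frechet_derivative f (at t) 1" "\<lambda>t. vector_derivative f (at t)"] by simp
qed

lemma smooth_on_const: "open S \<Longrightarrow> smooth_on S (\<lambda>x. c)"
  by (simp add: smooth_on_def Ck_on_const)

lemma smooth_on_linear: "open S \<Longrightarrow> linear f \<Longrightarrow> smooth_on S f"
  by (simp add: smooth_on_def Ck_on_bounded_linear linear_conv_bounded_linear)

lemma smooth_on_add: "open S \<Longrightarrow> smooth_on S f \<Longrightarrow> smooth_on S g \<Longrightarrow> smooth_on S (\<lambda>x. f x + g x)"
  by (simp add: smooth_on_def Ck_on_add)

lemma smooth_on_bilinear:
  "bounded_bilinear h \<Longrightarrow> open S \<Longrightarrow> smooth_on S f \<Longrightarrow> smooth_on S g \<Longrightarrow> smooth_on S (\<lambda>x. h (f x) (g x))"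
  by (simp add: smooth_on_def bounded_bilinear.Ck_on)

lemmas smooth_on_scaleR = smooth_on_bilinear[OF bounded_bilinear_scaleR]
  and smooth_on_inner = smooth_on_bilinear[OF bounded_bilinear_inner]

lemma smooth_on_mult:
  fixes f g :: "'a::euclidean_space \<Rightarrow> 'b::{euclidean_space,real_normed_algebra}"
  shows "open S \<Longrightarrow> smooth_on S f \<Longrightarrow> smooth_on S g \<Longrightarrow> smooth_on S (\<lambda>x. f x * g x)"
  by (rule smooth_on_bilinear[OF bounded_bilinear_mult])

lemma smooth_on_sum: "open S \<Longrightarrow> (\<And>i. i \<in> I \<Longrightarrow> smooth_on S (f i)) \<Longrightarrow> smooth_on S (\<lambda>x. \<Sum>i\<in>I. f i x)"
  by (simp add: smooth_on_def Ck_on_sum)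

lemma smooth_on_compose:
  assumes "open S" "smooth_on S f" "smooth_on T g" "f ` S \<subseteq> T"
  shows "smooth_on S (\<lambda>x. g (f x))"
  using assms by (auto simp: smooth_on_def intro: Ck_on_compose[OF assms(1) _ _ assms(4)])

lemma smooth_on_compose_linear: "open S \<Longrightarrow> linear g \<Longrightarrow> smooth_on S f \<Longrightarrow> smooth_on S (\<lambda>x. g (f x))"
  by (rule smooth_on_compose[where T = UNIV]) (auto intro: smooth_on_linear)

lemma smooth_on_ident: "open S \<Longrightarrow> smooth_on S (\<lambda>x. x)"
  by (rule smooth_on_linear) (auto simp: linear_iff)

lemma smooth_on_minus: "open S \<Longrightarrow> smooth_on S f \<Longrightarrow> smooth_on S (\<lambda>x. - f x)"
  by (rule smooth_on_compose_linear) (auto simp: linear_iff)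

lemma smooth_on_diff: "open S \<Longrightarrow> smooth_on S f \<Longrightarrow> smooth_on S g \<Longrightarrow> smooth_on S (\<lambda>x. f x - g x)"
  using smooth_on_add[of S f "\<lambda>x. - g x"] smooth_on_minus[of S g] by simp

lemma smooth_on_components:
  assumes "open S" shows "smooth_on S f \<longleftrightarrow> (\<forall>b\<in>Basis. smooth_on S (\<lambda>x. f x \<bullet> b))"
proof
  assume "smooth_on S f"
  then show "\<forall>b\<in>Basis. smooth_on S (\<lambda>x. f x \<bullet> b)"
    by (auto intro!: smooth_on_inner smooth_on_const assms)
next
  assume "\<forall>b\<in>Basis. smooth_on S (\<lambda>x. f x \<bullet> b)"
  then have "smooth_on S (\<lambda>x. \<Sum>b\<in>Basis. (f x \<bullet> b) *\<^sub>R b)"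
    by (auto intro!: smooth_on_sum smooth_on_scaleR smooth_on_const assms)
  then show "smooth_on S f" by (simp add: euclidean_representation)
qed

lemma smooth_on_vec:
  fixes f :: "'a::euclidean_space \<Rightarrow> real^'n"
  assumes "open S" shows "smooth_on S f \<longleftrightarrow> (\<forall>i. smooth_on S (\<lambda>x. f x $ i))"
  unfolding smooth_on_components[OF assms, of f] by (auto simp: Basis_vec_def inner_axis)

lemma smooth_on_Pair:
  assumes "open S" "smooth_on S f" "smooth_on S g"
  shows "smooth_on S (\<lambda>x. (f x, g x))"
proof -
  have "smooth_on S (\<lambda>x. (\<lambda>y. (y, 0)) (f x) + (\<lambda>y. (0, y)) (g x))"
    by (intro smooth_on_add smooth_on_compose_linear[of S "\<lambda>y. (y, 0)"] smooth_on_compose_linear[of S "\<lambda>y. (0, y)"] assms)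
       (auto simp: linear_iff)
  then show ?thesis by simp
qed

lemma smooth_on_sin_cos:
  "smooth_on (UNIV :: real set) (sin :: real \<Rightarrow> real)" "smooth_on (UNIV :: real set) (cos :: real \<Rightarrow> real)"
proof -
  have "Ck_on k (sin :: real \<Rightarrow> real) UNIV \<and> Ck_on k (cos :: real \<Rightarrow> real) UNIV" for k
  proof (induction k)
    case 0
    show ?case by (auto intro: continuous_intros)
  next
    case (Suc k)
    then have "Ck_on k (\<lambda>x. (- 1) * sin x :: real) UNIV"
      by (intro bounded_bilinear.Ck_on[OF bounded_bilinear_mult] Ck_on_const) auto
    then have s: "Ck_on k (\<lambda>x. - sin x :: real) UNIV" by simp
    have "Ck_on (Suc k) (sin :: real \<Rightarrow> real) UNIV"
      by (rule Ck_on_real[where f' = cos]) (use Suc in \<open>auto simp flip: has_real_derivative_iff_has_vector_derivative\<close>)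
    moreover have "Ck_on (Suc k) (cos :: real \<Rightarrow> real) UNIV"
      by (rule Ck_on_real[OF _ _ s]) (auto simp flip: has_real_derivative_iff_has_vector_derivative)
    ultimately show ?case by blast
  qed
  then show "smooth_on (UNIV :: real set) (sin :: real \<Rightarrow> real)" "smooth_on (UNIV :: real set) (cos :: real \<Rightarrow> real)"
    by (auto simp: smooth_on_def)
qed

section \<open>Quotients, norms and flat functions\<close>

lemma smooth_on_inverse: "smooth_on (- {0}) (inverse :: real \<Rightarrow> real)"
  unfolding smooth_on_def
proof
  fix k show "Ck_on k (inverse :: real \<Rightarrow> real) (- {0})"
  proof (induction k)
    case (Suc k)
    have "Ck_on k (\<lambda>x. (- 1) * (inverse x * inverse x) :: real) (- {0})"
      by (intro bounded_bilinear.Ck_on[OF bounded_bilinear_mult] Ck_on_const Suc) auto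
    moreover have "(inverse has_vector_derivative (- 1) * (inverse x * inverse x)) (at x)" if "x \<in> - {0}" for x :: real
      using DERIV_inverse[of x] that
      by (simp add: has_real_derivative_iff_has_vector_derivative power2_eq_square numeral_2_eq_2)
    ultimately show ?case by (intro Ck_on_real) auto
  qed (auto intro!: continuous_intros)
qed

lemma smooth_on_divide:
  fixes f g :: "'a::euclidean_space \<Rightarrow> real"
  assumes "open S" "smooth_on S f" "smooth_on S g" "\<And>x. x \<in> S \<Longrightarrow> g x \<noteq> 0"
  shows "smooth_on S (\<lambda>x. f x / g x)"
proof -
  have "smooth_on S (\<lambda>x. inverse (g x))"
    by (rule smooth_on_compose[OF assms(1,3) smooth_on_inverse]) (use assms(4) in auto)
  with assms show ?thesis by (auto simp: divide_inverse intro: smooth_on_mult)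
qed

lemma smooth_on_sqrt: "smooth_on {0<..} sqrt"
  unfolding smooth_on_def
proof
  fix k show "Ck_on k sqrt {0<..}"
  proof (induction k)
    case (Suc k)
    have "Ck_on k (\<lambda>x. inverse (sqrt x)) {0<..}"
      by (rule Ck_on_compose[OF _ Suc smooth_on_Ck[OF smooth_on_inverse]]) auto
    then have "Ck_on k (\<lambda>x. inverse (sqrt x) * (1/2)) {0<..}"
      by (intro bounded_bilinear.Ck_on[OF bounded_bilinear_mult] Ck_on_const) auto
    then show ?case
      by (rule Ck_on_real[rotated 2]) (auto simp flip: has_real_derivative_iff_has_vector_derivative intro!: derivative_eq_intros)
  qed (auto intro!: continuous_intros)
qed

lemma smooth_on_norm: "open S \<Longrightarrow> smooth_on S f \<Longrightarrow> (\<And>x. x \<in> S \<Longrightarrow> f x \<noteq> 0) \<Longrightarrow> smooth_on S (\<lambda>x. norm (f x))"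
  unfolding norm_eq_sqrt_inner
  by (rule smooth_on_compose[OF _ _ smooth_on_sqrt]) (auto intro: smooth_on_inner)

text \<open>The index makes the family closed under differentiation up to linear combinations, so
  smoothness becomes one induction. \<open>flat_exp 0\<close> is the classical flat function and
  \<open>flat_exp 2\<close> its derivative; both reappear in the trial function on thin
  cones.\<close>

definition flat_exp :: "nat \<Rightarrow> real \<Rightarrow> real" where
  "flat_exp n s = (if s > 0 then inverse s ^ n * exp (- inverse s) else 0)"

lemma flat_exp_tendsto: "(flat_exp n \<longlongrightarrow> 0) (at 0)"
proof -
  have "((\<lambda>x. x ^ n / exp x) \<longlongrightarrow> (0::real)) at_top" by (rule tendsto_power_div_exp_0)
  then have "((\<lambda>s. inverse s ^ n / exp (inverse s)) \<longlongrightarrow> (0::real)) (at_right 0)"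
    using filterlim_compose[OF _ filterlim_inverse_at_top_right] by blast
  then have "(flat_exp n \<longlongrightarrow> 0) (at_right 0)"
    by (rule Lim_transform_eventually)
       (auto simp: flat_exp_def eventually_at_filter exp_minus divide_inverse)
  moreover have "(flat_exp n \<longlongrightarrow> 0) (at_left 0)"
    by (rule Lim_transform_eventually[OF tendsto_const]) (auto simp: flat_exp_def eventually_at_filter)
  ultimately show ?thesis by (simp add: filterlim_at_split)
qed

lemma flat_exp_derivative:
  "(flat_exp n has_real_derivative (flat_exp (n + 2) s - real n * flat_exp (n + 1) s)) (at s)"
proof -
  consider "s > 0" | "s < 0" | "s = 0" by linarith
  then show ?thesis
  proof cases
    case 1
    have "((\<lambda>s. inverse s ^ n * exp (- inverse s)) has_real_derivative
        (flat_exp (n + 2) s - real n * flat_exp (n + 1) s)) (at s)"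
      using 1 by (auto intro!: derivative_eq_intros simp: flat_exp_def power2_eq_square divide_simps)
        (cases n; simp add: field_simps)
    then show ?thesis
      by (rule has_field_derivative_transform_within_open[of _ _ _ "{0<..}"]) (use 1 in \<open>auto simp: flat_exp_def\<close>)
  next
    case 2
    have "((\<lambda>s. 0) has_real_derivative 0) (at s)" by simp
    then have "(flat_exp n has_real_derivative 0) (at s)"
      by (rule has_field_derivative_transform_within_open[of _ _ _ "{..<0}"]) (use 2 in \<open>auto simp: flat_exp_def\<close>)
    with 2 show ?thesis by (simp add: flat_exp_def)
  next
    case 3
    \<comment> \<open>The difference quotient at \<open>0\<close> is again a member of the family,
      \<open>flat_exp (n + 1)\<close>.\<close>
    have "((\<lambda>h. (flat_exp n h - flat_exp n 0) / (h - 0)) \<longlongrightarrow> 0) (at 0)"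
      by (rule Lim_transform_eventually[OF flat_exp_tendsto[of "n + 1"]])
         (auto simp: flat_exp_def eventually_at_filter field_simps)
    with 3 show ?thesis by (simp add: has_field_derivative_iff flat_exp_def)
  qed
qed

lemma smooth_on_flat_exp: "smooth_on UNIV (flat_exp n)"
proof -
  have "Ck_on k (flat_exp n) UNIV" for k
  proof (induction k arbitrary: n)
    case 0
    show ?case
      using flat_exp_derivative by (auto intro!: continuous_at_imp_continuous_on DERIV_isCont)
  next
    case (Suc k)
    have "Ck_on k (\<lambda>s. flat_exp (n + 2) s + (- real n) * flat_exp (n + 1) s) UNIV"
      by (intro Ck_on_add bounded_bilinear.Ck_on[OF bounded_bilinear_mult] Ck_on_const Suc) auto
    then show ?case
      by (rule Ck_on_real[rotated 2])
         (use flat_exp_derivative in \<open>auto simp flip: has_real_derivative_iff_has_vector_derivative\<close>)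
  qed
  then show ?thesis by (simp add: smooth_on_def)
qed

section \<open>Charts\<close>

lemma smooth_map_onI: "open T \<Longrightarrow> smooth_on T f \<Longrightarrow> A \<subseteq> T \<Longrightarrow> smooth_map_on A f"
  unfolding smooth_map_on_def by blast

lemma smooth_map_on_subset: "smooth_map_on A f \<Longrightarrow> B \<subseteq> A \<Longrightarrow> smooth_map_on B f"
  unfolding smooth_map_on_def by blast

lemma smooth_map_on_continuous:
  assumes "smooth_map_on A f" shows "continuous_on A f"
proof -
  obtain T g where g: "A \<subseteq> T" "smooth_on T g" "\<And>x. x \<in> A \<Longrightarrow> g x = f x"
    using assms unfolding smooth_map_on_def by blast
  have "continuous_on A g" using smooth_on_continuous[OF g(2)] g(1) continuous_on_subset by blast
  then show ?thesis using g(3) by (simp cong: continuous_on_cong)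
qed

lemma smooth_map_on_cong: "smooth_map_on A f \<Longrightarrow> (\<And>x. x \<in> A \<Longrightarrow> f x = g x) \<Longrightarrow> smooth_map_on A g"
  unfolding smooth_map_on_def by metis

lemma smooth_map_on_compose:
  assumes "smooth_map_on A f" "smooth_map_on B g" "f ` A \<subseteq> B"
  shows "smooth_map_on A (\<lambda>x. g (f x))"
proof -
  obtain T f' where f: "open T" "A \<subseteq> T" "smooth_on T f'" "\<And>x. x \<in> A \<Longrightarrow> f' x = f x"
    using assms(1) unfolding smooth_map_on_def by blast
  obtain S g' where g: "open S" "B \<subseteq> S" "smooth_on S g'" "\<And>x. x \<in> B \<Longrightarrow> g' x = g x"
    using assms(2) unfolding smooth_map_on_def by blast
  define W where "W = T \<inter> f' -` S"
  have W: "open W" unfolding W_def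
    using smooth_on_continuous[OF f(3)] f(1) g(1) by (simp add: continuous_open_preimage)
  have "smooth_on W (\<lambda>x. g' (f' x))"
    by (rule smooth_on_compose[OF W smooth_on_subset[OF f(3)] g(3)]) (auto simp: W_def)
  moreover have "A \<subseteq> W" using f(2,4) g(2) assms(3) by (force simp: W_def)
  moreover have "g' (f' x) = g (f x)" if "x \<in> A" for x
    using that f(4) g(4) assms(3) by (metis image_subset_iff)
  ultimately show ?thesis using W unfolding smooth_map_on_def by blast
qed

lemma smooth_map_on_open:
  assumes "smooth_map_on A f" "open A" shows "smooth_on A f"
proof -
  obtain T g where g: "A \<subseteq> T" "smooth_on T g" "\<And>x. x \<in> A \<Longrightarrow> g x = f x"
    using assms(1) unfolding smooth_map_on_def by blast
  have "smooth_on A g" using g smooth_on_subset by blast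
  then show ?thesis using smooth_on_cong[OF assms(2), of g f] g(3) by blast
qed

text \<open>Carrying the inverse as a second map, instead of \<open>inv_into\<close>, lets
  composites, restrictions and inverses of charts be given by explicit formulas.\<close>

definition diffeo_pair :: "'a::euclidean_space set \<Rightarrow> 'b::euclidean_space set \<Rightarrow> ('a \<Rightarrow> 'b) \<Rightarrow> ('b \<Rightarrow> 'a) \<Rightarrow> bool" where
  "diffeo_pair N V U G \<longleftrightarrow> smooth_map_on N U \<and> smooth_map_on V G \<and> U ` N \<subseteq> V \<and> G ` V \<subseteq> N \<and>
     (\<forall>x\<in>N. G (U x) = x) \<and> (\<forall>y\<in>V. U (G y) = y)"

lemma diffeo_pair_image: "diffeo_pair N V U G \<Longrightarrow> U ` N = V"
  unfolding diffeo_pair_def by force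

lemma diffeo_pair_imp_diffeomorphism:
  assumes "diffeo_pair N V U G" shows "diffeomorphism_between N V U"
proof -
  have inj: "inj_on U N" using assms unfolding diffeo_pair_def by (metis inj_onI)
  have "inv_into N U y = G y" if "y \<in> V" for y
    using assms that inj unfolding diffeo_pair_def by (intro inv_into_f_eq) auto
  then have "smooth_map_on V (inv_into N U)"
    using assms unfolding diffeo_pair_def by (metis (no_types, lifting) smooth_map_on_cong)
  then show ?thesis
    using assms inj diffeo_pair_image[OF assms] by (simp add: diffeomorphism_between_def bij_betw_def diffeo_pair_def)
qed

lemma diffeomorphism_pair:
  assumes "diffeomorphism_between N V U" shows "diffeo_pair N V U (inv_into N U)"
  using assms unfolding diffeo_pair_def diffeomorphism_between_def bij_betw_def
  by (auto simp: inv_into_into f_inv_into_f)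

lemma diffeo_pair_compose:
  assumes "diffeo_pair N V U G" "diffeo_pair V W U' G'"
  shows "diffeo_pair N W (\<lambda>x. U' (U x)) (\<lambda>y. G (G' y))"
  using assms unfolding diffeo_pair_def image_subset_iff
  by (auto intro!: smooth_map_on_compose[of N U V U'] smooth_map_on_compose[of W G' V G])

lemma diffeo_pair_linear:
  fixes L :: "'a::euclidean_space \<Rightarrow> 'b::euclidean_space"
  assumes "linear L" "linear L'" "\<And>x. L' (L x) = x" "\<And>x. L (L' x) = x"
  shows "diffeo_pair V {w. L' w \<in> V} L L'"
  unfolding diffeo_pair_def using assms by (auto intro!: smooth_map_onI[OF open_UNIV] smooth_on_linear)

lemma diffeo_pair_restrict:
  assumes "diffeo_pair N V U G" "T \<subseteq> N"
  shows "diffeo_pair T (U ` T) U G"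
  using assms unfolding diffeo_pair_def
  by (auto intro: smooth_map_on_subset simp: subset_iff)

text \<open>The image of \<open>T\<close> is the preimage of \<open>T\<close> under the continuous
  inverse \<open>G\<close>. Relative openness in \<open>M\<close> treats spheres and whole spaces
  alike.\<close>

lemma diffeo_pair_open_image:
  assumes "diffeo_pair N V U G" "open V" "openin (top_of_set M) N" "openin (top_of_set M) T" "T \<subseteq> N"
  shows "open (U ` T)"
proof -
  have U: "U x \<in> V" "G (U x) = x" if "x \<in> T" for x
    using assms(1,5) that unfolding diffeo_pair_def by blast+
  have G: "U (G y) = y" if "y \<in> V" for y using assms(1) that unfolding diffeo_pair_def by blast
  have e: "U ` T = V \<inter> G -` T"
  proof (intro equalityI subsetI)
    show "y \<in> V \<inter> G -` T" if "y \<in> U ` T" for y using that U by auto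
    show "y \<in> U ` T" if "y \<in> V \<inter> G -` T" for y using that G[of y] by (intro image_eqI[of _ _ "G y"]) auto
  qed
  have "continuous_on V G" "G ` V \<subseteq> N" using assms(1) smooth_map_on_continuous unfolding diffeo_pair_def by auto
  moreover have "openin (top_of_set N) T" using assms(3-5) by (meson openin_imp_subset openin_subset_trans)
  ultimately have "openin (top_of_set V) (V \<inter> G -` T)" by (intro continuous_openin_preimage[of _ _ N]) auto
  then show ?thesis unfolding e using assms(2) by (simp add: openin_open_eq)
qed

lemma diffeo_pair_open_preimage:
  assumes "diffeo_pair N V U G" "openin (top_of_set M) N" "open W"
  shows "openin (top_of_set M) (N \<inter> U -` W)"
proof -
  have "continuous_on N U" using assms(1) smooth_map_on_continuous unfolding diffeo_pair_def by blast
  then have "openin (top_of_set N) (N \<inter> U -` W)" using assms(3) by (simp add: continuous_openin_preimage_gen)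
  then show ?thesis using assms(2) openin_trans by blast
qed

section \<open>Conical charts\<close>

text \<open>Neighbourhoods of \<open>y\<close> in \<open>M\<close> and of \<open>U y\<close>
  correspond under the chart. As \<Omega> is arbitrary, the same lemma can be applied to the
  complement, which then gives boundaries.\<close>

lemma chart_closure:
  assumes p: "diffeo_pair N V U G" and "open V" "openin (top_of_set M) N" and im: "U ` (N \<inter> \<Omega>) = V \<inter> C" and y: "y \<in> N"
  shows "y \<in> top_of_set M closure_of \<Omega> \<longleftrightarrow> U y \<in> closure C"
proof -
  have yM: "y \<in> M" using assms(3) y openin_imp_subset by blast
  have Uy: "U y \<in> V" using p y unfolding diffeo_pair_def by blast
  show ?thesis
  proof
    assume L: "y \<in> top_of_set M closure_of \<Omega>"
    show "U y \<in> closure C"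
      unfolding closure_iff_nhds_not_empty
    proof (intro allI impI)
      fix A T assume "T \<subseteq> A" "open T" "U y \<in> T"
      then have "openin (top_of_set M) (N \<inter> U -` (V \<inter> T))" "y \<in> N \<inter> U -` (V \<inter> T)"
        using diffeo_pair_open_preimage[OF p assms(3), of "V \<inter> T"] \<open>open V\<close> y Uy by auto
      moreover have "\<forall>T. y \<in> T \<and> openin (top_of_set M) T \<longrightarrow> (\<exists>z. z \<in> \<Omega> \<and> z \<in> T)"
        using L unfolding in_closure_of by (rule conjunct2)
      ultimately obtain z where z: "z \<in> \<Omega>" "z \<in> N \<inter> U -` (V \<inter> T)" by meson
      then have "U z \<in> U ` (N \<inter> \<Omega>)" by blast
      then have "U z \<in> C \<inter> A" using im \<open>T \<subseteq> A\<close> z(2) by auto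
      then show "C \<inter> A \<noteq> {}" by blast
    qed
  next
    assume R: "U y \<in> closure C"
    show "y \<in> top_of_set M closure_of \<Omega>"
      unfolding in_closure_of
    proof (intro conjI allI impI)
      fix T assume T: "y \<in> T \<and> openin (top_of_set M) T"
      then have "openin (top_of_set M) (T \<inter> N)" using assms(3) by (intro openin_Int) auto
      then have "open (U ` (T \<inter> N))" by (intro diffeo_pair_open_image[OF p assms(2,3)]) auto
      moreover have "U y \<in> U ` (T \<inter> N)" using T y by blast
      ultimately obtain w where w: "w \<in> C" "w \<in> U ` (T \<inter> N)" using R by (metis closure_iff_nhds_not_empty disjoint_iff subset_refl)
      then obtain z where z: "z \<in> T" "z \<in> N" "w = U z" by blast
      have "U z \<in> V" using z(2) p unfolding diffeo_pair_def by auto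
      then have "U z \<in> U ` (N \<inter> \<Omega>)" using w(1) z(3) by (simp add: im)
      then obtain z' where z': "z' \<in> N" "z' \<in> \<Omega>" "U z = U z'" by auto
      then have "z = z'" using z(2) p unfolding diffeo_pair_def by metis
      with z z' show "\<exists>z. z \<in> \<Omega> \<and> z \<in> T" by auto
    qed (use yM in simp)
  qed
qed

text \<open>A boundary is the intersection of the closures of a set and of its complement. Hence the
  boundary clause of \<open>cone_chart\<close> follows from membership alone, and later charts have
  to be checked only for membership.\<close>

lemma cone_chartI:
  assumes p: "diffeo_pair N V U G" and "open V" "openin (top_of_set M) N" "x \<in> N" "U x = 0"
    and im: "\<And>y. y \<in> N \<Longrightarrow> y \<in> \<Omega> \<longleftrightarrow> U y \<in> C"
  shows "cone_chart M \<Omega> x C U"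
proof -
  have UN: "U ` N = V" using p by (rule diffeo_pair_image)
  have 0: "0 \<in> V" using UN assms(4,5) by force
  have NM: "N \<subseteq> M" using assms(3) openin_imp_subset by blast
  have 1: "U ` (N \<inter> \<Omega>) = V \<inter> C" using UN im by auto
  have 2: "U ` (N \<inter> (M - \<Omega>)) = V \<inter> - C" using UN im NM by auto
  have "y \<in> top_of_set M frontier_of \<Omega> \<longleftrightarrow> U y \<in> frontier C" if "y \<in> N" for y
    using chart_closure[OF p assms(2,3) 1 that] chart_closure[OF p assms(2,3) 2 that]
    by (simp add: frontier_of_closures frontier_closures)
  then have "U ` (N \<inter> (top_of_set M frontier_of \<Omega>)) = V \<inter> frontier C" using UN by auto
  then show ?thesis
    unfolding cone_chart_def using assms(2-5) 0 1 diffeo_pair_imp_diffeomorphism[OF p] by blast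
qed

lemma cone_chartE:
  assumes "cone_chart M \<Omega> x C U"
  obtains N V G where "diffeo_pair N V U G" "open V" "openin (top_of_set M) N" "x \<in> N" "U x = 0"
    "\<And>y. y \<in> N \<Longrightarrow> y \<in> \<Omega> \<longleftrightarrow> U y \<in> C" "\<And>y. y \<in> N \<Longrightarrow> y \<in> top_of_set M frontier_of \<Omega> \<longleftrightarrow> U y \<in> frontier C"
proof -
  obtain N V where N: "openin (top_of_set M) N" "x \<in> N" "open V" "0 \<in> V" "diffeomorphism_between N V U" "U x = 0"
      "U ` (N \<inter> \<Omega>) = V \<inter> C" "U ` (N \<inter> (top_of_set M frontier_of \<Omega>)) = V \<inter> frontier C"
    using assms unfolding cone_chart_def by blast
  have inj: "inj_on U N" and V: "U ` N = V" using N(5) by (auto simp: diffeomorphism_between_def bij_betw_def)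
  have iff: "y \<in> A \<longleftrightarrow> U y \<in> B" if "U ` (N \<inter> A) = V \<inter> B" "y \<in> N" for y A B
  proof
    assume "U y \<in> B"
    then have "U y \<in> U ` (N \<inter> A)" using that V by auto
    then obtain z where "z \<in> N \<inter> A" "U y = U z" by auto
    then show "y \<in> A" using inj that(2) by (metis IntE inj_onD)
  qed (use that in auto)
  note iff[OF N(7)] iff[OF N(8)]
  from that[OF diffeomorphism_pair[OF N(5)] N(3,1,2,6) this] show thesis .
qed

text \<open>The chart is pulled back along \<Phi>, and only the part of \<open>N\<close> that \<Phi>
  sends into the domain of \<open>U\<close> is kept. This moves charts along central projections of
  spheres and along affine changes of variables.\<close>

lemma cone_chart_transfer:
  assumes ch: "cone_chart UNIV D (\<Phi> x) C U" and p: "diffeo_pair N W \<Phi> \<Psi>" and "open W" "openin (top_of_set M) N" "x \<in> N"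
    and D: "\<And>y. y \<in> N \<Longrightarrow> y \<in> \<Omega> \<longleftrightarrow> \<Phi> y \<in> D"
  shows "cone_chart M \<Omega> x C (\<lambda>y. U (\<Phi> y))"
proof -
  obtain N1 V G where c: "diffeo_pair N1 V U G" "open V" "openin (top_of_set UNIV) N1" "\<Phi> x \<in> N1" "U (\<Phi> x) = 0"
      "\<And>y. y \<in> N1 \<Longrightarrow> y \<in> D \<longleftrightarrow> U y \<in> C"
    using ch by (rule cone_chartE) blast
  have N1: "open N1" using c(3) by simp
  let ?N = "N \<inter> \<Phi> -` N1"
  have oN: "openin (top_of_set M) ?N" using diffeo_pair_open_preimage[OF p assms(4) N1] .
  have oi: "open (\<Phi> ` ?N)" using diffeo_pair_open_image[OF p assms(3,4) oN] by blast
  have "diffeo_pair ?N (U ` \<Phi> ` ?N) (\<lambda>y. U (\<Phi> y)) (\<lambda>y. \<Psi> (G y))"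
    by (rule diffeo_pair_compose[OF diffeo_pair_restrict[OF p] diffeo_pair_restrict[OF c(1)]]) auto
  moreover have "open (U ` \<Phi> ` ?N)"
    by (rule diffeo_pair_open_image[OF c(1-3)]) (use oi in auto)
  ultimately show ?thesis
    by (rule cone_chartI[OF _ _ oN]) (use assms(5) c D in auto)
qed

lemma cone_chart_local_id:
  fixes D :: "'a::euclidean_space set"
  assumes "r > 0" "\<And>z. norm z < r \<Longrightarrow> z \<in> D \<longleftrightarrow> z \<in> P"
  shows "cone_chart UNIV D 0 P (\<lambda>x. x)"
proof (rule cone_chartI)
  show "diffeo_pair (ball 0 r) (ball 0 r) (\<lambda>x::'a. x) (\<lambda>x. x)"
    unfolding diffeo_pair_def by (auto intro!: smooth_map_onI[OF open_UNIV] smooth_on_ident)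
qed (use assms in auto)

section \<open>Uniqueness of the tangent cone\<close>

lemma has_derivative_inverse_at:
  assumes p: "diffeo_pair N V U G" "open V" and "0 \<in> V" "U x = 0" "x \<in> N" and U: "(U has_derivative (\<lambda>h. h)) (at x)"
  shows "(G has_derivative (\<lambda>h. h)) (at 0)"
proof -
  have G0: "G 0 = x" using p assms(4,5) unfolding diffeo_pair_def by metis
  have "smooth_on V G" using p unfolding diffeo_pair_def by (simp add: smooth_map_on_open)
  then have G: "(G has_derivative frechet_derivative G (at 0)) (at 0)" using assms(3) by (rule smooth_on_has_derivative)
  have "((\<lambda>y. U (G y)) has_derivative (\<lambda>h. frechet_derivative G (at 0) h)) (at 0)"
    using diff_chain_at[OF G, of U "\<lambda>h. h"] U by (simp add: G0 o_def)
  moreover have "((\<lambda>y. U (G y)) has_derivative (\<lambda>h. h)) (at 0)"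
    by (rule has_derivative_transform_within_open[OF has_derivative_ident p(2) assms(3)])
       (use p(1) in \<open>auto simp: diffeo_pair_def\<close>)
  ultimately have "frechet_derivative G (at 0) = (\<lambda>h. h)" using has_derivative_unique by blast
  then show ?thesis using G by simp
qed

text \<open>Blow-up at the origin: a map with identity differential sends a ray to a curve which,
  rescaled by \<open>1 / t\<close>, converges to the direction of that ray.\<close>

lemma curve_through_chart:
  fixes v :: "'a::euclidean_space"
  assumes "(H has_derivative (\<lambda>h. h)) (at 0)" "H 0 = 0"
  shows "((\<lambda>t. (1 / t) *\<^sub>R H (t *\<^sub>R v)) \<longlongrightarrow> v) (at_right (0::real))"
proof -
  have "((\<lambda>t. H (t *\<^sub>R v)) has_derivative (\<lambda>h. h *\<^sub>R v)) (at 0)"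
  proof -
    have "((\<lambda>t. t *\<^sub>R v) has_derivative (\<lambda>h. h *\<^sub>R v)) (at 0)" by (auto intro!: derivative_eq_intros)
    from diff_chain_at[OF this, of H "\<lambda>h. h"] show ?thesis using assms(1) by (simp add: o_def)
  qed
  then have "((\<lambda>t. H (t *\<^sub>R v)) has_vector_derivative v) (at 0 within {0<..})"
    by (auto simp: has_vector_derivative_def intro: has_derivative_at_withinI)
  then have "((\<lambda>t. (1 / norm (t - 0)) *\<^sub>R (H (t *\<^sub>R v) - (H (0 *\<^sub>R v) + (t - 0) *\<^sub>R v))) \<longlongrightarrow> 0) (at_right 0)"
    by (simp add: has_vector_derivative_def has_derivative_within divide_inverse)
  then have "((\<lambda>t. (1 / norm t) *\<^sub>R (H (t *\<^sub>R v) - t *\<^sub>R v) + v) \<longlongrightarrow> 0 + v) (at_right 0)"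
    by (intro tendsto_add tendsto_const) (simp add: assms(2))
  then have l: "((\<lambda>t. (1 / norm t) *\<^sub>R (H (t *\<^sub>R v) - t *\<^sub>R v) + v) \<longlongrightarrow> v) (at_right 0)" by simp
  have "\<forall>\<^sub>F t in at_right 0. (1 / norm t) *\<^sub>R (H (t *\<^sub>R v) - t *\<^sub>R v) + v = (1 / t) *\<^sub>R H (t *\<^sub>R v)"
    unfolding eventually_at_filter by (auto simp: scaleR_diff_right)
  then show ?thesis by (rule Lim_transform_eventually[OF l])
qed

lemma open_cone_scale:
  assumes "open_cone C" "t > 0" shows "t *\<^sub>R w \<in> C \<longleftrightarrow> w \<in> C"
proof
  assume "t *\<^sub>R w \<in> C"
  then have "(1 / t) *\<^sub>R t *\<^sub>R w \<in> C" using assms unfolding open_cone_def by (meson divide_pos_pos zero_less_one)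
  then show "w \<in> C" using assms by simp
qed (use assms in \<open>auto simp: open_cone_def\<close>)

lemma closure_open_cone_scale:
  fixes C :: "'a::euclidean_space set"
  assumes "open_cone C" "t > 0" shows "t *\<^sub>R w \<in> closure C \<longleftrightarrow> w \<in> closure C"
proof -
  have "(\<lambda>x. t *\<^sub>R x) ` C = C"
  proof
    show "C \<subseteq> (\<lambda>x. t *\<^sub>R x) ` C"
    proof
      fix y assume "y \<in> C"
      then have "(1 / t) *\<^sub>R y \<in> C" using open_cone_scale[OF assms(1), of "1 / t" y] assms(2) by simp
      moreover have "y = t *\<^sub>R (1 / t) *\<^sub>R y" using assms(2) by simp
      ultimately show "y \<in> (\<lambda>x. t *\<^sub>R x) ` C" by (rule_tac image_eqI)
    qed
  qed (use open_cone_scale[OF assms] in auto)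
  then have "closure C = (\<lambda>x. t *\<^sub>R x) ` closure C" using closure_scaleR[of t C] by simp
  moreover have "inj (\<lambda>x::'a. t *\<^sub>R x)" using assms(2) by (simp add: inj_on_def)
  ultimately show ?thesis by (metis inj_image_mem_iff)
qed

lemma frontier_open_cone_scale:
  fixes C :: "'a::euclidean_space set"
  assumes "open_cone C" "t > 0" shows "t *\<^sub>R w \<in> frontier C \<longleftrightarrow> w \<in> frontier C"
  using assms closure_open_cone_scale[OF assms] open_cone_scale[OF assms]
  by (simp add: frontier_def open_cone_def interior_open)

text \<open>The transition map between two normalized charts has identity differential. It carries
  small points of the ray through \<open>v\<close> in \<open>C1\<close> into \<open>C2\<close>;
  rescaling stays in the cone \<open>C2\<close> and converges to \<open>v\<close>. Only the closure
  is reached in the limit, so the boundary is followed by the same argument.\<close>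

lemma tangent_subset_closure:
  assumes C1: "open_cone C1" and C2: "open_cone C2"
    and c1: "cone_chart UNIV \<Omega> x C1 U1" and c2: "cone_chart UNIV \<Omega> x C2 U2"
    and d1: "(U1 has_derivative (\<lambda>h. h)) (at x)" and d2: "(U2 has_derivative (\<lambda>h. h)) (at x)"
  shows "C1 \<subseteq> closure C2" "frontier C1 \<subseteq> closure (frontier C2)"
proof -
  obtain N1 V1 G1 where 1: "diffeo_pair N1 V1 U1 G1" "open V1" "openin (top_of_set UNIV) N1" "x \<in> N1" "U1 x = 0"
      "\<And>y. y \<in> N1 \<Longrightarrow> y \<in> \<Omega> \<longleftrightarrow> U1 y \<in> C1" "\<And>y. y \<in> N1 \<Longrightarrow> y \<in> top_of_set UNIV frontier_of \<Omega> \<longleftrightarrow> U1 y \<in> frontier C1"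
    using c1 by (rule cone_chartE) blast
  obtain N2 V2 G2 where 2: "diffeo_pair N2 V2 U2 G2" "open V2" "openin (top_of_set UNIV) N2" "x \<in> N2" "U2 x = 0"
      "\<And>y. y \<in> N2 \<Longrightarrow> y \<in> \<Omega> \<longleftrightarrow> U2 y \<in> C2" "\<And>y. y \<in> N2 \<Longrightarrow> y \<in> top_of_set UNIV frontier_of \<Omega> \<longleftrightarrow> U2 y \<in> frontier C2"
    using c2 by (rule cone_chartE) blast
  have V1: "0 \<in> V1" using 1(1,4,5) unfolding diffeo_pair_def by force
  have G1x: "G1 0 = x" using 1(1,4,5) unfolding diffeo_pair_def by metis
  have dG: "(G1 has_derivative (\<lambda>h. h)) (at 0)" using has_derivative_inverse_at[OF 1(1,2) V1 1(5,4) d1] .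
  define H where "H y = U2 (G1 y)" for y
  have dH: "(H has_derivative (\<lambda>h. h)) (at 0)" and H0: "H 0 = 0"
    using diff_chain_at[OF dG, of U2 "\<lambda>h. h"] d2 2(5) by (auto simp: H_def[abs_def] o_def G1x)
  have G1c: "isCont G1 0" using dG has_derivative_continuous by blast
  have ev: "\<forall>\<^sub>F t in at_right (0::real). t *\<^sub>R v \<in> V1 \<and> G1 (t *\<^sub>R v) \<in> N2 \<and> t > 0" for v
  proof -
    have l: "((\<lambda>t. t *\<^sub>R v) \<longlongrightarrow> 0) (at_right (0::real))"
      by (rule tendsto_eq_intros | simp)+
    have "((\<lambda>t. G1 (t *\<^sub>R v)) \<longlongrightarrow> x) (at_right (0::real))"
      using isCont_tendsto_compose[OF G1c l] by (simp add: G1x)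
    then have "\<forall>\<^sub>F t in at_right (0::real). G1 (t *\<^sub>R v) \<in> N2"
      using 2(3,4) topological_tendstoD[of _ x "at_right 0" N2] by simp
    moreover have "\<forall>\<^sub>F t in at_right (0::real). t *\<^sub>R v \<in> V1" using l 1(2) V1 topological_tendstoD by blast
    moreover have "\<forall>\<^sub>F t in at_right (0::real). t > 0" by (simp add: eventually_at_filter)
    ultimately show ?thesis by eventually_elim simp
  qed
  note sc = open_cone_scale and scf = frontier_open_cone_scale
  have GV: "G1 y \<in> N1" "U1 (G1 y) = y" if "y \<in> V1" for y
    using 1(1) that unfolding diffeo_pair_def by auto
  show "C1 \<subseteq> closure C2"
  proof
    fix v assume v: "v \<in> C1"
    have e: "\<forall>\<^sub>F t in at_right (0::real). (1 / t) *\<^sub>R H (t *\<^sub>R v) \<in> C2"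
      using ev[of v]
    proof eventually_elim
      case (elim t)
      have "t *\<^sub>R v \<in> C1" using v sc[OF C1, of t v] elim by blast
      then have "G1 (t *\<^sub>R v) \<in> \<Omega>" using 1(6)[of "G1 (t *\<^sub>R v)"] GV[of "t *\<^sub>R v"] elim by metis
      then have "H (t *\<^sub>R v) \<in> C2" using 2(6)[of "G1 (t *\<^sub>R v)"] elim unfolding H_def by blast
      moreover have "0 < 1 / t" using elim by simp
      ultimately show ?case using sc[OF C2, of "1 / t" "H (t *\<^sub>R v)"] by blast
    qed
    show "v \<in> closure C2"
      by (rule Lim_in_closed_set[OF closed_closure eventually_mono[OF e] trivial_limit_at_right_real curve_through_chart[OF dH H0]])
         (rule subsetD[OF closure_subset])
  qed
  show "frontier C1 \<subseteq> closure (frontier C2)"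
  proof
    fix v assume v: "v \<in> frontier C1"
    have e: "\<forall>\<^sub>F t in at_right (0::real). (1 / t) *\<^sub>R H (t *\<^sub>R v) \<in> frontier C2"
      using ev[of v]
    proof eventually_elim
      case (elim t)
      have "t *\<^sub>R v \<in> frontier C1" using v scf[OF C1, of t v] elim by (simp only:)
      then have "G1 (t *\<^sub>R v) \<in> top_of_set UNIV frontier_of \<Omega>"
        using 1(7)[of "G1 (t *\<^sub>R v)"] GV[of "t *\<^sub>R v"] elim by metis
      then have "H (t *\<^sub>R v) \<in> frontier C2" using 2(7)[of "G1 (t *\<^sub>R v)"] elim unfolding H_def by blast
      moreover have "0 < 1 / t" using elim by simp
      ultimately show ?case using scf[OF C2, of "1 / t" "H (t *\<^sub>R v)"] by blast
    qed
    show "v \<in> closure (frontier C2)"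
      by (rule Lim_in_closed_set[OF closed_closure eventually_mono[OF e] trivial_limit_at_right_real curve_through_chart[OF dH H0]])
         (rule subsetD[OF closure_subset])
  qed
qed

text \<open>A point of \<open>C1\<close> lies in \<open>C2\<close> or on its boundary. The latter is
  excluded because the boundary of \<open>C2\<close> lies in that of \<open>C1\<close>, which misses
  the open set \<open>C1\<close>. This is where the boundary clause of a chart is used.\<close>

lemma is_tangent_cone_subset:
  assumes "is_tangent_cone \<Omega> x C1" "is_tangent_cone \<Omega> x C2"
  shows "C1 \<subseteq> C2"
proof -
  obtain U1 U2 where U: "open_cone C1" "cone_chart UNIV \<Omega> x C1 U1" "(U1 has_derivative (\<lambda>h. h)) (at x)"
     "open_cone C2" "cone_chart UNIV \<Omega> x C2 U2" "(U2 has_derivative (\<lambda>h. h)) (at x)"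
    using assms unfolding is_tangent_cone_def by blast
  have "C1 \<subseteq> closure C2" using tangent_subset_closure(1)[OF U(1,4,2,5,3,6)] .
  moreover have "frontier C2 \<subseteq> closure (frontier C1)" using tangent_subset_closure(2)[OF U(4,1,5,2,6,3)] .
  moreover have "closure (frontier C1) = frontier C1" by simp
  moreover have "frontier C1 \<inter> C1 = {}" using U(1) by (simp add: open_cone_def frontier_disjoint_eq)
  moreover have "closure C2 = C2 \<union> frontier C2" using closure_Un_frontier by blast
  ultimately show ?thesis by blast
qed

lemma tangent_cone_eq: "is_tangent_cone \<Omega> x C \<Longrightarrow> tangent_cone \<Omega> x = C"
  unfolding tangent_cone_def by (rule the_equality) (auto dest: is_tangent_cone_subset)

text \<open>Gnomonic charts: the central projection from the sphere to the affine hyperplane \<open>\<Lambda> (\<cdot>, 1)\<close>.\<close>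

lemma sphere_chart:
  fixes \<Lambda> :: "'a::euclidean_space \<times> real \<Rightarrow> 'b::euclidean_space" and C :: "'b set"
  assumes "linear \<Lambda>" "linear \<Lambda>'" and inv: "\<And>w. \<Lambda>' (\<Lambda> w) = w" "\<And>y. \<Lambda> (\<Lambda>' y) = y"
    and C: "open_cone C" and x: "x \<in> sphere 0 1" "\<Lambda> (0, 1) = x"
    and ch: "cone_chart UNIV {z. \<Lambda> (z, 1) \<in> C} 0 P U"
  shows "\<exists>U'. cone_chart (sphere 0 1) (C \<inter> sphere 0 1) x P U'"
proof -
  \<comment> \<open>The inverse \<open>\<Lambda>'\<close> splits a vector into a horizontal part and
    a height; central projection divides by the height and is defined where it is positive.\<close>
  define N where "N = {y \<in> sphere 0 1. snd (\<Lambda>' y) > 0}"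
  define \<Phi> where "\<Phi> y = (1 / snd (\<Lambda>' y)) *\<^sub>R fst (\<Lambda>' y)" for y
  define \<Psi> where "\<Psi> z = (1 / norm (\<Lambda> (z, 1))) *\<^sub>R \<Lambda> (z, 1)" for z
  have nz: "\<Lambda> (z, 1) \<noteq> 0" for z
    using inv(1)[of "(z, 1)"] linear_0[OF assms(2)] by (metis prod.inject zero_neq_one zero_prod_def)
  have lf: "linear (\<lambda>y. fst (\<Lambda>' y))" "linear (\<lambda>y. snd (\<Lambda>' y))"
    using linear_compose[OF assms(2) linear_fst] linear_compose[OF assms(2) linear_snd] by (auto simp: o_def)
  let ?T = "{y. snd (\<Lambda>' y) > 0}"
  have oT: "open ?T"
    by (intro open_Collect_less continuous_on_const linear_continuous_on) (use lf linear_conv_bounded_linear in auto)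
  note sc = open_cone_scale[OF C]
  have dec: "y = snd (\<Lambda>' y) *\<^sub>R \<Lambda> (\<Phi> y, 1)" if "snd (\<Lambda>' y) > 0" for y
  proof -
    have "snd (\<Lambda>' y) *\<^sub>R \<Lambda> (\<Phi> y, 1) = \<Lambda> (snd (\<Lambda>' y) *\<^sub>R (\<Phi> y, 1))" by (rule linear_cmul[OF assms(1), symmetric])
    also have "snd (\<Lambda>' y) *\<^sub>R (\<Phi> y, 1) = \<Lambda>' y" using that by (simp add: \<Phi>_def prod_eq_iff)
    finally show ?thesis by (simp add: inv(2))
  qed
  have \<Psi>N: "\<Psi> z \<in> N" "\<Phi> (\<Psi> z) = z" for z
  proof -
    have L: "\<Lambda>' (\<Psi> z) = (1 / norm (\<Lambda> (z, 1))) *\<^sub>R (z, 1)"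
      unfolding \<Psi>_def linear_cmul[OF assms(2)] inv(1) ..
    show "\<Psi> z \<in> N" unfolding N_def using nz[of z] by (simp add: L) (simp add: \<Psi>_def)
    show "\<Phi> (\<Psi> z) = z" unfolding \<Phi>_def L using nz[of z] by simp
  qed
  have \<Psi>\<Phi>: "\<Psi> (\<Phi> y) = y" if "y \<in> N" for y
  proof -
    have s: "snd (\<Lambda>' y) > 0" "norm y = 1" using that by (auto simp: N_def)
    have "1 = snd (\<Lambda>' y) * norm (\<Lambda> (\<Phi> y, 1))"
      using arg_cong[OF dec[OF s(1)], of norm] s by simp
    then have "1 / norm (\<Lambda> (\<Phi> y, 1)) = snd (\<Lambda>' y)" using s(1) by (metis mult_eq_0_iff nonzero_eq_divide_eq zero_neq_one)
    then show ?thesis unfolding \<Psi>_def using dec[OF s(1)] by simp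
  qed
  have p: "diffeo_pair N UNIV \<Phi> \<Psi>"
    unfolding diffeo_pair_def
  proof (intro conjI)
    have "smooth_on ?T \<Phi>"
      unfolding \<Phi>_def by (intro smooth_on_scaleR smooth_on_divide oT smooth_on_const smooth_on_linear lf) auto
    then show "smooth_map_on N \<Phi>" by (rule smooth_map_onI[OF oT]) (auto simp: N_def)
    have "smooth_on UNIV (\<lambda>z. (z, 1 :: real))" by (intro smooth_on_Pair smooth_on_ident smooth_on_const) auto
    then have "smooth_on UNIV (\<lambda>z. \<Lambda> (z, 1))" by (rule smooth_on_compose_linear[OF open_UNIV assms(1)])
    then have "smooth_on UNIV \<Psi>"
      unfolding \<Psi>_def by (intro smooth_on_scaleR smooth_on_divide smooth_on_norm smooth_on_const) (auto simp: nz)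
    then show "smooth_map_on UNIV \<Psi>" by (rule smooth_map_onI[OF open_UNIV]) auto
  qed (use \<Psi>N \<Psi>\<Phi> in auto)
  have Lx: "\<Lambda>' x = (0, 1)" using inv(1)[of "(0, 1)"] x(2) by simp
  have "cone_chart (sphere 0 1) (C \<inter> sphere 0 1) x P (\<lambda>y. U (\<Phi> y))"
  proof (rule cone_chart_transfer[OF _ p open_UNIV])
    show "cone_chart UNIV {z. \<Lambda> (z, 1) \<in> C} (\<Phi> x) P U" using ch by (simp add: \<Phi>_def Lx)
    have "N = sphere 0 1 \<inter> ?T" by (auto simp: N_def)
    then show "openin (top_of_set (sphere 0 1)) N" using oT by auto
    show "x \<in> N" using x(1) by (simp add: N_def Lx)
    show "y \<in> C \<inter> sphere 0 1 \<longleftrightarrow> \<Phi> y \<in> {z. \<Lambda> (z, 1) \<in> C}" if "y \<in> N" for y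
      using that dec[of y] sc[of "snd (\<Lambda>' y)" "\<Lambda> (\<Phi> y, 1)"] by (auto simp: N_def)
  qed
  then show ?thesis by blast
qed

lemma is_tangent_cone_interior:
  fixes \<Omega> :: "'a::euclidean_space set"
  assumes "open \<Omega>" "x \<in> \<Omega>" shows "is_tangent_cone \<Omega> x UNIV"
proof -
  have 1: "smooth_on UNIV (\<lambda>y. y - x)" "smooth_on UNIV (\<lambda>y. y + x)"
    by (intro smooth_on_diff smooth_on_add smooth_on_ident smooth_on_const open_UNIV)+
  have "diffeo_pair \<Omega> {w. w + x \<in> \<Omega>} (\<lambda>y. y - x) (\<lambda>y. y + x)"
    unfolding diffeo_pair_def by (auto intro: smooth_map_onI[OF open_UNIV] 1)
  moreover have "open {w. w + x \<in> \<Omega>}"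
    using assms(1) open_vimage[of \<Omega> "\<lambda>w. w + x"] by (simp add: vimage_def continuous_intros)
  ultimately have "cone_chart UNIV \<Omega> x UNIV (\<lambda>y. y - x)"
    by (rule cone_chartI) (use assms in auto)
  moreover have "((\<lambda>y. y - x) has_derivative (\<lambda>h. h)) (at x)" by (auto intro!: derivative_eq_intros)
  ultimately show ?thesis unfolding is_tangent_cone_def by (auto simp: open_cone_def)
qed

lemma tangent_cone_interior: "open \<Omega> \<Longrightarrow> x \<in> \<Omega> \<Longrightarrow> tangent_cone \<Omega> x = UNIV"
  by (intro tangent_cone_eq is_tangent_cone_interior)

section \<open>Compactly supported test functions\<close>

text \<open>Extends \<open>test_function\<close> to other domains and codomains: duality and
  parallel transport call for complex-valued test functions.\<close>

definition compact_test :: "'a::euclidean_space set \<Rightarrow> ('a \<Rightarrow> 'b::euclidean_space) \<Rightarrow> bool" where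
  "compact_test C \<psi> \<longleftrightarrow> smooth_on UNIV \<psi> \<and> (\<exists>K. compact K \<and> K \<subseteq> C \<and> (\<forall>x. x \<notin> K \<longrightarrow> \<psi> x = 0))"

lemma compact_test_real: "compact_test C \<phi> \<longleftrightarrow> test_function C \<phi>"
  by (simp add: compact_test_def test_function_def)

lemma compact_test_mono: "compact_test C \<psi> \<Longrightarrow> C \<subseteq> D \<Longrightarrow> compact_test D \<psi>"
  unfolding compact_test_def by blast

lemma compact_test_zero: "compact_test C \<psi> \<Longrightarrow> x \<notin> C \<Longrightarrow> \<psi> x = 0"
  unfolding compact_test_def by blast

lemma compact_test_continuous: "compact_test C \<psi> \<Longrightarrow> continuous_on S \<psi>"
  unfolding compact_test_def using smooth_on_continuous continuous_on_subset by blast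

lemma compact_test_scaleR:
  assumes "compact_test C \<eta>" "smooth_on UNIV g"
  shows "compact_test C (\<lambda>x. \<eta> x *\<^sub>R g x)"
  using assms unfolding compact_test_def by (auto intro!: smooth_on_scaleR) 

lemma integrable_lebesgue_continuous_compact:
  fixes f :: "'a::euclidean_space \<Rightarrow> 'b::euclidean_space"
  assumes "continuous_on UNIV f" "compact K" "\<And>x. x \<notin> K \<Longrightarrow> f x = 0"
  shows "integrable lebesgue f"
proof -
  have "integrable lborel (\<lambda>x. indicator K x *\<^sub>R f x)"
    using assms by (intro borel_integrable_compact) (auto intro: continuous_on_subset)
  moreover have "indicator K x *\<^sub>R f x = f x" for x
    using assms(3)[of x] by (auto split: split_indicator)
  ultimately have "integrable lborel f" by simp
  then show ?thesis
    by (subst integrable_completion) (use assms(1) in \<open>auto intro: borel_measurable_continuous_onI\<close>)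
qed

lemma borel_measurable_lebesgue_continuous:
  fixes f :: "'a::euclidean_space \<Rightarrow> 'b::euclidean_space"
  shows "continuous_on UNIV f \<Longrightarrow> f \<in> borel_measurable lebesgue"
  by (intro measurable_completion) (simp add: borel_measurable_continuous_onI)

lemma compact_test_bounded:
  assumes "compact_test C \<psi>" obtains B where "B \<ge> 0" "\<And>x. norm (\<psi> x) \<le> B"
proof -
  obtain K where K: "compact K" "\<And>x. x \<notin> K \<Longrightarrow> \<psi> x = 0"
    using assms unfolding compact_test_def by blast
  have "compact (\<psi> ` K)" using compact_continuous_image[OF compact_test_continuous[OF assms] K(1)] .
  then obtain B where B: "\<And>x. x \<in> K \<Longrightarrow> norm (\<psi> x) \<le> B"
    using compact_imp_bounded bounded_iff by (metis image_eqI)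
  have "norm (\<psi> x) \<le> max B 0" for x using B[of x] K(2)[of x] by fastforce
  then show ?thesis using that[of "max B 0"] by auto
qed

lemma compact_test_integrable_square:
  assumes "compact_test C \<psi>" shows "integrable lebesgue (\<lambda>x. (norm (\<psi> x))\<^sup>2)"
proof -
  obtain K where K: "compact K" "\<And>x. x \<notin> K \<Longrightarrow> \<psi> x = 0"
    using assms unfolding compact_test_def by blast
  show ?thesis
    by (rule integrable_lebesgue_continuous_compact[OF _ K(1)])
       (use K(2) compact_test_continuous[OF assms, of UNIV] in \<open>auto intro!: continuous_intros\<close>)
qed

text \<open>A finite sum of bumps on balls that cover \<open>K\<close>. Positivity on
  \<open>K\<close> is all that is asked for, since the cut-off will be divided out again.\<close>

lemma compact_test_positive:
  fixes C :: "'a::euclidean_space set"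
  assumes "open C" "compact K" "K \<subseteq> C"
  obtains \<eta> :: "'a \<Rightarrow> real" where "compact_test C \<eta>" "\<And>x. \<eta> x \<ge> 0" "\<And>x. x \<in> K \<Longrightarrow> \<eta> x > 0"
proof -
  have "\<exists>r>0. cball x r \<subseteq> C" if "x \<in> K" for x
    using assms that open_contains_cball by blast
  then obtain r where r: "\<And>x. x \<in> K \<Longrightarrow> r x > 0 \<and> cball x (r x) \<subseteq> C" by metis
  obtain F where F: "finite F" "F \<subseteq> K" "K \<subseteq> (\<Union>x\<in>F. ball x (r x))"
  proof (rule compactE_image[OF assms(2), of K "\<lambda>x. ball x (r x)"])
    show "K \<subseteq> (\<Union>x\<in>K. ball x (r x))" using r by force
  qed auto
  define b where "b x y = flat_exp 0 ((r x)\<^sup>2 - (y - x) \<bullet> (y - x))" for x y :: 'a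
  have pos: "b x y > 0 \<longleftrightarrow> y \<in> ball x (r x)" and zero: "y \<notin> ball x (r x) \<Longrightarrow> b x y = 0" if "x \<in> F" for x y
  proof -
    have "(r x)\<^sup>2 - (y - x) \<bullet> (y - x) > 0 \<longleftrightarrow> norm (y - x) < r x"
    proof -
      have "0 < r x" using r that F(2) by blast
      then show ?thesis by (simp add: dot_square_norm) (metis abs_norm_cancel abs_of_pos abs_square_less_1 norm_ge_zero power2_less_imp_less power_strict_mono less_eq_real_def zero_less_numeral)
    qed
    then show "b x y > 0 \<longleftrightarrow> y \<in> ball x (r x)" "y \<notin> ball x (r x) \<Longrightarrow> b x y = 0"
      by (auto simp: b_def flat_exp_def dist_norm norm_minus_commute)
  qed
  have nn: "b x y \<ge> 0" for x y by (simp add: b_def flat_exp_def)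
  have sm: "smooth_on UNIV (b x)" for x
    unfolding b_def by (rule smooth_on_compose[OF _ _ smooth_on_flat_exp])
      (auto intro!: smooth_on_diff smooth_on_inner smooth_on_const smooth_on_ident)
  show ?thesis
  proof (rule that[of "\<lambda>y. \<Sum>x\<in>F. b x y"])
    have "smooth_on UNIV (\<lambda>y. \<Sum>x\<in>F. b x y)" using sm by (auto intro: smooth_on_sum)
    moreover have "compact (\<Union>x\<in>F. cball x (r x))" using F(1) by (auto intro: compact_UN)
    moreover have "(\<Union>x\<in>F. cball x (r x)) \<subseteq> C" using r F(2) by blast
    moreover have "(\<Sum>x\<in>F. b x y) = 0" if "y \<notin> (\<Union>x\<in>F. cball x (r x))" for y
      using that zero by (intro sum.neutral) force
    ultimately show "compact_test C (\<lambda>y. \<Sum>x\<in>F. b x y)" unfolding compact_test_def by blast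
    show "(\<Sum>x\<in>F. b x y) \<ge> 0" for y using nn by (simp add: sum_nonneg)
    show "(\<Sum>x\<in>F. b x y) > 0" if y: "y \<in> K" for y
    proof -
      obtain x where "x \<in> F" "y \<in> ball x (r x)" using F(3) y by blast
      then show ?thesis using pos nn F(1) by (intro sum_pos2[of F x]) auto
    qed
  qed
qed

section \<open>Integrals of products and of derivatives\<close>

text \<open>Both claims come from \<open>a * b \<le> a^2 * t / 2 + b^2 / (2 * t)\<close>: the choice
  \<open>t = 1\<close> gives integrability, and optimizing over \<open>t\<close> gives the
  Cauchy-Schwarz inequality.\<close>

lemma
  fixes f g :: "'a \<Rightarrow> complex"
  assumes "f \<in> borel_measurable M" "g \<in> borel_measurable M"
    and "integrable M (\<lambda>x. (norm (f x))\<^sup>2)" "integrable M (\<lambda>x. (norm (g x))\<^sup>2)"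
  shows integrable_mult_L2: "integrable M (\<lambda>x. f x * g x)"
    and Cauchy_Schwarz_integral: "norm (\<integral>x. f x * g x \<partial>M)
      \<le> sqrt (\<integral>x. (norm (f x))\<^sup>2 \<partial>M) * sqrt (\<integral>x. (norm (g x))\<^sup>2 \<partial>M)"
proof -
  have ag: "a * b \<le> a\<^sup>2 * t / 2 + b\<^sup>2 / (2 * t)" if "t > 0" for a b t :: real
  proof -
    have "0 \<le> (a * t - b)\<^sup>2 / (2 * t)" using that by simp
    also have "\<dots> = a\<^sup>2 * t / 2 + b\<^sup>2 / (2 * t) - a * b"
      using that by (simp add: power2_eq_square field_simps)
    finally show ?thesis by simp
  qed
  show int: "integrable M (\<lambda>x. f x * g x)"
  proof (rule Bochner_Integration.integrable_bound)
    show "integrable M (\<lambda>x. (norm (f x))\<^sup>2 + (norm (g x))\<^sup>2)" using assms by simp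
    show "AE x in M. norm (f x * g x) \<le> norm ((norm (f x))\<^sup>2 + (norm (g x))\<^sup>2)"
    proof (intro AE_I2)
      fix x
      have "norm (f x) * norm (g x) \<le> (norm (f x))\<^sup>2 / 2 + (norm (g x))\<^sup>2 / 2"
        using ag[of 1 "norm (f x)" "norm (g x)"] by simp
      moreover have "norm ((norm (f x))\<^sup>2 + (norm (g x))\<^sup>2) = (norm (f x))\<^sup>2 + (norm (g x))\<^sup>2" by simp
      ultimately show "norm (f x * g x) \<le> norm ((norm (f x))\<^sup>2 + (norm (g x))\<^sup>2)"
        using zero_le_power2[of "norm (f x)"] zero_le_power2[of "norm (g x)"] by (simp only: norm_mult)
    qed
  qed (use assms in measurable)
  define I where "I = (\<integral>x. (norm (f x))\<^sup>2 \<partial>M)"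
  define J where "J = (\<integral>x. (norm (g x))\<^sup>2 \<partial>M)"
  have bd: "norm (\<integral>x. f x * g x \<partial>M) \<le> I * t / 2 + J / (2 * t)" if "t > 0" for t
  proof -
    have "norm (\<integral>x. f x * g x \<partial>M) \<le> (\<integral>x. norm (f x * g x) \<partial>M)" by (rule integral_norm_bound)
    also have "\<dots> \<le> (\<integral>x. (norm (f x))\<^sup>2 * (t / 2) + (norm (g x))\<^sup>2 * (1 / (2 * t)) \<partial>M)"
      using int assms ag[OF that] by (intro integral_mono integrable_norm) (auto simp: norm_mult)
    also have "\<dots> = I * (t / 2) + J * (1 / (2 * t))"
      unfolding I_def J_def using assms(3,4) by (subst Bochner_Integration.integral_add) auto
    finally show ?thesis by simp
  qed
  have nn: "I \<ge> 0" "J \<ge> 0" by (auto simp: I_def J_def)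
  show "norm (\<integral>x. f x * g x \<partial>M) \<le> sqrt (\<integral>x. (norm (f x))\<^sup>2 \<partial>M) * sqrt (\<integral>x. (norm (g x))\<^sup>2 \<partial>M)"
    unfolding I_def[symmetric] J_def[symmetric]
  proof (cases "I = 0 \<or> J = 0")
    case True
    \<comment> \<open>If one factor has norm zero, the optimal weight degenerates to zero or
      infinity; finite weights still bring the bound below every positive \<open>e\<close>.\<close>
    have "norm (\<integral>x. f x * g x \<partial>M) \<le> e" if "e > 0" for e
    proof (cases "I = 0")
      case True
      have "J / (2 * ((J + 1) / (2 * e))) \<le> e" using nn that by (simp add: field_simps)
      with bd[of "(J + 1) / (2 * e)"] True that nn show ?thesis by simp
    next
      case False
      with \<open>I = 0 \<or> J = 0\<close> bd[of "2 * e / I"] nn that show ?thesis by simp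
    qed
    then have "norm (\<integral>x. f x * g x \<partial>M) \<le> 0" by (meson dense_ge)
    with True show "norm (\<integral>x. f x * g x \<partial>M) \<le> sqrt I * sqrt J" by auto
  next
    case False
    with nn have p: "I > 0" "J > 0" by auto
    have "I * (sqrt J / sqrt I) / 2 + J / (2 * (sqrt J / sqrt I)) = sqrt I * sqrt J"
    proof -
      have "sqrt I * sqrt I = I" "sqrt J * sqrt J = J" using nn by auto
      then have "I * (sqrt J / sqrt I) = sqrt I * sqrt J" "J / (2 * (sqrt J / sqrt I)) = sqrt I * sqrt J / 2"
        using p by (simp_all add: divide_simps mult_ac)
      then show ?thesis by simp
    qed
    with bd[of "sqrt J / sqrt I"] p show "norm (\<integral>x. f x * g x \<partial>M) \<le> sqrt I * sqrt J" by simp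
  qed
qed

text \<open>By the mean value inequality the difference quotients inherit the bound
  \<open>G\<close>, so dominated convergence applies along every sequence tending to
  \<open>t0\<close>.\<close>

lemma has_vector_derivative_integral:
  fixes F :: "real \<Rightarrow> 'a \<Rightarrow> 'b::{banach, second_countable_topology}"
  assumes "\<delta> > 0"
    and der: "\<And>t x. \<bar>t - t0\<bar> < \<delta> \<Longrightarrow> ((\<lambda>t. F t x) has_vector_derivative F' t x) (at t)"
    and bd: "\<And>t x. \<bar>t - t0\<bar> < \<delta> \<Longrightarrow> norm (F' t x) \<le> G x"
    and G: "integrable M G" and F: "\<And>t. \<bar>t - t0\<bar> < \<delta> \<Longrightarrow> integrable M (F t)" and "F' t0 \<in> borel_measurable M"
  shows "((\<lambda>t. \<integral>x. F t x \<partial>M) has_vector_derivative (\<integral>x. F' t0 x \<partial>M)) (at t0)"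
proof -
  have q: "(f has_vector_derivative f') (at t0) \<longleftrightarrow> ((\<lambda>t. (1 / (t - t0)) *\<^sub>R (f t - f t0)) \<longlongrightarrow> f') (at t0)"
    for f :: "real \<Rightarrow> 'b" and f'
  proof -
    have "(f has_vector_derivative f') (at t0) \<longleftrightarrow> ((\<lambda>t. (1 / norm (t - t0)) *\<^sub>R (f t - (f t0 + (t - t0) *\<^sub>R f'))) \<longlongrightarrow> 0) (at t0)"
      by (auto simp: has_vector_derivative_def has_derivative_within bounded_linear_scaleR_left divide_inverse)
    also have "\<dots> \<longleftrightarrow> ((\<lambda>t. (1 / (t - t0)) *\<^sub>R (f t - f t0) - f') \<longlongrightarrow> 0) (at t0)"
    proof (subst (1 2) tendsto_norm_zero_iff[symmetric], rule tendsto_cong)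
      have "norm ((1 / norm (t - t0)) *\<^sub>R (f t - (f t0 + (t - t0) *\<^sub>R f'))) = norm ((1 / (t - t0)) *\<^sub>R (f t - f t0) - f')"
        if "t \<noteq> t0" for t
      proof -
        have "(1 / (t - t0)) *\<^sub>R (f t - f t0) - f' = (1 / (t - t0)) *\<^sub>R (f t - (f t0 + (t - t0) *\<^sub>R f'))"
          using that by (simp add: scaleR_diff_right scaleR_add_right)
        then show ?thesis by simp
      qed
      then show "\<forall>\<^sub>F t in at t0. norm ((1 / norm (t - t0)) *\<^sub>R (f t - (f t0 + (t - t0) *\<^sub>R f'))) = norm ((1 / (t - t0)) *\<^sub>R (f t - f t0) - f')"
        by (auto simp: eventually_at_filter)
    qed
    finally show ?thesis by (simp add: LIM_zero_iff)
  qed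
  have nn: "G x \<ge> 0" for x using bd[of t0 x] \<open>\<delta> > 0\<close> by (auto intro: order_trans[OF norm_ge_zero])
  show ?thesis
    unfolding q tendsto_at_iff_sequentially o_def
  proof (intro allI impI)
    fix X assume X: "\<forall>i::nat. X i \<in> UNIV - {t0}" "X \<longlonglongrightarrow> t0"
    then obtain N where N: "\<And>n. n \<ge> N \<Longrightarrow> \<bar>X n - t0\<bar> < \<delta>"
      using \<open>\<delta> > 0\<close> by (metis LIMSEQ_iff real_norm_def)
    \<comment> \<open>The shift by \<open>N\<close> keeps every term inside the window of radius
      \<delta> on which \<open>G\<close> dominates.\<close>
    have "(\<lambda>n. \<integral>x. (1 / (X (n + N) - t0)) *\<^sub>R (F (X (n + N)) x - F t0 x) \<partial>M) \<longlonglongrightarrow> (\<integral>x. F' t0 x \<partial>M)"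
    proof (rule integral_dominated_convergence[OF _ _ G])
      show "AE x in M. (\<lambda>n. (1 / (X (n + N) - t0)) *\<^sub>R (F (X (n + N)) x - F t0 x)) \<longlonglongrightarrow> F' t0 x"
      proof (intro AE_I2)
        fix x
        have "((\<lambda>t. (1 / (t - t0)) *\<^sub>R (F t x - F t0 x)) \<longlongrightarrow> F' t0 x) (at t0)"
          using der[of t0 x] \<open>\<delta> > 0\<close> q by simp
        then show "(\<lambda>n. (1 / (X (n + N) - t0)) *\<^sub>R (F (X (n + N)) x - F t0 x)) \<longlonglongrightarrow> F' t0 x"
          using X LIMSEQ_ignore_initial_segment[OF X(2), of N] by (auto simp: tendsto_at_iff_sequentially o_def)
      qed
      show "AE x in M. norm ((1 / (X (n + N) - t0)) *\<^sub>R (F (X (n + N)) x - F t0 x)) \<le> G x" for n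
      proof (intro AE_I2)
        fix x
        let ?t = "X (n + N)"
        have b: "norm (F ?t x - F t0 x) \<le> G x * norm (?t - t0)"
        proof (rule differentiable_bound[of "{t. \<bar>t - t0\<bar> < \<delta>}" _ "\<lambda>t h. h *\<^sub>R F' t x"])
          have "{t. \<bar>t - t0\<bar> < \<delta>} = ball t0 \<delta>" by (auto simp: dist_real_def)
          then show "convex {t. \<bar>t - t0\<bar> < \<delta>}" by simp
          show "((\<lambda>t. F t x) has_derivative (\<lambda>h. h *\<^sub>R F' t x)) (at t within {t. \<bar>t - t0\<bar> < \<delta>})"
            if "t \<in> {t. \<bar>t - t0\<bar> < \<delta>}" for t
            using der[of t x] that by (auto simp: has_vector_derivative_def intro: has_derivative_at_withinI)
          show "onorm (\<lambda>h. h *\<^sub>R F' t x) \<le> G x" if "t \<in> {t. \<bar>t - t0\<bar> < \<delta>}" for t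
            using bd[of t x] that by (auto simp: mult.commute[of "G x"] intro!: onorm_le mult_left_mono)
          show "?t \<in> {t. \<bar>t - t0\<bar> < \<delta>}" using N[of "n + N"] by simp
          show "t0 \<in> {t. \<bar>t - t0\<bar> < \<delta>}" using \<open>\<delta> > 0\<close> by simp
        qed
        have "?t \<noteq> t0" using X by blast
        with b show "norm ((1 / (?t - t0)) *\<^sub>R (F ?t x - F t0 x)) \<le> G x"
          unfolding norm_scaleR by (simp add: pos_divide_le_eq)
      qed
      show "(\<lambda>x. (1 / (X (n + N) - t0)) *\<^sub>R (F (X (n + N)) x - F t0 x)) \<in> borel_measurable M" for n
        using F[of "X (n + N)"] F[of t0] N[of "n + N"] \<open>\<delta> > 0\<close> by (intro borel_measurable_scaleR borel_measurable_diff) auto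
    qed fact
    moreover have "(\<integral>x. (1 / (X (n + N) - t0)) *\<^sub>R (F (X (n + N)) x - F t0 x) \<partial>M)
        = (1 / (X (n + N) - t0)) *\<^sub>R ((\<integral>x. F (X (n + N)) x \<partial>M) - (\<integral>x. F t0 x \<partial>M))" for n
      using F[of "X (n + N)"] F[of t0] N[of "n + N"] \<open>\<delta> > 0\<close> by simp
    ultimately show "(\<lambda>n. (1 / (X n - t0)) *\<^sub>R ((\<integral>x. F (X n) x \<partial>M) - (\<integral>x. F t0 x \<partial>M))) \<longlonglongrightarrow> (\<integral>x. F' t0 x \<partial>M)"
      by (rule_tac LIMSEQ_offset[of _ N]) (simp only:)
  qed
qed

lemma integral_lebesgue_translate:
  fixes f :: "'a::euclidean_space \<Rightarrow> 'b::euclidean_space"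
  assumes "continuous_on UNIV f"
  shows "(\<integral>x. f (x + a) \<partial>lebesgue) = (\<integral>x. f x \<partial>lebesgue)"
proof -
  have m: "f \<in> borel_measurable borel" using assms by (rule borel_measurable_continuous_onI)
  have "(\<integral>x. f x \<partial>lborel) = (\<integral>x. f x \<partial>(distr lborel borel ((+) a)))"
    by (simp add: lborel_distr_plus)
  also have "\<dots> = (\<integral>x. f (x + a) \<partial>lborel)" using m by (subst integral_distr) (auto simp: add.commute)
  finally show ?thesis using m by (simp add: integral_completion)
qed

text \<open>The integral of \<open>w (x + t *\<^sub>R v)\<close> does not depend on
  \<open>t\<close>; differentiation under the integral at \<open>t = 0\<close> yields the claim.
  This replaces integration by parts.\<close>

lemma integral_derivative_zero:
  fixes w :: "'a::euclidean_space \<Rightarrow> 'b::euclidean_space"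
  assumes der: "\<And>x. (w has_derivative D x) (at x)" and cont: "continuous_on UNIV (\<lambda>x. D x v)"
    and K: "compact K" "\<And>x. x \<notin> K \<Longrightarrow> w x = 0"
  shows "(\<integral>x. D x v \<partial>lebesgue) = 0"
proof -
  obtain R where R: "K \<subseteq> cball 0 R" "R > 0" 
    using bounded_subset_ballD[OF compact_imp_bounded[OF K(1)], of 0] ball_subset_cball by blast
  have D0: "D x v = 0" if "x \<notin> K" for x
  proof -
    have "(w has_derivative (\<lambda>h. 0)) (at x)"
      by (rule has_derivative_transform_within_open[of "\<lambda>x. 0" _ _ _ "- K"])
         (use that K in \<open>auto simp: compact_imp_closed open_Compl\<close>)
    then show ?thesis using has_derivative_unique[OF der] by metis
  qed
  have wc: "continuous_on UNIV w"
    using der by (auto intro!: continuous_at_imp_continuous_on has_derivative_continuous)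
  obtain B where B: "\<And>x. norm (D x v) \<le> B"
  proof -
    have "compact ((\<lambda>x. D x v) ` K)" by (rule compact_continuous_image[OF continuous_on_subset[OF cont] K(1)]) auto
    then obtain B where B: "\<And>x. x \<in> K \<Longrightarrow> norm (D x v) \<le> B"
      using compact_imp_bounded bounded_iff by (metis image_eqI)
    have "norm (D x v) \<le> max B 0" for x using B[of x] D0[of x] by fastforce
    then show ?thesis using that by blast
  qed
  \<comment> \<open>A ball that contains the supports of all translates with
    \<open>\<bar>t\<bar> < 1\<close>, so that one integrable bound serves them all.\<close>
  let ?R = "R + norm v"
  have ts: "norm x \<le> ?R" if "x + t *\<^sub>R v \<in> K" "\<bar>t\<bar> < 1" for x t
  proof -
    have "norm x \<le> norm (x + t *\<^sub>R v) + norm (t *\<^sub>R v)" by (metis add_diff_cancel norm_triangle_ineq4)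
    moreover have "norm (t *\<^sub>R v) \<le> norm v" using that(2) by (simp add: mult_left_le_one_le)
    ultimately show ?thesis using that R(1) by force
  qed
  have "((\<lambda>t. \<integral>x. w (x + t *\<^sub>R v) \<partial>lebesgue) has_vector_derivative (\<integral>x. D (x + 0 *\<^sub>R v) v \<partial>lebesgue)) (at 0)"
  proof (rule has_vector_derivative_integral[where \<delta> = 1 and G = "\<lambda>x. B * indicator (cball 0 ?R) x"])
    show "((\<lambda>t. w (x + t *\<^sub>R v)) has_vector_derivative D (x + t *\<^sub>R v) v) (at t)" for t x
    proof -
      have "((\<lambda>t. w (x + t *\<^sub>R v)) has_derivative (\<lambda>h. D (x + t *\<^sub>R v) (h *\<^sub>R v))) (at t)"
        by (rule diff_chain_at[OF _ der, unfolded o_def]) (auto intro!: derivative_eq_intros)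
      moreover have "linear (D (x + t *\<^sub>R v))" using der has_derivative_linear by blast
      ultimately show ?thesis by (simp add: has_vector_derivative_def linear_cmul)
    qed
    show "norm (D (x + t *\<^sub>R v) v) \<le> B * indicator (cball 0 ?R) x" if "\<bar>t - 0\<bar> < 1" for t x
      using B[of "x + t *\<^sub>R v"] D0[of "x + t *\<^sub>R v"] ts[of x t] that by (auto split: split_indicator)
    have "integrable lborel (\<lambda>x::'a. indicator (cball 0 ?R) x *\<^sub>R B)"
      by (intro borel_integrable_compact) auto
    then show "integrable lebesgue (\<lambda>x::'a. B * indicator (cball 0 ?R) x)"
      by (subst integrable_completion) (auto simp: mult.commute)
    show "integrable lebesgue (\<lambda>x. w (x + t *\<^sub>R v))" if "\<bar>t - 0\<bar> < 1" for t
      by (rule integrable_lebesgue_continuous_compact[of _ "cball 0 ?R"])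
         (use that ts[of _ t] K(2) in \<open>auto intro!: continuous_on_compose2[OF wc] continuous_intros\<close>)
    show "(\<lambda>x. D (x + 0 *\<^sub>R v) v) \<in> borel_measurable lebesgue"
      using cont by (simp add: borel_measurable_lebesgue_continuous)
  qed simp
  moreover have "(\<lambda>t. \<integral>x. w (x + t *\<^sub>R v) \<partial>lebesgue) = (\<lambda>t. \<integral>x. w x \<partial>lebesgue)"
    by (simp add: integral_lebesgue_translate[OF wc])
  ultimately show ?thesis
    using vector_derivative_unique_at[of _ _ 0 0] by fastforce
qed

section \<open>Duality characterisation of the L2 norm\<close>

lemma smooth_on_polynomial_function:
  fixes p :: "'a::euclidean_space \<Rightarrow> 'b::euclidean_space"
  assumes "polynomial_function p" shows "smooth_on UNIV p"
proof -
  have r: "smooth_on UNIV q" if "real_polynomial_function q" for q :: "'a \<Rightarrow> real"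
    using that by induction (auto intro: smooth_on_linear bounded_linear.linear smooth_on_const smooth_on_add smooth_on_mult)
  have "smooth_on UNIV (\<lambda>x. p x \<bullet> b)" for b
    using assms bounded_linear_inner_left[of b] unfolding polynomial_function_def by (auto simp: o_def intro!: r)
  then show ?thesis by (subst smooth_on_components) auto
qed

text \<open>First extension of the bound: on the compact support of \<eta>, a continuous
  \<open>g\<close> is a uniform limit of polynomials, and \<eta> times a polynomial is a legitimate
  test function.\<close>

lemma test_bound_continuous:
  fixes v :: "'a::euclidean_space \<Rightarrow> complex" and \<eta> :: "'a \<Rightarrow> real"
  assumes v: "v \<in> borel_measurable lebesgue" "integrable lebesgue (\<lambda>x. (norm (v x))\<^sup>2)"
    and bd: "\<And>\<psi>. compact_test C \<psi> \<Longrightarrow> norm (\<integral>x. v x * \<psi> x \<partial>lebesgue) \<le> M * sqrt (\<integral>x. (norm (\<psi> x))\<^sup>2 \<partial>lebesgue)"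
    and \<eta>: "compact_test C \<eta>" and g: "continuous_on UNIV g"
  shows "norm (\<integral>x. v x * (\<eta> x *\<^sub>R g x) \<partial>lebesgue) \<le> M * sqrt (\<integral>x. (norm (\<eta> x *\<^sub>R g x))\<^sup>2 \<partial>lebesgue)"
proof -
  obtain K where K: "compact K" "\<And>x. x \<notin> K \<Longrightarrow> \<eta> x = 0"
    using \<eta> unfolding compact_test_def by blast
  have "\<exists>p. polynomial_function p \<and> (\<forall>x\<in>K. norm (g x - p x) < inverse (real (Suc n)))" for n
    by (rule Stone_Weierstrass_polynomial_function[OF K(1)]) (use g continuous_on_subset in auto)
  then obtain P where P: "\<And>n. polynomial_function (P n)" "\<And>n x. x \<in> K \<Longrightarrow> norm (g x - P n x) < inverse (real (Suc n))"
    by metis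
  have lim: "(\<lambda>n. \<eta> x *\<^sub>R P n x) \<longlonglongrightarrow> \<eta> x *\<^sub>R g x" for x
  proof (cases "x \<in> K")
    case True
    have "(\<lambda>n. g x - P n x) \<longlonglongrightarrow> 0"
      by (rule Lim_null_comparison[OF _ LIMSEQ_inverse_real_of_nat]) (intro always_eventually allI less_imp_le P(2)[OF True])
    then have "P \<longlonglongrightarrow> g \<longleftrightarrow> P \<longlonglongrightarrow> g" "(\<lambda>n. P n x) \<longlonglongrightarrow> g x"
      using LIM_zero_iff tendsto_minus_cancel_left[of "\<lambda>n. g x - P n x" 0 sequentially]
      by (auto simp: LIM_zero_iff)
    then show ?thesis by (intro tendsto_intros)
  next
    case False
    then show ?thesis using K(2) by simp
  qed
  have pb: "norm (\<eta> x *\<^sub>R P n x) \<le> norm (\<eta> x *\<^sub>R g x) + \<bar>\<eta> x\<bar>" for n x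
  proof (cases "x \<in> K")
    case True
    have "norm (P n x) \<le> norm (g x) + norm (g x - P n x)" by (metis add.commute norm_minus_commute norm_triangle_sub)
    also have "\<dots> \<le> norm (g x) + 1" using P(2)[OF True, of n] inverse_le_1_iff[of "real (Suc n)"] by simp
    finally have "\<bar>\<eta> x\<bar> * norm (P n x) \<le> \<bar>\<eta> x\<bar> * (norm (g x) + 1)" by (rule mult_left_mono) simp
    then show ?thesis by (simp add: algebra_simps)
  next
    case False
    then show ?thesis using K(2) by simp
  qed
  have test: "compact_test C (\<lambda>x. \<eta> x *\<^sub>R P n x)" for n
    using \<eta> P(1) by (intro compact_test_scaleR smooth_on_polynomial_function)
  \<comment> \<open>The approximation error is at most 1 on \<open>K\<close>, so this compactly
    supported function dominates all approximants.\<close>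
  define h where "h = (\<lambda>x. complex_of_real (norm (\<eta> x *\<^sub>R g x) + \<bar>\<eta> x\<bar>))"
  have hc: "continuous_on UNIV h"
    unfolding h_def using compact_test_continuous[OF \<eta>, of UNIV] g by (intro continuous_intros) auto
  have h0: "h x = 0" if "x \<notin> K" for x using K(2)[OF that] by (simp add: h_def)
  have h2: "integrable lebesgue (\<lambda>x. (norm (h x))\<^sup>2)"
    by (rule integrable_lebesgue_continuous_compact[OF _ K(1)]) (use hc h0 in \<open>auto intro!: continuous_intros\<close>)
  have hm: "h \<in> borel_measurable lebesgue" using hc by (rule borel_measurable_lebesgue_continuous)
  have nh: "norm (h x) = norm (\<eta> x *\<^sub>R g x) + \<bar>\<eta> x\<bar>" for x unfolding h_def norm_of_real by simp
  have gm: "(\<lambda>x. \<eta> x *\<^sub>R g x) \<in> borel_measurable lebesgue"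
    using compact_test_continuous[OF \<eta>, of UNIV] g by (intro borel_measurable_lebesgue_continuous continuous_intros)
  have pm: "(\<lambda>x. \<eta> x *\<^sub>R P n x) \<in> borel_measurable lebesgue" for n
    using compact_test_continuous[OF test] by (intro borel_measurable_lebesgue_continuous)
  have l1: "(\<lambda>n. \<integral>x. v x * (\<eta> x *\<^sub>R P n x) \<partial>lebesgue) \<longlonglongrightarrow> (\<integral>x. v x * (\<eta> x *\<^sub>R g x) \<partial>lebesgue)"
  proof (rule integral_dominated_convergence)
    show "integrable lebesgue (\<lambda>x. norm (v x * h x))"
      by (intro integrable_norm integrable_mult_L2 v hm h2)
    show "AE x in lebesgue. norm (v x * \<eta> x *\<^sub>R P n x) \<le> norm (v x * h x)" for n
      unfolding norm_mult[of "v _"] nh using pb by (intro AE_I2 mult_left_mono) auto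
    show "AE x in lebesgue. (\<lambda>n. v x * \<eta> x *\<^sub>R P n x) \<longlonglongrightarrow> v x * \<eta> x *\<^sub>R g x"
      by (intro AE_I2 tendsto_mult_left lim)
    show "(\<lambda>x. v x * \<eta> x *\<^sub>R g x) \<in> borel_measurable lebesgue" by (rule borel_measurable_times[OF v(1) gm])
    show "(\<lambda>x. v x * \<eta> x *\<^sub>R P n x) \<in> borel_measurable lebesgue" for n by (rule borel_measurable_times[OF v(1) pm])
  qed
  have l2: "(\<lambda>n. \<integral>x. (norm (\<eta> x *\<^sub>R P n x))\<^sup>2 \<partial>lebesgue) \<longlonglongrightarrow> (\<integral>x. (norm (\<eta> x *\<^sub>R g x))\<^sup>2 \<partial>lebesgue)"
  proof (rule integral_dominated_convergence[OF _ _ h2])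
    show "AE x in lebesgue. norm ((norm (\<eta> x *\<^sub>R P n x))\<^sup>2) \<le> (norm (h x))\<^sup>2" for n
      unfolding nh norm_power real_norm_def abs_norm_cancel using pb by (intro AE_I2 power_mono) simp_all
    show "AE x in lebesgue. (\<lambda>n. (norm (\<eta> x *\<^sub>R P n x))\<^sup>2) \<longlonglongrightarrow> (norm (\<eta> x *\<^sub>R g x))\<^sup>2"
      by (intro AE_I2 tendsto_power tendsto_norm lim)
    show "(\<lambda>x. (norm (\<eta> x *\<^sub>R g x))\<^sup>2) \<in> borel_measurable lebesgue" using gm by measurable
    show "(\<lambda>x. (norm (\<eta> x *\<^sub>R P n x))\<^sup>2) \<in> borel_measurable lebesgue" for n using pm by measurable
  qed
  show ?thesis
    by (rule LIMSEQ_le[OF tendsto_norm[OF l1] tendsto_mult_left[OF tendsto_real_sqrt[OF l2]]]) (use bd test in blast)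
qed

text \<open>Second extension: a measurable \<open>g\<close> is almost everywhere a limit of
  continuous functions, and the factor \<eta> supplies the domination.\<close>

lemma test_bound_bounded:
  fixes v :: "'a::euclidean_space \<Rightarrow> complex" and \<eta> :: "'a \<Rightarrow> real"
  assumes v: "v \<in> borel_measurable lebesgue" "integrable lebesgue (\<lambda>x. (norm (v x))\<^sup>2)"
    and bd: "\<And>\<psi>. compact_test C \<psi> \<Longrightarrow> norm (\<integral>x. v x * \<psi> x \<partial>lebesgue) \<le> M * sqrt (\<integral>x. (norm (\<psi> x))\<^sup>2 \<partial>lebesgue)"
    and \<eta>: "compact_test C \<eta>" and g: "g \<in> borel_measurable lebesgue" "\<And>x. norm (g x) \<le> B" and "B > 0"
  shows "norm (\<integral>x. v x * (\<eta> x *\<^sub>R g x) \<partial>lebesgue) \<le> M * sqrt (\<integral>x. (norm (\<eta> x *\<^sub>R g x))\<^sup>2 \<partial>lebesgue)"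
proof -
  have "g measurable_on UNIV" using g(1) by (intro lebesgue_measurable_imp_measurable_on) auto
  then obtain N q where N: "negligible N" and q: "\<And>n. continuous_on UNIV (q n)"
    and ql: "\<And>x. x \<notin> N \<Longrightarrow> (\<lambda>n. q n x) \<longlonglongrightarrow> g x"
    unfolding measurable_on_def by auto
  \<comment> \<open>truncation at height \<open>B\<close> keeps the approximants continuous and makes them uniformly bounded\<close>
  define Q where "Q n x = (B / max B (norm (q n x))) *\<^sub>R q n x" for n x
  have Qc: "continuous_on UNIV (Q n)" for n
    unfolding Q_def using q \<open>B > 0\<close> by (intro continuous_intros) (auto simp: max_def)
  have Qb: "norm (Q n x) \<le> B" for n x
    using \<open>B > 0\<close> by (auto simp: Q_def max_def field_simps)
  have "AE x in lebesgue. x \<notin> N" using N by (simp add: negligible_iff_null_sets AE_not_in)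
  then have Ql: "AE x in lebesgue. (\<lambda>n. Q n x) \<longlonglongrightarrow> g x"
  proof eventually_elim
    fix x assume "x \<notin> N"
    then have "(\<lambda>n. (B / max B (norm (q n x))) *\<^sub>R q n x) \<longlonglongrightarrow> (B / max B (norm (g x))) *\<^sub>R g x"
      using ql \<open>B > 0\<close> by (intro tendsto_intros) (auto simp: max_def)
    moreover have "max B (norm (g x)) = B" using g(2)[of x] by simp
    ultimately show "(\<lambda>n. Q n x) \<longlonglongrightarrow> g x" using \<open>B > 0\<close> by (simp add: Q_def)
  qed
  have \<eta>m: "\<eta> \<in> borel_measurable lebesgue"
    using compact_test_continuous[OF \<eta>] by (rule borel_measurable_lebesgue_continuous)
  define h where "h = (\<lambda>x. complex_of_real (\<eta> x * B))"
  have nh: "norm (h x) = \<bar>\<eta> x\<bar> * B" for x using \<open>B > 0\<close> by (simp add: h_def norm_mult)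
  have h2: "integrable lebesgue (\<lambda>x. (norm (h x))\<^sup>2)"
    unfolding nh power_mult_distrib using compact_test_integrable_square[OF \<eta>] by simp
  have hm: "h \<in> borel_measurable lebesgue" unfolding h_def using \<eta>m by measurable
  have Qm: "Q n \<in> borel_measurable lebesgue" for n
    using Qc by (rule borel_measurable_lebesgue_continuous)
  have bd': "norm (\<eta> x *\<^sub>R Q n x) \<le> norm (h x)" for n x
    unfolding nh using Qb[of n x] by (simp add: mult_left_mono)
  have l1: "(\<lambda>n. \<integral>x. v x * (\<eta> x *\<^sub>R Q n x) \<partial>lebesgue) \<longlonglongrightarrow> (\<integral>x. v x * (\<eta> x *\<^sub>R g x) \<partial>lebesgue)"
  proof (rule integral_dominated_convergence)
    show "integrable lebesgue (\<lambda>x. norm (v x * h x))"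
      by (intro integrable_norm integrable_mult_L2 v hm h2)
    show "AE x in lebesgue. norm (v x * \<eta> x *\<^sub>R Q n x) \<le> norm (v x * h x)" for n
      unfolding norm_mult[of "v _"] using bd' by (intro AE_I2 mult_left_mono) auto
    show "AE x in lebesgue. (\<lambda>n. v x * \<eta> x *\<^sub>R Q n x) \<longlonglongrightarrow> v x * \<eta> x *\<^sub>R g x"
      using Ql by eventually_elim (intro tendsto_mult_left tendsto_intros)
    show "(\<lambda>x. v x * \<eta> x *\<^sub>R g x) \<in> borel_measurable lebesgue"
      by (intro borel_measurable_times borel_measurable_scaleR v g \<eta>m)
    show "(\<lambda>x. v x * \<eta> x *\<^sub>R Q n x) \<in> borel_measurable lebesgue" for n
      by (intro borel_measurable_times borel_measurable_scaleR v Qm \<eta>m)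
  qed
  have l2: "(\<lambda>n. \<integral>x. (norm (\<eta> x *\<^sub>R Q n x))\<^sup>2 \<partial>lebesgue) \<longlonglongrightarrow> (\<integral>x. (norm (\<eta> x *\<^sub>R g x))\<^sup>2 \<partial>lebesgue)"
  proof (rule integral_dominated_convergence[OF _ _ h2])
    show "AE x in lebesgue. norm ((norm (\<eta> x *\<^sub>R Q n x))\<^sup>2) \<le> (norm (h x))\<^sup>2" for n
      unfolding norm_power real_norm_def abs_norm_cancel using bd' by (intro AE_I2 power_mono) simp_all
    show "AE x in lebesgue. (\<lambda>n. (norm (\<eta> x *\<^sub>R Q n x))\<^sup>2) \<longlonglongrightarrow> (norm (\<eta> x *\<^sub>R g x))\<^sup>2"
      using Ql by eventually_elim (intro tendsto_power tendsto_norm tendsto_intros)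
    show "(\<lambda>x. (norm (\<eta> x *\<^sub>R g x))\<^sup>2) \<in> borel_measurable lebesgue"
      using g(1) \<eta>m by measurable
    show "(\<lambda>x. (norm (\<eta> x *\<^sub>R Q n x))\<^sup>2) \<in> borel_measurable lebesgue" for n
      using Qm \<eta>m by measurable
  qed
  show ?thesis
    by (rule LIMSEQ_le[OF tendsto_norm[OF l1] tendsto_mult_left[OF tendsto_real_sqrt[OF l2]]])
       (use test_bound_continuous[OF v bd \<eta> Qc] in blast)
qed

text \<open>The extremal test function would be the conjugate of \<open>v\<close>. Truncated to a
  compact set on which \<open>v\<close> is bounded it is admissible by the preceding extensions and
  gives \<open>I \<le> M * sqrt I\<close> for the truncated integral \<open>I\<close>. The
  truncations then exhaust \<open>C\<close>.\<close>

proposition L2_norm_le_of_test_bound: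
  fixes v :: "'a::euclidean_space \<Rightarrow> complex"
  assumes "open C" and v: "v \<in> borel_measurable lebesgue" "integrable lebesgue (\<lambda>x. (norm (v x))\<^sup>2)"
    and out: "\<And>x. x \<notin> C \<Longrightarrow> v x = 0"
    and bd: "\<And>\<psi>. compact_test C \<psi> \<Longrightarrow> norm (\<integral>x. v x * \<psi> x \<partial>lebesgue) \<le> M * sqrt (\<integral>x. (norm (\<psi> x))\<^sup>2 \<partial>lebesgue)"
  shows "(\<integral>x. (norm (v x))\<^sup>2 \<partial>lebesgue) \<le> M\<^sup>2"
proof -
  obtain K where K: "\<And>n. compact (K n)" "\<And>n. K n \<subseteq> C" "\<And>n. K n \<subseteq> interior (K (Suc n))" "\<Union>(range K) = C"
    using open_Union_compact_subsets[OF \<open>open C\<close>] by metis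
  define E where "E n = {x \<in> K n. norm (v x) \<le> real n}" for n
  have Em: "E n \<in> sets lebesgue" for n
  proof -
    have "E n = K n \<inter> {x \<in> space lebesgue. norm (v x) \<le> real n}" by (auto simp: E_def)
    also have "\<dots> \<in> sets lebesgue"
    proof (rule sets.Int)
      show "{x \<in> space lebesgue. norm (v x) \<le> real n} \<in> sets lebesgue" using v(1) by measurable
    qed (simp add: K(1) lmeasurable_compact fmeasurableD)
    finally show ?thesis .
  qed
  have le: "(\<integral>x. indicator (E n) x *\<^sub>R (norm (v x))\<^sup>2 \<partial>lebesgue) \<le> M\<^sup>2" for n
  proof -
    obtain \<eta> :: "'a \<Rightarrow> real" where \<eta>: "compact_test C \<eta>" "\<And>x. \<eta> x \<ge> 0" "\<And>x. x \<in> K n \<Longrightarrow> \<eta> x > 0"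
      using compact_test_positive[OF \<open>open C\<close> K(1,2)] by metis
    have \<eta>m: "\<eta> \<in> borel_measurable lebesgue"
      using compact_test_continuous[OF \<eta>(1)] by (rule borel_measurable_lebesgue_continuous)
    obtain c where c: "c > 0" "\<And>x. x \<in> K n \<Longrightarrow> \<eta> x \<ge> c"
    proof (cases "K n = {}")
      case False
      then obtain y where "y \<in> K n" "\<And>x. x \<in> K n \<Longrightarrow> \<eta> y \<le> \<eta> x"
        using continuous_attains_inf[OF K(1) False compact_test_continuous[OF \<eta>(1)]] by blast
      then show ?thesis using that[of "\<eta> y"] \<eta>(3) by blast
    qed (auto intro: that[of 1])
    \<comment> \<open>Division by \<eta> is harmless on \<open>E n\<close>, where \<eta> is bounded
      below by \<open>c\<close>; the product of \<eta> and \<open>g\<close> is then exactly the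
      truncated conjugate of \<open>v\<close>.\<close>
    define g where "g x = indicator (E n) x *\<^sub>R (cnj (v x) / complex_of_real (\<eta> x))" for x
    have "(\<lambda>x. cnj (v x)) \<in> borel_measurable lebesgue"
      by (rule borel_measurable_continuous_on[OF _ v(1)]) (intro continuous_intros)
    then have gm: "g \<in> borel_measurable lebesgue"
      unfolding g_def using \<eta>m Em by (auto intro!: borel_measurable_scaleR borel_measurable_divide)
    have gb: "norm (g x) \<le> real n / c + 1" for x
    proof (cases "x \<in> E n")
      case True
      then have "norm (v x) \<le> real n" "\<eta> x \<ge> c" using c(2) by (auto simp: E_def)
      then have "norm (v x) / \<eta> x \<le> real n / c" using c(1) by (intro frac_le) auto
      with True \<eta>(2)[of x] show ?thesis by (simp add: g_def norm_divide)
    qed (use c(1) in \<open>simp add: g_def\<close>)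
    have gx: "\<eta> x *\<^sub>R g x = indicator (E n) x *\<^sub>R cnj (v x)" for x
      using \<eta>(3)[of x] by (auto simp: g_def E_def scaleR_conv_of_real split: split_indicator)
    define I where "I = (\<integral>x. indicator (E n) x *\<^sub>R (norm (v x))\<^sup>2 \<partial>lebesgue)"
    have I: "I \<ge> 0" unfolding I_def by (intro Bochner_Integration.integral_nonneg) auto
    have 1: "v x * (\<eta> x *\<^sub>R g x) = complex_of_real (indicator (E n) x *\<^sub>R (norm (v x))\<^sup>2)" for x
      unfolding gx by (auto simp: complex_norm_square[symmetric] simp flip: of_real_power split: split_indicator)
    have 2: "(norm (\<eta> x *\<^sub>R g x))\<^sup>2 = indicator (E n) x *\<^sub>R (norm (v x))\<^sup>2" for x
      unfolding gx by (auto split: split_indicator)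
    have "norm (complex_of_real I) \<le> M * sqrt I"
      using test_bound_bounded[OF v bd \<eta>(1) gm gb] c(1) unfolding 1 2 I_def integral_complex_of_real by (simp add: add_nonneg_pos)
    then have IM: "I \<le> M * sqrt I" using I by simp
    have "I \<le> M\<^sup>2"
    proof (cases "I = 0")
      case False
      with I have "sqrt I > 0" by simp
      moreover have "sqrt I * sqrt I \<le> M * sqrt I" using IM I by simp
      ultimately have "sqrt I \<le> M" by (meson mult_right_le_imp_le)
      then show ?thesis using I by (metis real_sqrt_ge_zero power_mono real_sqrt_pow2)
    qed simp
    then show ?thesis by (simp add: I_def)
  qed
  have "(\<lambda>n. \<integral>x. indicator (E n) x *\<^sub>R (norm (v x))\<^sup>2 \<partial>lebesgue) \<longlonglongrightarrow> (\<integral>x. (norm (v x))\<^sup>2 \<partial>lebesgue)"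
  proof (rule integral_dominated_convergence[OF _ _ v(2)])
    show "AE x in lebesgue. (\<lambda>n. indicator (E n) x *\<^sub>R (norm (v x))\<^sup>2) \<longlonglongrightarrow> (norm (v x))\<^sup>2"
    proof (intro AE_I2)
      fix x
      show "(\<lambda>n. indicator (E n) x *\<^sub>R (norm (v x))\<^sup>2) \<longlonglongrightarrow> (norm (v x))\<^sup>2"
      proof (cases "x \<in> C")
        case True
        then obtain m where m: "x \<in> K m" using K(4) by blast
        have mono: "K i \<subseteq> K j" if "i \<le> j" for i j
          using lift_Suc_mono_le[of K, OF _ that] K(3) interior_subset by blast
        have "indicator (E n) x *\<^sub>R (norm (v x))\<^sup>2 = (norm (v x))\<^sup>2" if "n \<ge> max m (nat \<lceil>norm (v x)\<rceil>)" for n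
          using that mono[of m n] m by (auto simp: E_def split: split_indicator)
        then show ?thesis
          by (intro tendsto_eventually eventually_sequentiallyI) blast
      qed (simp add: out)
    qed
    show "AE x in lebesgue. norm (indicator (E n) x *\<^sub>R (norm (v x))\<^sup>2) \<le> (norm (v x))\<^sup>2" for n
      by (auto split: split_indicator)
  qed (use v(1) Em in \<open>auto intro!: borel_measurable_scaleR\<close>)
  then show ?thesis by (rule LIMSEQ_le_const2) (use le in auto)
qed

section \<open>Parallel transport and a magnetic Poincare inequality\<close>

lemma compact_test_add:
  assumes "compact_test C f" "compact_test C g" shows "compact_test C (\<lambda>x. f x + g x)"
proof -
  obtain K L where K: "compact K" "K \<subseteq> C" "\<And>x. x \<notin> K \<Longrightarrow> f x = 0" and L: "compact L" "L \<subseteq> C" "\<And>x. x \<notin> L \<Longrightarrow> g x = 0"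
    using assms unfolding compact_test_def by blast
  have "smooth_on UNIV (\<lambda>x. f x + g x)" using assms by (auto simp: compact_test_def intro: smooth_on_add)
  moreover have "compact (K \<union> L)" "K \<union> L \<subseteq> C" "\<forall>x. x \<notin> K \<union> L \<longrightarrow> f x + g x = 0" using K L by auto
  ultimately show ?thesis unfolding compact_test_def by blast
qed

lemma compact_test_bilinear:
  assumes "bounded_bilinear h" "smooth_on UNIV f" "compact_test C g"
  shows "compact_test C (\<lambda>x. h (f x) (g x))"
proof -
  have "smooth_on UNIV (\<lambda>x. h (f x) (g x))"
    by (rule smooth_on_bilinear[OF assms(1) open_UNIV assms(2)]) (use assms(3) in \<open>simp add: compact_test_def\<close>)
  then show ?thesis
    using assms(3) bounded_bilinear.zero_right[OF assms(1)] unfolding compact_test_def by metis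
qed

lemma compact_test_linear:
  assumes "linear l" "compact_test C g"
  shows "compact_test C (\<lambda>x. l (g x))"
proof -
  have "smooth_on UNIV (\<lambda>x. l (g x))"
    by (rule smooth_on_compose_linear[OF open_UNIV assms(1)]) (use assms(2) in \<open>simp add: compact_test_def\<close>)
  then show ?thesis
    using assms(2) linear_0[OF assms(1)] unfolding compact_test_def by metis
qed

lemma compact_test_frechet:
  assumes "compact_test C g"
  shows "compact_test C (\<lambda>x. frechet_derivative g (at x) h)"
proof -
  obtain K where K: "smooth_on UNIV g" "compact K" "K \<subseteq> C" "\<And>x. x \<notin> K \<Longrightarrow> g x = 0"
    using assms unfolding compact_test_def by blast
  have "frechet_derivative g (at x) h = 0" if "x \<notin> K" for x
  proof -
    have "(g has_derivative (\<lambda>h. 0)) (at x)"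
      by (rule has_derivative_transform_within_open[of "\<lambda>x. 0" _ _ _ "- K"])
         (use that K in \<open>auto simp: compact_imp_closed open_Compl\<close>)
    from fun_cong[OF frechet_derivative_at[OF this]] show ?thesis by simp
  qed
  with K smooth_on_frechet show ?thesis unfolding compact_test_def by blast
qed

lemma compact_test_has_derivative:
  "compact_test C g \<Longrightarrow> (g has_derivative frechet_derivative g (at x)) (at x)"
  unfolding compact_test_def using smooth_on_has_derivative by blast

lemma compact_test_L2:
  fixes \<psi> :: "'a::euclidean_space \<Rightarrow> complex"
  assumes "compact_test C \<psi>"
  shows "\<psi> \<in> borel_measurable lebesgue" "integrable lebesgue (\<lambda>x. (norm (\<psi> x))\<^sup>2)"
  using compact_test_integrable_square[OF assms] borel_measurable_lebesgue_continuous[OF compact_test_continuous[OF assms]]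
  by auto

text \<open>Rephrased through the extension by zero, so that integrals over the whole space, with
  their translation invariance, can be used throughout.\<close>

lemma L2_on_iff:
  "L2_on C u \<longleftrightarrow> (\<lambda>x. indicator C x *\<^sub>R u x) \<in> borel_measurable lebesgue \<and>
     integrable lebesgue (\<lambda>x. (norm (indicator C x *\<^sub>R u x))\<^sup>2)"
proof -
  have "(\<lambda>x. indicator C x *\<^sub>R (norm (u x))\<^sup>2) = (\<lambda>x. (norm (indicator C x *\<^sub>R u x))\<^sup>2)"
    by (auto split: split_indicator)
  then show ?thesis by (simp add: L2_on_def set_borel_measurable_def set_integrable_def)
qed

lemma L2_norm_sq_eq: "L2_norm_sq C u = (\<integral>x. (norm (indicator C x *\<^sub>R u x))\<^sup>2 \<partial>lebesgue)"
  unfolding L2_norm_sq_def set_lebesgue_integral_def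
  by (rule Bochner_Integration.integral_cong) (auto split: split_indicator)

text \<open>The component of a complex vector in a real direction. It is complex bilinear; the inner
  product on \<open>complex^'n\<close> is real valued and loses the imaginary part.\<close>

definition contract :: "real^'n \<Rightarrow> complex^'n \<Rightarrow> complex" where
  "contract p z = (\<Sum>j\<in>UNIV. complex_of_real (p $ j) * z $ j)"

lemma norm_contract_le: "norm (contract p z) \<le> norm p * norm z"
proof -
  have "norm (contract p z) \<le> (\<Sum>j\<in>UNIV. \<bar>p $ j\<bar> * norm (z $ j))"
    unfolding contract_def by (rule order_trans[OF norm_sum]) (simp add: norm_mult)
  also have "\<dots> = (\<Sum>j\<in>UNIV. \<bar>p $ j\<bar> * \<bar>norm (z $ j)\<bar>)" by simp
  also have "\<dots> \<le> L2_set (\<lambda>j. p $ j) UNIV * L2_set (\<lambda>j. norm (z $ j)) UNIV"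
    by (rule L2_set_mult_ineq)
  finally show ?thesis by (simp add: norm_vec_def L2_set_def)
qed

lemma contract_measurable:
  assumes "F \<in> borel_measurable M" shows "(\<lambda>x. contract p (F x)) \<in> borel_measurable M"
proof -
  have "continuous_on UNIV (contract p)" unfolding contract_def by (intro continuous_intros)
  then show ?thesis using assms by (rule borel_measurable_continuous_on)
qed

lemma contract_L2:
  fixes F :: "'a::euclidean_space \<Rightarrow> complex^'n"
  assumes "F \<in> borel_measurable lebesgue" "integrable lebesgue (\<lambda>x. (norm (F x))\<^sup>2)"
  shows "integrable lebesgue (\<lambda>x. (norm (contract p (F x)))\<^sup>2)"
    and "sqrt (\<integral>x. (norm (contract p (F x)))\<^sup>2 \<partial>lebesgue) \<le> norm p * sqrt (\<integral>x. (norm (F x))\<^sup>2 \<partial>lebesgue)"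
proof -
  have le: "(norm (contract p (F x)))\<^sup>2 \<le> (norm p)\<^sup>2 * (norm (F x))\<^sup>2" for x
    using power_mono[OF norm_contract_le] by (metis norm_ge_zero power_mult_distrib)
  show i: "integrable lebesgue (\<lambda>x. (norm (contract p (F x)))\<^sup>2)"
  proof (rule Bochner_Integration.integrable_bound)
    show "integrable lebesgue (\<lambda>x. (norm p)\<^sup>2 * (norm (F x))\<^sup>2)" using assms by simp
    show "(\<lambda>x. (norm (contract p (F x)))\<^sup>2) \<in> borel_measurable lebesgue"
      using contract_measurable[OF assms(1)] by measurable
    show "AE x in lebesgue. norm ((norm (contract p (F x)))\<^sup>2) \<le> norm ((norm p)\<^sup>2 * (norm (F x))\<^sup>2)"
      using le by simp
  qed
  have "(\<integral>x. (norm (contract p (F x)))\<^sup>2 \<partial>lebesgue) \<le> (\<integral>x. (norm p)\<^sup>2 * (norm (F x))\<^sup>2 \<partial>lebesgue)"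
    using i assms le by (intro integral_mono) auto
  then have "sqrt (\<integral>x. (norm (contract p (F x)))\<^sup>2 \<partial>lebesgue) \<le> sqrt ((norm p)\<^sup>2 * (\<integral>x. (norm (F x))\<^sup>2 \<partial>lebesgue))"
    by (simp add: real_sqrt_le_mono)
  then show "sqrt (\<integral>x. (norm (contract p (F x)))\<^sup>2 \<partial>lebesgue) \<le> norm p * sqrt (\<integral>x. (norm (F x))\<^sup>2 \<partial>lebesgue)"
    by (simp add: real_sqrt_mult)
qed

text \<open>The defining identity uses real test functions and coordinate directions. Splitting
  \<psi> into real and imaginary parts and summing over the coordinates of \<open>p\<close> extends
  it by linearity; the integrals split because each product is integrable.\<close>

lemma magnetic_gradient_complex:
  assumes mg: "magnetic_gradient A C u f" and "L2_on C u" "L2_on C f" "linear A"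
    and \<psi>: "compact_test C \<psi>"
  defines "v \<equiv> \<lambda>x. indicator C x *\<^sub>R u x" and "F \<equiv> \<lambda>x. indicator C x *\<^sub>R f x"
  shows "(\<integral>x. v x * (\<i> * frechet_derivative \<psi> (at x) p + complex_of_real (A x \<bullet> p) * \<psi> x) \<partial>lebesgue)
    = (\<integral>x. contract p (F x) * \<psi> x \<partial>lebesgue)"
proof -
  have v: "v \<in> borel_measurable lebesgue" "integrable lebesgue (\<lambda>x. (norm (v x))\<^sup>2)"
    and F: "F \<in> borel_measurable lebesgue" "integrable lebesgue (\<lambda>x. (norm (F x))\<^sup>2)"
    using assms(2,3) unfolding L2_on_iff v_def F_def by auto
  have iv: "integrable lebesgue (\<lambda>x. v x * g x)" if "compact_test C g" for g
    using integrable_mult_L2[OF v(1) compact_test_L2(1)[OF that] v(2) compact_test_L2(2)[OF that]] .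
  \<comment> \<open>Coordinates are contractions with basis vectors, so their measurability and
    integrability come from the lemmas on \<open>contract\<close>.\<close>
  have Fj: "(\<lambda>x. F x $ j) = (\<lambda>x. contract (axis j 1) (F x))" for j
    by (auto simp: contract_def axis_def if_distrib[of complex_of_real] if_distrib[of "\<lambda>x. x * _"] cong: if_cong)
  have iF: "integrable lebesgue (\<lambda>x. F x $ j * g x)" if "compact_test C g" for g j
    using integrable_mult_L2[OF contract_measurable[OF F(1)] compact_test_L2(1)[OF that] contract_L2(1)[OF F] compact_test_L2(2)[OF that],
      of "axis j 1"] by (simp add: fun_cong[OF Fj, symmetric])
  have Asm: "smooth_on UNIV (\<lambda>x. A x $ j)" for j
    using smooth_on_linear[of UNIV A] \<open>linear A\<close> by (simp add: smooth_on_vec)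
  define T where "T j \<phi> x = \<i> * complex_of_real (frechet_derivative \<phi> (at x) (axis j 1)) + complex_of_real (A x $ j * \<phi> x)"
    for j \<phi> and x :: "real^3"
  have Tt: "compact_test C (T j \<phi>)" if "compact_test C \<phi>" for j \<phi>
  proof -
    have "compact_test C (\<lambda>x. complex_of_real (frechet_derivative \<phi> (at x) (axis j 1)))"
      by (rule compact_test_linear[of complex_of_real, OF _ compact_test_frechet[OF that]]) (auto simp: linear_iff scaleR_conv_of_real)
    then have "compact_test C (\<lambda>x. \<i> * complex_of_real (frechet_derivative \<phi> (at x) (axis j 1)))"
      by (rule compact_test_bilinear[OF bounded_bilinear_mult smooth_on_const[OF open_UNIV]])
    moreover have "compact_test C (\<lambda>x. complex_of_real (A x $ j * \<phi> x))"
      by (rule compact_test_linear[of complex_of_real "C" "\<lambda>x. A x $ j * \<phi> x"])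
         (use compact_test_bilinear[OF bounded_bilinear_mult Asm that] in \<open>auto simp: linear_iff scaleR_conv_of_real\<close>)
    ultimately show ?thesis unfolding T_def by (rule compact_test_add)
  qed
  have base: "(\<integral>x. v x * T j \<phi> x \<partial>lebesgue) = (\<integral>x. F x $ j * complex_of_real (\<phi> x) \<partial>lebesgue)" if "compact_test C \<phi>" for j \<phi>
    using mg that unfolding magnetic_gradient_def compact_test_real[symmetric] set_lebesgue_integral_def T_def v_def F_def
    by simp
  define R I where "R x = Re (\<psi> x)" and "I x = Im (\<psi> x)" for x
  have RI: "compact_test C R" "compact_test C I"
    unfolding R_def I_def by (rule compact_test_linear[OF _ \<psi>]; simp add: linear_iff)+
  have \<psi>eq: "\<psi> x = complex_of_real (R x) + \<i> * complex_of_real (I x)" for x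
    by (simp add: R_def I_def complex_eq_iff)
  have D: "frechet_derivative \<psi> (at x) h = complex_of_real (frechet_derivative R (at x) h) + \<i> * complex_of_real (frechet_derivative I (at x) h)" for x h
  proof -
    have "(\<psi> has_derivative (\<lambda>h. complex_of_real (frechet_derivative R (at x) h) + \<i> * complex_of_real (frechet_derivative I (at x) h))) (at x)"
      unfolding \<psi>eq[abs_def]
      by (intro has_derivative_add has_derivative_mult_right has_derivative_of_real compact_test_has_derivative[OF RI(1)] compact_test_has_derivative[OF RI(2)])
    from fun_cong[OF frechet_derivative_at[OF this], of h] show ?thesis by simp
  qed
  have lin: "frechet_derivative \<psi> (at x) p = (\<Sum>j\<in>UNIV. (p $ j) *\<^sub>R frechet_derivative \<psi> (at x) (axis j 1))" for x
  proof -
    have l: "linear (frechet_derivative \<psi> (at x))"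
      using compact_test_has_derivative[OF \<psi>] has_derivative_linear by blast
    have "p = (\<Sum>j\<in>UNIV. (p $ j) *\<^sub>R axis j 1)" by (simp add: vec_eq_iff axis_def if_distrib[of "\<lambda>x. _ * x"] cong: if_cong)
    then have "frechet_derivative \<psi> (at x) p = frechet_derivative \<psi> (at x) (\<Sum>j\<in>UNIV. (p $ j) *\<^sub>R axis j 1)" by simp
    also have "\<dots> = (\<Sum>j\<in>UNIV. (p $ j) *\<^sub>R frechet_derivative \<psi> (at x) (axis j 1))"
      by (simp add: linear_sum[OF l] linear_cmul[OF l])
    finally show ?thesis .
  qed
  have split: "v x * (\<i> * frechet_derivative \<psi> (at x) p + complex_of_real (A x \<bullet> p) * \<psi> x)
      = (\<Sum>j\<in>UNIV. complex_of_real (p $ j) * (v x * T j R x + \<i> * (v x * T j I x)))" for x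
    unfolding T_def lin unfolding D \<psi>eq[of x] inner_vec_def
    by (simp add: sum_distrib_left sum_distrib_right sum.distrib[symmetric] scaleR_conv_of_real algebra_simps)
  have "(\<integral>x. v x * (\<i> * frechet_derivative \<psi> (at x) p + complex_of_real (A x \<bullet> p) * \<psi> x) \<partial>lebesgue)
     = (\<Sum>j\<in>UNIV. complex_of_real (p $ j) * ((\<integral>x. v x * T j R x \<partial>lebesgue) + \<i> * (\<integral>x. v x * T j I x \<partial>lebesgue)))"
    unfolding split using iv[OF Tt[OF RI(1)]] iv[OF Tt[OF RI(2)]]
    by (simp add: Bochner_Integration.integral_sum)
  also have "\<dots> = (\<Sum>j\<in>UNIV. complex_of_real (p $ j) * (\<integral>x. F x $ j * \<psi> x \<partial>lebesgue))"
  proof (rule sum.cong[OF refl])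
    fix j
    have c: "compact_test C (\<lambda>x. complex_of_real (R x))" "compact_test C (\<lambda>x. complex_of_real (I x))"
      by (rule compact_test_linear[of complex_of_real, OF _ RI(1)] compact_test_linear[of complex_of_real, OF _ RI(2)]; simp add: linear_iff scaleR_conv_of_real)+
    have "(\<integral>x. F x $ j * \<psi> x \<partial>lebesgue) = (\<integral>x. F x $ j * complex_of_real (R x) + \<i> * (F x $ j * complex_of_real (I x)) \<partial>lebesgue)"
      by (rule Bochner_Integration.integral_cong) (auto simp: \<psi>eq algebra_simps)
    also have "\<dots> = (\<integral>x. F x $ j * complex_of_real (R x) \<partial>lebesgue) + \<i> * (\<integral>x. F x $ j * complex_of_real (I x) \<partial>lebesgue)"
      using iF[OF c(1)] iF[OF c(2)] by simp
    finally show "complex_of_real (p $ j) * ((\<integral>x. v x * T j R x \<partial>lebesgue) + \<i> * (\<integral>x. v x * T j I x \<partial>lebesgue))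
      = complex_of_real (p $ j) * (\<integral>x. F x $ j * \<psi> x \<partial>lebesgue)"
      by (simp add: base RI)
  qed
  also have "\<dots> = (\<integral>x. (\<Sum>j\<in>UNIV. complex_of_real (p $ j) * (F x $ j * \<psi> x)) \<partial>lebesgue)"
    using iF[OF \<psi>] by (simp add: Bochner_Integration.integral_sum)
  also have "\<dots> = (\<integral>x. contract p (F x) * \<psi> x \<partial>lebesgue)"
    by (simp add: contract_def sum_distrib_right mult.assoc)
  finally show ?thesis .
qed

text \<open>For linear \<open>A\<close> the phase is the line integral of \<open>A\<close> along the
  segment from \<open>y - p\<close> to \<open>y\<close>. The sign is that of the transposed operator
  \<open>i \<nabla> + A\<close>, because the transport acts on the test function and not on
  \<open>u\<close>.\<close>

definition transport :: "('a::euclidean_space \<Rightarrow> 'a) \<Rightarrow> 'a \<Rightarrow> ('a \<Rightarrow> complex) \<Rightarrow> 'a \<Rightarrow> complex" where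
  "transport A p \<psi> y = cis (p \<bullet> A y - (p \<bullet> A p) / 2) * \<psi> (y - p)"

lemma smooth_on_cis:
  assumes "smooth_on UNIV g" shows "smooth_on UNIV (\<lambda>y. cis (g y))"
proof -
  have "smooth_on UNIV (\<lambda>y. cos (g y) *\<^sub>R 1 + sin (g y) *\<^sub>R \<i>)"
    using assms by (intro smooth_on_add smooth_on_scaleR smooth_on_const smooth_on_compose[OF _ assms smooth_on_sin_cos(1)]
      smooth_on_compose[OF _ assms smooth_on_sin_cos(2)]) auto
  moreover have "(\<lambda>y. cos (g y) *\<^sub>R 1 + sin (g y) *\<^sub>R \<i>) = (\<lambda>y. cis (g y))" by (auto simp: complex_eq_iff)
  ultimately show ?thesis by simp
qed

text \<open>The support is moved by \<open>p\<close>, so stability of \<open>C\<close> under this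
  one translation is enough, even if \<open>C\<close> is not invariant under its inverse.\<close>

lemma compact_test_transport:
  assumes "linear A" "compact_test C \<psi>" "\<And>x. x \<in> C \<Longrightarrow> x + p \<in> C"
  shows "compact_test C (transport A p \<psi>)"
proof -
  obtain K where K: "smooth_on UNIV \<psi>" "compact K" "K \<subseteq> C" "\<And>x. x \<notin> K \<Longrightarrow> \<psi> x = 0"
    using assms(2) unfolding compact_test_def by blast
  have "smooth_on UNIV (\<lambda>y. \<psi> (y - p))"
    by (rule smooth_on_compose[OF _ _ K(1)]) (auto intro!: smooth_on_diff smooth_on_ident smooth_on_const)
  moreover have "smooth_on UNIV (\<lambda>y. cis (p \<bullet> A y - (p \<bullet> A p) / 2))"
    using assms(1) by (intro smooth_on_cis smooth_on_diff smooth_on_inner smooth_on_const smooth_on_linear) auto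
  ultimately have "smooth_on UNIV (transport A p \<psi>)"
    unfolding transport_def[abs_def] by (intro smooth_on_mult) auto
  moreover have "compact ((\<lambda>x. x + p) ` K)" using K(2) by (intro compact_continuous_image continuous_intros)
  moreover have "(\<lambda>x. x + p) ` K \<subseteq> C" using K(3) assms(3) by blast
  moreover have "transport A p \<psi> y = 0" if "y \<notin> (\<lambda>x. x + p) ` K" for y
  proof -
    have "y - p \<notin> K" using that by (metis diff_add_cancel image_eqI)
    then show ?thesis by (simp add: transport_def K(4))
  qed
  ultimately show ?thesis unfolding compact_test_def by blast
qed

lemma integral_norm_transport:
  assumes "compact_test C \<psi>"
  shows "(\<integral>y. (norm (transport A p \<psi> y))\<^sup>2 \<partial>lebesgue) = (\<integral>y. (norm (\<psi> y))\<^sup>2 \<partial>lebesgue)"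
  using integral_lebesgue_translate[of "\<lambda>y. (norm (\<psi> y))\<^sup>2" "- p"]
    continuous_on_power[OF continuous_on_norm[OF compact_test_continuous[OF assms, of UNIV]]]
  by (simp add: transport_def norm_mult)

lemma has_vector_derivative_cis:
  assumes "(g has_real_derivative g') (at t)"
  shows "((\<lambda>t. cis (g t)) has_vector_derivative (g' *\<^sub>R (\<i> * cis (g t)))) (at t)"
proof -
  have "((\<lambda>t. cos (g t) *\<^sub>R 1 + sin (g t) *\<^sub>R \<i>) has_vector_derivative ((- sin (g t) * g') *\<^sub>R 1 + (cos (g t) * g') *\<^sub>R \<i>)) (at t)"
    using assms by (auto intro!: derivative_eq_intros simp: has_real_derivative_iff_has_vector_derivative[symmetric])
  moreover have "(\<lambda>t. cos (g t) *\<^sub>R 1 + sin (g t) *\<^sub>R \<i>) = (\<lambda>t. cis (g t))" by (auto simp: complex_eq_iff)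
  moreover have "(- sin (g t) * g') *\<^sub>R 1 + (cos (g t) * g') *\<^sub>R \<i> = g' *\<^sub>R (\<i> * cis (g t))" by (auto simp: complex_eq_iff)
  ultimately show ?thesis by simp
qed

text \<open>The transports along multiples of \<open>p\<close> commute with their generator. Hence
  the derivative in \<open>t\<close> can be written as a magnetic derivative of the already
  transported function, which is the form in which the weak gradient of \<open>u\<close> can be
  inserted.\<close>

lemma transport_derivatives:
  fixes p :: "'a::euclidean_space"
  assumes "linear A" and \<psi>: "\<And>x. (\<psi> has_derivative D x) (at x)"
  defines "dt \<equiv> \<lambda>t y. cis (t * (p \<bullet> A y) - t\<^sup>2 * (p \<bullet> A p) / 2) *
      (\<i> * complex_of_real (p \<bullet> A y - t * (p \<bullet> A p)) * \<psi> (y - t *\<^sub>R p) - D (y - t *\<^sub>R p) p)"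
  shows "((\<lambda>t. transport A (t *\<^sub>R p) \<psi> y) has_vector_derivative dt t y) (at t)"
    and "dt t y = \<i> * (\<i> * frechet_derivative (transport A (t *\<^sub>R p) \<psi>) (at y) p + complex_of_real (A y \<bullet> p) * transport A (t *\<^sub>R p) \<psi> y)"
proof -
  have Dl: "linear (D x)" for x using \<psi> has_derivative_linear by blast
  have tr: "transport A (t *\<^sub>R p) \<psi> = (\<lambda>y. cis (t * (p \<bullet> A y) - t\<^sup>2 * (p \<bullet> A p) / 2) * \<psi> (y - t *\<^sub>R p))" for t
    using \<open>linear A\<close> by (intro ext) (simp add: transport_def linear_cmul power2_eq_square mult.assoc)
  have "((\<lambda>t. cis (t * (p \<bullet> A y) - t\<^sup>2 * (p \<bullet> A p) / 2)) has_vector_derivative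
      ((p \<bullet> A y - t * (p \<bullet> A p)) *\<^sub>R (\<i> * cis (t * (p \<bullet> A y) - t\<^sup>2 * (p \<bullet> A p) / 2)))) (at t)"
    by (rule has_vector_derivative_cis) (auto intro!: derivative_eq_intros)
  moreover have "((\<lambda>t. \<psi> (y - t *\<^sub>R p)) has_vector_derivative - D (y - t *\<^sub>R p) p) (at t)"
  proof -
    have "((\<lambda>t. \<psi> (y - t *\<^sub>R p)) has_derivative (\<lambda>h. D (y - t *\<^sub>R p) (- (h *\<^sub>R p)))) (at t)"
      by (rule diff_chain_at[OF _ \<psi>, unfolded o_def]) (auto intro!: derivative_eq_intros)
    then show ?thesis by (simp add: has_vector_derivative_def linear_neg[OF Dl] linear_cmul[OF Dl])
  qed
  ultimately have "((\<lambda>t. cis (t * (p \<bullet> A y) - t\<^sup>2 * (p \<bullet> A p) / 2) * \<psi> (y - t *\<^sub>R p)) has_vector_derivative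
     (cis (t * (p \<bullet> A y) - t\<^sup>2 * (p \<bullet> A p) / 2) * (- D (y - t *\<^sub>R p) p) +
      ((p \<bullet> A y - t * (p \<bullet> A p)) *\<^sub>R (\<i> * cis (t * (p \<bullet> A y) - t\<^sup>2 * (p \<bullet> A p) / 2))) * \<psi> (y - t *\<^sub>R p))) (at t)"
    by (rule has_vector_derivative_mult)
  then show "((\<lambda>t. transport A (t *\<^sub>R p) \<psi> y) has_vector_derivative dt t y) (at t)"
    unfolding tr dt_def by (simp add: scaleR_conv_of_real algebra_simps)
  let ?l = "\<lambda>y. t * (p \<bullet> A y) - t\<^sup>2 * (p \<bullet> A p) / 2"
  have Ad: "(A has_derivative A) (at y)" using \<open>linear A\<close> by (simp add: linear_imp_has_derivative)
  have cd: "((\<lambda>y. cis (?l y)) has_derivative (\<lambda>h. (t * (p \<bullet> A h)) *\<^sub>R (\<i> * cis (?l y)))) (at y)"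
  proof -
    have "(cis has_derivative (\<lambda>h. h *\<^sub>R (\<i> * cis (?l y)))) (at (?l y))"
      using has_vector_derivative_cis[OF DERIV_ident, of "?l y"] by (simp add: has_vector_derivative_def)
    moreover have "(?l has_derivative (\<lambda>h. t * (p \<bullet> A h))) (at y)"
      using Ad by (auto intro!: derivative_eq_intros)
    ultimately show ?thesis using diff_chain_at by (force simp: o_def)
  qed
  have "((\<lambda>y. \<psi> (y - t *\<^sub>R p)) has_derivative D (y - t *\<^sub>R p)) (at y)"
  proof -
    have "((\<lambda>y. y - t *\<^sub>R p) has_derivative (\<lambda>h. h)) (at y)" by (auto intro!: derivative_eq_intros)
    from diff_chain_at[OF this \<psi>] show ?thesis by (simp add: o_def)
  qed
  from has_derivative_mult[OF cd this]
  have "(transport A (t *\<^sub>R p) \<psi> has_derivative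
    (\<lambda>h. cis (?l y) * D (y - t *\<^sub>R p) h + (t * (p \<bullet> A h)) *\<^sub>R (\<i> * cis (?l y)) * \<psi> (y - t *\<^sub>R p))) (at y)"
    unfolding tr .
  from fun_cong[OF frechet_derivative_at[OF this], of p]
  have "frechet_derivative (transport A (t *\<^sub>R p) \<psi>) (at y) p =
    cis (?l y) * D (y - t *\<^sub>R p) p + (t * (p \<bullet> A p)) *\<^sub>R (\<i> * cis (?l y)) * \<psi> (y - t *\<^sub>R p)"
    by simp
  then show "dt t y = \<i> * (\<i> * frechet_derivative (transport A (t *\<^sub>R p) \<psi>) (at y) p + complex_of_real (A y \<bullet> p) * transport A (t *\<^sub>R p) \<psi> y)"
    unfolding dt_def by (simp add: tr scaleR_conv_of_real algebra_simps inner_commute)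
qed

text \<open>Along the segment from \<open>0\<close> to \<open>p\<close>, the pairing
  \<open>H t\<close> of \<open>u\<close> with the transported function has as derivative, up to a
  factor of modulus one, the pairing of the component of \<open>f\<close> along \<open>p\<close>
  with that function. The Cauchy-Schwarz inequality bounds it and the mean value inequality
  integrates the bound.\<close>

lemma transport_bound:
  assumes mg: "magnetic_gradient A C u f" and "L2_on C u" "L2_on C f" "linear A"
    and \<psi>: "compact_test C \<psi>" and shift: "\<And>x t. x \<in> C \<Longrightarrow> 0 \<le> t \<Longrightarrow> x + t *\<^sub>R p \<in> C"
  defines "v \<equiv> \<lambda>x. indicator C x *\<^sub>R u x"
  shows "norm ((\<integral>x. v x * transport A p \<psi> x \<partial>lebesgue) - (\<integral>x. v x * \<psi> x \<partial>lebesgue))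
     \<le> norm p * sqrt (L2_norm_sq C f) * sqrt (\<integral>x. (norm (\<psi> x))\<^sup>2 \<partial>lebesgue)"
proof -
  define F where "F = (\<lambda>x. indicator C x *\<^sub>R f x)"
  have v: "v \<in> borel_measurable lebesgue" "integrable lebesgue (\<lambda>x. (norm (v x))\<^sup>2)"
    and F: "F \<in> borel_measurable lebesgue" "integrable lebesgue (\<lambda>x. (norm (F x))\<^sup>2)"
    using assms(2,3) unfolding L2_on_iff v_def F_def by auto
  have iv: "integrable lebesgue (\<lambda>x. v x * g x)" if "compact_test D g" for g D
    using integrable_mult_L2[OF v(1) compact_test_L2(1)[OF that] v(2) compact_test_L2(2)[OF that]] .
  let ?D = "\<lambda>x. frechet_derivative \<psi> (at x)"
  let ?dt = "\<lambda>t y. cis (t * (p \<bullet> A y) - t\<^sup>2 * (p \<bullet> A p) / 2) *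
      (\<i> * complex_of_real (p \<bullet> A y - t * (p \<bullet> A p)) * \<psi> (y - t *\<^sub>R p) - ?D (y - t *\<^sub>R p) p)"
  note td = transport_derivatives[OF \<open>linear A\<close> compact_test_has_derivative[OF \<psi>], where p = p]
  define H where "H t = (\<integral>x. v x * transport A (t *\<^sub>R p) \<psi> x \<partial>lebesgue)" for t
  \<comment> \<open>The two-sided derivative at \<open>t = 0\<close> involves negative
    \<open>t\<close>, for which the support may leave \<open>C\<close>. Only integrability is asked
    there; the weak gradient is inserted for nonnegative \<open>t\<close> only, with
    \<open>tC\<close>.\<close>
  have tt: "compact_test UNIV (transport A (t *\<^sub>R p) \<psi>)" for t
    using \<open>linear A\<close> compact_test_mono[OF \<psi>, of UNIV] by (intro compact_test_transport) auto
  have tC: "compact_test C (transport A (t *\<^sub>R p) \<psi>)" if "t \<ge> 0" for t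
    using shift that by (intro compact_test_transport \<psi> \<open>linear A\<close>) auto
  obtain K where K: "compact K" "K \<subseteq> C" "\<And>x. x \<notin> K \<Longrightarrow> \<psi> x = 0" using \<psi> unfolding compact_test_def by blast
  have K': "?D x p = 0" if "x \<notin> K" for x
  proof -
    have "(\<psi> has_derivative (\<lambda>h. 0)) (at x)"
      by (rule has_derivative_transform_within_open[of "\<lambda>x. 0" _ _ _ "- K"])
         (use that K in \<open>auto simp: compact_imp_closed open_Compl\<close>)
    from fun_cong[OF frechet_derivative_at[OF this]] show ?thesis by simp
  qed
  obtain R where R: "K \<subseteq> ball 0 R" using bounded_subset_ballD[OF compact_imp_bounded[OF K(1)], of 0] by blast
  obtain B0 where B0: "B0 \<ge> 0" "\<And>x. norm (\<psi> x) \<le> B0" using compact_test_bounded[OF \<psi>] by blast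
  obtain B1 where B1: "B1 \<ge> 0" "\<And>x. norm (?D x p) \<le> B1" using compact_test_bounded[OF compact_test_frechet[OF \<psi>]] by blast
  obtain a where a: "a > 0" "\<And>x. norm (A x) \<le> a * norm x" 
    using linear_bounded_pos[OF \<open>linear A\<close>] by (metis mult.commute)
  \<comment> \<open>A window of radius 1 around \<open>t \<in> {0..1}\<close> stays within
    \<open>\<bar>t\<bar> < 2\<close>, which accounts for the factors 2 here and in
    \<open>G\<close>.\<close>
  define R' where "R' = \<bar>R\<bar> + 2 * norm p"
  define G where "G = (norm p * a * R' + 2 * \<bar>p \<bullet> A p\<bar>) * B0 + B1"
  have G0: "G \<ge> 0" unfolding G_def R'_def using a B0(1) B1(1) by simp
  have dtb: "norm (?dt t y) \<le> G * indicator (cball 0 R') y" if t: "\<bar>t\<bar> < 2" for t y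
  proof (cases "y - t *\<^sub>R p \<in> K")
    case True
    have tp: "norm (t *\<^sub>R p) \<le> 2 * norm p" using t by (simp add: mult_right_mono)
    have "norm y \<le> norm (y - t *\<^sub>R p) + norm (t *\<^sub>R p)" by (metis add.commute norm_triangle_sub)
    then have y: "norm y \<le> R'" using True R tp unfolding R'_def by force
    have "\<bar>p \<bullet> A y\<bar> \<le> norm p * norm (A y)" by (rule Cauchy_Schwarz_ineq2)
    also have "\<dots> \<le> norm p * (a * R')" using a y by (intro mult_left_mono order_trans[OF a(2)]) auto
    finally have 1: "\<bar>p \<bullet> A y\<bar> \<le> norm p * a * R'" by simp
    have 2: "\<bar>t * (p \<bullet> A p)\<bar> \<le> 2 * \<bar>p \<bullet> A p\<bar>" using t by (simp add: abs_mult mult_right_mono)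
    have "norm (?dt t y) \<le> \<bar>p \<bullet> A y - t * (p \<bullet> A p)\<bar> * norm (\<psi> (y - t *\<^sub>R p)) + norm (?D (y - t *\<^sub>R p) p)"
      unfolding norm_mult[of "cis _"] norm_cis
      by (simp only: mult_1, rule order_trans[OF norm_triangle_ineq4]) (simp add: norm_mult del: of_real_diff)
    also have "\<dots> \<le> G"
      unfolding G_def using 1 2 B0 B1 by (intro add_mono mult_mono) auto
    finally show ?thesis using y by simp
  next
    case False
    then show ?thesis using K(3) K' G0 by simp
  qed
  have ind: "compact (cball (0::real^3) R')" by simp
  define gG where "gG y = indicator (cball 0 R') y *\<^sub>R complex_of_real G" for y :: "real^3"
  have "integrable lborel (\<lambda>x::real^3. indicator (cball 0 R') x *\<^sub>R G\<^sup>2)"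
    by (intro borel_integrable_compact) auto
  then have "integrable lebesgue (\<lambda>x::real^3. indicator (cball 0 R') x *\<^sub>R G\<^sup>2)"
    by (subst integrable_completion) auto
  moreover have "(norm (gG x))\<^sup>2 = indicator (cball 0 R') x *\<^sub>R G\<^sup>2" for x
    by (auto simp: gG_def split: split_indicator)
  ultimately have gG2: "integrable lebesgue (\<lambda>x. (norm (gG x))\<^sup>2)" by simp
  have gGm: "gG \<in> borel_measurable lebesgue"
    unfolding gG_def by (intro measurable_completion borel_measurable_scaleR borel_measurable_indicator) auto
  have igG: "integrable lebesgue (\<lambda>x. norm (v x * gG x))"
    by (intro integrable_norm integrable_mult_L2 v gGm gG2)
  have cont: "continuous_on UNIV (?dt t)" for t
  proof -
    have 1: "continuous_on UNIV A" using \<open>linear A\<close> by (simp add: linear_continuous_on linear_conv_bounded_linear)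
    have 2: "continuous_on UNIV (\<lambda>y. \<psi> (y - t *\<^sub>R p))"
      by (rule continuous_on_compose2[OF compact_test_continuous[OF \<psi>, of UNIV]]) (intro continuous_intros, simp)
    have 4: "continuous_on UNIV (\<lambda>y. ?D (y - t *\<^sub>R p) p)"
      by (rule continuous_on_compose2[OF compact_test_continuous[OF compact_test_frechet[OF \<psi>], of UNIV]])
         (intro continuous_intros, simp)
    have 3: "continuous_on UNIV (\<lambda>y. cis (t * (p \<bullet> A y) - t\<^sup>2 * (p \<bullet> A p) / 2))"
      by (intro continuous_on_cis continuous_intros 1)
    show ?thesis by (intro continuous_on_mult continuous_on_diff continuous_on_of_real continuous_on_const continuous_on_inner 1 2 3 4)
  qed
  have H': "(H has_vector_derivative (\<integral>x. v x * ?dt t x \<partial>lebesgue)) (at t)" if "t \<in> {0..1}" for t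
    unfolding H_def
  proof (rule has_vector_derivative_integral[OF zero_less_one _ _ igG])
    show "((\<lambda>t. v x * transport A (t *\<^sub>R p) \<psi> x) has_vector_derivative v x * ?dt s x) (at s)" for s x
      by (intro has_vector_derivative_mult_right td(1))
    show "norm (v x * ?dt s x) \<le> norm (v x * gG x)" if "\<bar>s - t\<bar> < 1" for s x
    proof -
      have "norm (?dt s x) \<le> norm (gG x)"
      proof -
        have "\<bar>s\<bar> < 2" using that \<open>t \<in> {0..1}\<close> by auto
        moreover have "norm (gG x) = G * indicator (cball 0 R') x" using G0 by (simp add: gG_def)
        ultimately show ?thesis using dtb[of s x] by presburger
      qed
      then show ?thesis unfolding norm_mult[of "v x"] by (intro mult_left_mono) auto
    qed
    show "integrable lebesgue (\<lambda>x. v x * transport A (s *\<^sub>R p) \<psi> x)" for s by (rule iv[OF tt])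
    show "(\<lambda>x. v x * ?dt t x) \<in> borel_measurable lebesgue"
      by (intro borel_measurable_times v borel_measurable_lebesgue_continuous cont)
  qed
  define M where "M = norm p * sqrt (L2_norm_sq C f) * sqrt (\<integral>x. (norm (\<psi> x))\<^sup>2 \<partial>lebesgue)"
  have bd: "norm (\<integral>x. v x * ?dt t x \<partial>lebesgue) \<le> M" if "t \<in> {0..1}" for t
  proof -
    let ?T = "transport A (t *\<^sub>R p) \<psi>"
    have "(\<integral>x. v x * ?dt t x \<partial>lebesgue) = \<i> * (\<integral>x. v x * (\<i> * frechet_derivative ?T (at x) p + complex_of_real (A x \<bullet> p) * ?T x) \<partial>lebesgue)"
      unfolding td(2) by (simp add: mult.left_commute[of "v _"])
    also have "\<dots> = \<i> * (\<integral>x. contract p (F x) * ?T x \<partial>lebesgue)"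
      unfolding v_def F_def using that
      by (subst magnetic_gradient_complex[OF mg assms(2-4) tC]) auto
    finally have "norm (\<integral>x. v x * ?dt t x \<partial>lebesgue) = norm (\<integral>x. contract p (F x) * ?T x \<partial>lebesgue)" by (simp add: norm_mult)
    also have "\<dots> \<le> sqrt (\<integral>x. (norm (contract p (F x)))\<^sup>2 \<partial>lebesgue) * sqrt (\<integral>x. (norm (?T x))\<^sup>2 \<partial>lebesgue)"
      by (intro Cauchy_Schwarz_integral contract_measurable F contract_L2(1) compact_test_L2[OF tt])
    also have "\<dots> \<le> (norm p * sqrt (\<integral>x. (norm (F x))\<^sup>2 \<partial>lebesgue)) * sqrt (\<integral>x. (norm (?T x))\<^sup>2 \<partial>lebesgue)"
      by (intro mult_right_mono contract_L2(2)[OF F]) auto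
    finally show ?thesis unfolding M_def L2_norm_sq_eq F_def integral_norm_transport[OF \<psi>] .
  qed
  have "norm (H 1 - H 0) \<le> M * norm (1 - 0 :: real)"
  proof (rule differentiable_bound[of "{0..1::real}" H "\<lambda>t h. h *\<^sub>R (\<integral>x. v x * ?dt t x \<partial>lebesgue)"])
    show "(H has_derivative (\<lambda>h. h *\<^sub>R (\<integral>x. v x * ?dt t x \<partial>lebesgue))) (at t within {0..1})" if "t \<in> {0..1}" for t
      using H'[OF that] by (auto simp: has_vector_derivative_def intro: has_derivative_at_withinI)
    show "onorm (\<lambda>h. h *\<^sub>R (\<integral>x. v x * ?dt t x \<partial>lebesgue)) \<le> M" if "t \<in> {0..1}" for t
      using bd[OF that] by (auto simp: mult.commute[of M] intro!: onorm_le mult_left_mono)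
  qed auto
  then show ?thesis unfolding H_def M_def using \<open>linear A\<close> by (simp add: transport_def[abs_def] linear_0)
qed

theorem magnetic_poincare:
  assumes mg: "magnetic_gradient A C u f" and L2: "L2_on C u" "L2_on C f" and "linear A" "open C"
    and p: "\<And>x t. x \<in> C \<Longrightarrow> 0 \<le> t \<Longrightarrow> x + t *\<^sub>R p \<in> C" and q: "\<And>x t. x \<in> C \<Longrightarrow> 0 \<le> t \<Longrightarrow> x + t *\<^sub>R q \<in> C"
    and flux: "\<bar>p \<bullet> A q - q \<bullet> A p\<bar> = pi"
  shows "L2_norm_sq C u \<le> (norm p + norm q)\<^sup>2 * L2_norm_sq C f"
proof -
  define v where "v = (\<lambda>x. indicator C x *\<^sub>R u x)"
  have v: "v \<in> borel_measurable lebesgue" "integrable lebesgue (\<lambda>x. (norm (v x))\<^sup>2)"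
    using L2(1) unfolding L2_on_iff v_def by auto
  have p1: "x + p \<in> C" and q1: "x + q \<in> C" if "x \<in> C" for x
    using p[OF that, of 1] q[OF that, of 1] by auto
  have holonomy: "transport A p (transport A q \<psi>) y = - transport A q (transport A p \<psi>) y" for \<psi> y
  proof -
    have c: "cis (p \<bullet> A q - q \<bullet> A p) = -1"
      using flux by (auto simp: abs_if complex_eq_iff split: if_splits) (metis cos_minus cos_pi sin_minus sin_pi minus_diff_eq minus_minus neg_0_equal_iff_equal)+
    have "transport A p (transport A q \<psi>) y = cis (p \<bullet> A q - q \<bullet> A p) * transport A q (transport A p \<psi>) y"
    proof -
      have "(p \<bullet> A y - (p \<bullet> A p) / 2) + (q \<bullet> A (y - p) - (q \<bullet> A q) / 2)
        = (p \<bullet> A q - q \<bullet> A p) + ((q \<bullet> A y - (q \<bullet> A q) / 2) + (p \<bullet> A (y - q) - (p \<bullet> A p) / 2))"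
        using \<open>linear A\<close> by (simp add: linear_diff inner_diff_right)
      moreover have "y - p - q = y - q - p" by simp
      ultimately show ?thesis
        unfolding transport_def mult.assoc[symmetric] cis_mult by (simp only:)
    qed
    then show ?thesis by (simp add: c)
  qed
  define N where "N = sqrt (L2_norm_sq C f)"
  have "L2_norm_sq C f \<ge> 0" by (simp add: L2_norm_sq_eq)
  have "(\<integral>x. (norm (v x))\<^sup>2 \<partial>lebesgue) \<le> ((norm p + norm q) * N)\<^sup>2"
  proof (rule L2_norm_le_of_test_bound[OF \<open>open C\<close> v])
    show "v x = 0" if "x \<notin> C" for x using that by (simp add: v_def)
    fix \<psi> :: "real^3 \<Rightarrow> complex" assume \<psi>: "compact_test C \<psi>"
    let ?J = "\<lambda>\<psi>. \<integral>x. v x * \<psi> x \<partial>lebesgue"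
    define S where "S = sqrt (\<integral>x. (norm (\<psi> x))\<^sup>2 \<partial>lebesgue)"
    have pt: "compact_test C (transport A p \<psi>)" "compact_test C (transport A q \<psi>)"
      using p1 q1 \<open>linear A\<close> \<psi> by (auto intro!: compact_test_transport)
    have 1: "norm (?J (transport A p \<psi>) - ?J \<psi>) \<le> norm p * N * S"
      and 2: "norm (?J (transport A q (transport A p \<psi>)) - ?J (transport A p \<psi>)) \<le> norm q * N * S"
      and 3: "norm (?J (transport A q \<psi>) - ?J \<psi>) \<le> norm q * N * S"
      and 4: "norm (?J (transport A p (transport A q \<psi>)) - ?J (transport A q \<psi>)) \<le> norm p * N * S"
      unfolding v_def N_def S_def
      using transport_bound[OF mg L2 \<open>linear A\<close> \<psi> p] transport_bound[OF mg L2 \<open>linear A\<close> \<psi> q]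
        transport_bound[OF mg L2 \<open>linear A\<close> pt(1) q] transport_bound[OF mg L2 \<open>linear A\<close> pt(2) p]
      by (auto simp: integral_norm_transport[OF \<psi>])
    have 5: "?J (transport A p (transport A q \<psi>)) = - ?J (transport A q (transport A p \<psi>))"
      by (simp add: holonomy)
    define a b c d where "a = ?J \<psi>" and "b = ?J (transport A p \<psi>)" and "c = ?J (transport A q (transport A p \<psi>))"
      and "d = ?J (transport A q \<psi>)"
    \<comment> \<open>Two ways round the parallelogram lead from \<open>a\<close> over
      \<open>b\<close> to \<open>c\<close> and from \<open>a\<close> over \<open>d\<close> to
      \<open>- c\<close>. The four edge differences therefore add up to twice \<open>a\<close>, in
      place of cancelling.\<close>
    have "2 * a = - ((b - a) + (c - b) + (d - a) + (- c - d))" by simp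
    then have "2 * norm a \<le> norm (b - a) + norm (c - b) + norm (d - a) + norm (- c - d)"
    proof -
      have "2 * norm a = norm (2 * a)" by (simp add: norm_mult)
      also have "\<dots> = norm ((b - a) + (c - b) + (d - a) + (- c - d))"
        unfolding \<open>2 * a = _\<close> by (rule norm_minus_cancel)
      also have "\<dots> \<le> norm (b - a) + norm (c - b) + norm (d - a) + norm (- c - d)"
        by (intro norm_triangle_le add_mono order_refl)
      finally show ?thesis .
    qed
    also have "\<dots> \<le> 2 * ((norm p + norm q) * N * S)"
      using 1 2 3 4 unfolding 5 a_def[symmetric] b_def[symmetric] c_def[symmetric] d_def[symmetric]
      by (simp add: algebra_simps)
    finally show "norm (?J \<psi>) \<le> (norm p + norm q) * N * sqrt (\<integral>x. (norm (\<psi> x))\<^sup>2 \<partial>lebesgue)"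
      unfolding S_def a_def by simp
  qed
  then show ?thesis
    using \<open>L2_norm_sq C f \<ge> 0\<close> by (simp add: L2_norm_sq_eq[of C u] v_def N_def power_mult_distrib)
qed

section \<open>Lower bounds on half-spaces and wedges\<close>

text \<open>Twice the antisymmetric part of the bilinear form given by \<open>A\<close>, hence
  independent of the gauge. By \<open>flux_curl\<close> it is the flux of \<open>B\<close> through
  the parallelogram on \<open>q\<close> and \<open>p\<close>.\<close>

definition flux :: "('a::euclidean_space \<Rightarrow> 'a) \<Rightarrow> 'a \<Rightarrow> 'a \<Rightarrow> real" where
  "flux A p q = p \<bullet> A q - q \<bullet> A p"

lemma flux_linear:
  assumes "linear A"
  shows "flux A (s *\<^sub>R p) q = s * flux A p q" "flux A p (s *\<^sub>R q) = s * flux A p q"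
    "flux A (p + p') q = flux A p q + flux A p' q" "flux A p (q + q') = flux A p q + flux A p q'"
    "flux A p p = 0"
  using assms by (auto simp: flux_def linear_cmul linear_add inner_add_left inner_add_right algebra_simps)

lemma curl_linear:
  assumes "linear A"
  shows "curl A x = vector [A (axis 2 1) $ 3 - A (axis 3 1) $ 2, A (axis 3 1) $ 1 - A (axis 1 1) $ 3, A (axis 1 1) $ 2 - A (axis 2 1) $ 1]"
proof -
  have "frechet_derivative A (at x) = A"
    using linear_imp_has_derivative[OF assms] frechet_derivative_at by metis
  then show ?thesis by (simp add: curl_def)
qed

lemma flux_curl:
  fixes A :: "real^3 \<Rightarrow> real^3"
  assumes "linear A" "\<forall>x. curl A x = B"
  shows "flux A p q = B \<bullet> cross3 q p"
proof -
  have e: "A q = q$1 *\<^sub>R A (axis 1 1) + q$2 *\<^sub>R A (axis 2 1) + q$3 *\<^sub>R A (axis 3 1)" for q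
  proof -
    have "q = q$1 *\<^sub>R axis 1 1 + q$2 *\<^sub>R axis 2 1 + q$3 *\<^sub>R axis 3 1"
      by (simp add: vec_eq_iff forall_3 axis_def)
    then have "A q = A (q$1 *\<^sub>R axis 1 1 + q$2 *\<^sub>R axis 2 1 + q$3 *\<^sub>R axis 3 1)" by simp
    then show ?thesis by (simp add: linear_add[OF assms(1)] linear_cmul[OF assms(1)])
  qed
  have "B = vector [A (axis 2 1) $ 3 - A (axis 3 1) $ 2, A (axis 3 1) $ 1 - A (axis 1 1) $ 3, A (axis 1 1) $ 2 - A (axis 2 1) $ 1]"
    using assms curl_linear by metis
  then show ?thesis
    by (simp add: flux_def e[of p] e[of q] inner_vec_def sum_3 cross_components algebra_simps)
qed

text \<open>Stretching both unit vectors by \<open>l\<close> multiplies the flux by the square of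
  \<open>l\<close>; \<open>l\<close> is chosen to make the flux equal to \<open>pi\<close> in
  modulus, and the squared sum of lengths becomes \<open>4 * pi\<close> divided by the original
  flux.\<close>

lemma poincare_of_shifts:
  assumes mg: "magnetic_gradient A C u f" and L2: "L2_on C u" "L2_on C f" and "linear A" "open C"
    and a: "\<And>x t. x \<in> C \<Longrightarrow> 0 \<le> t \<Longrightarrow> x + t *\<^sub>R a \<in> C" and b: "\<And>x t. x \<in> C \<Longrightarrow> 0 \<le> t \<Longrightarrow> x + t *\<^sub>R b \<in> C"
    and "norm a = 1" "norm b = 1" and flux: "\<bar>flux A a b\<bar> \<ge> \<kappa>" "\<kappa> > 0"
  shows "L2_norm_sq C u \<le> (4 * pi / \<kappa>) * L2_norm_sq C f"
proof -
  define k where "k = \<bar>flux A a b\<bar>"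
  define l where "l = sqrt (pi / k)"
  have k: "k > 0" "k \<ge> \<kappa>" using flux by (auto simp: k_def)
  have l: "l > 0" "l\<^sup>2 = pi / k" using k by (auto simp: l_def)
  have "L2_norm_sq C u \<le> (norm (l *\<^sub>R a) + norm (l *\<^sub>R b))\<^sup>2 * L2_norm_sq C f"
  proof (rule magnetic_poincare[OF mg L2 \<open>linear A\<close> \<open>open C\<close>])
    show "x + t *\<^sub>R l *\<^sub>R a \<in> C" "x + t *\<^sub>R l *\<^sub>R b \<in> C" if "x \<in> C" "0 \<le> t" for x t
      using a[OF that(1), of "t * l"] b[OF that(1), of "t * l"] that l by auto
    have "flux A (l *\<^sub>R a) (l *\<^sub>R b) = l\<^sup>2 * flux A a b"
      using flux_linear[OF \<open>linear A\<close>] by (simp add: power2_eq_square)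
    then have "\<bar>flux A (l *\<^sub>R a) (l *\<^sub>R b)\<bar> = l\<^sup>2 * k" by (simp add: k_def abs_mult)
    then show "\<bar>l *\<^sub>R a \<bullet> A (l *\<^sub>R b) - l *\<^sub>R b \<bullet> A (l *\<^sub>R a)\<bar> = pi"
      using l k by (simp add: flux_def)
  qed
  also have "(norm (l *\<^sub>R a) + norm (l *\<^sub>R b))\<^sup>2 = 4 * l\<^sup>2"
    using assms(8,9) l by (simp add: power2_eq_square)
  also have "4 * l\<^sup>2 * L2_norm_sq C f \<le> (4 * pi / \<kappa>) * L2_norm_sq C f"
  proof (rule mult_right_mono)
    show "4 * l\<^sup>2 \<le> 4 * pi / \<kappa>" using l k flux(2) by (simp add: frac_le)
  qed (simp add: L2_norm_sq_eq)
  finally show ?thesis .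
qed

text \<open>The fluxes of \<open>B\<close> through the three coordinate planes of the frame are, up
  to sign, its three components. They are recovered from the fluxes through the three pairs of shift
  directions, with a loss controlled by \<open>sin \<beta>\<close>, so these cannot all be
  small.\<close>

lemma poincare_of_frame:
  fixes A h :: "real^3 \<Rightarrow> real^3"
  assumes mg: "magnetic_gradient A C u f" and L2: "L2_on C u" "L2_on C f" and "linear A" "\<forall>x. curl A x = B" "open C"
    and h: "orthogonal_transformation h" and \<beta>: "0 < \<beta>" "\<beta> < pi" and "B \<noteq> 0"
    and shift: "\<And>x t d. x \<in> C \<Longrightarrow> 0 \<le> t \<Longrightarrow> d \<in> {axis 1 1, axis 3 1, vector [cos \<beta>, sin \<beta>, 0]} \<Longrightarrow> x + t *\<^sub>R h d \<in> C"
  shows "L2_norm_sq C u \<le> (12 * pi / (norm B * sin \<beta>)) * L2_norm_sq C f"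
proof -
  have lin: "linear h" using h orthogonal_transformation_linear by blast
  have sb: "sin \<beta> > 0" using \<beta> by (simp add: sin_gt_zero)
  define X Y Z where "X = flux A (h (axis 1 1)) (h (axis 2 1))" and "Y = flux A (h (axis 1 1)) (h (axis 3 1))"
    and "Z = flux A (h (axis 2 1)) (h (axis 3 1))"
  let ?b = "vector [cos \<beta>, sin \<beta>, 0] :: real^3"
  have bd: "?b = cos \<beta> *\<^sub>R axis 1 1 + sin \<beta> *\<^sub>R axis 2 1" by (simp add: vec_eq_iff forall_3 axis_def)
  have hb: "h ?b = cos \<beta> *\<^sub>R h (axis 1 1) + sin \<beta> *\<^sub>R h (axis 2 1)"
    unfolding bd by (simp add: linear_add[OF lin] linear_cmul[OF lin])
  have f1: "flux A (h (axis 1 1)) (h ?b) = sin \<beta> * X" and f3: "flux A (h ?b) (h (axis 3 1)) = cos \<beta> * Y + sin \<beta> * Z"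
    unfolding hb X_def Y_def Z_def using flux_linear[OF \<open>linear A\<close>] by auto
  have n: "norm (h (axis i 1)) = 1" for i using h by (simp add: orthogonal_transformation_norm)
  have nb: "norm (h ?b) = 1"
  proof -
    have "norm ?b = 1" by (simp add: norm_vec_def L2_set_def sum_3)
    then show ?thesis using h by (simp only: orthogonal_transformation_norm)
  qed
  have sq: "X\<^sup>2 + Y\<^sup>2 + Z\<^sup>2 = (norm B)\<^sup>2"
  proof -
    obtain b0 where b0: "B = h b0" using orthogonal_transformation_surj[OF h] by (metis surjD)
    \<comment> \<open>The frame may be a reflection, which changes the sign of cross products; only
      squares are compared.\<close>
    have d: "(det (matrix h))\<^sup>2 = 1"
      using det_orthogonal_matrix orthogonal_transformation_matrix h by (metis power2_eq_square one_power2 power2_minus)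
    have i: "B \<bullet> h e = b0 \<bullet> e" for e using h b0 by (simp add: orthogonal_transformation_def)
    have "X\<^sup>2 = (b0 $ 3)\<^sup>2" "Y\<^sup>2 = (b0 $ 2)\<^sup>2" "Z\<^sup>2 = (b0 $ 1)\<^sup>2"
      unfolding X_def Y_def Z_def flux_curl[OF assms(4,5)] cross_orthogonal_transformation[OF h] inner_scaleR_right i
        power_mult_distrib d cross_basis
      by (auto simp: inner_axis)
    then show ?thesis
      unfolding b0 orthogonal_transformation_norm[OF h] by (simp add: norm_vec_def L2_set_def sum_3)
  qed
  \<comment> \<open>If all three fluxes were below \<kappa>, then \<open>sin \<beta>\<close> times
    the components would be below \<kappa>, \<kappa> and \<open>2 * \<kappa>\<close>. Their squares
    sum to less than six times the square of \<kappa>, whereas the division by 3 makes the true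
    value nine times that square.\<close>
  define \<kappa> where "\<kappa> = norm B * sin \<beta> / 3"
  have \<kappa>: "\<kappa> > 0" using sb \<open>B \<noteq> 0\<close> by (simp add: \<kappa>_def)
  have "\<bar>sin \<beta> * X\<bar> \<ge> \<kappa> \<or> \<bar>Y\<bar> \<ge> \<kappa> \<or> \<bar>cos \<beta> * Y + sin \<beta> * Z\<bar> \<ge> \<kappa>"
  proof (rule ccontr)
    assume "\<not> ?thesis"
    then have s: "\<bar>sin \<beta> * X\<bar> < \<kappa>" "\<bar>Y\<bar> < \<kappa>" "\<bar>cos \<beta> * Y + sin \<beta> * Z\<bar> < \<kappa>" by auto
    have "\<bar>cos \<beta> * Y\<bar> \<le> \<bar>Y\<bar>" by (simp add: abs_mult mult_left_le_one_le)
    then have z: "\<bar>sin \<beta> * Z\<bar> < 2 * \<kappa>" using s by linarith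
    have y: "\<bar>sin \<beta> * Y\<bar> < \<kappa>"
      using s(2) sb by (simp add: abs_mult) (metis abs_ge_zero abs_of_pos abs_sin_le_one mult_left_le_one_le order_le_less_trans less_eq_real_def)
    have "(sin \<beta> * X)\<^sup>2 < \<kappa>\<^sup>2" "(sin \<beta> * Y)\<^sup>2 < \<kappa>\<^sup>2" "(sin \<beta> * Z)\<^sup>2 < (2 * \<kappa>)\<^sup>2"
    proof -
      have "a\<^sup>2 < b\<^sup>2" if "\<bar>a\<bar> < b" for a b :: real
        using that by (metis abs_ge_zero power2_abs power_strict_mono zero_less_numeral)
      then show "(sin \<beta> * X)\<^sup>2 < \<kappa>\<^sup>2" "(sin \<beta> * Y)\<^sup>2 < \<kappa>\<^sup>2" "(sin \<beta> * Z)\<^sup>2 < (2 * \<kappa>)\<^sup>2"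
        using s(1) y z by blast+
    qed
    then have "(sin \<beta>)\<^sup>2 * (X\<^sup>2 + Y\<^sup>2 + Z\<^sup>2) < 6 * \<kappa>\<^sup>2" by (simp add: power_mult_distrib algebra_simps)
    then have "(sin \<beta> * norm B)\<^sup>2 < 6 * (norm B * sin \<beta>)\<^sup>2 / 9"
      unfolding sq by (simp add: \<kappa>_def power_mult_distrib power_divide)
    moreover have "(sin \<beta> * norm B)\<^sup>2 \<ge> 0" by simp
    ultimately show False by (simp add: mult.commute)
  qed
  then have "L2_norm_sq C u \<le> (4 * pi / \<kappa>) * L2_norm_sq C f"
  proof (elim disjE)
    assume "\<bar>sin \<beta> * X\<bar> \<ge> \<kappa>"
    then show ?thesis
      by (intro poincare_of_shifts[OF mg L2 \<open>linear A\<close> \<open>open C\<close>, where a = "h (axis 1 1)" and b = "h ?b" and \<kappa> = \<kappa>])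
        (auto simp: n nb f1 \<kappa> intro: shift)
  next
    assume "\<bar>Y\<bar> \<ge> \<kappa>"
    then show ?thesis
      by (intro poincare_of_shifts[OF mg L2 \<open>linear A\<close> \<open>open C\<close>, where a = "h (axis 1 1)" and b = "h (axis 3 1)" and \<kappa> = \<kappa>])
        (auto simp: n nb Y_def \<kappa> intro: shift)
  next
    assume "\<bar>cos \<beta> * Y + sin \<beta> * Z\<bar> \<ge> \<kappa>"
    then show ?thesis
      by (intro poincare_of_shifts[OF mg L2 \<open>linear A\<close> \<open>open C\<close>, where a = "h ?b" and b = "h (axis 3 1)" and \<kappa> = \<kappa>])
        (auto simp: n nb f3 \<kappa> intro: shift)
  qed
  then show ?thesis by (simp add: \<kappa>_def)
qed

section \<open>Wedges and their translations\<close>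

lemma polar_coordinates:
  fixes a b :: real assumes "(a, b) \<noteq> (0, 0)"
  obtains r \<theta> where "r > 0" "0 \<le> \<theta>" "\<theta> < 2 * pi" "a = r * cos \<theta>" "b = r * sin \<theta>"
proof -
  define r where "r = sqrt (a\<^sup>2 + b\<^sup>2)"
  have r: "r > 0" "r\<^sup>2 = a\<^sup>2 + b\<^sup>2" using assms by (auto simp: r_def sum_power2_gt_zero_iff)
  have "(a / r)\<^sup>2 + (b / r)\<^sup>2 = (a\<^sup>2 + b\<^sup>2) / r\<^sup>2" by (simp add: power_divide add_divide_distrib)
  also have "\<dots> = 1" unfolding r(2)[symmetric] using r(1) by simp
  finally have "(a / r)\<^sup>2 + (b / r)\<^sup>2 = 1" .
  then obtain t where "0 \<le> t" "t < 2 * pi" "a / r = cos t" "b / r = sin t" by (rule sincos_total_2pi)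
  with r(1) that[of r t] show thesis by (simp add: field_simps)
qed

text \<open>In polar coordinates the two inequalities are \<open>sin \<theta> > 0\<close> and
  \<open>sin (\<alpha> - \<theta>) > 0\<close>. Up to opening \<open>pi\<close> they describe the
  wedge, which is then an intersection of half-spaces and stable under translations in its own
  directions.\<close>

lemma model_wedge_convex:
  assumes "0 < \<alpha>" "\<alpha> \<le> pi"
  shows "model_wedge \<alpha> = {x. x$2 > 0 \<and> x$1 * sin \<alpha> - x$2 * cos \<alpha> > 0}"
proof (intro set_eqI iffI)
  fix x assume "x \<in> model_wedge \<alpha>"
  then obtain r \<theta> where r: "r > 0" "0 < \<theta>" "\<theta> < \<alpha>" "x$1 = r * cos \<theta>" "x$2 = r * sin \<theta>"
    by (auto simp: model_wedge_def)
  have "sin \<theta> > 0" "sin (\<alpha> - \<theta>) > 0" using r assms by (auto intro: sin_gt_zero)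
  moreover have "x$1 * sin \<alpha> - x$2 * cos \<alpha> = r * sin (\<alpha> - \<theta>)" by (simp add: r sin_diff algebra_simps)
  moreover have "x$2 > 0" "r * sin (\<alpha> - \<theta>) > 0" using r calculation by auto
  ultimately show "x \<in> {x. x$2 > 0 \<and> x$1 * sin \<alpha> - x$2 * cos \<alpha> > 0}" unfolding mem_Collect_eq by (simp only:)
next
  fix x :: "real^3" assume x: "x \<in> {x. x$2 > 0 \<and> x$1 * sin \<alpha> - x$2 * cos \<alpha> > 0}"
  then have "(x$1, x$2) \<noteq> (0, 0)" by auto
  then obtain r \<theta> where r: "r > 0" "0 \<le> \<theta>" "\<theta> < 2 * pi" "x$1 = r * cos \<theta>" "x$2 = r * sin \<theta>"
    by (rule polar_coordinates)
  have s: "sin \<theta> > 0" using x r by (simp add: zero_less_mult_iff)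
  then have \<theta>: "0 < \<theta>" "\<theta> < pi"
    using r sin_le_zero[of \<theta>] by (auto simp: less_le) (metis linorder_not_le nle_le sin_zero order.strict_iff_order sin_le_zero)+
  have "r * sin (\<alpha> - \<theta>) > 0" using x by (simp add: r sin_diff algebra_simps)
  then have s2: "sin (\<alpha> - \<theta>) > 0" using r by (simp add: zero_less_mult_iff)
  have "\<theta> < \<alpha>"
  proof (rule ccontr)
    assume "\<not> \<theta> < \<alpha>"
    then have "sin (\<theta> - \<alpha>) \<ge> 0" using \<theta> assms by (intro sin_ge_zero) auto
    then show False using s2 by (metis minus_diff_eq neg_0_le_iff_le not_le sin_minus)
  qed
  then show "x \<in> model_wedge \<alpha>" unfolding model_wedge_def using r \<theta> by blast
qed

lemma open_model_wedge_convex: "0 < \<alpha> \<Longrightarrow> \<alpha> \<le> pi \<Longrightarrow> open (model_wedge \<alpha>)"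
  unfolding model_wedge_convex
  by (auto intro!: open_Collect_conj open_Collect_less continuous_intros)

text \<open>The three directions lie in the closed wedge, and a convex wedge absorbs them. They
  depend on the lower bound \<beta> and not on \<alpha>, which makes the resulting constant
  uniform.\<close>

lemma shift_model_wedge:
  assumes "0 < \<beta>" "\<beta> \<le> \<alpha>" "\<alpha> \<le> pi" "\<beta> \<le> pi / 2" "x \<in> model_wedge \<alpha>" "0 \<le> t"
    "d \<in> {axis 1 1, axis 3 1, vector [cos \<beta>, sin \<beta>, 0]}"
  shows "x + t *\<^sub>R d \<in> model_wedge \<alpha>"
proof -
  have s: "sin \<alpha> \<ge> 0" "sin \<beta> \<ge> 0" "cos \<beta> \<ge> 0" "sin (\<alpha> - \<beta>) \<ge> 0"
    using assms by (auto intro!: sin_ge_zero cos_ge_zero)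
  have "t * (cos \<beta> * sin \<alpha> - sin \<beta> * cos \<alpha>) \<ge> 0"
    using s(4) assms(6) by (simp add: sin_diff mult.commute)
  moreover have "0 < \<alpha>" using assms by simp
  ultimately show ?thesis
    using assms s unfolding model_wedge_convex[OF \<open>0 < \<alpha>\<close> assms(3)]
    by (auto simp: axis_def algebra_simps add_pos_nonneg)
       (use mult_nonneg_nonneg[OF assms(6) s(1)] mult_nonneg_nonneg[OF assms(6) s(2)] in linarith)+
qed

lemma L2_on_subset:
  assumes "L2_on C u" "open D" "D \<subseteq> C"
  shows "L2_on D u" "L2_norm_sq D u \<le> L2_norm_sq C u"
proof -
  have e: "indicator D x *\<^sub>R u x = indicator D x *\<^sub>R (indicator C x *\<^sub>R u x)" for x
    using assms(3) by (auto split: split_indicator)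
  have D: "D \<in> sets lebesgue" using assms(2) by (simp add: lborelD)
  have m: "(\<lambda>x. indicator D x *\<^sub>R u x) \<in> borel_measurable lebesgue"
    unfolding e by (rule borel_measurable_scaleR[OF borel_measurable_indicator[OF D]]) (use assms(1) in \<open>simp only: L2_on_iff\<close>)
  have le: "(norm (indicator D x *\<^sub>R u x))\<^sup>2 \<le> (norm (indicator C x *\<^sub>R u x))\<^sup>2" for x
    using assms(3) by (auto split: split_indicator)
  have i: "integrable lebesgue (\<lambda>x. (norm (indicator D x *\<^sub>R u x))\<^sup>2)"
  proof (rule Bochner_Integration.integrable_bound)
    show "integrable lebesgue (\<lambda>x. (norm (indicator C x *\<^sub>R u x))\<^sup>2)" using assms(1) by (simp only: L2_on_iff)
    show "(\<lambda>x. (norm (indicator D x *\<^sub>R u x))\<^sup>2) \<in> borel_measurable lebesgue" using m by measurable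
    show "AE x in lebesgue. norm ((norm (indicator D x *\<^sub>R u x))\<^sup>2) \<le> norm ((norm (indicator C x *\<^sub>R u x))\<^sup>2)"
      using le by (intro AE_I2) (simp only: real_norm_def abs_of_nonneg zero_le_power2)
  qed
  show "L2_on D u" using m i by (simp only: L2_on_iff simp_thms)
  show "L2_norm_sq D u \<le> L2_norm_sq C u"
    unfolding L2_norm_sq_eq using i le assms(1) by (intro integral_mono) (simp_all only: L2_on_iff)
qed

lemma magnetic_gradient_subset:
  assumes "magnetic_gradient A C u f" "D \<subseteq> C"
  shows "magnetic_gradient A D u f"
  unfolding magnetic_gradient_def
proof (intro allI impI)
  fix \<phi> j assume t: "test_function D \<phi>"
  then have tC: "test_function C \<phi>" using assms(2) by (meson compact_test_mono compact_test_real)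
  have z: "\<phi> x = 0" "frechet_derivative \<phi> (at x) h = 0" if "x \<notin> D" for x h
    using compact_test_zero compact_test_frechet t that by (force simp flip: compact_test_real)+
  have "set_lebesgue_integral lebesgue D g = set_lebesgue_integral lebesgue C g" if "\<And>x. x \<notin> D \<Longrightarrow> g x = 0"
    for g :: "real^3 \<Rightarrow> complex"
    unfolding set_lebesgue_integral_def using that assms(2)
    by (intro Bochner_Integration.integral_cong) (auto split: split_indicator)
  then show "(LINT x:D|lebesgue. u x * (\<i> * complex_of_real (frechet_derivative \<phi> (at x) (axis j 1)) + complex_of_real (A x $ j * \<phi> x))) =
       (LINT x:D|lebesgue. f x $ j * complex_of_real (\<phi> x))"
    using assms(1) tC z unfolding magnetic_gradient_def by auto
qed

lemma open_orthogonal_image: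
  fixes h :: "real^'n \<Rightarrow> real^'n"
  shows "orthogonal_transformation h \<Longrightarrow> open S \<Longrightarrow> open (h ` S)"
  by (meson open_surjective_linear_image orthogonal_transformation_linear orthogonal_transformation_surj)

lemma poincare_convex_wedge:
  fixes A :: "real^3 \<Rightarrow> real^3"
  assumes mg: "magnetic_gradient A C u f" and L2: "L2_on C u" "L2_on C f" and "linear A" "\<forall>x. curl A x = B" "B \<noteq> 0"
    and h: "orthogonal_transformation h" and \<beta>: "0 < \<beta>" "\<beta> \<le> pi / 2" "\<beta> \<le> \<alpha>" "\<alpha> \<le> pi"
    and sub: "h ` model_wedge \<alpha> \<subseteq> C"
  shows "L2_norm_sq (h ` model_wedge \<alpha>) u \<le> (12 * pi / (norm B * sin \<beta>)) * L2_norm_sq (h ` model_wedge \<alpha>) f"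
proof -
  have op: "open (h ` model_wedge \<alpha>)"
    using \<beta> by (intro open_orthogonal_image h open_model_wedge_convex) auto
  have lin: "linear h" using h orthogonal_transformation_linear by blast
  show ?thesis
  proof (rule poincare_of_frame[OF magnetic_gradient_subset[OF mg sub] L2_on_subset(1)[OF L2(1) op sub]
        L2_on_subset(1)[OF L2(2) op sub] assms(4,5) op h])
    fix x d :: "real^3" and t :: real
    assume "x \<in> h ` model_wedge \<alpha>" "0 \<le> t" and d: "d \<in> {axis 1 1, axis 3 1, vector [cos \<beta>, sin \<beta>, 0]}"
    then obtain y where y: "y \<in> model_wedge \<alpha>" "x = h y" by blast
    have "x + t *\<^sub>R h d = h (y + t *\<^sub>R d)" by (simp add: y linear_add[OF lin] linear_cmul[OF lin])
    moreover have "y + t *\<^sub>R d \<in> model_wedge \<alpha>"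
      using shift_model_wedge[OF \<beta>(1,3,4,2) y(1) \<open>0 \<le> t\<close> d] .
    ultimately show "x + t *\<^sub>R h d \<in> h ` model_wedge \<alpha>" by simp
  qed (use \<beta> assms pi_gt_zero in auto)
qed

definition rotate3 :: "real \<Rightarrow> real^3 \<Rightarrow> real^3" where
  "rotate3 \<gamma> x = vector [cos \<gamma> * x$1 - sin \<gamma> * x$2, sin \<gamma> * x$1 + cos \<gamma> * x$2, x$3]"

lemma orthogonal_rotate3: "orthogonal_transformation (rotate3 \<gamma>)"
proof -
  have "linear (rotate3 \<gamma>)"
    by (rule linearI) (auto simp: rotate3_def vec_eq_iff forall_3 algebra_simps)
  moreover have "norm (rotate3 \<gamma> x) = norm x" for x
  proof -
    have "(cos \<gamma> * x$1 - sin \<gamma> * x$2)\<^sup>2 + (sin \<gamma> * x$1 + cos \<gamma> * x$2)\<^sup>2 = ((cos \<gamma>)\<^sup>2 + (sin \<gamma>)\<^sup>2) * ((x$1)\<^sup>2 + (x$2)\<^sup>2)"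
      by (simp only: power2_eq_square algebra_simps)
    then have "(cos \<gamma> * x$1 - sin \<gamma> * x$2)\<^sup>2 + (sin \<gamma> * x$1 + cos \<gamma> * x$2)\<^sup>2 = (x$1)\<^sup>2 + (x$2)\<^sup>2"
      by simp
    then show ?thesis by (simp add: rotate3_def norm_vec_def L2_set_def sum_3)
  qed
  ultimately show ?thesis by (simp add: orthogonal_transformation)
qed

text \<open>The interval of angles from \<open>0\<close> to \<alpha> is the union of the two
  intervals of length \<open>pi\<close> at its ends; they overlap because \<alpha> is below
  \<open>2 * pi\<close>.\<close>

lemma model_wedge_union:
  assumes "pi \<le> \<alpha>" "\<alpha> < 2 * pi"
  shows "model_wedge \<alpha> = model_wedge pi \<union> rotate3 (\<alpha> - pi) ` model_wedge pi"
proof (intro set_eqI iffI)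
  fix x assume "x \<in> model_wedge \<alpha>"
  then obtain r \<theta> where r: "r > 0" "0 < \<theta>" "\<theta> < \<alpha>" "x$1 = r * cos \<theta>" "x$2 = r * sin \<theta>"
    by (auto simp: model_wedge_def)
  show "x \<in> model_wedge pi \<union> rotate3 (\<alpha> - pi) ` model_wedge pi"
  proof (cases "\<theta> < pi")
    case True
    then show ?thesis using r by (auto simp: model_wedge_def)
  next
    case False
    define \<eta> where "\<eta> = \<theta> - (\<alpha> - pi)"
    have \<eta>: "0 < \<eta>" "\<eta> < pi" using False r assms by (auto simp: \<eta>_def)
    define y :: "real^3" where "y = vector [r * cos \<eta>, r * sin \<eta>, x$3]"
    have "y \<in> model_wedge pi" unfolding model_wedge_def y_def using r(1) \<eta> by auto
    moreover have "rotate3 (\<alpha> - pi) y = x"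
    proof -
      have "\<theta> = (\<alpha> - pi) + \<eta>" by (simp add: \<eta>_def)
      then have "cos \<theta> = cos (\<alpha> - pi) * cos \<eta> - sin (\<alpha> - pi) * sin \<eta>"
        "sin \<theta> = sin (\<alpha> - pi) * cos \<eta> + cos (\<alpha> - pi) * sin \<eta>" by (simp_all only: cos_add sin_add)
      with r have "x$1 = cos (\<alpha> - pi) * (r * cos \<eta>) - sin (\<alpha> - pi) * (r * sin \<eta>)"
        "x$2 = sin (\<alpha> - pi) * (r * cos \<eta>) + cos (\<alpha> - pi) * (r * sin \<eta>)" by (simp_all only: algebra_simps)
      then show ?thesis unfolding rotate3_def y_def by (simp only: vec_eq_iff forall_3 vector_3 simp_thms)
    qed
    ultimately show ?thesis by blast
  qed
next
  fix x assume "x \<in> model_wedge pi \<union> rotate3 (\<alpha> - pi) ` model_wedge pi"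
  then show "x \<in> model_wedge \<alpha>"
  proof
    assume "x \<in> model_wedge pi" then show ?thesis using assms by (force simp: model_wedge_def)
  next
    assume "x \<in> rotate3 (\<alpha> - pi) ` model_wedge pi"
    then obtain y r \<theta> where r: "x = rotate3 (\<alpha> - pi) y" "r > 0" "0 < \<theta>" "\<theta> < pi" "y$1 = r * cos \<theta>" "y$2 = r * sin \<theta>"
      by (auto simp: model_wedge_def)
    have "x$1 = r * cos (\<alpha> - pi + \<theta>)" "x$2 = r * sin (\<alpha> - pi + \<theta>)"
      unfolding cos_add sin_add r(1) rotate3_def by (simp_all only: vector_3 r algebra_simps)
    moreover have "0 < \<alpha> - pi + \<theta>" "\<alpha> - pi + \<theta> < \<alpha>" using r assms by auto
    ultimately show ?thesis unfolding model_wedge_def using r(2) by blast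
  qed
qed

lemma open_model_wedge:
  assumes "0 < \<alpha>" "\<alpha> < 2 * pi" shows "open (model_wedge \<alpha>)"
proof (cases "\<alpha> \<le> pi")
  case False
  then show ?thesis
    using assms model_wedge_union[of \<alpha>] open_model_wedge_convex[of pi] open_orthogonal_image[OF orthogonal_rotate3]
    by (auto intro!: open_Un)
qed (use assms open_model_wedge_convex in auto)

text \<open>\<open>wedge_of_opening\<close> excludes the opening \<open>pi\<close>, but the
  estimates on \<open>model_wedge\<close> include it; half-spaces are thereby treated as convex
  wedges.\<close>

lemma half_space_wedge:
  assumes "half_space C" obtains h where "orthogonal_transformation h" "C = h ` model_wedge pi"
proof -
  obtain n where n: "n \<noteq> 0" "C = {x. n \<bullet> x > 0}" using assms by (auto simp: half_space_def)
  obtain h :: "real^3 \<Rightarrow> real^3" where h: "orthogonal_transformation h" "h (axis 2 1) = (1 / norm n) *\<^sub>R n"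
    by (rule orthogonal_transformation_exists_1[of "axis 2 1" "(1 / norm n) *\<^sub>R n"]) (use n in auto)
  have n': "n = norm n *\<^sub>R h (axis 2 1)" using n(1) h(2) by simp
  have i: "n \<bullet> h x = norm n * x$2" for x
  proof -
    have "n \<bullet> h x = norm n * (h (axis 2 1) \<bullet> h x)" by (subst n') simp
    also have "h (axis 2 1) \<bullet> h x = x $ 2" using h(1) by (simp add: orthogonal_transformation_def inner_axis')
    finally show ?thesis .
  qed
  have "model_wedge pi = {x. x$2 > 0}" by (subst model_wedge_convex) auto
  then have "C = h ` model_wedge pi"
    using n i orthogonal_transformation_surj[OF h(1)] by (auto simp: zero_less_mult_iff) (metis (mono_tags, lifting) i image_eqI mem_Collect_eq surjD zero_less_mult_iff norm_not_less_zero)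
  with h(1) that show thesis by blast
qed

lemma L2_norm_sq_Un:
  assumes "L2_on (C \<union> D) u" "open C" "open D"
  shows "L2_norm_sq (C \<union> D) u \<le> L2_norm_sq C u + L2_norm_sq D u"
proof -
  have i: "integrable lebesgue (\<lambda>x. (norm (indicator E x *\<^sub>R u x))\<^sup>2)" if "E = C \<or> E = D \<or> E = C \<union> D" for E
    using that assms L2_on_subset(1)[OF assms(1)] by (auto simp: L2_on_iff)
  have "L2_norm_sq (C \<union> D) u \<le> (\<integral>x. (norm (indicator C x *\<^sub>R u x))\<^sup>2 + (norm (indicator D x *\<^sub>R u x))\<^sup>2 \<partial>lebesgue)"
    unfolding L2_norm_sq_eq using i by (intro integral_mono Bochner_Integration.integrable_add) (auto split: split_indicator)
  also have "\<dots> = L2_norm_sq C u + L2_norm_sq D u" using i by (simp add: L2_norm_sq_eq)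
  finally show ?thesis .
qed

text \<open>Weak gradients restrict to open subsets, so a wedge beyond \<open>pi\<close> can be cut
  into two half-spaces without any condition along the cut. Each half sees at most the energy on
  \<open>C\<close>, whence twice the constant of the convex case.\<close>

theorem poincare_cones:
  fixes A :: "real^3 \<Rightarrow> real^3"
  assumes mg: "magnetic_gradient A C u f" and L2: "L2_on C u" "L2_on C f" and "linear A" "\<forall>x. curl A x = B" "B \<noteq> 0"
    and \<beta>: "0 < \<beta>" "\<beta> \<le> pi / 2"
    and C: "C = UNIV \<or> half_space C \<or> (\<exists>\<alpha>\<ge>\<beta>. wedge_of_opening \<alpha> C)"
  shows "L2_norm_sq C u \<le> (24 * pi / (norm B * sin \<beta>)) * L2_norm_sq C f"
proof -
  define c where "c = 12 * pi / (norm B * sin \<beta>)"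
  have sb: "sin \<beta> > 0" using \<beta> pi_gt_zero by (intro sin_gt_zero) linarith+
  have c: "c > 0" using sb assms(6) by (simp add: c_def)
  have nn: "L2_norm_sq D f \<ge> 0" for D by (simp add: L2_norm_sq_eq)
  have wedge: "L2_norm_sq (h ` model_wedge \<alpha>) u \<le> c * L2_norm_sq (h ` model_wedge \<alpha>) f"
    if "orthogonal_transformation h" "\<beta> \<le> \<alpha>" "\<alpha> \<le> pi" "h ` model_wedge \<alpha> \<subseteq> C" for h \<alpha>
    unfolding c_def using that by (intro poincare_convex_wedge[OF mg L2 assms(4-6) _ \<beta>])
  have "L2_norm_sq C u \<le> 2 * c * L2_norm_sq C f"
    using C
  proof (elim disjE exE conjE)
    assume U: "C = UNIV"
    have "L2_norm_sq C u \<le> c * L2_norm_sq C f" unfolding c_def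
      by (rule poincare_of_frame[OF mg L2 assms(4,5) _ orthogonal_transformation_id]) (use U \<beta> pi_gt_zero assms(6) in auto)
    also have "\<dots> \<le> 2 * c * L2_norm_sq C f" using c nn[of C] by simp
    finally show ?thesis .
  next
    assume "half_space C"
    then obtain h where "orthogonal_transformation h" "C = h ` model_wedge pi" by (rule half_space_wedge)
    then have "L2_norm_sq C u \<le> c * L2_norm_sq C f" using wedge[of h pi] \<beta> pi_gt_zero by simp
    also have "\<dots> \<le> 2 * c * L2_norm_sq C f" using c nn[of C] by simp
    finally show ?thesis .
  next
    fix \<alpha> assume \<alpha>: "\<beta> \<le> \<alpha>" "wedge_of_opening \<alpha> C"
    then obtain h where h: "orthogonal_transformation h" "C = h ` model_wedge \<alpha>" and a: "\<alpha> < 2 * pi"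
      by (auto simp: wedge_of_opening_def)
    show ?thesis
    proof (cases "\<alpha> \<le> pi")
      case True
      then have "L2_norm_sq C u \<le> c * L2_norm_sq C f" using wedge[of h \<alpha>] h \<alpha> by simp
      also have "\<dots> \<le> 2 * c * L2_norm_sq C f" using c nn[of C] by simp
      finally show ?thesis .
    next
      case False
      let ?g = "\<lambda>x. h (rotate3 (\<alpha> - pi) x)"
      define C1 C2 where "C1 = h ` model_wedge pi" and "C2 = ?g ` model_wedge pi"
      have CU: "C = C1 \<union> C2"
        using model_wedge_union[of \<alpha>] False a by (simp add: h(2) C1_def C2_def image_Un image_image)
      have g: "orthogonal_transformation ?g"
        using orthogonal_transformation_compose[OF h(1) orthogonal_rotate3] by (simp add: o_def)
      have op: "open C1" "open C2"
        unfolding C1_def C2_def using h(1) g by (auto intro!: open_orthogonal_image open_model_wedge)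
      have sub: "C1 \<subseteq> C" "C2 \<subseteq> C" by (auto simp: CU)
      have pi: "\<beta> \<le> pi" using \<beta> pi_gt_zero by linarith
      have "L2_norm_sq C u \<le> L2_norm_sq C1 u + L2_norm_sq C2 u"
        using L2_norm_sq_Un[OF _ op] L2(1) CU by simp
      also have "\<dots> \<le> c * L2_norm_sq C1 f + c * L2_norm_sq C2 f"
        unfolding C1_def C2_def
        using wedge[OF h(1) pi order_refl sub(1)[unfolded C1_def]] wedge[OF g pi order_refl sub(2)[unfolded C2_def]] by linarith
      also have "\<dots> \<le> c * L2_norm_sq C f + c * L2_norm_sq C f"
        using c L2_on_subset(2)[OF L2(2) op(1) sub(1)] L2_on_subset(2)[OF L2(2) op(2) sub(2)]
        by (intro add_mono mult_left_mono) auto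
      finally show ?thesis by simp
    qed
  qed
  then show ?thesis by (simp add: c_def)
qed

section \<open>Trial functions\<close>

lemma integrable_indicator_continuous:
  fixes g :: "'a::euclidean_space \<Rightarrow> 'b::euclidean_space"
  assumes "open C" "continuous_on UNIV g" "compact K" "\<And>x. x \<in> C \<Longrightarrow> x \<notin> K \<Longrightarrow> g x = 0"
  shows "integrable lebesgue (\<lambda>x. indicator C x *\<^sub>R g x)"
proof (rule Bochner_Integration.integrable_bound)
  have "integrable lborel (\<lambda>x. indicator K x *\<^sub>R g x)"
    using assms by (intro borel_integrable_compact) (auto intro: continuous_on_subset)
  then show "integrable lebesgue (\<lambda>x. indicator K x *\<^sub>R g x)"
    using assms by (subst integrable_completion)
      (auto intro!: borel_measurable_scaleR borel_measurable_continuous_onI borel_measurable_indicator simp: borel_compact)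
  have "C \<in> sets lebesgue" using assms(1) by (simp add: lborelD)
  then show "(\<lambda>x. indicator C x *\<^sub>R g x) \<in> borel_measurable lebesgue"
    by (intro borel_measurable_scaleR borel_measurable_indicator borel_measurable_lebesgue_continuous assms(2))
  show "AE x in lebesgue. norm (indicator C x *\<^sub>R g x) \<le> norm (indicator K x *\<^sub>R g x)"
    using assms(4) by (intro AE_I2) (auto split: split_indicator)
qed

lemma L2_on_continuous:
  assumes "open C" "continuous_on UNIV u" "compact K" "\<And>x. x \<in> C \<Longrightarrow> x \<notin> K \<Longrightarrow> u x = 0"
  shows "L2_on C u"
proof -
  have "integrable lebesgue (\<lambda>x. indicator C x *\<^sub>R (norm (u x))\<^sup>2)"
    by (rule integrable_indicator_continuous[OF assms(1) _ assms(3)]) (use assms in \<open>auto intro!: continuous_intros\<close>)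
  moreover have "C \<in> sets lebesgue" using assms(1) by (simp add: lborelD)
  then have "(\<lambda>x. indicator C x *\<^sub>R u x) \<in> borel_measurable lebesgue"
    by (intro borel_measurable_scaleR borel_measurable_indicator borel_measurable_lebesgue_continuous assms(2))
  ultimately show ?thesis by (simp add: L2_on_def set_borel_measurable_def set_integrable_def)
qed

text \<open>A vanishing integral would confine the nonempty open set where \<open>g\<close> is
  positive to a null set.\<close>

lemma integral_indicator_pos:
  fixes g :: "'a::euclidean_space \<Rightarrow> real"
  assumes "open C" "continuous_on UNIV g" "\<And>x. g x \<ge> 0" "a \<in> C" "g a > 0"
    and int: "integrable lebesgue (\<lambda>x. indicator C x *\<^sub>R g x)"
  shows "(\<integral>x. indicator C x *\<^sub>R g x \<partial>lebesgue) > 0"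
proof -
  let ?g = "\<lambda>x. indicator C x *\<^sub>R g x"
  have nn: "?g x \<ge> 0" for x using assms(3) by simp
  have "(\<integral>x. ?g x \<partial>lebesgue) \<noteq> 0"
  proof
    assume "(\<integral>x. ?g x \<partial>lebesgue) = 0"
    then have "AE x in lebesgue. ?g x = 0"
      using integral_nonneg_eq_0_iff_AE[OF int] nn by simp
    from this[unfolded eventually_ae_filter]
    obtain N where "N \<in> null_sets lebesgue" "{x \<in> space lebesgue. ?g x \<noteq> 0} \<subseteq> N" by blast
    then have N: "N \<in> null_sets lebesgue" "{x. ?g x \<noteq> 0} \<subseteq> N" by auto
    define U where "U = C \<inter> g -` {0<..}"
    have "open U" unfolding U_def using assms(1,2) by (intro open_Int open_vimage) auto
    moreover have "a \<in> U" using assms by (simp add: U_def)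
    moreover have "U \<subseteq> N" using N(2) by (auto simp: U_def)
    then have "negligible U" using N(1) by (meson negligible_iff_null_sets negligible_subset)
    ultimately show False using open_not_negligible by blast
  qed
  moreover have "(\<integral>x. ?g x \<partial>lebesgue) \<ge> 0" using nn by (rule Bochner_Integration.integral_nonneg)
  ultimately show ?thesis by linarith
qed

text \<open>The product of \<open>u\<close> with a test function has compact support in
  \<open>C\<close>, so integrating its derivative leaves no boundary term, whatever \<open>u\<close>
  does on the boundary of \<open>C\<close>.\<close>

lemma magnetic_gradient_classical:
  assumes "linear A" and der: "\<And>x. (u has_derivative Du x) (at x)" and cont: "\<And>j. continuous_on UNIV (\<lambda>x. Du x (axis j 1))"
  shows "magnetic_gradient A C u (\<lambda>x. vec_lambda (\<lambda>j. - \<i> * Du x (axis j 1) + complex_of_real (A x $ j) * u x))"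
  unfolding magnetic_gradient_def
proof (intro allI impI)
  fix \<phi> j assume "test_function C \<phi>"
  then have t: "compact_test C \<phi>" by (simp add: compact_test_real)
  obtain K where K: "compact K" "K \<subseteq> C" "\<And>x. x \<notin> K \<Longrightarrow> \<phi> x = 0" using t unfolding compact_test_def by blast
  let ?e = "axis j 1 :: real^3"
  define D\<phi> where "D\<phi> x = frechet_derivative \<phi> (at x) ?e" for x
  have dt: "compact_test C D\<phi>" unfolding D\<phi>_def using t by (rule compact_test_frechet)
  have D0: "D\<phi> x = 0" if "x \<notin> K" for x
  proof -
    have "(\<phi> has_derivative (\<lambda>h. 0)) (at x)"
      by (rule has_derivative_transform_within_open[of "\<lambda>x. 0" _ _ _ "- K"])
         (use that K in \<open>auto simp: compact_imp_closed open_Compl\<close>)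
    from fun_cong[OF frechet_derivative_at[OF this]] show ?thesis by (simp add: D\<phi>_def)
  qed
  have uc: "continuous_on UNIV u" using der by (auto intro!: continuous_at_imp_continuous_on has_derivative_continuous)
  have Ac: "continuous_on UNIV A" using \<open>linear A\<close> by (simp add: linear_continuous_on linear_conv_bounded_linear)
  note pc = compact_test_continuous[OF t, of UNIV] and dc = compact_test_continuous[OF dt, of UNIV]
  let ?L = "\<lambda>x. u x * (\<i> * complex_of_real (D\<phi> x) + complex_of_real (A x $ j * \<phi> x))"
  let ?R = "\<lambda>x. (- \<i> * Du x ?e + complex_of_real (A x $ j) * u x) * complex_of_real (\<phi> x)"
  have glob: "set_lebesgue_integral lebesgue C g = (\<integral>x. g x \<partial>lebesgue)" if "\<And>x. x \<notin> K \<Longrightarrow> g x = 0" for g :: "_ \<Rightarrow> complex"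
    unfolding set_lebesgue_integral_def using that K(2)
    by (intro Bochner_Integration.integral_cong) (auto split: split_indicator)
  have iL: "integrable lebesgue ?L" and iR: "integrable lebesgue ?R"
    by (rule integrable_lebesgue_continuous_compact[OF _ K(1)], intro continuous_intros uc pc dc Ac cont, simp add: K(3) D0)+
  define w where "w x = u x * complex_of_real (\<phi> x)" for x
  have wd: "(w has_derivative (\<lambda>h. u x * complex_of_real (frechet_derivative \<phi> (at x) h) + Du x h * complex_of_real (\<phi> x))) (at x)" for x
    unfolding w_def by (intro has_derivative_mult der has_derivative_of_real compact_test_has_derivative[OF t])
  have "(\<integral>x. u x * complex_of_real (frechet_derivative \<phi> (at x) ?e) + Du x ?e * complex_of_real (\<phi> x) \<partial>lebesgue) = 0"
    by (rule integral_derivative_zero[OF wd _ K(1)])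
       (use K(3) in \<open>auto simp: w_def intro!: continuous_intros uc pc dc[unfolded D\<phi>_def] cont\<close>)
  then have "(\<integral>x. \<i> * (u x * complex_of_real (D\<phi> x) + Du x ?e * complex_of_real (\<phi> x)) \<partial>lebesgue) = 0"
    by (simp add: D\<phi>_def)
  moreover have "?L x - ?R x = \<i> * (u x * complex_of_real (D\<phi> x) + Du x ?e * complex_of_real (\<phi> x))" for x
    by (simp add: algebra_simps)
  ultimately have "(\<integral>x. ?L x - ?R x \<partial>lebesgue) = 0" by simp
  then have "(\<integral>x. ?L x \<partial>lebesgue) = (\<integral>x. ?R x \<partial>lebesgue)"
    using Bochner_Integration.integral_diff[OF iL iR] by simp
  then show "(LINT x:C|lebesgue. u x * (\<i> * complex_of_real (frechet_derivative \<phi> (at x) (axis j 1)) + complex_of_real (A x $ j * \<phi> x))) =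
       (LINT x:C|lebesgue. (\<chi> j. - \<i> * Du x (axis j 1) + complex_of_real (A x $ j) * u x) $ j * complex_of_real (\<phi> x))"
    unfolding D\<phi>_def[symmetric] vec_lambda_beta
    by (subst (1 2) glob) (simp_all add: K(3) D0)
qed

section \<open>The ground energy as an infimum of quotients\<close>

definition admissible :: "(real^3 \<Rightarrow> real^3) \<Rightarrow> (real^3) set \<Rightarrow> (real^3 \<Rightarrow> complex) \<Rightarrow> (real^3 \<Rightarrow> complex^3) \<Rightarrow> bool" where
  "admissible A C u f \<longleftrightarrow> L2_on C u \<and> L2_norm_sq C u \<noteq> 0 \<and> L2_on C f \<and> magnetic_gradient A C u f"

lemma ground_energy_admissible: "ground_energy A C = Inf {L2_norm_sq C f / L2_norm_sq C u | u f. admissible A C u f}"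
  by (simp add: ground_energy_def admissible_def)

lemma quotient_bdd_below: "bdd_below {L2_norm_sq C f / L2_norm_sq C u | u f. admissible A C u f}"
  by (rule bdd_belowI[of _ 0]) (auto simp: L2_norm_sq_eq)

lemma ground_energy_le: "admissible A C u f \<Longrightarrow> ground_energy A C \<le> L2_norm_sq C f / L2_norm_sq C u"
  unfolding ground_energy_admissible by (rule cInf_lower[OF _ quotient_bdd_below]) blast

text \<open>The infimum of the empty set is an unspecified real, hence the minimum.\<close>

lemma ground_energy_ge: "ground_energy A C \<ge> min 0 (Inf {})"
proof (cases "{L2_norm_sq C f / L2_norm_sq C u | u f. admissible A C u f} = {}")
  case True
  then show ?thesis unfolding ground_energy_admissible True by simp
next
  case False
  have "0 \<le> ground_energy A C"
    unfolding ground_energy_admissible by (rule cInf_greatest[OF False]) (auto simp: L2_norm_sq_eq)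
  then show ?thesis by simp
qed

text \<open>Any bump function will do. It is required for lower bounds: over an empty set of
  quotients the infimum would be an unspecified real.\<close>

lemma ex_admissible:
  assumes "linear A" "open C" "C \<noteq> {}"
  shows "\<exists>u f. admissible A C u f"
proof -
  obtain a where a: "a \<in> C" using assms by blast
  obtain \<eta> :: "real^3 \<Rightarrow> real" where \<eta>: "compact_test C \<eta>" "\<And>x. \<eta> x \<ge> 0" "\<eta> a > 0"
    using compact_test_positive[OF \<open>open C\<close>, of "{a}"] a by auto
  define u where "u x = complex_of_real (\<eta> x)" for x
  define Du where "Du x h = complex_of_real (frechet_derivative \<eta> (at x) h)" for x h
  have uc: "continuous_on UNIV u" unfolding u_def using compact_test_continuous[OF \<eta>(1)] by (intro continuous_intros)
  have der: "(u has_derivative Du x) (at x)" for x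
    unfolding u_def Du_def by (intro has_derivative_of_real compact_test_has_derivative[OF \<eta>(1)])
  have Dc: "continuous_on UNIV (\<lambda>x. Du x h)" for h
    unfolding Du_def by (intro continuous_intros compact_test_continuous[OF compact_test_frechet[OF \<eta>(1)]])
  define f where "f = (\<lambda>x. \<chi> j. - \<i> * Du x (axis j 1) + complex_of_real (A x $ j) * u x)"
  have mg: "magnetic_gradient A C u f" unfolding f_def using assms(1) der Dc by (rule magnetic_gradient_classical)
  obtain K where K: "compact K" "K \<subseteq> C" "\<And>x. x \<notin> K \<Longrightarrow> \<eta> x = 0" using \<eta>(1) unfolding compact_test_def by blast
  have D0: "Du x h = 0" if "x \<notin> K" for x h
  proof -
    have "(\<eta> has_derivative (\<lambda>h. 0)) (at x)"
      by (rule has_derivative_transform_within_open[of "\<lambda>x. 0" _ _ _ "- K"])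
         (use that K in \<open>auto simp: compact_imp_closed open_Compl\<close>)
    from fun_cong[OF frechet_derivative_at[OF this]] show ?thesis by (simp add: Du_def)
  qed
  have Ac: "continuous_on UNIV A" using \<open>linear A\<close> by (simp add: linear_continuous_on linear_conv_bounded_linear)
  have fc: "continuous_on UNIV f" unfolding f_def by (intro continuous_intros Dc uc Ac)
  have "L2_on C u" by (rule L2_on_continuous[OF assms(2) uc K(1)]) (simp add: u_def K(3))
  moreover have "L2_on C f" by (rule L2_on_continuous[OF assms(2) fc K(1)]) (simp add: f_def u_def K(3) D0 vec_eq_iff)
  moreover have "L2_norm_sq C u > 0"
    unfolding L2_norm_sq_def set_lebesgue_integral_def
    by (rule integral_indicator_pos[OF assms(2) _ _ a])
       (use \<open>L2_on C u\<close> uc \<eta> in \<open>auto simp: u_def L2_on_def set_integrable_def intro!: continuous_intros\<close>)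
  ultimately show ?thesis using mg unfolding admissible_def by force
qed

lemma ground_energy_lower_bound:
  fixes A :: "real^3 \<Rightarrow> real^3"
  assumes "linear A" "\<forall>x. curl A x = B" "B \<noteq> 0" and \<beta>: "0 < \<beta>" "\<beta> \<le> pi / 2"
    and C: "C = UNIV \<or> half_space C \<or> (\<exists>\<alpha>\<ge>\<beta>. wedge_of_opening \<alpha> C)"
  shows "ground_energy A C \<ge> norm B * sin \<beta> / (24 * pi)"
proof -
  have "open C \<and> C \<noteq> {}"
    using C
  proof (elim disjE exE conjE)
    assume "half_space C"
    then obtain h where h: "orthogonal_transformation h" "C = h ` model_wedge pi" by (rule half_space_wedge)
    have "axis 2 1 \<in> model_wedge pi" by (subst model_wedge_convex) (auto simp: axis_def)
    then show ?thesis using h open_orthogonal_image[OF h(1) open_model_wedge[of pi]] by auto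
  next
    fix \<alpha> assume "wedge_of_opening \<alpha> C"
    then obtain h where h: "orthogonal_transformation h" "C = h ` model_wedge \<alpha>" "0 < \<alpha>" "\<alpha> < 2 * pi"
      by (auto simp: wedge_of_opening_def)
    have "vector [1 * cos (\<alpha> / 2), 1 * sin (\<alpha> / 2), 0] \<in> model_wedge \<alpha>"
      unfolding model_wedge_def mem_Collect_eq vector_3 using h(3) by (metis field_sum_of_halves half_gt_zero less_add_same_cancel1 zero_less_one)
    then show ?thesis using h open_orthogonal_image[OF h(1) open_model_wedge[of \<alpha>]] by auto
  qed auto
  then have ne: "{L2_norm_sq C f / L2_norm_sq C u | u f. admissible A C u f} \<noteq> {}"
    using ex_admissible[OF assms(1)] by auto
  have sb: "sin \<beta> > 0" using \<beta> pi_gt_zero by (intro sin_gt_zero) linarith+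
  show ?thesis
    unfolding ground_energy_admissible
  proof (rule cInf_greatest[OF ne])
    fix r assume "r \<in> {L2_norm_sq C f / L2_norm_sq C u | u f. admissible A C u f}"
    then obtain u f where r: "r = L2_norm_sq C f / L2_norm_sq C u" and uf: "admissible A C u f" by blast
    have "L2_norm_sq C u \<le> (24 * pi / (norm B * sin \<beta>)) * L2_norm_sq C f"
      using uf unfolding admissible_def by (intro poincare_cones[OF _ _ _ assms(1-3) \<beta> C]) auto
    moreover have "L2_norm_sq C u > 0"
      using uf unfolding admissible_def by (simp add: L2_norm_sq_eq less_le)
    ultimately show "norm B * sin \<beta> / (24 * pi) \<le> r"
      using sb assms(3) by (simp add: r field_simps)
  qed
qed

section \<open>The energy of a thin cone\<close>

lemma vector_2_axis: "vector [a, b] = a *\<^sub>R axis 1 1 + b *\<^sub>R (axis 2 1 :: real^2)"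
  by (simp add: vec_eq_iff forall_2 axis_def)

lemma open_cone_of:
  assumes "open \<omega>" shows "open (cone_of \<omega>)"
proof -
  let ?S = "{x :: real^3. x$3 > 0}"
  have S: "open ?S" by (intro open_Collect_less continuous_intros)
  have "continuous_on ?S (\<lambda>x. vector [x $ 1 / x $ 3, x $ 2 / x $ 3] :: real^2)"
    unfolding vector_2_axis by (intro continuous_intros) auto
  then have "open (?S \<inter> (\<lambda>x. vector [x $ 1 / x $ 3, x $ 2 / x $ 3]) -` \<omega>)"
    using S assms by (meson continuous_on_open_vimage inf_commute continuous_open_preimage)
  moreover have "cone_of \<omega> = ?S \<inter> (\<lambda>x. vector [x $ 1 / x $ 3, x $ 2 / x $ 3]) -` \<omega>" by (auto simp: cone_of_def)
  ultimately show ?thesis by simp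
qed

lemma integral_lborel_diagonal:
  fixes c :: "'a::euclidean_space \<Rightarrow> real" and h :: "'a \<Rightarrow> real"
  assumes "\<And>j. j \<in> Basis \<Longrightarrow> c j \<noteq> 0" "h \<in> borel_measurable borel"
  shows "(\<integral>x. h x \<partial>lborel) = (\<Prod>j\<in>Basis. \<bar>c j\<bar>) * (\<integral>x. h (\<Sum>j\<in>Basis. (c j * (x \<bullet> j)) *\<^sub>R j) \<partial>lborel)"
proof -
  let ?T = "\<lambda>x. 0 + (\<Sum>j\<in>Basis. (c j * (x \<bullet> j)) *\<^sub>R j)"
  have "(\<integral>x. h x \<partial>lborel) = (\<integral>x. h x \<partial>density (distr lborel borel ?T) (\<lambda>_. ennreal (\<Prod>j\<in>Basis. \<bar>c j\<bar>)))"
    using lborel_affine_euclidean[of c 0, OF assms(1)] by simp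
  also have "\<dots> = (\<integral>x. (\<Prod>j\<in>Basis. \<bar>c j\<bar>) *\<^sub>R h x \<partial>distr lborel borel ?T)"
    using assms(2) by (subst integral_density) (auto intro!: prod_nonneg)
  also have "\<dots> = (\<integral>x. (\<Prod>j\<in>Basis. \<bar>c j\<bar>) *\<^sub>R h (?T x) \<partial>lborel)"
    using assms(2) by (subst integral_distr) auto
  finally show ?thesis by simp
qed

text \<open>The trial function lives on the heights up to \<open>1 / sqrt \<epsilon>\<close>. There
  the width of the cone is of order \<open>sqrt \<epsilon>\<close>, so the squared potential in the
  adapted gauge and the squared slope of the profile are both of order \<epsilon>.\<close>

lemma thin_cone_energy:
  fixes A :: "real^3 \<Rightarrow> real^3"
  assumes "open \<omega>" "bounded \<omega>" "\<omega> \<noteq> {}" "linear A" "\<forall>x. curl A x = B"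
  obtains K where "K \<ge> 0" "\<And>\<epsilon>. \<epsilon> > 0 \<Longrightarrow> ground_energy A (cone_of ((\<lambda>y. \<epsilon> *\<^sub>R y) ` \<omega>)) \<le> K * \<epsilon>"
proof -
  obtain R where R: "R > 0" "\<And>y. y \<in> \<omega> \<Longrightarrow> norm y \<le> R" using assms(2) by (meson bounded_pos)
  \<comment> \<open>a gauge for the same field that is small near the axis of the cone\<close>
  define A' where "A' x = (vector [- (B$3) * x$2 / 2, B$3 * x$1 / 2, B$1 * x$2 - B$2 * x$1] :: real^3)" for x :: "real^3"
  \<comment> \<open>Two linear potentials with the same curl differ by a symmetric map, the gradient
    of the quadratic form \<open>q\<close>. The phase \<open>cis (- q x)\<close> then exchanges
    \<open>A\<close> for \<open>A'\<close>.\<close>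
  define S where "S x = A x - A' x" for x
  have linA': "linear A'" by (rule linearI) (auto simp: A'_def vec_eq_iff forall_3 field_simps)
  have linS: "linear S" unfolding S_def using assms(4) linA' by (rule linear_compose_sub)
  have curlA': "\<forall>x. curl A' x = B"
    unfolding curl_linear[OF linA'] by (simp add: A'_def axis_def vec_eq_iff forall_3)
  have symS: "x \<bullet> S h = h \<bullet> S x" for x h
    using flux_curl[OF assms(4,5), of x h] flux_curl[OF linA' curlA', of x h]
    by (simp add: S_def flux_def inner_diff_right)
  define q where "q x = (x \<bullet> S x) / 2" for x
  have Sd: "(S has_derivative S) (at x)" for x using linS by (rule linear_imp_has_derivative)
  have qd: "(q has_derivative (\<lambda>h. h \<bullet> S x)) (at x)" for x
    unfolding q_def by (rule has_derivative_eq_rhs[OF has_derivative_divide'[OF has_derivative_inner[OF has_derivative_ident Sd]]])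
      (auto simp: symS)
  let ?h0 = "flat_exp 0" and ?h2 = "flat_exp 2"
  have hc: "continuous_on UNIV (flat_exp n)" for n using smooth_on_flat_exp smooth_on_continuous by blast
  define J0 where "J0 = (\<integral>x. indicator (cone_of \<omega>) x *\<^sub>R (?h0 (1 - (x$3)\<^sup>2))\<^sup>2 \<partial>lborel)"
  \<comment> \<open>Evaluated at \<epsilon> times the squared height and multiplied by \<epsilon>,
    this bounds the squared magnetic gradient: the first summand comes from \<open>A'\<close>, the
    second is the square of the derivative of the profile.\<close>
  define G where "G s = s * ((norm B * R)\<^sup>2 * (?h0 (1 - s))\<^sup>2 + 4 * (?h2 (1 - s))\<^sup>2)" for s
  define J1 where "J1 = (\<integral>x. indicator (cone_of \<omega>) x *\<^sub>R G ((x$3)\<^sup>2) \<partial>lborel)"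
  have Gc: "continuous_on UNIV G" unfolding G_def by (intro continuous_intros continuous_on_compose2[OF hc]) auto
  have fl0: "flat_exp n s = 0" if "s \<le> 0" for n s using that by (simp add: flat_exp_def)
  have coneI: "norm x \<le> (1 + \<epsilon> * R * 2) * \<bar>x$3\<bar>" "(x$1)\<^sup>2 + (x$2)\<^sup>2 \<le> (\<epsilon> * R * x$3)\<^sup>2"
    if xC: "x \<in> cone_of ((\<lambda>y. \<epsilon> *\<^sub>R y) ` \<omega>)" "\<epsilon> > 0" for x \<epsilon>
  proof -
    obtain y where y: "y \<in> \<omega>" "vector [x$1 / x$3, x$2 / x$3] = \<epsilon> *\<^sub>R y" and x3: "x$3 > 0"
      using xC(1) unfolding cone_of_def by blast
    have e: "x$1 = x$3 * (\<epsilon> * y$1)" "x$2 = x$3 * (\<epsilon> * y$2)"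
      using y(2) x3 by (auto simp: vec_eq_iff forall_2 field_simps)
    have ny: "(y$1)\<^sup>2 + (y$2)\<^sup>2 \<le> R\<^sup>2"
      using R(2)[OF y(1)] power_mono[of "norm y" R 2] by (simp add: norm_vec_def L2_set_def sum_2)
    have "(x$1)\<^sup>2 + (x$2)\<^sup>2 = (\<epsilon> * x$3)\<^sup>2 * ((y$1)\<^sup>2 + (y$2)\<^sup>2)" by (simp add: e power2_eq_square algebra_simps)
    also have "\<dots> \<le> (\<epsilon> * x$3)\<^sup>2 * R\<^sup>2" using ny by (intro mult_left_mono) auto
    finally show 2: "(x$1)\<^sup>2 + (x$2)\<^sup>2 \<le> (\<epsilon> * R * x$3)\<^sup>2" by (simp add: power_mult_distrib mult_ac)
    have "\<bar>x$1\<bar> \<le> \<epsilon> * R * x$3" "\<bar>x$2\<bar> \<le> \<epsilon> * R * x$3"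
    proof -
      have nn: "0 \<le> \<epsilon> * R * x$3" using that(2) R x3 by simp
      have "(x$1)\<^sup>2 \<le> (\<epsilon> * R * x$3)\<^sup>2" "(x$2)\<^sup>2 \<le> (\<epsilon> * R * x$3)\<^sup>2"
        using 2 zero_le_power2[of "x$1"] zero_le_power2[of "x$2"] by linarith+
      then show "\<bar>x$1\<bar> \<le> \<epsilon> * R * x$3" "\<bar>x$2\<bar> \<le> \<epsilon> * R * x$3" using nn by (auto intro: abs_le_square_iff[THEN iffD2, THEN order_trans])
    qed
    moreover have "norm x \<le> \<bar>x$1\<bar> + \<bar>x$2\<bar> + \<bar>x$3\<bar>"
      using norm_le_l1_cart[of x] by (simp add: sum_3)
    ultimately show "norm x \<le> (1 + \<epsilon> * R * 2) * \<bar>x$3\<bar>" using x3 by (simp add: algebra_simps)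
  qed
  \<comment> \<open>The profile vanishes above height \<open>1 / sqrt \<epsilon>\<close>, and the
    part of the cone below that height lies in this ball.\<close>
  define KK where "KK \<epsilon> = cball (0::real^3) ((1 + \<epsilon> * R * 2) * sqrt (1 / \<epsilon>))" for \<epsilon>
  have supp: "1 - \<epsilon> * (x$3)\<^sup>2 \<le> 0" if "x \<in> cone_of ((\<lambda>y. \<epsilon> *\<^sub>R y) ` \<omega>)" "\<epsilon> > 0" "x \<notin> KK \<epsilon>" for x \<epsilon>
  proof -
    have "(1 + \<epsilon> * R * 2) * sqrt (1 / \<epsilon>) < (1 + \<epsilon> * R * 2) * \<bar>x$3\<bar>"
      using coneI(1)[OF that(1,2)] that(3) by (simp add: KK_def)
    moreover have "1 + \<epsilon> * R * 2 > 0" using that(2) R by (simp add: add_pos_pos)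
    ultimately have "sqrt (1 / \<epsilon>) < \<bar>x$3\<bar>" by simp
    then have "1 / \<epsilon> < (x$3)\<^sup>2" by (metis power2_abs real_less_lsqrt real_sqrt_abs real_sqrt_less_iff)
    then show ?thesis using that(2) by (simp add: field_simps)
  qed
  have op: "open (cone_of ((\<lambda>y. \<epsilon> *\<^sub>R y) ` \<omega>))" if "\<epsilon> > 0" for \<epsilon>
    using assms(1) that by (intro open_cone_of open_scaling) auto
  have C1: "cone_of \<omega> = cone_of ((\<lambda>y. 1 *\<^sub>R y) ` \<omega>)" by simp
  have intG: "integrable lebesgue (\<lambda>x. indicator (cone_of ((\<lambda>y. \<epsilon> *\<^sub>R y) ` \<omega>)) x *\<^sub>R F (\<epsilon> * (x$3)\<^sup>2))"
    if "\<epsilon> > 0" "continuous_on UNIV F" "\<And>s. s \<ge> 1 \<Longrightarrow> F s = 0" for \<epsilon> and F :: "real \<Rightarrow> real"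
    by (rule integrable_indicator_continuous[OF op[OF that(1)], of _ "KK \<epsilon>"])
       (use supp[OF _ that(1)] that(3) in \<open>auto intro!: continuous_intros continuous_on_compose2[OF that(2)] simp: KK_def\<close>)
  have C1ne: "\<exists>x. x \<in> cone_of \<omega> \<and> (x$3)\<^sup>2 < 1"
  proof -
    obtain y where y: "y \<in> \<omega>" using assms(3) by blast
    have "vector [y$1, y$2] = y" by (simp add: vec_eq_iff forall_2)
    then have "vector [y$1 / 2, y$2 / 2, 1 / 2] \<in> cone_of \<omega>" using y by (simp add: cone_of_def)
    then show ?thesis by (intro exI[of _ "vector [y$1 / 2, y$2 / 2, 1 / 2]"]) (simp add: power2_eq_square)
  qed
  have bm: "(\<lambda>x. indicator (cone_of ((\<lambda>y. \<epsilon> *\<^sub>R y) ` \<omega>)) x *\<^sub>R F (\<epsilon> * (x$3)\<^sup>2)) \<in> borel_measurable borel"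
    if "\<epsilon> > 0" "continuous_on UNIV F" for \<epsilon> and F :: "real \<Rightarrow> real"
    using op[OF that(1)]
    by (intro borel_measurable_scaleR borel_measurable_indicator borel_measurable_continuous_onI
        continuous_on_compose2[OF that(2)] continuous_intros) auto
  have F0c: "continuous_on UNIV (\<lambda>s. (?h0 (1 - s))\<^sup>2)" by (intro continuous_intros continuous_on_compose2[OF hc]) auto
  have J0: "J0 > 0"
  proof -
    obtain a where a: "a \<in> cone_of \<omega>" "(a$3)\<^sup>2 < 1" using C1ne by blast
    have "0 < (\<integral>x. indicator (cone_of \<omega>) x *\<^sub>R (?h0 (1 - (x$3)\<^sup>2))\<^sup>2 \<partial>lebesgue)"
    proof (rule integral_indicator_pos[OF _ _ _ a(1)])
      show "integrable lebesgue (\<lambda>x. indicator (cone_of \<omega>) x *\<^sub>R (?h0 (1 - (x$3)\<^sup>2))\<^sup>2)"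
        using intG[of 1, OF _ F0c] by (simp add: fl0)
      show "continuous_on UNIV (\<lambda>x::real^3. (?h0 (1 - (x$3)\<^sup>2))\<^sup>2)"
        by (intro continuous_intros continuous_on_compose2[OF hc]) auto
    qed (use a assms(1) open_cone_of in \<open>auto simp: flat_exp_def\<close>)
    then show ?thesis
      unfolding J0_def using bm[of 1, OF _ F0c] by (simp add: integral_completion)
  qed
  have scale: "(\<integral>x. indicator (cone_of ((\<lambda>y. \<epsilon> *\<^sub>R y) ` \<omega>)) x *\<^sub>R F (\<epsilon> * (x$3)\<^sup>2) \<partial>lebesgue)
      = sqrt \<epsilon> * (\<integral>x. indicator (cone_of \<omega>) x *\<^sub>R F ((x$3)\<^sup>2) \<partial>lborel)"
    if e: "\<epsilon> > 0" and F: "continuous_on UNIV F" for \<epsilon> and F :: "real \<Rightarrow> real"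
  proof -
    \<comment> \<open>This diagonal map multiplies slopes by \<epsilon> and so carries the cone over
      \<omega> to the cone over its dilate, while it removes \<epsilon> from the profile. Its
      Jacobian \<open>sqrt \<epsilon>\<close> cancels in the quotient.\<close>
    define c where "c j = (if j = axis 3 1 then 1 / sqrt \<epsilon> else sqrt \<epsilon>)" for j :: "real^3"
    have ne: "axis (1::3) (1::real) \<noteq> axis 3 1" "axis (2::3) (1::real) \<noteq> axis 3 1" by (auto simp: axis_eq_axis)
    have B3: "(Basis :: (real^3) set) = {axis 1 1, axis 2 1, axis 3 1}"
      by (auto simp: Basis_vec_def) (metis exhaust_3)
    have dist: "axis (1::3) (1::real) \<noteq> axis 2 1" by (auto simp: axis_eq_axis)
    have pr: "(\<Prod>j\<in>Basis. \<bar>c j\<bar>) = sqrt \<epsilon>"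
      using e ne dist by (simp add: B3 c_def)
    have T: "(\<Sum>j\<in>Basis. (c j * (x \<bullet> j)) *\<^sub>R j) = vector [sqrt \<epsilon> * x$1, sqrt \<epsilon> * x$2, x$3 / sqrt \<epsilon>]" for x :: "real^3"
      using ne dist by (simp add: B3 c_def vec_eq_iff forall_3 inner_axis) (simp add: axis_def)
    let ?h = "\<lambda>x. indicator (cone_of ((\<lambda>y. \<epsilon> *\<^sub>R y) ` \<omega>)) x *\<^sub>R F (\<epsilon> * (x$3)\<^sup>2)"
    have cone: "vector [sqrt \<epsilon> * x$1, sqrt \<epsilon> * x$2, x$3 / sqrt \<epsilon>] \<in> cone_of ((\<lambda>y. \<epsilon> *\<^sub>R y) ` \<omega>) \<longleftrightarrow> x \<in> cone_of \<omega>" for x :: "real^3"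
    proof -
      have "vector [sqrt \<epsilon> * x$1 / (x$3 / sqrt \<epsilon>), sqrt \<epsilon> * x$2 / (x$3 / sqrt \<epsilon>)] = \<epsilon> *\<^sub>R (vector [x$1 / x$3, x$2 / x$3] :: real^2)"
        using e by (simp add: vec_eq_iff forall_2 field_simps)
      moreover have "inj (\<lambda>y :: real^2. \<epsilon> *\<^sub>R y)" using e by (simp add: inj_on_def)
      ultimately show ?thesis
        using e by (simp add: cone_of_def inj_image_mem_iff zero_less_divide_iff)
    qed
    have "(\<integral>x. ?h x \<partial>lebesgue) = (\<integral>x. ?h x \<partial>lborel)" using bm[OF e F] by (simp add: integral_completion)
    also have "\<dots> = (\<Prod>j\<in>Basis. \<bar>c j\<bar>) * (\<integral>x. ?h (\<Sum>j\<in>Basis. (c j * (x \<bullet> j)) *\<^sub>R j) \<partial>lborel)"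
      by (rule integral_lborel_diagonal[OF _ bm[OF e F]]) (use e in \<open>auto simp: c_def\<close>)
    also have "\<dots> = sqrt \<epsilon> * (\<integral>x. indicator (cone_of \<omega>) x *\<^sub>R F ((x$3)\<^sup>2) \<partial>lborel)"
      unfolding pr T using e by (simp add: indicator_def cone power_divide)
    finally show ?thesis .
  qed
  have J1: "J1 \<ge> 0"
    unfolding J1_def by (rule Bochner_Integration.integral_nonneg) (auto simp: G_def split: split_indicator)
  have "ground_energy A (cone_of ((\<lambda>y. \<epsilon> *\<^sub>R y) ` \<omega>)) \<le> (J1 / J0) * \<epsilon>" if e: "\<epsilon> > 0" for \<epsilon>
  proof -
    let ?C = "cone_of ((\<lambda>y. \<epsilon> *\<^sub>R y) ` \<omega>)"
    define g where "g x = ?h0 (1 - \<epsilon> * (x$3)\<^sup>2)" for x :: "real^3"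
    define g' where "g' x = - 2 * \<epsilon> * x$3 * ?h2 (1 - \<epsilon> * (x$3)\<^sup>2)" for x :: "real^3"
    define u where "u x = cis (- q x) * complex_of_real (g x)" for x
    define Du where "Du x h = cis (- q x) * complex_of_real (g' x * h$3) + (- (h \<bullet> S x)) *\<^sub>R (\<i> * cis (- q x)) * complex_of_real (g x)" for x h
    have gd: "(g has_derivative (\<lambda>h. g' x * h$3)) (at x)" for x
    proof -
      have "((\<lambda>x. 1 - \<epsilon> * (x$3)\<^sup>2) has_derivative (\<lambda>h. - 2 * \<epsilon> * x$3 * h$3)) (at x)"
        by (auto intro!: derivative_eq_intros bounded_linear_imp_has_derivative[OF bounded_linear_vec_nth])
      moreover have "(?h0 has_derivative (\<lambda>h. ?h2 s * h)) (at s)" for s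
        using flat_exp_derivative[of 0 s] by (simp add: has_field_derivative_def numeral_2_eq_2)
      ultimately show ?thesis
        using diff_chain_at[of "\<lambda>x. 1 - \<epsilon> * (x$3)\<^sup>2" "\<lambda>h. - 2 * \<epsilon> * x$3 * h$3" x ?h0 "\<lambda>h. ?h2 (1 - \<epsilon> * (x$3)\<^sup>2) * h"]
        by (simp add: o_def g_def[abs_def] g'_def mult_ac)
    qed
    have cd: "((\<lambda>x. cis (- q x)) has_derivative (\<lambda>h. (- (h \<bullet> S x)) *\<^sub>R (\<i> * cis (- q x)))) (at x)" for x
    proof -
      have "(cis has_derivative (\<lambda>h. h *\<^sub>R (\<i> * cis s))) (at s)" for s
        using has_vector_derivative_cis[OF DERIV_ident, of s] by (simp add: has_vector_derivative_def)
      from diff_chain_at[OF has_derivative_minus[OF qd] this] show ?thesis by (simp add: o_def)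
    qed
    have der: "(u has_derivative Du x) (at x)" for x
      unfolding u_def Du_def by (intro has_derivative_mult cd has_derivative_of_real gd)
    have Sc: "continuous_on UNIV S" "continuous_on UNIV A" using linS assms(4) by (simp_all add: linear_continuous_on linear_conv_bounded_linear)
    have qc: "continuous_on UNIV q" unfolding q_def by (intro continuous_intros Sc) auto
    have gc: "continuous_on UNIV g" unfolding g_def by (intro continuous_intros continuous_on_compose2[OF hc]) auto
    have g'c: "continuous_on UNIV g'" unfolding g'_def by (intro continuous_intros continuous_on_compose2[OF hc]) auto
    have Dc: "continuous_on UNIV (\<lambda>x. Du x h)" for h unfolding Du_def by (intro continuous_intros qc gc g'c Sc)
    have uc: "continuous_on UNIV u" unfolding u_def by (intro continuous_intros qc gc)
    define f where "f = (\<lambda>x. \<chi> j. - \<i> * Du x (axis j 1) + complex_of_real (A x $ j) * u x)"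
    have fc: "continuous_on UNIV f" unfolding f_def by (intro continuous_intros Dc uc Sc)
    have mg: "magnetic_gradient A ?C u f" unfolding f_def using assms(4) der Dc by (rule magnetic_gradient_classical)
    \<comment> \<open>Up to the phase, the real part of the magnetic gradient carries the new
      potential and the imaginary part the derivative of the profile, so the squared norm has no
      cross term.\<close>
    have fj: "f x $ j = cis (- q x) * Complex (A' x $ j * g x) (- (g' x * axis j 1 $ 3))" for x j
    proof -
      have e: "A x $ j = A' x $ j + axis j 1 \<bullet> S x" by (simp add: inner_axis' S_def)
      show ?thesis
        unfolding f_def u_def Du_def vec_lambda_beta Complex_eq e by (simp add: scaleR_conv_of_real algebra_simps)
    qed
    have nf: "(norm (f x))\<^sup>2 = (norm (A' x))\<^sup>2 * (g x)\<^sup>2 + (g' x)\<^sup>2" for x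
    proof -
      have n: "(norm (f x $ j))\<^sup>2 = (A' x $ j)\<^sup>2 * (g x)\<^sup>2 + (g' x)\<^sup>2 * (axis j 1 $ 3)\<^sup>2" for j
        unfolding fj norm_mult by (simp add: cmod_power2 power_mult_distrib)
      have "(norm (f x))\<^sup>2 = (\<Sum>j\<in>UNIV. (norm (f x $ j))\<^sup>2)" by (simp add: norm_vec_def L2_set_def sum_nonneg)
      moreover have "(norm (A' x))\<^sup>2 = (\<Sum>j\<in>UNIV. (A' x $ j)\<^sup>2)" by (simp add: norm_vec_def L2_set_def sum_nonneg)
      ultimately show ?thesis unfolding n by (simp add: sum_3 axis_def algebra_simps)
    qed
    have nA': "(norm (A' x))\<^sup>2 \<le> (norm B)\<^sup>2 * ((x$1)\<^sup>2 + (x$2)\<^sup>2)" for x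
    proof -
      have "(norm (A' x))\<^sup>2 = (B$3)\<^sup>2 * ((x$1)\<^sup>2 + (x$2)\<^sup>2) / 4 + (B$1 * x$2 - B$2 * x$1)\<^sup>2"
        by (simp add: A'_def norm_vec_def L2_set_def sum_3 sum_nonneg power_divide power_mult_distrib algebra_simps)
      moreover have "(B$1 * x$2 - B$2 * x$1)\<^sup>2 + (B$1 * x$1 + B$2 * x$2)\<^sup>2 = ((B$1)\<^sup>2 + (B$2)\<^sup>2) * ((x$1)\<^sup>2 + (x$2)\<^sup>2)"
        by (simp only: power2_eq_square algebra_simps)
      moreover have "(norm B)\<^sup>2 = (B$1)\<^sup>2 + (B$2)\<^sup>2 + (B$3)\<^sup>2" by (simp add: norm_vec_def L2_set_def sum_3)
      moreover have "0 \<le> (B$3)\<^sup>2 * ((x$1)\<^sup>2 + (x$2)\<^sup>2)" "0 \<le> (B$1 * x$1 + B$2 * x$2)\<^sup>2" by auto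
      ultimately show ?thesis by (simp only: distrib_right)
    qed
    have le: "(norm (f x))\<^sup>2 \<le> \<epsilon> * G (\<epsilon> * (x$3)\<^sup>2)" if x: "x \<in> ?C" for x
    proof -
      have "(norm (A' x))\<^sup>2 \<le> (norm B)\<^sup>2 * (\<epsilon> * R * x$3)\<^sup>2"
        using nA'[of x] coneI(2)[OF x e] by (meson mult_left_mono order_trans zero_le_power2)
      then have "(norm (A' x))\<^sup>2 * (g x)\<^sup>2 \<le> (norm B)\<^sup>2 * (\<epsilon> * R * x$3)\<^sup>2 * (g x)\<^sup>2"
        by (rule mult_right_mono) simp
      then show ?thesis
        unfolding nf G_def g_def g'_def by (simp add: power2_eq_square algebra_simps)
    qed
    have z: "g x = 0" "g' x = 0" if "x \<in> ?C" "x \<notin> KK \<epsilon>" for x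
      using supp[OF that(1) e that(2)] by (auto simp: g_def g'_def fl0)
    have cK: "compact (KK \<epsilon>)" by (simp add: KK_def)
    have Lu: "L2_on ?C u" by (rule L2_on_continuous[OF op[OF e] uc cK]) (simp add: u_def z)
    have Lf: "L2_on ?C f" by (rule L2_on_continuous[OF op[OF e] fc cK]) (simp add: fj z vec_eq_iff Complex_eq)
    have nu: "L2_norm_sq ?C u = sqrt \<epsilon> * J0"
      unfolding L2_norm_sq_def set_lebesgue_integral_def u_def norm_mult norm_cis g_def
      using scale[OF e F0c] by (simp add: J0_def)
    have "L2_norm_sq ?C f \<le> (\<integral>x. \<epsilon> * (indicator ?C x *\<^sub>R G (\<epsilon> * (x$3)\<^sup>2)) \<partial>lebesgue)"
      unfolding L2_norm_sq_def set_lebesgue_integral_def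
    proof (intro integral_mono)
      show "integrable lebesgue (\<lambda>x. indicator ?C x *\<^sub>R (norm (f x))\<^sup>2)"
        using Lf by (simp add: L2_on_def set_integrable_def)
      show "integrable lebesgue (\<lambda>x. \<epsilon> * (indicator ?C x *\<^sub>R G (\<epsilon> * (x$3)\<^sup>2)))"
        by (intro integrable_mult_right intG[OF e Gc]) (auto simp: G_def fl0)
      show "indicator ?C x *\<^sub>R (norm (f x))\<^sup>2 \<le> \<epsilon> * (indicator ?C x *\<^sub>R G (\<epsilon> * (x$3)\<^sup>2))" for x
        using le[of x] by (auto split: split_indicator)
    qed
    also have "\<dots> = \<epsilon> * (sqrt \<epsilon> * J1)"
      using scale[OF e Gc] by (simp add: J1_def)
    finally have nfle: "L2_norm_sq ?C f \<le> \<epsilon> * (sqrt \<epsilon> * J1)" .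
    have "admissible A ?C u f" using Lu Lf mg nu J0 e by (simp add: admissible_def)
    then have "ground_energy A ?C \<le> L2_norm_sq ?C f / L2_norm_sq ?C u" by (rule ground_energy_le)
    also have "\<dots> \<le> \<epsilon> * (sqrt \<epsilon> * J1) / (sqrt \<epsilon> * J0)"
      unfolding nu using nfle J0 e by (intro divide_right_mono) auto
    also have "\<dots> = (J1 / J0) * \<epsilon>" using e by simp
    finally show ?thesis .
  qed
  then show thesis using that[of "J1 / J0"] J0 J1 by simp
qed

section \<open>Corner concentration\<close>

theorem corner_concentration:
  fixes \<omega> :: "(real^2) set" and A :: "real^3 \<Rightarrow> real^3" and \<Omega> :: "real \<Rightarrow> (real^3) set"
  assumes "open \<omega>" "bounded \<omega>" "\<omega> \<noteq> {}" "linear A" "\<forall>x. curl A x = B" "B \<noteq> 0" "0 < \<epsilon>\<^sub>0" "0 < \<beta>\<^sub>0"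
    and fam: "\<And>\<epsilon>. 0 < \<epsilon> \<Longrightarrow> \<epsilon> < \<epsilon>\<^sub>0 \<Longrightarrow> corner_domain_3D (\<Omega> \<epsilon>) \<and>
      (\<exists>v \<in> vertices (\<Omega> \<epsilon>). tangent_cone (\<Omega> \<epsilon>) v = cone_of ((\<lambda>y. \<epsilon> *\<^sub>R y) ` \<omega>)) \<and>
      (\<forall>x \<alpha>. is_edge_opening (\<Omega> \<epsilon>) x \<alpha> \<longrightarrow> \<beta>\<^sub>0 \<le> \<alpha>)"
  shows "\<forall>\<^sub>F \<epsilon> in at_right 0. (INF x \<in> closure (\<Omega> \<epsilon>). ground_energy A (tangent_cone (\<Omega> \<epsilon>) x))
    < (INF x \<in> closure (\<Omega> \<epsilon>) - vertices (\<Omega> \<epsilon>). ground_energy A (tangent_cone (\<Omega> \<epsilon>) x))"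
proof -
  obtain K where K: "K \<ge> 0" "\<And>\<epsilon>. \<epsilon> > 0 \<Longrightarrow> ground_energy A (cone_of ((\<lambda>y. \<epsilon> *\<^sub>R y) ` \<omega>)) \<le> K * \<epsilon>"
    using thin_cone_energy[OF assms(1-5)] by blast
  define \<beta> where "\<beta> = min \<beta>\<^sub>0 (pi / 2)"
  have \<beta>: "0 < \<beta>" "\<beta> \<le> pi / 2" "\<beta> \<le> \<beta>\<^sub>0" using assms(8) by (auto simp: \<beta>_def)
  define c where "c = norm B * sin \<beta> / (24 * pi)"
  have "sin \<beta> > 0" using \<beta> pi_gt_zero by (intro sin_gt_zero) linarith+
  then have c: "c > 0" using assms(6) by (simp add: c_def)
  \<comment> \<open>Dividing by \<open>K + 1\<close> also covers \<open>K = 0\<close>.\<close>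
  define b where "b = min \<epsilon>\<^sub>0 (c / (K + 1))"
  have b: "b > 0" using assms(7) c K(1) by (simp add: b_def)
  show ?thesis
    unfolding eventually_at_right_field
  proof (intro exI[of _ b] conjI b allI impI)
    fix \<epsilon> :: real assume e: "0 < \<epsilon>" "\<epsilon> < b"
    then have e0: "\<epsilon> < \<epsilon>\<^sub>0" "\<epsilon> < c / (K + 1)" by (auto simp: b_def)
    let ?E = "\<lambda>x. ground_energy A (tangent_cone (\<Omega> \<epsilon>) x)"
    obtain v where v: "v \<in> vertices (\<Omega> \<epsilon>)" "tangent_cone (\<Omega> \<epsilon>) v = cone_of ((\<lambda>y. \<epsilon> *\<^sub>R y) ` \<omega>)"
      using fam e(1) e0(1) by blast
    have vc: "v \<in> closure (\<Omega> \<epsilon>)" using v(1) by (simp add: vertices_def)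
    have op: "open (\<Omega> \<epsilon>)" using fam e(1) e0(1) by (simp add: corner_domain_3D_def corner_domains_def)
    \<comment> \<open>This infimum also runs over vertices, for whose cones no estimate is at hand;
      \<open>ground_energy_ge\<close> supplies the lower bound without which \<open>INF\<close>
      carries no information.\<close>
    have "(INF x \<in> closure (\<Omega> \<epsilon>). ?E x) \<le> ?E v"
      by (rule cINF_lower[OF _ vc]) (auto intro!: bdd_belowI2 ground_energy_ge)
    also have "\<dots> \<le> K * \<epsilon>" using K(2)[OF e(1)] v(2) by simp
    also have "\<dots> < c"
    proof -
      have "(K + 1) * \<epsilon> < c" using e0(2) K(1) by (simp add: pos_less_divide_eq mult.commute)
      then show ?thesis using e(1) by (simp add: algebra_simps)
    qed
    also have "c \<le> (INF x \<in> closure (\<Omega> \<epsilon>) - vertices (\<Omega> \<epsilon>). ?E x)"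
    proof (rule cINF_greatest)
      \<comment> \<open>An interior point keeps the second infimum from being the unspecified one
        over the empty set.\<close>
      obtain y where y: "y \<in> \<Omega> \<epsilon>" using vc by (metis closure_empty empty_iff ex_in_conv)
      then have "tangent_cone (\<Omega> \<epsilon>) y = UNIV" using tangent_cone_interior[OF op] by blast
      then have "y \<in> closure (\<Omega> \<epsilon>) - vertices (\<Omega> \<epsilon>)" using y closure_subset by (auto simp: vertices_def)
      then show "closure (\<Omega> \<epsilon>) - vertices (\<Omega> \<epsilon>) \<noteq> {}" by blast
      show "c \<le> ?E x" if "x \<in> closure (\<Omega> \<epsilon>) - vertices (\<Omega> \<epsilon>)" for x
        unfolding c_def
      proof (rule ground_energy_lower_bound[OF assms(4-6) \<beta>(1,2)])
        show "tangent_cone (\<Omega> \<epsilon>) x = UNIV \<or> half_space (tangent_cone (\<Omega> \<epsilon>) x) \<or>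
          (\<exists>\<alpha>\<ge>\<beta>. wedge_of_opening \<alpha> (tangent_cone (\<Omega> \<epsilon>) x))"
        proof -
          have "\<beta> \<le> \<alpha>" if "wedge_of_opening \<alpha> (tangent_cone (\<Omega> \<epsilon>) x)" for \<alpha>
            using that \<open>x \<in> closure (\<Omega> \<epsilon>) - vertices (\<Omega> \<epsilon>)\<close> fam[OF e(1) e0(1)] \<beta>(3)
            unfolding is_edge_opening_def by (meson DiffD1 order_trans)
          then show ?thesis using that unfolding vertices_def by blast
        qed
      qed
    qed
    finally show "(INF x \<in> closure (\<Omega> \<epsilon>). ?E x) < (INF x \<in> closure (\<Omega> \<epsilon>) - vertices (\<Omega> \<epsilon>). ?E x)" .
  qed
qed

section \<open>Plane cones, wedges and cones over plane domains\<close>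

lemma isCont_closure:
  fixes f :: "'a::metric_space \<Rightarrow> 'b::metric_space"
  assumes "x \<in> closure C" "isCont f x" "\<And>y. y \<in> C \<Longrightarrow> f y \<in> D"
  shows "f x \<in> closure D"
proof -
  obtain s where s: "\<And>n. s n \<in> C" "s \<longlonglongrightarrow> x" using assms(1) closure_sequential by blast
  have "(\<lambda>n. f (s n)) \<longlonglongrightarrow> f x" using isCont_tendsto_compose[OF assms(2) s(2)] .
  moreover have "\<forall>n. f (s n) \<in> D" using s(1) assms(3) by blast
  ultimately show ?thesis unfolding closure_sequential by (intro exI[of _ "\<lambda>n. f (s n)"] conjI)
qed

lemma linear_isCont:
  fixes f :: "'a::euclidean_space \<Rightarrow> 'b::euclidean_space"
  shows "linear f \<Longrightarrow> isCont f x"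
  by (simp add: linear_continuous_at linear_conv_bounded_linear)

lemma open_linear_vimage:
  fixes f :: "'a::euclidean_space \<Rightarrow> 'b::euclidean_space"
  assumes "linear f" "open S" shows "open {x. f x \<in> S}"
proof -
  have "open (f -` S)"
    using assms by (intro open_vimage linear_continuous_on) (auto simp: linear_conv_bounded_linear)
  then show ?thesis by (simp add: vimage_def)
qed

text \<open>A cone in the plane whose boundary rays are locally graphs: each \<open>x\<close> on a boundary ray has a line through it
  that enters the cone on one side only.\<close>

definition flat_cone :: "(real^2) set \<Rightarrow> bool" where
  "flat_cone Q \<longleftrightarrow> open_cone Q \<and> (\<forall>x\<in>closure Q. x \<noteq> 0 \<longrightarrow> x \<notin> Q \<longrightarrow>
     (\<exists>v. (\<forall>c. v \<noteq> c *\<^sub>R x) \<and> (\<forall>z. x + z *\<^sub>R v \<in> Q \<longleftrightarrow> z > 0)))"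

text \<open>The case in which the affine slice of \<open>C\<close> already coincides with a cone
  near the origin, so that the identity is a chart of the slice.\<close>

lemma sphere_chart_inj:
  fixes \<Lambda> :: "'a::euclidean_space \<times> real \<Rightarrow> 'b::euclidean_space" and C :: "'b set"
  assumes "linear \<Lambda>" and inj: "\<And>z s. \<Lambda> (z, s) = 0 \<Longrightarrow> z = 0 \<and> s = 0" and "DIM('b) = DIM('a) + 1"
    and C: "open_cone C" and x: "x \<in> sphere 0 1" "\<Lambda> (0, 1) = x"
    and D: "r > 0" "\<And>z. norm z < r \<Longrightarrow> \<Lambda> (z, 1) \<in> C \<longleftrightarrow> z \<in> P" and P: "open_cone P"
  shows "is_tangent_cone_sphere (C \<inter> sphere 0 1) x P"
proof -
  have "inj \<Lambda>" unfolding linear_injective_0[OF assms(1)] using inj by (auto simp: zero_prod_def)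
  then obtain \<Lambda>' where L: "linear \<Lambda>'" "\<And>w. \<Lambda>' (\<Lambda> w) = w" "\<And>y. \<Lambda> (\<Lambda>' y) = y"
    using linear_injective_isomorphism[of \<Lambda>] assms(1,3) by auto
  have "cone_chart UNIV {z. \<Lambda> (z, 1) \<in> C} 0 P (\<lambda>x. x)" using D by (intro cone_chart_local_id[of r]) auto
  from sphere_chart[OF assms(1) L C x this] show ?thesis unfolding is_tangent_cone_sphere_def using P by blast
qed

lemma open_contains_origin:
  assumes "linear \<Lambda>" "open C" "\<Lambda> (0, 1) \<in> C"
  obtains r where "r > 0" "\<And>z::'a::euclidean_space. norm z < r \<Longrightarrow> (\<Lambda> (z, 1 :: real) :: 'b::euclidean_space) \<in> C"
proof -
  have "continuous_on UNIV (\<lambda>z::'a. \<Lambda> (z, 1))"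
    by (rule continuous_on_compose2[of UNIV \<Lambda>]) (use assms(1) in \<open>auto simp: linear_continuous_on linear_conv_bounded_linear intro!: continuous_intros\<close>)
  then have "open ((\<lambda>z. \<Lambda> (z, 1)) -` C)" using assms(2) by (rule open_vimage[rotated])
  moreover have "0 \<in> (\<lambda>z. \<Lambda> (z, 1)) -` C" using assms(3) by simp
  ultimately obtain r where "r > 0" "ball 0 r \<subseteq> (\<lambda>z. \<Lambda> (z, 1)) -` C" using open_contains_ball by blast
  then show thesis using that[of r] by (auto simp: subset_iff)
qed

lemma closure_of_sphere_cone:
  assumes "x \<in> top_of_set (sphere 0 1) closure_of (C \<inter> sphere 0 1)"
  shows "x \<in> sphere 0 1" "x \<in> closure C"
proof -
  have "x \<in> sphere 0 1 \<inter> closure (sphere 0 1 \<inter> (C \<inter> sphere 0 1))" using assms by (simp add: closure_of_subtopology)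
  then show "x \<in> sphere 0 1" "x \<in> closure C" using closure_mono[of "sphere 0 1 \<inter> (C \<inter> sphere 0 1)" C] by auto
qed

lemma cones_over_sphereI:
  fixes C :: "'b::euclidean_space set" and T :: "'a::euclidean_space set set"
  assumes "open_cone C" "\<And>x. x \<in> sphere 0 1 \<Longrightarrow> x \<in> closure C \<Longrightarrow> \<exists>P\<in>T. is_tangent_cone_sphere (C \<inter> sphere 0 1) x P"
  shows "C \<in> cones_over (corner_domains_sphere T)"
proof -
  have "openin (top_of_set (sphere 0 1)) (C \<inter> sphere 0 1)"
    using assms(1) openin_open_Int[of C "sphere 0 1"] by (simp add: open_cone_def Int_commute)
  then show ?thesis
    unfolding cones_over_def corner_domains_sphere_def using assms closure_of_sphere_cone by blast
qed

lemma half_line_tangent: "{z::real^1. z$1 > 0} \<in> tangent_cones_1" "(UNIV :: (real^1) set) \<in> tangent_cones_1"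
proof -
  have "open {z::real^1. z$1 > 0}" by (intro open_Collect_less continuous_intros)
  then show "{z::real^1. z$1 > 0} \<in> tangent_cones_1" "(UNIV :: (real^1) set) \<in> tangent_cones_1"
    unfolding tangent_cones_1_def cones_over_def by (simp_all add: open_cone_def)
qed

text \<open>The section of a plane cone is one-dimensional. On a boundary ray the line supplied by
  \<open>flat_cone\<close> is the affine slice and meets the cone in a half-line; on an interior ray
  any independent direction gives a full neighbourhood.\<close>

lemma flat_cone_tangent:
  assumes "flat_cone Q" shows "Q \<in> tangent_cones_2"
  unfolding tangent_cones_2_def
proof (rule cones_over_sphereI)
  show Q: "open_cone Q" using assms by (simp add: flat_cone_def)
  fix x assume x: "x \<in> sphere 0 1" "x \<in> closure Q"
  then have x0: "x \<noteq> 0" by auto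
  have chart: "is_tangent_cone_sphere (Q \<inter> sphere 0 1) x P"
    if v: "\<And>c. v \<noteq> c *\<^sub>R x" and P: "open_cone P" "r > 0" "\<And>z. norm z < r \<Longrightarrow> (z$1) *\<^sub>R v + x \<in> Q \<longleftrightarrow> z \<in> P" for v r and P :: "(real^1) set"
  proof (rule sphere_chart_inj[where \<Lambda> = "\<lambda>w. (fst w $ 1) *\<^sub>R v + snd w *\<^sub>R x" and r = r])
    show "linear (\<lambda>w::(real^1) \<times> real. (fst w $ 1) *\<^sub>R v + snd w *\<^sub>R x)"
      by (rule linearI) (auto simp: algebra_simps)
    show "z = 0 \<and> s = 0" if z: "(fst (z, s) $ 1) *\<^sub>R v + snd (z, s) *\<^sub>R x = 0" for z :: "real^1" and s
    proof -
      have "z$1 = 0"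
      proof (rule ccontr)
        assume "z$1 \<noteq> 0"
        have "(z$1) *\<^sub>R v = (- s) *\<^sub>R x" using z by (simp add: eq_neg_iff_add_eq_0)
        then have "(1 / z$1) *\<^sub>R (z$1) *\<^sub>R v = (1 / z$1) *\<^sub>R (- s) *\<^sub>R x" by simp
        then have "v = (1 / z$1 * (- s)) *\<^sub>R x" using \<open>z$1 \<noteq> 0\<close> by simp
        then show False using v by blast
      qed
      moreover have "s = 0" using z x0 calculation by auto
      ultimately show ?thesis by (simp add: vec_eq_iff forall_1)
    qed
  qed (use Q x P in auto)
  show "\<exists>P\<in>tangent_cones_1. is_tangent_cone_sphere (Q \<inter> sphere 0 1) x P"
  proof (cases "x \<in> Q")
    case True
    \<comment> \<open>A quarter turn of \<open>x\<close>, hence not a multiple of it.\<close>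
    define v :: "real^2" where "v = vector [- x$2, x$1]"
    have v: "v \<noteq> c *\<^sub>R x" for c
    proof
      assume "v = c *\<^sub>R x"
      then have 1: "- x$2 = c * x$1" "x$1 = c * x$2" by (auto simp: v_def vec_eq_iff forall_2)
      then have "x$1 * (1 + c * c) = 0" "x$2 * (1 + c * c) = 0" by (auto simp: algebra_simps) (metis add.commute add.right_inverse mult.assoc mult.commute mult_minus_right)+
      moreover have "1 + c * c > 0" by (simp add: add_pos_nonneg)
      ultimately have "x = 0" by (auto simp: vec_eq_iff forall_2)
      then show False using x0 by simp
    qed
    have "linear (\<lambda>w::(real^1) \<times> real. (fst w $ 1) *\<^sub>R v + snd w *\<^sub>R x)"
      by (rule linearI) (auto simp: algebra_simps)
    then obtain r where "r > 0" "\<And>z::real^1. norm z < r \<Longrightarrow> (fst (z, 1::real) $ 1) *\<^sub>R v + snd (z, 1::real) *\<^sub>R x \<in> Q"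
      by (rule open_contains_origin[of _ Q]) (use Q True in \<open>auto simp: open_cone_def\<close>)
    then have "is_tangent_cone_sphere (Q \<inter> sphere 0 1) x (UNIV :: (real^1) set)"
      by (intro chart[OF v, of _ r]) (auto simp: open_cone_def)
    then show ?thesis using half_line_tangent(2) by blast
  next
    case False
    then obtain v where v: "\<And>c. v \<noteq> c *\<^sub>R x" "\<And>z. x + z *\<^sub>R v \<in> Q \<longleftrightarrow> z > 0"
      using assms x x0 unfolding flat_cone_def by blast
    have "is_tangent_cone_sphere (Q \<inter> sphere 0 1) x {z::real^1. z$1 > 0}"
      by (rule chart[OF v(1), of _ 1]) (auto simp: add.commute[of _ x] v(2) open_cone_def intro!: open_Collect_less continuous_intros)
    then show ?thesis using half_line_tangent(1) by blast
  qed
qed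

lemma flat_cone_linear:
  assumes Q: "flat_cone Q" and L: "linear L" "linear L'" "\<And>x. L' (L x) = x" "\<And>x. L (L' x) = x"
  shows "flat_cone {x. L' x \<in> Q}"
proof -
  have oc: "open_cone Q" using Q by (simp add: flat_cone_def)
  have "open_cone {x. L' x \<in> Q}"
    using oc open_linear_vimage[OF L(2)] by (auto simp: open_cone_def linear_cmul[OF L(2)])
  moreover have "\<exists>v. (\<forall>c. v \<noteq> c *\<^sub>R x) \<and> (\<forall>z. x + z *\<^sub>R v \<in> {x. L' x \<in> Q} \<longleftrightarrow> z > 0)"
    if x: "x \<in> closure {x. L' x \<in> Q}" "x \<noteq> 0" "x \<notin> {x. L' x \<in> Q}" for x
  proof -
    have "L' x \<in> closure Q" by (rule isCont_closure[OF x(1) linear_isCont[OF L(2)]]) simp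
    moreover have "L' x \<noteq> 0" using x(2) L(4) linear_0[OF L(1)] by metis
    ultimately obtain v where v: "\<And>c. v \<noteq> c *\<^sub>R L' x" "\<And>z. L' x + z *\<^sub>R v \<in> Q \<longleftrightarrow> z > 0"
      using Q x(3) unfolding flat_cone_def by blast
    have "L v \<noteq> c *\<^sub>R x" for c using v(1)[of c] L(3)[of v] by (metis linear_cmul[OF L(2)])
    moreover have "L' (x + z *\<^sub>R L v) = L' x + z *\<^sub>R v" for z by (simp add: linear_add[OF L(2)] linear_cmul[OF L(2)] L(3))
    ultimately show ?thesis using v(2) by (intro exI[of _ "L v"]) auto
  qed
  ultimately show ?thesis unfolding flat_cone_def by blast
qed

text \<open>Up to linear maps these are the plane cones met at interior points, at smooth boundary
  points, and at convex and nonconvex corners of a polygonal domain.\<close>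

lemma flat_cone_models:
  "flat_cone UNIV" "flat_cone {z. z$1 > 0}" "flat_cone {z. z$1 > 0 \<and> z$2 > 0}" "flat_cone {z. z$1 > 0 \<or> z$2 > 0}"
proof -
  show "flat_cone UNIV" by (auto simp: flat_cone_def open_cone_def)
  have e1: "axis 1 1 \<noteq> c *\<^sub>R x" if "x$1 = 0" for c and x :: "real^2"
    using that by (auto simp: vec_eq_iff forall_2 axis_def)
  have e2: "axis 2 1 \<noteq> c *\<^sub>R x" if "x$2 = 0" for c and x :: "real^2"
    using that by (auto simp: vec_eq_iff forall_2 axis_def)
  have cl: "closure S \<subseteq> T" if "closed T" "S \<subseteq> T" for S T :: "(real^2) set" using that by (simp add: closure_minimal)
  show "flat_cone {z. z$1 > 0}"
    unfolding flat_cone_def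
  proof (intro conjI ballI impI)
    show "open_cone {z :: real^2. z$1 > 0}" by (auto simp: open_cone_def intro!: open_Collect_less continuous_intros)
    fix x :: "real^2" assume x: "x \<in> closure {z. z$1 > 0}" "x \<noteq> 0" "x \<notin> {z. z$1 > 0}"
    have "closure {z :: real^2. z$1 > 0} \<subseteq> {z. z$1 \<ge> 0}" by (intro cl closed_Collect_le continuous_intros) auto
    then have "x$1 = 0" using x by force
    then show "\<exists>v. (\<forall>c. v \<noteq> c *\<^sub>R x) \<and> (\<forall>z. x + z *\<^sub>R v \<in> {z. z$1 > 0} \<longleftrightarrow> z > 0)"
      using e1 by (intro exI[of _ "axis 1 1"]) (auto simp: axis_def)
  qed
  show "flat_cone {z. z$1 > 0 \<and> z$2 > 0}"
    unfolding flat_cone_def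
  proof (intro conjI ballI impI)
    show "open_cone {z :: real^2. z$1 > 0 \<and> z$2 > 0}"
      by (auto simp: open_cone_def intro!: open_Collect_conj open_Collect_less continuous_intros)
    fix x :: "real^2" assume x: "x \<in> closure {z. z$1 > 0 \<and> z$2 > 0}" "x \<noteq> 0" "x \<notin> {z. z$1 > 0 \<and> z$2 > 0}"
    have "closure {z :: real^2. z$1 > 0 \<and> z$2 > 0} \<subseteq> {z. z$1 \<ge> 0 \<and> z$2 \<ge> 0}"
      by (intro cl closed_Collect_conj closed_Collect_le continuous_intros) auto
    then have "x$1 \<ge> 0" "x$2 \<ge> 0" using x by auto
    then consider "x$1 = 0" "x$2 > 0" | "x$2 = 0" "x$1 > 0"
      using x(2,3) by (force simp: vec_eq_iff forall_2)
    then show "\<exists>v. (\<forall>c. v \<noteq> c *\<^sub>R x) \<and> (\<forall>z. x + z *\<^sub>R v \<in> {z. z$1 > 0 \<and> z$2 > 0} \<longleftrightarrow> z > 0)"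
    proof cases
      case 1
      then show ?thesis using e1 by (intro exI[of _ "axis 1 1"]) (auto simp: axis_def)
    next
      case 2
      then show ?thesis using e2 by (intro exI[of _ "axis 2 1"]) (auto simp: axis_def)
    qed
  qed
  show "flat_cone {z. z$1 > 0 \<or> z$2 > 0}"
    unfolding flat_cone_def
  proof (intro conjI ballI impI)
    show "open_cone {z :: real^2. z$1 > 0 \<or> z$2 > 0}"
      by (auto simp: open_cone_def intro!: open_Collect_disj open_Collect_less continuous_intros)
    fix x :: "real^2" assume x: "x \<in> closure {z. z$1 > 0 \<or> z$2 > 0}" "x \<noteq> 0" "x \<notin> {z. z$1 > 0 \<or> z$2 > 0}"
    have "closure {z :: real^2. z$1 > 0 \<or> z$2 > 0} \<subseteq> {z. z$1 \<ge> 0 \<or> z$2 \<ge> 0}"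
      by (intro cl closed_Collect_disj closed_Collect_le continuous_intros) auto
    then have "x$1 \<ge> 0 \<or> x$2 \<ge> 0" "x$1 \<le> 0" "x$2 \<le> 0" using x by auto
    then consider "x$1 = 0" "x$2 < 0" | "x$2 = 0" "x$1 < 0"
      using x(2) by (force simp: vec_eq_iff forall_2)
    then show "\<exists>v. (\<forall>c. v \<noteq> c *\<^sub>R x) \<and> (\<forall>z. x + z *\<^sub>R v \<in> {z. z$1 > 0 \<or> z$2 > 0} \<longleftrightarrow> z > 0)"
    proof cases
      case 1
      then show ?thesis using e1 by (intro exI[of _ "axis 1 1"]) (auto simp: axis_def)
    next
      case 2
      then show ?thesis using e2 by (intro exI[of _ "axis 2 1"]) (auto simp: axis_def)
    qed
  qed
qed

section \<open>Wedges and cones over plane sets\<close>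

definition proj :: "real^3 \<Rightarrow> real^2" where "proj x = vector [x$1, x$2]"

definition emb :: "real^2 \<Rightarrow> real \<Rightarrow> real^3" where "emb y t = vector [y$1, y$2, t]"

lemma proj_emb [simp]: "proj (emb y t) = y" "emb y t $ 3 = t" "emb (proj x) (x$3) = x"
  by (auto simp: proj_def emb_def vec_eq_iff forall_2 forall_3)

lemma linear_proj: "linear proj"
  by (rule linearI) (auto simp: proj_def vec_eq_iff forall_2)

lemma proj_simps [simp]: "proj (x + y) = proj x + proj y" "proj (x - y) = proj x - proj y" "proj (c *\<^sub>R x) = c *\<^sub>R proj x" "proj 0 = 0"
  using linear_proj by (auto simp: linear_add linear_diff linear_cmul linear_0)

lemma emb_simps:
  "emb (y + y') (t + t') = emb y t + emb y' t'" "emb (c *\<^sub>R y) (c * t) = c *\<^sub>R emb y t" "emb 0 0 = 0"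
  by (auto simp: emb_def vec_eq_iff forall_3)

lemma linear_emb: "linear (\<lambda>w. emb (fst w) (snd w))" "linear (\<lambda>y. emb y 0)"
  by (rule linearI; auto simp: emb_def vec_eq_iff forall_3)+

lemma emb_eq_0_iff [simp]: "emb y t = 0 \<longleftrightarrow> y = 0 \<and> t = 0"
  by (auto simp: emb_def vec_eq_iff forall_2 forall_3)

lemma norm_emb: "(norm (emb y t))\<^sup>2 = (norm y)\<^sup>2 + t\<^sup>2"
  by (simp add: emb_def norm_vec_def L2_set_def sum_2 sum_3)

lemma norm_proj_le: "norm (proj x) \<le> norm x" "\<bar>x$3\<bar> \<le> norm x"
proof -
  have "(norm x)\<^sup>2 = (norm (proj x))\<^sup>2 + (x$3)\<^sup>2" using norm_emb[of "proj x" "x$3"] by simp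
  then have "(norm (proj x))\<^sup>2 \<le> (norm x)\<^sup>2" by simp
  then show "norm (proj x) \<le> norm x" by (rule power2_le_imp_le) simp
  show "\<bar>x$3\<bar> \<le> norm x" by (rule component_le_norm_cart)
qed

lemma sphere_interior_tangent:
  assumes C: "open_cone C" and x: "x \<in> sphere 0 1" "x \<in> (C :: (real^3) set)"
  shows "\<exists>P\<in>tangent_cones_2. is_tangent_cone_sphere (C \<inter> sphere 0 1) x P"
proof -
  obtain h :: "real^3 \<Rightarrow> real^3" where h: "orthogonal_transformation h" "h (axis 3 1) = x"
    by (rule orthogonal_transformation_exists_1[of "axis 3 1" x]) (use x in auto)
  let ?\<Lambda> = "\<lambda>w::(real^2) \<times> real. h (emb (fst w) (snd w))"
  have lin: "linear ?\<Lambda>"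
    using linear_compose[OF linear_emb(1) orthogonal_transformation_linear[OF h(1)]] by (simp add: o_def)
  have e3: "emb 0 1 = axis 3 1" by (simp add: emb_def vec_eq_iff forall_3 axis_def)
  obtain r where r: "r > 0" "\<And>z::real^2. norm z < r \<Longrightarrow> ?\<Lambda> (z, 1) \<in> C"
    by (rule open_contains_origin[OF lin, of C]) (use C x h in \<open>auto simp: open_cone_def e3\<close>)
  have "is_tangent_cone_sphere (C \<inter> sphere 0 1) x (UNIV :: (real^2) set)"
  proof (rule sphere_chart_inj[OF lin, where r = r])
    show "z = 0 \<and> s = 0" if "?\<Lambda> (z, s) = 0" for z s
      using that h(1) by (metis emb_eq_0_iff fst_conv norm_eq_zero orthogonal_transformation_norm snd_conv)
    show "?\<Lambda> (z, 1) \<in> C \<longleftrightarrow> z \<in> UNIV" if "norm z < r" for z using r(2)[OF that] by simp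
    show "?\<Lambda> (0, 1) = x" by (simp add: e3 h)
  qed (use C x r(1) in \<open>auto simp: open_cone_def\<close>)
  then show ?thesis using flat_cone_tangent[OF flat_cone_models(1)] by blast
qed

text \<open>A cylinder over \<open>Q\<close> along the line spanned by \<open>emb b 1\<close>. The
  shear in the definition brings that line to the vertical.\<close>

definition wedge_over :: "real^2 \<Rightarrow> (real^2) set \<Rightarrow> (real^3) set" where
  "wedge_over b Q = {x. proj x - x$3 *\<^sub>R b \<in> Q}"

lemma linear_shear: "linear (\<lambda>x. proj x - x$3 *\<^sub>R b)"
  by (rule linearI) (auto simp: algebra_simps)

lemma open_cone_wedge_over:
  assumes "open_cone Q" shows "open_cone (wedge_over b Q)"
proof -
  have "open (wedge_over b Q)"
    unfolding wedge_over_def using assms by (intro open_linear_vimage linear_shear) (simp add: open_cone_def)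
  moreover have "\<rho> *\<^sub>R x \<in> wedge_over b Q" if "\<rho> > 0" "x \<in> wedge_over b Q" for \<rho> x
  proof -
    have "proj (\<rho> *\<^sub>R x) - (\<rho> *\<^sub>R x)$3 *\<^sub>R b = \<rho> *\<^sub>R (proj x - x$3 *\<^sub>R b)" by (simp add: algebra_simps)
    then show ?thesis using that assms unfolding wedge_over_def open_cone_def by (simp del: vector_scaleR_component proj_simps)
  qed
  ultimately show ?thesis by (simp add: open_cone_def)
qed

text \<open>The sheared projection \<open>w\<close> of \<open>x\<close> tells where \<open>x\<close>
  lies on the section: in the interior, on a face, or on the edge line when \<open>w\<close>
  vanishes. The local models are the plane, a half-plane and \<open>Q\<close> itself.\<close>

lemma wedge_over_tangent:
  assumes Q: "flat_cone Q" shows "wedge_over b Q \<in> tangent_cones_3"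
  unfolding tangent_cones_3_def
proof (rule cones_over_sphereI)
  let ?C = "wedge_over b Q" and ?L = "\<lambda>x. proj x - x$3 *\<^sub>R b"
  have Qc: "open_cone Q" using Q by (simp add: flat_cone_def)
  then show C: "open_cone ?C" by (rule open_cone_wedge_over)
  fix x assume x: "x \<in> sphere 0 1" "x \<in> closure ?C"
  then have x0: "x \<noteq> 0" by auto
  define w where "w = ?L x"
  have w: "w \<in> closure Q" unfolding w_def
    by (rule isCont_closure[OF x(2) linear_isCont[OF linear_shear]]) (simp add: wedge_over_def)
  consider "w \<in> Q" | "w \<notin> Q" "w \<noteq> 0" | "w = 0" by blast
  then show "\<exists>P\<in>tangent_cones_2. is_tangent_cone_sphere (?C \<inter> sphere 0 1) x P"
  proof cases
    case 1
    then show ?thesis using sphere_interior_tangent[OF C x(1)] by (simp add: w_def wedge_over_def)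
  next
    case 2
    then obtain v where v: "\<And>c. v \<noteq> c *\<^sub>R w" "\<And>z. w + z *\<^sub>R v \<in> Q \<longleftrightarrow> z > 0"
      using Q w unfolding flat_cone_def by blast
    \<comment> \<open>The slice is spanned by a direction transversal to the face and by the
      direction of the edge, along which the wedge is invariant; so only the first coordinate
      decides membership.\<close>
    let ?\<Lambda> = "\<lambda>u::(real^2) \<times> real. (fst u $ 1) *\<^sub>R emb v 0 + (fst u $ 2) *\<^sub>R emb b 1 + snd u *\<^sub>R x"
    have LL: "?L (?\<Lambda> u) = (fst u $ 1) *\<^sub>R v + snd u *\<^sub>R w" for u by (simp add: w_def algebra_simps)
    have "is_tangent_cone_sphere (?C \<inter> sphere 0 1) x {z::real^2. z$1 > 0}"
    proof (rule sphere_chart_inj[where \<Lambda> = ?\<Lambda> and r = 1])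
      show "linear ?\<Lambda>" by (rule linearI) (auto simp: algebra_simps)
      show "z = 0 \<and> s = 0" if z: "?\<Lambda> (z, s) = 0" for z s
      proof -
        have e: "(z$1) *\<^sub>R v + s *\<^sub>R w = 0" using LL[of "(z, s)"] unfolding z by simp
        have z1: "z$1 = 0"
        proof (rule ccontr)
          assume nz: "z$1 \<noteq> 0"
          have "(z$1) *\<^sub>R v = (- s) *\<^sub>R w" using e by (simp add: eq_neg_iff_add_eq_0)
          then have "(1 / z$1) *\<^sub>R (z$1) *\<^sub>R v = (1 / z$1) *\<^sub>R (- s) *\<^sub>R w" by simp
          then have "v = (1 / z$1 * (- s)) *\<^sub>R w" using nz by simp
          then show False using v(1) by blast
        qed
        then have s: "s = 0" using e 2 by simp
        have "(z$2) *\<^sub>R emb b 1 = 0" using z z1 s by simp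
        then have "z$2 = 0" by simp
        then show ?thesis using z1 s by (simp add: vec_eq_iff forall_2)
      qed
      show "?\<Lambda> (z, 1) \<in> ?C \<longleftrightarrow> z \<in> {z. z$1 > 0}" for z
        unfolding wedge_over_def mem_Collect_eq LL using v(2)[of "z$1"] by (simp add: add.commute)
    qed (use C x flat_cone_models(2) in \<open>auto simp: flat_cone_def\<close>)
    then show ?thesis using flat_cone_tangent[OF flat_cone_models(2)] by blast
  next
    case 3
    \<comment> \<open>On the edge line a horizontal slice through \<open>x\<close> is transversal
      and meets the wedge in a copy of \<open>Q\<close>.\<close>
    have xe: "x = (x$3) *\<^sub>R emb b 1"
    proof -
      have "proj x = x$3 *\<^sub>R b" using 3 by (simp add: w_def)
      then have "emb (proj x) (x$3) = emb (x$3 *\<^sub>R b) (x$3 * 1)" by simp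
      then show ?thesis by (simp only: proj_emb emb_simps)
    qed
    then have x3: "x$3 \<noteq> 0" using x0 by (metis scaleR_zero_left)
    let ?\<Lambda> = "\<lambda>u::(real^2) \<times> real. emb (fst u) 0 + snd u *\<^sub>R x"
    have LL: "?L (?\<Lambda> u) = fst u" for u using 3 by (simp add: w_def algebra_simps)
    have "is_tangent_cone_sphere (?C \<inter> sphere 0 1) x Q"
    proof (rule sphere_chart_inj[where \<Lambda> = ?\<Lambda> and r = 1])
      show "linear ?\<Lambda>" by (rule linearI) (auto simp: emb_def vec_eq_iff forall_3 algebra_simps)
      show "z = 0 \<and> s = 0" if z: "?\<Lambda> (z, s) = 0" for z s
      proof -
        have z0: "z = 0" using LL[of "(z, s)"] unfolding z by simp
        then have "s *\<^sub>R x = 0" using z emb_simps(3) by simp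
        then show ?thesis using z0 x0 by simp
      qed
      show "?\<Lambda> (z, 1) \<in> ?C \<longleftrightarrow> z \<in> Q" for z
        unfolding wedge_over_def mem_Collect_eq LL by simp
    qed (use C x Qc emb_simps(3) in auto)
    then show ?thesis using flat_cone_tangent[OF Q] by blast
  qed
qed

text \<open>The cone opens upwards for \<open>\<sigma> = 1\<close> and downwards for \<open>\<sigma> = - 1\<close>.\<close>

definition cone_over :: "real \<Rightarrow> (real^2) set \<Rightarrow> (real^3) set" where
  "cone_over \<sigma> \<omega> = {x. \<sigma> * x$3 > 0 \<and> (1 / (\<sigma> * x$3)) *\<^sub>R proj x \<in> \<omega>}"

lemma cone_of_eq: "cone_of \<omega> = cone_over 1 \<omega>"
proof -
  have "(1 / (1 * x$3)) *\<^sub>R proj x = vector [x$1 / x$3, x$2 / x$3]" for x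
    by (simp add: proj_def vec_eq_iff forall_2)
  then show ?thesis by (simp add: cone_of_def cone_over_def)
qed

lemma open_cone_cone_over:
  assumes "open \<omega>" "\<sigma> \<noteq> 0" shows "open_cone (cone_over \<sigma> \<omega>)"
proof -
  let ?S = "{x :: real^3. \<sigma> * x$3 > 0}"
  have S: "open ?S" by (intro open_Collect_less continuous_intros)
  have "continuous_on ?S (\<lambda>x. (1 / (\<sigma> * x$3)) *\<^sub>R proj x)"
    using linear_continuous_on[of proj ?S] linear_proj by (intro continuous_intros) (auto simp: linear_conv_bounded_linear)
  then have "open (?S \<inter> (\<lambda>x. (1 / (\<sigma> * x$3)) *\<^sub>R proj x) -` \<omega>)"
    using S assms(1) by (simp add: continuous_open_preimage)
  moreover have "cone_over \<sigma> \<omega> = ?S \<inter> (\<lambda>x. (1 / (\<sigma> * x$3)) *\<^sub>R proj x) -` \<omega>" by (auto simp: cone_over_def)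
  ultimately have "open (cone_over \<sigma> \<omega>)" by simp
  moreover have "\<rho> *\<^sub>R x \<in> cone_over \<sigma> \<omega>" if "\<rho> > 0" "x \<in> cone_over \<sigma> \<omega>" for \<rho> x
  proof -
    have 1: "(1 / (\<sigma> * (\<rho> *\<^sub>R x)$3)) *\<^sub>R proj (\<rho> *\<^sub>R x) = (1 / (\<sigma> * x$3)) *\<^sub>R proj x" using that(1) by simp
    have 2: "\<sigma> * (\<rho> *\<^sub>R x)$3 = \<rho> * (\<sigma> * x$3)" by simp
    show ?thesis unfolding cone_over_def mem_Collect_eq 1 unfolding 2 using that by (simp add: cone_over_def)
  qed
  ultimately show ?thesis by (simp add: open_cone_def)
qed

text \<open>A bounded base confines the cone to a closed circular one, so its closure meets height
  zero only at the apex; at all other points dividing by the height is continuous.\<close>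

lemma closure_cone_over:
  assumes R: "\<forall>y\<in>\<omega>. norm y \<le> R" and x: "x \<in> closure (cone_over \<sigma> \<omega>)"
  shows "\<sigma> * x$3 \<ge> 0" "norm (proj x) \<le> R * (\<sigma> * x$3)" "\<sigma> * x$3 > 0 \<Longrightarrow> (1 / (\<sigma> * x$3)) *\<^sub>R proj x \<in> closure \<omega>"
proof -
  let ?T = "{x :: real^3. 0 \<le> \<sigma> * x$3 \<and> norm (proj x) \<le> R * (\<sigma> * x$3)}"
  have "closed ?T"
    using linear_continuous_on[of proj UNIV] linear_proj
    by (intro closed_Collect_conj closed_Collect_le continuous_intros) (auto simp: linear_conv_bounded_linear)
  moreover have "cone_over \<sigma> \<omega> \<subseteq> ?T"
  proof
    fix x assume "x \<in> cone_over \<sigma> \<omega>"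
    then have p: "\<sigma> * x$3 > 0" "norm ((1 / (\<sigma> * x$3)) *\<^sub>R proj x) \<le> R" using R unfolding cone_over_def by blast+
    have "\<bar>1 / (\<sigma> * x$3)\<bar> = 1 / (\<sigma> * x$3)" using p(1) by (intro abs_of_pos) simp
    then have "norm (proj x) / (\<sigma> * x$3) \<le> R" using p(2) by (simp only: norm_scaleR) simp
    with p(1) show "x \<in> ?T" by (simp add: pos_divide_le_eq)
  qed
  ultimately have "x \<in> ?T" using x closure_minimal by blast
  then show "\<sigma> * x$3 \<ge> 0" "norm (proj x) \<le> R * (\<sigma> * x$3)" by auto
  assume "\<sigma> * x$3 > 0"
  then have "isCont (\<lambda>x. (1 / (\<sigma> * x$3)) *\<^sub>R proj x) x"
    using linear_isCont[OF linear_proj] by (intro continuous_intros) auto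
  from isCont_closure[OF x this] show "(1 / (\<sigma> * x$3)) *\<^sub>R proj x \<in> closure \<omega>" by (auto simp: cone_over_def)
qed

text \<open>The horizontal slice of the cone through \<open>x\<close> is a scaled and translated
  copy of \<omega>. Hence a chart of \<omega> at the corresponding point, composed with an affine
  map, is a chart of the section.\<close>

lemma cone_over_tangent:
  assumes "open \<omega>" "bounded \<omega>" "\<sigma> \<noteq> 0"
    and charts: "\<And>y. y \<in> closure \<omega> \<Longrightarrow> \<exists>Q U. flat_cone Q \<and> cone_chart UNIV \<omega> y Q U"
  shows "cone_over \<sigma> \<omega> \<in> tangent_cones_3"
  unfolding tangent_cones_3_def
proof (rule cones_over_sphereI)
  let ?C = "cone_over \<sigma> \<omega>"
  show C: "open_cone ?C" using assms(1,3) by (rule open_cone_cone_over)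
  obtain R where R: "\<forall>y\<in>\<omega>. norm y \<le> R" using assms(2) bounded_iff by blast
  fix x assume x: "x \<in> sphere 0 1" "x \<in> closure ?C"
  then have x0: "x \<noteq> 0" by auto
  note cl = closure_cone_over[OF R x(2)]
  have s: "\<sigma> * x$3 > 0"
  proof (rule ccontr)
    assume "\<not> ?thesis"
    then have "\<sigma> * x$3 = 0" using cl(1) by simp
    then have "x$3 = 0" "proj x = 0" using cl(2) assms(3) by auto
    then have "emb (proj x) (x$3) = 0" using emb_simps(3) by simp
    then show False using x0 by (simp only: proj_emb)
  qed
  define c where "c = 1 / (\<sigma> * x$3)"
  have c: "c > 0" "c * (\<sigma> * x$3) = 1" using s by (auto simp: c_def)
  obtain Q U where Q: "flat_cone Q" and U: "cone_chart UNIV \<omega> (c *\<^sub>R proj x) Q U"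
    using charts cl(3)[OF s] unfolding c_def by blast
  let ?\<Lambda> = "\<lambda>u::(real^2) \<times> real. emb (fst u) 0 + snd u *\<^sub>R x"
  have lin: "linear ?\<Lambda>" by (rule linearI) (auto simp: emb_def vec_eq_iff forall_3 algebra_simps)
  have inj: "inj ?\<Lambda>"
    unfolding linear_injective_0[OF lin]
  proof (intro allI impI)
    fix u :: "(real^2) \<times> real" assume u: "emb (fst u) 0 + snd u *\<^sub>R x = 0"
    have "(emb (fst u) 0 + snd u *\<^sub>R x) $ 3 = 0" unfolding u by simp
    then have "snd u = 0" using s by auto
    then show "u = 0" using u by (simp add: prod_eq_iff)
  qed
  then obtain \<Lambda>' where L: "linear \<Lambda>'" "\<And>w. \<Lambda>' (?\<Lambda> w) = w" "\<And>y. ?\<Lambda> (\<Lambda>' y) = y"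
    using linear_injective_isomorphism[OF lin inj] by auto
  have D: "z \<in> {z. ?\<Lambda> (z, 1) \<in> ?C} \<longleftrightarrow> c *\<^sub>R (z + proj x) \<in> \<omega>" for z
    using s by (simp add: cone_over_def c_def)
  have "cone_chart UNIV {z. ?\<Lambda> (z, 1) \<in> ?C} 0 Q (\<lambda>z. U (c *\<^sub>R (z + proj x)))"
  proof (rule cone_chart_transfer[where U = U and \<Phi> = "\<lambda>z. c *\<^sub>R (z + proj x)" and \<Psi> = "\<lambda>y. (1 / c) *\<^sub>R y - proj x" and W = UNIV and N = UNIV and D = \<omega>])
    show "diffeo_pair UNIV UNIV (\<lambda>z. c *\<^sub>R (z + proj x)) (\<lambda>y. (1 / c) *\<^sub>R y - proj x)"
      unfolding diffeo_pair_def using c(1)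
      by (auto intro!: smooth_map_onI[OF open_UNIV] smooth_on_scaleR smooth_on_add smooth_on_diff smooth_on_ident smooth_on_const)
  qed (use U D in auto)
  from sphere_chart[OF lin L C x(1) _ this]
  have "\<exists>U'. cone_chart (sphere 0 1) (?C \<inter> sphere 0 1) x Q U'" by (simp add: emb_simps(3))
  then have "is_tangent_cone_sphere (?C \<inter> sphere 0 1) x Q"
    unfolding is_tangent_cone_sphere_def using Q by (simp only: flat_cone_def simp_thms)
  then show "\<exists>P\<in>tangent_cones_2. is_tangent_cone_sphere (?C \<inter> sphere 0 1) x P"
    using flat_cone_tangent[OF Q] by (intro bexI)
qed

section \<open>Openings of wedges\<close>

lemma wedge_ball_image:
  assumes "orthogonal_transformation f" "y \<in> ball v r"
  shows "f y \<in> ball (f v) r"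
proof -
  have "dist (f v) (f y) = norm (f (v - y))"
    using linear_diff[OF orthogonal_transformation_linear[OF assms(1)]] by (simp add: dist_norm)
  also have "\<dots> = dist v y" using orthogonal_transformation_norm[OF assms(1)] by (simp add: dist_norm)
  finally show ?thesis using assms(2) by simp
qed

text \<open>For openings below a right angle, the centre of the ball has height at least
  \<open>r\<close> over the face at angle zero, since its foot there is outside the wedge. Being at
  distance at most 1 from the edge, its height is at most \<open>sin \<theta>\<close>, hence at most
  \<alpha>. Larger openings exceed 1.\<close>

lemma wedge_opening_ge:
  assumes W: "wedge_of_opening \<alpha> W" and b: "ball v r \<subseteq> W" "norm v \<le> 1" "0 < r" "r \<le> 1"
  shows "r \<le> \<alpha>"
proof -
  obtain f where f: "orthogonal_transformation f" "W = f ` model_wedge \<alpha>" and a: "0 < \<alpha>"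
    using W by (auto simp: wedge_of_opening_def)
  obtain v' where v': "f v' = v" using orthogonal_transformation_surj[OF f(1)] by (metis surjD)
  have inj: "inj f" using f(1) orthogonal_transformation_inj by blast
  have mod: "y \<in> model_wedge \<alpha>" if "y \<in> ball v' r" for y
    using wedge_ball_image[OF f(1) that] b(1) v' f(2) inj by (metis inj_image_mem_iff subsetD)
  have n: "norm v' \<le> 1" using b(2) v' f(1) by (metis orthogonal_transformation_norm)
  show ?thesis
  proof (cases "\<alpha> \<ge> pi / 2")
    case True
    then show ?thesis using b(4) pi_gt3 by linarith
  next
    case False
    have "v' \<in> model_wedge \<alpha>" using mod b(3) by simp
    then obtain \<rho> \<theta> where p: "\<rho> > 0" "0 < \<theta>" "\<theta> < \<alpha>" "v'$1 = \<rho> * cos \<theta>" "v'$2 = \<rho> * sin \<theta>"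
      by (auto simp: model_wedge_def)
    have "v'$2 \<ge> r"
    proof (rule ccontr)
      assume "\<not> v'$2 \<ge> r"
      have p2: "v'$2 \<ge> 0" using p False pi_gt_zero by (simp add: sin_ge_zero)
      define y where "y = v' - (v'$2) *\<^sub>R axis 2 1"
      have "dist v' y = \<bar>v'$2\<bar>" by (simp add: y_def dist_norm)
      then have "y \<in> model_wedge \<alpha>" using mod[of y] p2 \<open>\<not> v'$2 \<ge> r\<close> by simp
      then obtain s \<phi> where q: "s > 0" "0 < \<phi>" "\<phi> < \<alpha>" "y$2 = s * sin \<phi>" by (auto simp: model_wedge_def)
      have "sin \<phi> > 0" using q False pi_gt_zero by (intro sin_gt_zero) auto
      then show False using q by (simp add: y_def axis_def)
    qed
    also have "v'$2 \<le> sin \<theta>"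
    proof -
      have "\<rho>\<^sup>2 = (v'$1)\<^sup>2 + (v'$2)\<^sup>2" by (simp add: p power_mult_distrib flip: distrib_left)
      also have "\<dots> \<le> (norm v')\<^sup>2" by (simp add: norm_vec_def L2_set_def sum_3)
      finally have "\<rho> \<le> 1" using n by (meson norm_ge_zero order_trans power2_le_imp_le)
      moreover have "sin \<theta> \<ge> 0" using p False pi_gt_zero by (simp add: sin_ge_zero)
      ultimately show ?thesis using p by (simp add: mult_left_le_one_le)
    qed
    also have "\<dots> \<le> \<theta>" using p by (simp add: sin_x_le_x)
    finally show ?thesis using p by simp
  qed
qed

text \<open>A wedge of opening beyond \<open>3 / 2 * pi\<close> contains the half-space above its
  first face, so the ball lies below it and the centre at depth at least \<open>r\<close>. Its angle
  is at least \<alpha>, and the depth is at most the remaining angle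
  \<open>2 * pi - \<theta>\<close>.\<close>

lemma wedge_opening_le:
  assumes W: "wedge_of_opening \<alpha> W" and b: "ball v r \<subseteq> - W" "norm v \<le> 1" "0 < r" "r \<le> 1"
  shows "\<alpha> \<le> 2 * pi - r"
proof -
  obtain f where f: "orthogonal_transformation f" "W = f ` model_wedge \<alpha>" and a: "0 < \<alpha>" "\<alpha> < 2 * pi"
    using W by (auto simp: wedge_of_opening_def)
  obtain v' where v': "f v' = v" using orthogonal_transformation_surj[OF f(1)] by (metis surjD)
  have mod: "y \<notin> model_wedge \<alpha>" if "y \<in> ball v' r" for y
    using wedge_ball_image[OF f(1) that] b(1) v' f(2) by auto
  have n: "norm v' \<le> 1" using b(2) v' f(1) by (metis orthogonal_transformation_norm)
  show ?thesis
  proof (cases "\<alpha> \<le> 3 / 2 * pi")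
    case True
    then show ?thesis using b(4) pi_gt3 by linarith
  next
    case False
    have neg: "y$2 \<le> 0" if "y \<in> ball v' r" for y
    proof (rule ccontr)
      assume y: "\<not> y$2 \<le> 0"
      then have "y \<in> model_wedge pi" by (subst model_wedge_convex) auto
      then have "y \<in> model_wedge \<alpha>" using False pi_gt_zero unfolding model_wedge_def by force
      then show False using mod[OF that] by blast
    qed
    have r: "v'$2 \<le> - r"
    proof (rule ccontr)
      assume c: "\<not> v'$2 \<le> - r"
      have "v'$2 \<le> 0" using neg b(3) by simp
      \<comment> \<open>The midpoint between the depth \<open>- v'$2\<close> and \<open>r\<close>:
        far enough to cross the face, too short to leave the ball.\<close>
      define t where "t = (r - v'$2) / 2"
      have t: "0 \<le> t" "t < r" "v'$2 + t > 0" using c b(3) \<open>v'$2 \<le> 0\<close> by (auto simp: t_def field_simps)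
      define y where "y = v' + t *\<^sub>R axis 2 1"
      have "y \<in> ball v' r" using t by (simp add: y_def dist_norm)
      then show False using neg[of y] t by (simp add: y_def axis_def)
    qed
    then have "(v'$1, v'$2) \<noteq> (0, 0)" using b(3) by auto
    then obtain \<rho> \<theta> where p: "\<rho> > 0" "0 \<le> \<theta>" "\<theta> < 2 * pi" "v'$1 = \<rho> * cos \<theta>" "v'$2 = \<rho> * sin \<theta>"
      by (rule polar_coordinates)
    have "\<theta> \<ge> \<alpha>"
    proof (rule ccontr)
      assume "\<not> \<theta> \<ge> \<alpha>"
      moreover have "\<theta> \<noteq> 0" using p(5) r b(3) by auto
      ultimately have "v' \<in> model_wedge \<alpha>"
        unfolding model_wedge_def using p by (intro CollectI exI[of _ \<rho>] conjI exI[of _ \<theta>]) auto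
      then show False using mod b(3) by simp
    qed
    have "r \<le> \<rho> * sin (2 * pi - \<theta>)" using r p(5) by simp
    also have "\<dots> \<le> 2 * pi - \<theta>"
    proof -
      have "\<rho>\<^sup>2 = (v'$1)\<^sup>2 + (v'$2)\<^sup>2" by (simp add: p power_mult_distrib flip: distrib_left)
      also have "\<dots> \<le> (norm v')\<^sup>2" by (simp add: norm_vec_def L2_set_def sum_3)
      finally have "\<rho> \<le> 1" using n by (meson norm_ge_zero order_trans power2_le_imp_le)
      moreover have "sin (2 * pi - \<theta>) \<le> 2 * pi - \<theta>" using p by (intro sin_x_le_x) auto
      moreover have "0 \<le> 2 * pi - \<theta>" using p by simp
      ultimately show ?thesis
        using p(1) mult_left_mono[of "sin (2 * pi - \<theta>)" "2 * pi - \<theta>" \<rho>] mult_left_le_one_le[of "2 * pi - \<theta>" \<rho>] by linarith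
    qed
    finally show ?thesis using \<open>\<theta> \<ge> \<alpha>\<close> by simp
  qed
qed

text \<open>The whole space, half-spaces and wedges each contain a full line, parallel to the edge
  for a wedge. This certifies vertices without classifying all tangent cones.\<close>

lemma not_wedge_of_no_line:
  assumes "\<And>p d. d \<noteq> 0 \<Longrightarrow> \<exists>s. p + s *\<^sub>R d \<notin> C"
  shows "C \<noteq> UNIV" "\<not> half_space C" "\<not> wedge_of_opening \<alpha> C"
proof -
  show "C \<noteq> UNIV" using assms[of "axis 1 1"] by (metis UNIV_I axis_eq_0_iff zero_neq_one)
  have w: "C \<noteq> f ` model_wedge \<alpha>" if f: "orthogonal_transformation f" "0 < \<alpha>" for f \<alpha>
  proof
    assume C: "C = f ` model_wedge \<alpha>"
    define p :: "real^3" where "p = vector [1 * cos (\<alpha> / 2), 1 * sin (\<alpha> / 2), 0]"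
    have "f (axis 3 1) \<noteq> 0" using f(1) by (metis axis_eq_0_iff norm_eq_zero orthogonal_transformation_norm zero_neq_one)
    then obtain s where s: "f p + s *\<^sub>R f (axis 3 1) \<notin> C" using assms by blast
    have lin: "linear f" using f(1) orthogonal_transformation_linear by blast
    have "f p + s *\<^sub>R f (axis 3 1) = f (p + s *\<^sub>R axis 3 1)" by (simp add: linear_add[OF lin] linear_cmul[OF lin])
    moreover have "p + s *\<^sub>R axis 3 1 \<in> model_wedge \<alpha>"
      unfolding model_wedge_def mem_Collect_eq using f(2)
      by (intro exI[of _ 1] conjI exI[of _ "\<alpha> / 2"]) (auto simp: p_def axis_def)
    ultimately show False using s C by auto
  qed
  show "\<not> wedge_of_opening \<alpha> C" using w unfolding wedge_of_opening_def by blast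
  show "\<not> half_space C"
  proof
    assume "half_space C"
    then obtain h where "orthogonal_transformation h" "C = h ` model_wedge pi" by (rule half_space_wedge)
    then show False using w pi_gt_zero by blast
  qed
qed

text \<open>A line in the cone never reaches height zero, so it is horizontal; but horizontal slices
  are bounded with the base.\<close>

lemma cone_over_no_line:
  assumes "bounded \<omega>" "\<sigma> \<noteq> 0" "d \<noteq> 0"
  shows "\<exists>s. p + s *\<^sub>R d \<notin> cone_over \<sigma> \<omega>"
proof (rule ccontr)
  assume "\<not> ?thesis"
  then have all: "p + s *\<^sub>R d \<in> cone_over \<sigma> \<omega>" for s by blast
  obtain R where R: "\<forall>y\<in>\<omega>. norm y \<le> R" using assms(1) bounded_iff by blast
  have in': "\<sigma> * (p$3 + s * d$3) > 0" "norm (proj p + s *\<^sub>R proj d) \<le> R * (\<sigma> * (p$3 + s * d$3))" for s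
  proof -
    have a: "p + s *\<^sub>R d \<in> closure (cone_over \<sigma> \<omega>)" using all closure_subset by blast
    show "\<sigma> * (p$3 + s * d$3) > 0" using all[of s] by (simp add: cone_over_def)
    show "norm (proj p + s *\<^sub>R proj d) \<le> R * (\<sigma> * (p$3 + s * d$3))" using closure_cone_over(2)[OF R a] by simp
  qed
  have d3: "d$3 = 0"
  proof (rule ccontr)
    assume "d$3 \<noteq> 0"
    then have "p$3 + (- p$3 / d$3) * d$3 = 0" by simp
    then show False using in'(1)[of "- p$3 / d$3"] by simp
  qed
  have pd: "proj d \<noteq> 0"
  proof
    assume "proj d = 0"
    then have "emb (proj d) (d$3) = 0" using d3 emb_simps(3) by simp
    then show False using assms(3) by (simp only: proj_emb)
  qed
  define M where "M = R * (\<sigma> * p$3)"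
  define s where "s = (\<bar>M\<bar> + norm (proj p) + 1) / norm (proj d)"
  have "s > 0" using pd by (simp add: s_def add_nonneg_pos)
  have "norm (s *\<^sub>R proj d) \<le> norm (proj p + s *\<^sub>R proj d) + norm (proj p)"
    by (metis add_diff_cancel_left' norm_triangle_ineq4)
  then have "s * norm (proj d) \<le> M + norm (proj p)" using in'(2)[of s] d3 \<open>s > 0\<close> by (simp add: M_def)
  then show False using pd by (simp add: s_def)
qed

section \<open>Two curves crossing transversally\<close>

definition det2 :: "real^2 \<Rightarrow> real^2 \<Rightarrow> real" where "det2 a b = a$1 * b$2 - a$2 * b$1"

lemma det2_collinear:
  assumes "\<not> collinear {0, a, b}" shows "det2 a b \<noteq> 0"
proof
  assume d: "det2 a b = 0"
  have "a \<noteq> 0" using assms by (auto simp: collinear_lemma)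
  then have n: "(a$1)\<^sup>2 + (a$2)\<^sup>2 \<noteq> 0" by (auto simp: vec_eq_iff forall_2 sum_power2_eq_zero_iff)
  define c where "c = (a$1 * b$1 + a$2 * b$2) / ((a$1)\<^sup>2 + (a$2)\<^sup>2)"
  have e: "a$1 * b$2 = a$2 * b$1" using d by (simp add: det2_def)
  have "b$1 * ((a$1)\<^sup>2 + (a$2)\<^sup>2) = (a$1 * b$1 + a$2 * b$2) * a$1"
    using e by algebra
  moreover have "b$2 * ((a$1)\<^sup>2 + (a$2)\<^sup>2) = (a$1 * b$1 + a$2 * b$2) * a$2"
    using e by algebra
  ultimately have "b = c *\<^sub>R a" using n by (simp add: c_def vec_eq_iff forall_2 field_simps)
  then show False using assms by (auto simp: collinear_lemma)
qed

lemma cramer2: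
  assumes "det2 a b \<noteq> 0"
  shows "s *\<^sub>R a + t *\<^sub>R b = v \<longleftrightarrow> s = det2 v b / det2 a b \<and> t = det2 a v / det2 a b"
proof
  assume v: "s *\<^sub>R a + t *\<^sub>R b = v"
  have "det2 v b = s * det2 a b" "det2 a v = t * det2 a b"
    unfolding v[symmetric] by (simp_all add: det2_def algebra_simps)
  then show "s = det2 v b / det2 a b \<and> t = det2 a v / det2 a b" using assms by simp
next
  assume st: "s = det2 v b / det2 a b \<and> t = det2 a v / det2 a b"
  have "det2 v b * a$1 + det2 a v * b$1 = v$1 * det2 a b" "det2 v b * a$2 + det2 a v * b$2 = v$2 * det2 a b"
    by (simp_all add: det2_def algebra_simps)
  then have "(det2 v b * a$1 + det2 a v * b$1) / det2 a b = v$1" "(det2 v b * a$2 + det2 a v * b$2) / det2 a b = v$2"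
    using assms by simp_all
  then show "s *\<^sub>R a + t *\<^sub>R b = v" using st by (simp add: vec_eq_iff forall_2 add_divide_distrib)
qed

text \<open>Bootstrap: the derivative of \<open>g\<close> is a smooth function of \<open>g\<close>
  itself, so each order of regularity of \<open>g\<close> gives the next.\<close>

lemma smooth_inverse:
  fixes g :: "'a::euclidean_space \<Rightarrow> 'b::euclidean_space"
  assumes "open V" "\<And>y. y \<in> V \<Longrightarrow> (g has_derivative (\<lambda>v. E v (g y))) (at y)" "g ` V \<subseteq> W" "\<And>v. smooth_on W (E v)"
  shows "smooth_on V g"
  unfolding smooth_on_def
proof
  fix k show "Ck_on k g V"
  proof (induction k)
    case 0
    show ?case using assms(2) by (auto intro!: continuous_at_imp_continuous_on has_derivative_continuous)
  next
    case (Suc k)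
    show ?case
      by (rule Ck_on_SucI[OF assms(1,2)]) (use Ck_on_compose[OF assms(1) Suc smooth_on_Ck[OF assms(4)] assms(3)] in auto)
  qed
qed

text \<open>Adding the two curves sends the coordinate axes onto them, and the differential at the
  origin is invertible as the tangents are independent. The inverse function theorem thus
  straightens both curves at once, and Cramer's rule makes the derivative of the inverse explicit
  enough for \<open>smooth_inverse\<close>.\<close>

lemma two_curve_chart:
  fixes c1 c2 :: "real \<Rightarrow> real^2"
  defines "d1 \<equiv> \<lambda>t. vector_derivative c1 (at t)" and "d2 \<equiv> \<lambda>t. vector_derivative c2 (at t)"
  defines "\<Phi> \<equiv> \<lambda>z :: real^2. c1 (z$1) + c2 (z$2) - c1 0"
  assumes T: "open T" "0 \<in> T" and sm: "smooth_on T c1" "smooth_on T c2" and c0: "c2 0 = c1 0"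
    and nz: "det2 (d1 0) (d2 0) \<noteq> 0"
  obtains \<eta> N U where "\<eta> > 0" "{-\<eta><..<\<eta>} \<subseteq> T" "open N" "c1 0 \<in> N"
    "diffeo_pair N {z. \<bar>z$1\<bar> < \<eta> \<and> \<bar>z$2\<bar> < \<eta>} U \<Phi>"
    "(\<Phi> has_derivative (\<lambda>h. (h$1) *\<^sub>R d1 0 + (h$2) *\<^sub>R d2 0)) (at 0)"
proof -
  define W where "W = {z :: real^2. z$1 \<in> T \<and> z$2 \<in> T}"
  have W: "open W"
    unfolding W_def
    by (intro open_Collect_conj open_linear_vimage bounded_linear.linear[OF bounded_linear_vec_nth] T)
  define D where "D z h = (h$1) *\<^sub>R d1 (z$1) + (h$2) *\<^sub>R d2 (z$2)" for z h :: "real^2"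
  have lin: "linear (D z)" for z by (rule linearI) (auto simp: D_def algebra_simps)
  have vd: "(c1 has_derivative (\<lambda>h. h *\<^sub>R d1 t)) (at t)" "(c2 has_derivative (\<lambda>h. h *\<^sub>R d2 t)) (at t)" if "t \<in> T" for t
    unfolding d1_def d2_def
    using smooth_on_differentiable[OF sm(1) that] smooth_on_differentiable[OF sm(2) that]
    by (simp_all only: vector_derivative_works has_vector_derivative_def)
  have der: "(\<Phi> has_derivative D z) (at z)" if z: "z \<in> W" for z
  proof -
    have n: "((\<lambda>z::real^2. z$i) has_derivative (\<lambda>h. h$i)) (at z)" for i
      by (rule bounded_linear_imp_has_derivative[OF bounded_linear_vec_nth])
    have zT: "z$1 \<in> T" "z$2 \<in> T" using z by (auto simp: W_def)
    have "(\<Phi> has_derivative (\<lambda>h. (h$1) *\<^sub>R d1 (z$1) + (h$2) *\<^sub>R d2 (z$2) - 0)) (at z)"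
      unfolding \<Phi>_def
      by (intro has_derivative_diff has_derivative_add has_derivative_const
          diff_chain_at[OF n vd(1)[OF zT(1)], unfolded o_def] diff_chain_at[OF n vd(2)[OF zT(2)], unfolded o_def])
    then show ?thesis by (simp add: D_def[abs_def])
  qed
  have ds: "smooth_on T d1" "smooth_on T d2" unfolding d1_def d2_def by (intro smooth_on_vector_derivative T sm)+
  have nth: "smooth_on W (\<lambda>z. z$i)" for i :: 2
    using W smooth_on_linear[of W "\<lambda>z::real^2. z$i"] bounded_linear_vec_nth bounded_linear.linear by blast
  have dW: "smooth_on W (\<lambda>z. d1 (z$1))" "smooth_on W (\<lambda>z. d2 (z$2))"
    by (rule smooth_on_compose[OF W nth ds(1)], force simp: W_def) (rule smooth_on_compose[OF W nth ds(2)], force simp: W_def)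
  define \<Delta> where "\<Delta> z = det2 (d1 (z$1)) (d2 (z$2))" for z :: "real^2"
  have det_s: "smooth_on W (\<lambda>z. det2 (p z) (q z))" if "smooth_on W p" "smooth_on W q" for p q
    using that unfolding det2_def smooth_on_vec[OF W, of p] smooth_on_vec[OF W, of q]
    by (intro smooth_on_diff smooth_on_mult W) auto
  have \<Delta>s: "smooth_on W \<Delta>" unfolding \<Delta>_def by (rule det_s[OF dW])
  define W' where "W' = W \<inter> \<Delta> -` (- {0})"
  have W': "open W'" unfolding W'_def
    using smooth_on_continuous[OF \<Delta>s] W by (intro continuous_open_preimage) auto
  define E where "E v z = (vector [det2 v (d2 (z$2)) / \<Delta> z, det2 (d1 (z$1)) v / \<Delta> z] :: real^2)" for v z
  have Es: "smooth_on W' (E v)" for v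
  proof -
    have s: "smooth_on W' (\<lambda>z. det2 v (d2 (z$2)))" "smooth_on W' (\<lambda>z. det2 (d1 (z$1)) v)" "smooth_on W' \<Delta>"
      by (rule smooth_on_subset[OF det_s[OF smooth_on_const[OF W] dW(2)]] smooth_on_subset[OF det_s[OF dW(1) smooth_on_const[OF W]]]
          smooth_on_subset[OF \<Delta>s], simp add: W'_def)+
    show ?thesis
      unfolding smooth_on_vec[OF W'] E_def
      by (auto simp: forall_2 intro!: smooth_on_divide[OF W'] s) (auto simp: W'_def)
  qed
  have DE: "D z h = v \<longleftrightarrow> h = E v z" if "z \<in> W'" for z h v
    using cramer2[of "d1 (z$1)" "d2 (z$2)" "h$1" "h$2" v] that
    by (auto simp: D_def E_def \<Delta>_def W'_def vec_eq_iff forall_2)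
  have 0: "0 \<in> W'" using T nz by (simp add: W'_def W_def \<Delta>_def)
  have bl: "bounded_linear (D z)" for z using lin by (simp add: linear_conv_bounded_linear)
  have blE: "bounded_linear (\<lambda>v. E v z)" for z
    unfolding linear_conv_bounded_linear[symmetric]
    by (rule linearI) (auto simp: E_def det2_def vec_eq_iff forall_2 add_divide_distrib diff_divide_distrib algebra_simps)
  have 1: "(\<Phi> has_derivative blinfun_apply (Blinfun (D z))) (at z)" if "z \<in> W'" for z
    using der that bl by (simp add: W'_def bounded_linear_Blinfun_apply)
  have 2: "continuous_on W' (\<lambda>z. Blinfun (D z))"
  proof (rule continuous_on_blinfun_componentwise)
    fix i :: "real^2"
    have "continuous_on W' (\<lambda>z. D z i)"
      unfolding D_def using smooth_on_continuous[OF dW(1)] smooth_on_continuous[OF dW(2)]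
      by (intro continuous_intros) (auto simp: W'_def intro: continuous_on_subset)
    then show "continuous_on W' (\<lambda>z. blinfun_apply (Blinfun (D z)) i)" by (simp add: bl bounded_linear_Blinfun_apply)
  qed
  have 3: "Blinfun (\<lambda>v. E v 0) o\<^sub>L Blinfun (D 0) = id_blinfun"
  proof (rule blinfun_eqI)
    fix i show "blinfun_apply (Blinfun (\<lambda>v. E v 0) o\<^sub>L Blinfun (D 0)) i = blinfun_apply id_blinfun i"
      using DE[OF 0, of i "D 0 i"] by (simp add: bl blE bounded_linear_Blinfun_apply)
  qed
  obtain U' V g g' where IFT: "open U'" "U' \<subseteq> W'" "0 \<in> U'" "open V" "\<Phi> 0 \<in> V" "homeomorphism U' V \<Phi> g"
      "\<And>y. y \<in> V \<Longrightarrow> (g has_derivative (g' y)) (at y)"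
      "\<And>y. y \<in> V \<Longrightarrow> g' y = inv (blinfun_apply (Blinfun (D (g y))))"
    proof (rule inverse_function_theorem[OF W' 1 2 0 3])
    fix U' V g g'
    assume "open U'" "U' \<subseteq> W'" "0 \<in> U'" "open V" "\<Phi> 0 \<in> V" "homeomorphism U' V \<Phi> g"
      "\<And>y. y \<in> V \<Longrightarrow> (g has_derivative (g' y)) (at y)"
      "\<And>y. y \<in> V \<Longrightarrow> g' y = inv (blinfun_apply (Blinfun (D (g y))))"
    then show thesis by (rule that)
  qed
  have hom: "\<And>z. z \<in> U' \<Longrightarrow> g (\<Phi> z) = z \<and> \<Phi> z \<in> V" "\<And>y. y \<in> V \<Longrightarrow> \<Phi> (g y) = y \<and> g y \<in> U'"
    using IFT(6) unfolding homeomorphism_def by blast+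
  have gd: "(g has_derivative (\<lambda>v. E v (g y))) (at y)" if "y \<in> V" for y
  proof -
    have gW: "g y \<in> W'" using hom(2)[OF that] IFT(2) by blast
    have "g' y = inv (D (g y))" using IFT(8)[OF that] by (simp add: bl bounded_linear_Blinfun_apply)
    moreover have "inv (D (g y)) v = E v (g y)" for v
    proof (rule inv_f_eq)
      show "inj (D (g y))" using DE[OF gW] by (metis injI)
      show "D (g y) (E v (g y)) = v" using DE[OF gW] by simp
    qed
    ultimately have "g' y = (\<lambda>v. E v (g y))" by auto
    then show ?thesis using IFT(7)[OF that] by simp
  qed
  have gs: "smooth_on V g"
    by (rule smooth_inverse[OF IFT(4) gd _ Es]) (use hom IFT(2) in auto)
  have Ps: "smooth_on W \<Phi>"
  proof -
    have "smooth_on W (\<lambda>z. c1 (z$1))" "smooth_on W (\<lambda>z. c2 (z$2))"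
      by (rule smooth_on_compose[OF W nth sm(1)], force simp: W_def) (rule smooth_on_compose[OF W nth sm(2)], force simp: W_def)
    then show ?thesis unfolding \<Phi>_def by (intro smooth_on_diff smooth_on_add smooth_on_const W)
  qed
  obtain r where r: "r > 0" "ball 0 r \<subseteq> U'" using IFT(1,3) open_contains_ball by blast
  obtain r2 where r2: "r2 > 0" "ball 0 r2 \<subseteq> T" using T open_contains_ball by blast
  \<comment> \<open>Halving \<open>r\<close> puts the square of half-width \<eta> inside the ball,
    by the sum norm; \<open>r2\<close> keeps the parameters within the domain of the curves.\<close>
  define \<eta> where "\<eta> = min (r / 2) r2"
  have \<eta>: "\<eta> > 0" using r r2 by (simp add: \<eta>_def)
  define Q where "Q = {z :: real^2. \<bar>z$1\<bar> < \<eta> \<and> \<bar>z$2\<bar> < \<eta>}"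
  have QU: "Q \<subseteq> U'"
  proof
    fix z assume "z \<in> Q"
    moreover have "norm z \<le> \<bar>z$1\<bar> + \<bar>z$2\<bar>" using norm_le_l1_cart[of z] by (simp add: sum_2)
    ultimately have "norm z < r" using r by (auto simp: Q_def \<eta>_def)
    then show "z \<in> U'" using r(2) by auto
  qed
  have oQ: "open Q" unfolding Q_def by (intro open_Collect_conj open_Collect_less continuous_intros)
  have QN: "diffeo_pair Q (\<Phi> ` Q) \<Phi> g"
  proof (rule diffeo_pair_restrict[OF _ QU])
    show "diffeo_pair U' V \<Phi> g"
      unfolding diffeo_pair_def
      using hom smooth_map_onI[OF IFT(4) gs order_refl] smooth_map_onI[OF W Ps, of U'] IFT(2)
      by (auto simp: W'_def)
  qed
  have "open (\<Phi> ` Q)"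
  proof -
    have "\<Phi> ` Q = V \<inter> g -` Q" using hom QU by force
    then show ?thesis using smooth_on_continuous[OF gs] IFT(4) oQ by (simp add: continuous_open_preimage)
  qed
  moreover have "diffeo_pair (\<Phi> ` Q) Q g \<Phi>" using QN unfolding diffeo_pair_def by blast
  moreover have "c1 0 \<in> \<Phi> ` Q" using \<eta> c0 by (intro image_eqI[of _ _ 0]) (auto simp: \<Phi>_def Q_def)
  moreover have "{-\<eta><..<\<eta>} \<subseteq> T" using r2 by (auto simp: \<eta>_def dist_real_def subset_iff)
  moreover have "(\<Phi> has_derivative (\<lambda>h. (h$1) *\<^sub>R d1 0 + (h$2) *\<^sub>R d2 0)) (at 0)"
    using der[of 0] 0 by (simp add: W'_def D_def[abs_def])
  ultimately show thesis using that[of \<eta> "\<Phi> ` Q" g] \<eta> unfolding Q_def by blast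
qed

section \<open>Both sides of the boundary of a polygonal domain\<close>

lemma even_card_involution:
  assumes "finite A" "\<And>x. x \<in> A \<Longrightarrow> m x \<in> A \<and> m (m x) = x \<and> m x \<noteq> x"
  shows "even (card A)"
  using assms
proof (induction A rule: finite_psubset_induct)
  case (psubset A)
  show ?case
  proof (cases "A = {}")
    case False
    then obtain x where x: "x \<in> A" by blast
    let ?B = "A - {x, m x}"
    have mx: "m x \<in> A" "m x \<noteq> x" "m (m x) = x" using psubset.prems x by auto
    have "even (card ?B)"
    proof (rule psubset.IH)
      show "?B \<subset> A" using x by blast
      fix z assume z: "z \<in> ?B"
      then have mz: "m z \<in> A" "m (m z) = z" "m z \<noteq> z" using psubset.prems by auto
      have "m z \<noteq> x" using mz z mx by force
      moreover have "m z \<noteq> m x" using mz z mx by (metis DiffD2 insertI1)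
      ultimately show "m z \<in> ?B \<and> m (m z) = z \<and> m z \<noteq> z" using mz by blast
    qed
    moreover have "card A = card ?B + 2"
    proof -
      have "A = insert x (insert (m x) ?B)" using x mx by blast
      then have "card A = card (insert x (insert (m x) ?B))" by simp
      also have "\<dots> = Suc (Suc (card ?B))" using psubset.hyps mx by (subst card_insert_disjoint; simp)+
      finally show ?thesis by simp
    qed
    ultimately show ?thesis by simp
  qed simp
qed

text \<open>A connected set that misses a Jordan curve lies on one side of it. The opposite side is
  open and has the whole curve as boundary. The maps \<open>h\<close> and \<open>k\<close> pass to
  the complex plane, where the Jordan theorem is stated.\<close>

lemma jordan_other_side:
  fixes c :: "real \<Rightarrow> real^2"
  assumes c: "simple_path c" "pathfinish c = pathstart c" and \<omega>: "connected \<omega>" "\<omega> \<inter> path_image c = {}" and y: "y \<in> path_image c"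
  obtains O' where "open O'" "O' \<inter> \<omega> = {}" "y \<in> closure O'"
proof -
  define h where "h x = Complex (x$1) (x$2)" for x :: "real^2"
  define k where "k z = (vector [Re z, Im z] :: real^2)" for z
  have lh: "linear h" by (rule linearI) (auto simp: h_def complex_eq_iff)
  have lk: "linear k" by (rule linearI) (auto simp: k_def vec_eq_iff forall_2)
  have kh: "k (h x) = x" "h (k z) = z" for x z by (auto simp: h_def k_def vec_eq_iff forall_2)
  have inj: "inj h" using kh by (metis injI)
  have pim: "path_image (h \<circ> c) = h ` path_image c" by (simp add: path_image_def image_comp)
  have sp: "simple_path (h \<circ> c)" "pathfinish (h \<circ> c) = pathstart (h \<circ> c)"
    using c simple_path_linear_image_eq[OF lh inj] by (auto simp: pathfinish_def pathstart_def)
  let ?J = "h ` path_image c"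
  have J: "open (inside ?J)" "open (outside ?J)" "inside ?J \<inter> outside ?J = {}" "inside ?J \<union> outside ?J = - ?J"
      "frontier (inside ?J) = ?J" "frontier (outside ?J) = ?J"
    using Jordan_inside_outside[OF sp] unfolding pim by auto
  have con: "connected (h ` \<omega>)"
    using \<omega>(1) lh by (intro connected_continuous_image linear_continuous_on) (auto simp: linear_conv_bounded_linear)
  have dis: "h ` \<omega> \<inter> ?J = {}" using \<omega>(2) inj by (auto simp: inj_on_def)
  have "\<exists>P. open P \<and> P \<inter> h ` \<omega> = {} \<and> frontier P = ?J"
  proof (cases "h ` \<omega> \<inter> inside ?J = {}")
    case True
    then show ?thesis using J(1,5) by (intro exI[of _ "inside ?J"]) auto
  next
    case False
    have "inside ?J \<inter> h ` \<omega> = {} \<or> outside ?J \<inter> h ` \<omega> = {}"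
    proof (rule connectedD[OF con J(1,2)])
      show "inside ?J \<inter> outside ?J \<inter> h ` \<omega> = {}" using J(3) by auto
      show "h ` \<omega> \<subseteq> inside ?J \<union> outside ?J" unfolding J(4) using dis by auto
    qed
    then show ?thesis using False J(2,6) by (intro exI[of _ "outside ?J"]) auto
  qed
  then obtain P where P: "open P" "P \<inter> h ` \<omega> = {}" "frontier P = ?J" by blast
  show thesis
  proof (rule that)
    show "open {x. h x \<in> P}" using lh P(1) by (rule open_linear_vimage)
    show "{x. h x \<in> P} \<inter> \<omega> = {}" using P(2) by blast
    have "h y \<in> closure P" using P(3) y by (auto simp: frontier_def)
    from isCont_closure[OF this linear_isCont[OF lk], of "{x. h x \<in> P}"] show "y \<in> closure {x. h x \<in> P}"
      by (simp add: kh)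
  qed
qed

section \<open>Sides, ends and the pairing of ends\<close>

locale polygon =
  fixes \<omega> :: "(real^2) set" and S :: "(real \<Rightarrow> real^2) set"
  assumes op: "open \<omega>" and con: "connected \<omega>" and ne: "\<omega> \<noteq> {}" and fin: "finite S"
    and side: "\<gamma> \<in> S \<Longrightarrow> smooth_side \<gamma>"
    and fr: "frontier \<omega> = (\<Union>\<gamma>\<in>S. path_image \<gamma>)"
    and meet: "\<gamma> \<in> S \<Longrightarrow> \<delta> \<in> S \<Longrightarrow> \<gamma> \<noteq> \<delta> \<Longrightarrow> path_image \<gamma> \<inter> path_image \<delta> \<subseteq> {\<gamma> 0, \<gamma> 1} \<inter> {\<delta> 0, \<delta> 1}"
    and partner: "(\<gamma>, s) \<in> S \<times> {0, 1} \<Longrightarrow> \<exists>!(\<delta>, t). (\<delta>, t) \<in> S \<times> {0, 1} \<and> (\<delta>, t) \<noteq> (\<gamma>, s) \<and> \<delta> t = \<gamma> s"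
    and corner: "(\<gamma>, s) \<in> S \<times> {0, 1} \<Longrightarrow> (\<delta>, t) \<in> S \<times> {0, 1} \<Longrightarrow> (\<delta>, t) \<noteq> (\<gamma>, s) \<Longrightarrow> \<delta> t = \<gamma> s \<Longrightarrow>
       \<not> collinear {0, vector_derivative \<gamma> (at s), vector_derivative \<delta> (at t)}"

lemma polygonal_domain_polygon:
  assumes "polygonal_domain \<omega>" obtains S where "polygon \<omega> S"
proof -
  have "\<exists>S. finite S \<and> (\<forall>\<gamma>\<in>S. smooth_side \<gamma>) \<and> frontier \<omega> = (\<Union>\<gamma>\<in>S. path_image \<gamma>) \<and>
       (\<forall>\<gamma>\<in>S. \<forall>\<delta>\<in>S. \<gamma> \<noteq> \<delta> \<longrightarrow> path_image \<gamma> \<inter> path_image \<delta> \<subseteq> {\<gamma> 0, \<gamma> 1} \<inter> {\<delta> 0, \<delta> 1}) \<and>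
       (\<forall>(\<gamma>, s)\<in>S \<times> {0, 1}. \<exists>!(\<delta>, t). (\<delta>, t) \<in> S \<times> {0, 1} \<and> (\<delta>, t) \<noteq> (\<gamma>, s) \<and> \<delta> t = \<gamma> s) \<and>
       (\<forall>(\<gamma>, s)\<in>S \<times> {0, 1}. \<forall>(\<delta>, t)\<in>S \<times> {0, 1}. (\<delta>, t) \<noteq> (\<gamma>, s) \<and> \<delta> t = \<gamma> s \<longrightarrow>
          \<not> collinear {0, vector_derivative \<gamma> (at s), vector_derivative \<delta> (at t)})"
    using assms unfolding polygonal_domain_def by (elim conjE)
  then obtain S where S: "finite S \<and> (\<forall>\<gamma>\<in>S. smooth_side \<gamma>) \<and> frontier \<omega> = (\<Union>\<gamma>\<in>S. path_image \<gamma>) \<and>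
       (\<forall>\<gamma>\<in>S. \<forall>\<delta>\<in>S. \<gamma> \<noteq> \<delta> \<longrightarrow> path_image \<gamma> \<inter> path_image \<delta> \<subseteq> {\<gamma> 0, \<gamma> 1} \<inter> {\<delta> 0, \<delta> 1}) \<and>
       (\<forall>(\<gamma>, s)\<in>S \<times> {0, 1}. \<exists>!(\<delta>, t). (\<delta>, t) \<in> S \<times> {0, 1} \<and> (\<delta>, t) \<noteq> (\<gamma>, s) \<and> \<delta> t = \<gamma> s) \<and>
       (\<forall>(\<gamma>, s)\<in>S \<times> {0, 1}. \<forall>(\<delta>, t)\<in>S \<times> {0, 1}. (\<delta>, t) \<noteq> (\<gamma>, s) \<and> \<delta> t = \<gamma> s \<longrightarrow>
          \<not> collinear {0, vector_derivative \<gamma> (at s), vector_derivative \<delta> (at t)})"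
    by (rule exE)
  have "polygon \<omega> S"
  proof
    show "\<exists>!(\<delta>, t). (\<delta>, t) \<in> S \<times> {0, 1} \<and> (\<delta>, t) \<noteq> (\<gamma>, s) \<and> \<delta> t = \<gamma> s" if "(\<gamma>, s) \<in> S \<times> {0, 1}" for \<gamma> and s :: real
    proof -
      have "\<forall>p\<in>S \<times> {0, 1}. case p of (\<gamma>, s) \<Rightarrow> \<exists>!(\<delta>, t). (\<delta>, t) \<in> S \<times> {0, 1} \<and> (\<delta>, t) \<noteq> (\<gamma>, s) \<and> \<delta> t = \<gamma> s"
        using S by simp
      from bspec[OF this that] show ?thesis by (simp only: prod.case)
    qed
    show "\<not> collinear {0, vector_derivative \<gamma> (at s), vector_derivative \<delta> (at t)}"
      if "(\<gamma>, s) \<in> S \<times> {0, 1}" "(\<delta>, t) \<in> S \<times> {0, 1}" "(\<delta>, t) \<noteq> (\<gamma>, s)" "\<delta> t = \<gamma> s" for \<gamma> s \<delta> t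
    proof -
      have "\<forall>p\<in>S \<times> {0, 1}. \<forall>q\<in>S \<times> {0, 1}. q \<noteq> p \<and> fst q (snd q) = fst p (snd p) \<longrightarrow>
          \<not> collinear {0, vector_derivative (fst p) (at (snd p)), vector_derivative (fst q) (at (snd q))}"
        using S by (simp add: split_beta)
      from bspec[OF bspec[OF this that(1)] that(2)] that(3,4) show ?thesis by simp
    qed
    show "open \<omega>" "connected \<omega>" "\<omega> \<noteq> {}" using assms by (simp_all add: polygonal_domain_def)
    show "path_image \<gamma> \<inter> path_image \<delta> \<subseteq> {\<gamma> 0, \<gamma> 1} \<inter> {\<delta> 0, \<delta> 1}" if "\<gamma> \<in> S" "\<delta> \<in> S" "\<gamma> \<noteq> \<delta>" for \<gamma> \<delta>
      using S that by meson
  qed (use S in simp_all)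
  then show thesis by (rule that)
qed

context polygon
begin

text \<open>Ends are pairs of a side and a parameter, so the two ends of a loop stay different
  although they are the same point.\<close>

definition mate :: "(real \<Rightarrow> real^2) \<times> real \<Rightarrow> (real \<Rightarrow> real^2) \<times> real" where
  "mate e = (THE e'. e' \<in> S \<times> {0, 1} \<and> e' \<noteq> e \<and> fst e' (snd e') = fst e (snd e))"

lemma ex1_mate: "e \<in> S \<times> {0, 1} \<Longrightarrow> \<exists>!e'. e' \<in> S \<times> {0, 1} \<and> e' \<noteq> e \<and> fst e' (snd e') = fst e (snd e)"
proof -
  assume e: "e \<in> S \<times> {0, 1}"
  have eq: "(\<lambda>(\<delta>, t). (\<delta>, t) \<in> S \<times> {0, 1} \<and> (\<delta>, t) \<noteq> e \<and> \<delta> t = fst e (snd e))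
      = (\<lambda>e'. e' \<in> S \<times> {0, 1} \<and> e' \<noteq> e \<and> fst e' (snd e') = fst e (snd e))" by auto
  show ?thesis using partner[of "fst e" "snd e"] e unfolding prod.collapse eq by blast
qed

lemma mate:
  assumes "e \<in> S \<times> {0, 1}"
  shows "mate e \<in> S \<times> {0, 1}" "mate e \<noteq> e" "fst (mate e) (snd (mate e)) = fst e (snd e)" "mate (mate e) = e"
proof -
  have m: "mate e \<in> S \<times> {0, 1} \<and> mate e \<noteq> e \<and> fst (mate e) (snd (mate e)) = fst e (snd e)"
    unfolding mate_def by (rule theI'[OF ex1_mate[OF assms]])
  then show "mate e \<in> S \<times> {0, 1}" "mate e \<noteq> e" "fst (mate e) (snd (mate e)) = fst e (snd e)" by auto
  have "mate (mate e) \<in> S \<times> {0, 1} \<and> mate (mate e) \<noteq> mate e \<and> fst (mate (mate e)) (snd (mate (mate e))) = fst (mate e) (snd (mate e))"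
    unfolding mate_def[of "mate e"] by (rule theI'[OF ex1_mate]) (use m in blast)
  moreover have "e \<in> S \<times> {0, 1} \<and> e \<noteq> mate e \<and> fst e (snd e) = fst (mate e) (snd (mate e))" using assms m by auto
  moreover have "\<exists>!e'. e' \<in> S \<times> {0, 1} \<and> e' \<noteq> mate e \<and> fst e' (snd e') = fst (mate e) (snd (mate e))"
    by (rule ex1_mate) (use m in blast)
  ultimately show "mate (mate e) = e" by (metis (no_types, lifting))
qed

text \<open>Otherwise, removing the side \<open>\<gamma>\<close>, the component of its start in the remaining sides would contain an odd
  number of ends, although the sides come with two ends each.\<close>

lemma ends_connected_by_rest:
  assumes \<gamma>: "\<gamma> \<in> S" "\<gamma> 0 \<noteq> \<gamma> 1"
  shows "path_component (\<Union>\<delta>\<in>S - {\<gamma>}. path_image \<delta>) (\<gamma> 0) (\<gamma> 1)"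
proof (rule ccontr)
  let ?R = "\<Union>\<delta>\<in>S - {\<gamma>}. path_image \<delta>"
  assume no: "\<not> path_component ?R (\<gamma> 0) (\<gamma> 1)"
  \<comment> \<open>The swap of the two ends of a side acts on \<open>E\<close> without fixed
    points. The pairing \<open>mate\<close> acts likewise on \<open>E\<close> together with the
    start of \<gamma>. Both sets would then have an even number of elements.\<close>
  define E where "E = {e \<in> (S - {\<gamma>}) \<times> {0, 1}. path_component ?R (\<gamma> 0) (fst e (snd e))}"
  have finE: "finite E" unfolding E_def using fin by simp
  have flip: "(fst e, 1 - snd e) \<in> E" if "e \<in> E" for e
  proof -
    have e: "fst e \<in> S - {\<gamma>}" "snd e \<in> {0, 1}" "path_component ?R (\<gamma> 0) (fst e (snd e))" using that by (auto simp: E_def)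
    have "path_image (fst e) \<subseteq> ?R" using e(1) by blast
    moreover have "path_connected (path_image (fst e))"
      using side[of "fst e"] e(1) by (auto simp: smooth_side_def simple_path_imp_path intro: path_connected_path_image)
    moreover have "fst e (snd e) \<in> path_image (fst e)" "fst e (1 - snd e) \<in> path_image (fst e)"
      using e(2) by (auto simp: path_image_def)
    ultimately have "path_component ?R (fst e (snd e)) (fst e (1 - snd e))"
      by (meson path_component_of_subset path_connected_component)
    then have "path_component ?R (\<gamma> 0) (fst e (1 - snd e))" using e(3) path_component_trans by blast
    then show ?thesis using e by (auto simp: E_def)
  qed
  have "even (card E)"
  proof (rule even_card_involution[OF finE, of "\<lambda>e. (fst e, 1 - snd e)"])
    fix e assume "e \<in> E"
    moreover have "(fst e, 1 - snd e) \<noteq> e" using \<open>e \<in> E\<close> by (auto simp: E_def prod_eq_iff)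
    ultimately show "(fst e, 1 - snd e) \<in> E \<and> (fst (fst e, 1 - snd e), 1 - snd (fst e, 1 - snd e)) = e \<and> (fst e, 1 - snd e) \<noteq> e"
      using flip by simp
  qed
  moreover have "even (card (insert (\<gamma>, 0) E))"
  proof (rule even_card_involution[of _ mate])
    show "finite (insert (\<gamma>, 0) E)" using finE by simp
    fix e assume e: "e \<in> insert (\<gamma>, 0) E"
    then have eS: "e \<in> S \<times> {0, 1}" using \<gamma>(1) by (auto simp: E_def)
    \<comment> \<open>The pairing could leave the set only through the end
      \<open>(\<gamma>, 1)\<close>, but then the remaining sides would connect
      \<open>\<gamma> 0\<close> to \<open>\<gamma> 1\<close>.\<close>
    have reach: "mate e = (\<gamma>, 0) \<or> mate e \<in> E"
    proof (cases "fst (mate e) = \<gamma>")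
      case True
      then consider "mate e = (\<gamma>, 0)" | "mate e = (\<gamma>, 1)" using mate(1)[OF eS] by (auto simp: prod_eq_iff)
      then show ?thesis
      proof cases
        case 2
        then have pos: "fst e (snd e) = \<gamma> 1" using mate(3)[OF eS] by simp
        show ?thesis
        proof (cases "e = (\<gamma>, 0)")
          case True
          then show ?thesis using pos \<gamma>(2) by simp
        next
          case False
          then show ?thesis using e pos no by (auto simp: E_def)
        qed
      qed simp
    next
      case False
      then have m: "mate e \<in> (S - {\<gamma>}) \<times> {0, 1}" using mate(1)[OF eS] by auto
      have "path_component ?R (\<gamma> 0) (fst (mate e) (snd (mate e)))"
      proof (cases "e = (\<gamma>, 0)")
        case True
        then have "fst (mate e) (snd (mate e)) = \<gamma> 0" using mate(3)[OF eS] by simp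
        moreover have "fst (mate e) (snd (mate e)) \<in> ?R" using m by (force simp: path_image_def)
        ultimately show ?thesis by (metis path_component_refl)
      next
        case False
        then show ?thesis using e mate(3)[OF eS] by (auto simp: E_def)
      qed
      then show ?thesis using m by (simp add: E_def)
    qed
    show "mate e \<in> insert (\<gamma>, 0) E \<and> mate (mate e) = e \<and> mate e \<noteq> e" using reach mate(2,4)[OF eS] by blast
  qed
  moreover have "(\<gamma>, 0) \<notin> E" by (simp add: E_def)
  ultimately show False using finE by simp
qed

text \<open>A side that is a loop is a Jordan curve already. Any other side is closed up by an arc
  through the remaining sides; by \<open>meet\<close> the arc touches it at the two ends only, so
  the join is simple.\<close>

lemma other_side:
  assumes y: "y \<in> frontier \<omega>"
  obtains O' where "open O'" "O' \<inter> \<omega> = {}" "y \<in> closure O'"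
proof -
  obtain \<gamma> where \<gamma>: "\<gamma> \<in> S" "y \<in> path_image \<gamma>" using y fr by blast
  have sp: "simple_path \<gamma>" using side[OF \<gamma>(1)] by (simp add: smooth_side_def)
  have sub: "path_image \<delta> \<subseteq> frontier \<omega>" if "\<delta> \<in> S" for \<delta> using that fr by blast
  have dis: "\<omega> \<inter> frontier \<omega> = {}" using op by (metis frontier_disjoint_eq inf_commute)
  show thesis
  proof (cases "\<gamma> 0 = \<gamma> 1")
    case True
    then have cl: "pathfinish \<gamma> = pathstart \<gamma>" by (simp add: pathfinish_def pathstart_def)
    have "\<omega> \<inter> path_image \<gamma> = {}" using sub[OF \<gamma>(1)] dis by blast
    from jordan_other_side[OF sp cl con this \<gamma>(2)] that show thesis by blast
  next
    case False
    let ?R = "\<Union>\<delta>\<in>S - {\<gamma>}. path_image \<delta>"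
    obtain p where p: "path p" "path_image p \<subseteq> ?R" "pathstart p = \<gamma> 1" "pathfinish p = \<gamma> 0"
      using path_component_sym[OF ends_connected_by_rest[OF \<gamma>(1) False]] unfolding path_component_def by metis
    obtain q where q: "arc q" "path_image q \<subseteq> path_image p" "pathstart q = \<gamma> 1" "pathfinish q = \<gamma> 0"
      using path_contains_arc[OF p(1,3,4)] False by metis
    have arc: "arc \<gamma>" using sp False by (simp add: arc_simple_path pathstart_def pathfinish_def)
    have int: "path_image \<gamma> \<inter> path_image q \<subseteq> {pathstart \<gamma>, pathstart q}"
    proof
      fix z assume z: "z \<in> path_image \<gamma> \<inter> path_image q"
      then obtain \<delta> where "\<delta> \<in> S" "\<delta> \<noteq> \<gamma>" "z \<in> path_image \<delta>" using p(2) q(2) by blast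
      then have "z \<in> {\<gamma> 0, \<gamma> 1}" using meet[of \<gamma> \<delta>] \<gamma>(1) z by blast
      then show "z \<in> {pathstart \<gamma>, pathstart q}" using q(3) by (auto simp: pathstart_def)
    qed
    have J: "simple_path (\<gamma> +++ q)"
      by (rule simple_path_join_loop[OF arc q(1) _ _ int]) (use q(3,4) in \<open>auto simp: pathstart_def pathfinish_def\<close>)
    have cl: "pathfinish (\<gamma> +++ q) = pathstart (\<gamma> +++ q)" by (simp add: q(4) pathstart_def[of \<gamma>])
    have im: "path_image (\<gamma> +++ q) = path_image \<gamma> \<union> path_image q"
      by (rule path_image_join) (use q(3) in \<open>simp add: pathfinish_def\<close>)
    have "path_image q \<subseteq> frontier \<omega>" using q(2) p(2) sub by blast
    then have "\<omega> \<inter> path_image (\<gamma> +++ q) = {}" using sub[OF \<gamma>(1)] dis unfolding im by blast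
    moreover have "y \<in> path_image (\<gamma> +++ q)" using \<gamma>(2) im by blast
    ultimately show thesis using jordan_other_side[OF J cl con] that by blast
  qed
qed

end

section \<open>Tangent cones of polygonal domains\<close>

text \<open>Following the chart by \<open>L\<close>, the differential of its inverse at the origin,
  turns its differential into the identity and the model \<open>Q\<close> into its image under
  \<open>L\<close>.\<close>

lemma tangent_cone_of_chart:
  fixes \<Omega> :: "'a::euclidean_space set"
  assumes p: "diffeo_pair N V U \<Phi>" and "open N" "open V" "y \<in> N" "U y = 0"
    and \<Omega>: "\<And>x. x \<in> N \<Longrightarrow> x \<in> \<Omega> \<longleftrightarrow> U x \<in> Q" and oc: "open_cone {x. L' x \<in> Q}"
    and d: "(\<Phi> has_derivative L) (at 0)" and L: "linear L" "linear L'" "\<And>x. L' (L x) = x" "\<And>x. L (L' x) = x"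
  shows "is_tangent_cone \<Omega> y {x. L' x \<in> Q}"
proof -
  from diffeo_pair_compose[OF p diffeo_pair_linear[OF L]]
  have p': "diffeo_pair N {w. L' w \<in> V} (\<lambda>x. L (U x)) (\<lambda>w. \<Phi> (L' w))" .
  have "cone_chart UNIV \<Omega> y {x. L' x \<in> Q} (\<lambda>x. L (U x))"
    by (rule cone_chartI[OF p']) (use assms(2-5) \<Omega> L(3) linear_0[OF L(1)] open_linear_vimage[OF L(2)] in auto)
  moreover have "((\<lambda>x. L (U x)) has_derivative (\<lambda>h. h)) (at y)"
  proof -
    have "smooth_on N U" using p assms(2) unfolding diffeo_pair_def by (simp add: smooth_map_on_open)
    then have U: "(U has_derivative frechet_derivative U (at y)) (at y)" using assms(4) by (rule smooth_on_has_derivative)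
    have "((\<lambda>x. \<Phi> (U x)) has_derivative (\<lambda>h. L (frechet_derivative U (at y) h))) (at y)"
      using diff_chain_at[OF U, of \<Phi> L] d by (simp add: assms(5) o_def)
    moreover have "((\<lambda>x. \<Phi> (U x)) has_derivative (\<lambda>h. h)) (at y)"
      by (rule has_derivative_transform_within_open[OF has_derivative_ident assms(2,4)])
         (use p in \<open>auto simp: diffeo_pair_def\<close>)
    ultimately have e: "(\<lambda>h. L (frechet_derivative U (at y) h)) = (\<lambda>h. h)" by (rule has_derivative_unique)
    have "((\<lambda>x. L (U x)) has_derivative (\<lambda>h. L (frechet_derivative U (at y) h))) (at y)"
      using diff_chain_at[OF U linear_imp_has_derivative[OF L(1)]] by (simp add: o_def)
    then show ?thesis unfolding e .
  qed
  ultimately show ?thesis unfolding is_tangent_cone_def using oc by blast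
qed

lemma convex_half_planes: "convex {z::real^'n. z$i > c}" "convex {z::real^'n. z$i < c}"
  using convex_halfspace_gt[of c "axis i (1::real) :: real^'n"] convex_halfspace_lt[of "axis i (1::real) :: real^'n" c]
  by (simp_all add: inner_axis')

lemma convex_box2: "convex {z::real^2. \<bar>z$1\<bar> < \<eta> \<and> \<bar>z$2\<bar> < \<eta>}"
proof -
  have "{z::real^2. \<bar>z$1\<bar> < \<eta> \<and> \<bar>z$2\<bar> < \<eta>} = {z. z$1 < \<eta>} \<inter> {z. z$1 > - \<eta>} \<inter> ({z. z$2 < \<eta>} \<inter> {z. z$2 > - \<eta>})"
    by auto
  then show ?thesis by (auto intro!: convex_Int convex_half_planes)
qed

context polygon
begin

lemma disjoint_frontier: "\<omega> \<inter> frontier \<omega> = {}"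
  using op frontier_disjoint_eq[of \<omega>] by blast

text \<open>Each connected piece off the boundary is inside or outside. Not both are outside because
  \<open>y\<close> is in the closure of the domain, and not both inside because an open set outside
  accumulates at \<open>y\<close> by \<open>other_side\<close>.\<close>

lemma local_sides:
  assumes y: "y \<in> frontier \<omega>" and N: "open N" "y \<in> N" and X: "connected X1" "connected X2" "X1 \<union> X2 = N - frontier \<omega>"
  shows "X1 \<subseteq> \<omega> \<and> X2 \<inter> \<omega> = {} \<or> X2 \<subseteq> \<omega> \<and> X1 \<inter> \<omega> = {}"
proof -
  have dich: "Y \<subseteq> \<omega> \<or> Y \<inter> \<omega> = {}" if "connected Y" "Y \<subseteq> N - frontier \<omega>" for Y
    using connected_Int_frontier[OF that(1), of \<omega>] that(2) by blast
  have d1: "X1 \<subseteq> \<omega> \<or> X1 \<inter> \<omega> = {}" and d2: "X2 \<subseteq> \<omega> \<or> X2 \<inter> \<omega> = {}" using dich X by blast+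
  have "y \<in> closure \<omega>" using y by (simp add: frontier_def)
  then have "N \<inter> \<omega> \<noteq> {}" using N open_Int_closure_eq_empty[OF N(1), of \<omega>] by blast
  then have a: "(X1 \<union> X2) \<inter> \<omega> \<noteq> {}" unfolding X(3) using disjoint_frontier by blast
  obtain O' where O': "open O'" "O' \<inter> \<omega> = {}" "y \<in> closure O'" using other_side[OF y] by blast
  have "O' \<inter> closure \<omega> = {}" using open_Int_closure_eq_empty[OF O'(1), of \<omega>] O'(2) by blast
  then have "O' \<inter> frontier \<omega> = {}" by (auto simp: frontier_def)
  moreover have "N \<inter> O' \<noteq> {}" using N O'(3) open_Int_closure_eq_empty[OF N(1), of O'] by blast
  ultimately have b: "\<not> (X1 \<union> X2) \<subseteq> \<omega>" unfolding X(3) using O'(2) by blast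
  show ?thesis using d1 d2 a b by blast
qed

text \<open>Common part of side points and corners: \<open>A\<close> is the boundary in the
  straightened coordinates, \<open>P1\<close> and \<open>P2\<close> are the two regions it leaves,
  and \<open>local_sides\<close> decides which one is the domain. \<open>L'\<close> is the inverse
  of the differential of \<Phi> at the origin, by Cramer's rule.\<close>

lemma crossing:
  fixes c1 c2 :: "real \<Rightarrow> real^2"
  defines "d1 \<equiv> vector_derivative c1 (at 0)" and "d2 \<equiv> vector_derivative c2 (at 0)"
  defines "\<Phi> \<equiv> \<lambda>z :: real^2. c1 (z$1) + c2 (z$2) - c1 0"
  defines "B \<equiv> \<lambda>\<eta>. {z :: real^2. \<bar>z$1\<bar> < \<eta> \<and> \<bar>z$2\<bar> < \<eta>}"
  assumes T: "open T" "0 \<in> T" and sm: "smooth_on T c1" "smooth_on T c2" and c0: "c2 0 = c1 0"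
    and nz: "det2 d1 d2 \<noteq> 0" and y: "c1 0 \<in> frontier \<omega>"
    and near: "\<And>\<eta>. \<eta> > 0 \<Longrightarrow> \<exists>\<rho>>0. \<forall>x\<in>ball (c1 0) \<rho> \<inter> frontier \<omega>. \<exists>z\<in>A \<inter> B \<eta>. \<Phi> z = x"
    and A: "\<eta>0 > 0" "\<And>z. z \<in> A \<inter> B \<eta>0 \<Longrightarrow> \<Phi> z \<in> frontier \<omega>"
    and P: "P1 \<union> P2 = - A" and con: "\<And>\<eta>. \<eta> > 0 \<Longrightarrow> connected (P1 \<inter> B \<eta>)" "\<And>\<eta>. \<eta> > 0 \<Longrightarrow> connected (P2 \<inter> B \<eta>)"
    and flat: "flat_cone P1" "flat_cone P2"
  defines "L' \<equiv> \<lambda>v. vector [det2 v d2 / det2 d1 d2, det2 d1 v / det2 d1 d2] :: real^2"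
  obtains Q where "Q \<in> {P1, P2}" "flat_cone {x. L' x \<in> Q}" "is_tangent_cone \<omega> (c1 0) {x. L' x \<in> Q}"
proof -
  obtain \<eta> N U where tc: "\<eta> > 0" "{-\<eta><..<\<eta>} \<subseteq> T" "open N" "c1 0 \<in> N"
      "diffeo_pair N {z. \<bar>z$1\<bar> < \<eta> \<and> \<bar>z$2\<bar> < \<eta>} U \<Phi>"
      "(\<Phi> has_derivative (\<lambda>h. (h$1) *\<^sub>R d1 + (h$2) *\<^sub>R d2)) (at 0)"
    by (rule two_curve_chart[OF T sm c0 nz[unfolded d1_def d2_def], folded d1_def d2_def \<Phi>_def])
  note \<eta> = tc(1,3,4) and d = tc(6)
  have p: "diffeo_pair N (B \<eta>) U \<Phi>" using tc(5) by (simp add: B_def)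
  let ?L = "\<lambda>h::real^2. (h$1) *\<^sub>R d1 + (h$2) *\<^sub>R d2"
  have cr: "?L h = v \<longleftrightarrow> h = L' v" for h v
    using cramer2[OF nz, of "h$1" "h$2" v] by (auto simp: L'_def vec_eq_iff forall_2)
  have L: "linear ?L" by (rule linearI) (auto simp: algebra_simps)
  have L': "linear L'" by (rule linearI) (auto simp: L'_def det2_def vec_eq_iff forall_2 add_divide_distrib diff_divide_distrib algebra_simps)
  have inv: "L' (?L x) = x" "?L (L' x) = x" for x using cr by metis+
  have fl: "flat_cone {x. L' x \<in> Q}" if "Q \<in> {P1, P2}" for Q
    using flat that flat_cone_linear[OF _ L L' inv] by blast
  obtain \<rho> where \<rho>: "\<rho> > 0" "\<And>x. x \<in> ball (c1 0) \<rho> \<Longrightarrow> x \<in> frontier \<omega> \<Longrightarrow> \<exists>z\<in>A \<inter> B \<eta>. \<Phi> z = x"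
    using near[OF \<eta>(1)] by blast
  have P0: "\<Phi> 0 = c1 0" by (simp add: \<Phi>_def c0)
  have "isCont \<Phi> 0" using d has_derivative_continuous by blast
  then obtain r where r: "r > 0" "\<And>z. norm z < r \<Longrightarrow> \<Phi> z \<in> ball (c1 0) \<rho>"
    using \<rho>(1) unfolding continuous_at_eps_delta by (auto simp: P0 dist_norm norm_minus_commute)
  \<comment> \<open>The smaller square is mapped into the ball of radius \<rho>, where every
    boundary point comes from \<open>A\<close> within the larger square. Injectivity of \<Phi> there
    identifies the two parameters, so in the small square \<open>A\<close> is exactly the
    boundary.\<close>
  define \<eta>2 where "\<eta>2 = min (min \<eta> \<eta>0) (r / 2)"
  have \<eta>2: "\<eta>2 > 0" "\<eta>2 \<le> \<eta>" "\<eta>2 \<le> \<eta>0" using \<eta>(1) A(1) r(1) by (auto simp: \<eta>2_def)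
  have B2: "B \<eta>2 \<subseteq> B \<eta>" "B \<eta>2 \<subseteq> B \<eta>0" using \<eta>2 by (auto simp: B_def)
  have oB: "open (B e)" for e unfolding B_def by (intro open_Collect_conj open_Collect_less continuous_intros)
  have ball: "\<Phi> z \<in> ball (c1 0) \<rho>" if "z \<in> B \<eta>2" for z
  proof (rule r(2))
    have "norm z \<le> \<bar>z$1\<bar> + \<bar>z$2\<bar>" using norm_le_l1_cart[of z] by (simp add: sum_2)
    also have "\<dots> < r" using that r(1) by (auto simp: B_def \<eta>2_def)
    finally show "norm z < r" .
  qed
  have inj: "z = z'" if "z \<in> B \<eta>" "z' \<in> B \<eta>" "\<Phi> z = \<Phi> z'" for z z'
    using p that unfolding diffeo_pair_def by metis
  have iff: "\<Phi> z \<in> frontier \<omega> \<longleftrightarrow> z \<in> A" if z: "z \<in> B \<eta>2" for z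
  proof
    assume "\<Phi> z \<in> frontier \<omega>"
    then obtain z' where z': "z' \<in> A" "z' \<in> B \<eta>" "\<Phi> z' = \<Phi> z" using \<rho>(2)[OF ball[OF z]] by blast
    then have "z' = z" using inj z B2 by blast
    then show "z \<in> A" using z' by blast
  qed (use A(2) z B2 in blast)
  have p': "diffeo_pair (B \<eta>) N \<Phi> U" using p unfolding diffeo_pair_def by blast
  define N2 where "N2 = \<Phi> ` B \<eta>2"
  have oN2: "open N2"
    unfolding N2_def by (rule diffeo_pair_open_image[OF p' \<eta>(2), of UNIV]) (use oB B2 in auto)
  have p2: "diffeo_pair (B \<eta>2) N2 \<Phi> U" unfolding N2_def by (rule diffeo_pair_restrict[OF p' B2(1)])
  then have p3: "diffeo_pair N2 (B \<eta>2) U \<Phi>" unfolding diffeo_pair_def by blast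
  have yN: "c1 0 \<in> N2" unfolding N2_def using P0 \<eta>2(1) by (intro image_eqI[of _ _ 0]) (auto simp: B_def)
  have cont: "continuous_on (B \<eta>2) \<Phi>" using p2 smooth_map_on_continuous unfolding diffeo_pair_def by blast
  define X1 X2 where "X1 = \<Phi> ` (P1 \<inter> B \<eta>2)" and "X2 = \<Phi> ` (P2 \<inter> B \<eta>2)"
  have cX: "connected X1" "connected X2"
    unfolding X1_def X2_def
    by (intro connected_continuous_image con \<eta>2(1) continuous_on_subset[OF cont] Int_lower2)+
  have XN: "X1 \<union> X2 = N2 - frontier \<omega>"
  proof -
    have "X1 \<union> X2 = \<Phi> ` (B \<eta>2 - A)" unfolding X1_def X2_def using P by blast
    also have "\<dots> = N2 - frontier \<omega>" unfolding N2_def using iff by blast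
    finally show ?thesis .
  qed
  have U0: "U (c1 0) = 0"
    using p3 P0 \<eta>2(1) unfolding diffeo_pair_def B_def by (metis (mono_tags, lifting) abs_zero mem_Collect_eq zero_index)
  have side: "x \<in> \<omega> \<longleftrightarrow> U x \<in> Q" if "x \<in> N2" and Q: "\<Phi> ` (Q \<inter> B \<eta>2) \<subseteq> \<omega>" "\<Phi> ` (Q' \<inter> B \<eta>2) \<inter> \<omega> = {}" "Q \<union> Q' = - A" for x Q Q'
  proof -
    have z: "U x \<in> B \<eta>2" "\<Phi> (U x) = x" using p3 \<open>x \<in> N2\<close> unfolding diffeo_pair_def by auto
    show ?thesis
    proof
      assume x: "x \<in> \<omega>"
      then have "x \<notin> frontier \<omega>" using disjoint_frontier by blast
      then have "U x \<notin> A" using iff[OF z(1)] z(2) by simp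
      moreover have "U x \<notin> Q'" using Q(2) z x by (metis (no_types, lifting) IntI empty_iff image_eqI)
      ultimately show "U x \<in> Q" using Q(3) by blast
    next
      assume "U x \<in> Q"
      then have "\<Phi> (U x) \<in> \<omega>" using Q(1) z(1) by blast
      then show "x \<in> \<omega>" using z(2) by simp
    qed
  qed
  have tan: "is_tangent_cone \<omega> (c1 0) {x. L' x \<in> Q}" if "Q \<in> {P1, P2}" "\<And>x. x \<in> N2 \<Longrightarrow> x \<in> \<omega> \<longleftrightarrow> U x \<in> Q" for Q
    by (rule tangent_cone_of_chart[OF p3 oN2 oB yN U0 that(2) _ d L L' inv])
       (use fl[OF that(1)] in \<open>auto simp: flat_cone_def\<close>)
  from local_sides[OF y oN2 yN cX XN] show thesis
  proof
    assume a: "X1 \<subseteq> \<omega> \<and> X2 \<inter> \<omega> = {}"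
    have "x \<in> \<omega> \<longleftrightarrow> U x \<in> P1" if "x \<in> N2" for x
      using side[OF that, of P1 P2] a P unfolding X1_def X2_def by blast
    then show thesis using that[of P1] fl[of P1] tan[of P1] by blast
  next
    assume a: "X2 \<subseteq> \<omega> \<and> X1 \<inter> \<omega> = {}"
    have "x \<in> \<omega> \<longleftrightarrow> U x \<in> P2" if "x \<in> N2" for x
      using side[OF that, of P2 P1] a P unfolding X1_def X2_def by blast
    then show thesis using that[of P2] fl[of P2] tan[of P2] by blast
  qed
qed

text \<open>The images of the closed parameter sets \<open>K \<delta>\<close> form a finite union of
  compact sets that misses \<open>y\<close>, hence stay at a distance from \<open>y\<close>.\<close>

lemma frontier_near:
  assumes K: "\<And>\<delta>. \<delta> \<in> S \<Longrightarrow> closed (K \<delta>) \<and> K \<delta> \<subseteq> {0..1} \<and> y \<notin> \<delta> ` K \<delta>"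
  obtains \<rho> where "\<rho> > 0" "\<And>x. x \<in> ball y \<rho> \<Longrightarrow> x \<in> frontier \<omega> \<Longrightarrow> \<exists>\<delta>\<in>S. \<exists>u\<in>{0..1} - K \<delta>. x = \<delta> u"
proof -
  have "closed (\<delta> ` K \<delta>)" if "\<delta> \<in> S" for \<delta>
  proof -
    have "compact (K \<delta>)" using K[OF that] compact_Int_closed[of "{0..1::real}" "K \<delta>"] by (simp add: inf.absorb2)
    moreover have "continuous_on (K \<delta>) \<delta>"
      using side[OF that] K[OF that] by (auto simp: smooth_side_def simple_path_def path_def intro: continuous_on_subset)
    ultimately show ?thesis using compact_continuous_image compact_imp_closed by blast
  qed
  then have "closed (\<Union>\<delta>\<in>S. \<delta> ` K \<delta>)" using fin by (intro closed_UN) auto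
  then have "open (- (\<Union>\<delta>\<in>S. \<delta> ` K \<delta>))" by (simp add: open_Compl del: Compl_UN)
  moreover have "y \<in> - (\<Union>\<delta>\<in>S. \<delta> ` K \<delta>)" using K by blast
  ultimately obtain \<rho> where \<rho>: "\<rho> > 0" "ball y \<rho> \<subseteq> - (\<Union>\<delta>\<in>S. \<delta> ` K \<delta>)" by (rule openE)
  show thesis
  proof (rule that[OF \<rho>(1)])
    fix x assume x: "x \<in> ball y \<rho>" "x \<in> frontier \<omega>"
    then obtain \<delta> u where du: "\<delta> \<in> S" "u \<in> {0..1}" "x = \<delta> u" using fr by (auto simp: path_image_def)
    have "x \<notin> \<delta> ` K \<delta>" using subsetD[OF \<rho>(2) x(1)] du(1) by simp
    then have "u \<in> {0..1} - K \<delta>" using du(2,3) by blast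
    then show "\<exists>\<delta>\<in>S. \<exists>u\<in>{0..1} - K \<delta>. x = \<delta> u" using du(1,3) by blast
  qed
qed

lemma side_smooth:
  assumes "\<gamma> \<in> S"
  obtains T where "open T" "{0..1} \<subseteq> T" "smooth_on T \<gamma>" "\<forall>t\<in>{0..1}. vector_derivative \<gamma> (at t) \<noteq> 0"
    "\<forall>t\<in>{0..1}. \<forall>u\<in>{0..1}. \<gamma> t = \<gamma> u \<longrightarrow> t = u \<or> t \<in> {0, 1} \<and> u \<in> {0, 1}"
  using side[OF assms] unfolding smooth_side_def simple_path_def loop_free_def by blast

lemma smooth_reparam:
  assumes "open T" "smooth_on T \<gamma>" "a \<in> T"
  shows "open {\<tau>. a + m * \<tau> \<in> T}" "smooth_on {\<tau>. a + m * \<tau> \<in> T} (\<lambda>\<tau>. \<gamma> (a + m * \<tau>))"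
    "vector_derivative (\<lambda>\<tau>. \<gamma> (a + m * \<tau>)) (at 0) = m *\<^sub>R vector_derivative \<gamma> (at a)"
proof -
  have "open ((\<lambda>\<tau>. a + m * \<tau>) -` T)" using assms(1) by (intro open_vimage continuous_intros)
  then show o: "open {\<tau>. a + m * \<tau> \<in> T}" by (simp add: vimage_def)
  show "smooth_on {\<tau>. a + m * \<tau> \<in> T} (\<lambda>\<tau>. \<gamma> (a + m * \<tau>))"
    by (rule smooth_on_compose[OF o _ assms(2)]) (auto intro!: smooth_on_add smooth_on_mult smooth_on_const smooth_on_ident o)
  have "(\<gamma> has_vector_derivative vector_derivative \<gamma> (at a)) (at (a + m * 0))"
    using smooth_on_differentiable[OF assms(2,3)] by (simp flip: vector_derivative_works)
  moreover have "((\<lambda>\<tau>. a + m * \<tau>) has_vector_derivative m) (at 0)"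
    by (auto intro!: derivative_eq_intros simp flip: has_real_derivative_iff_has_vector_derivative)
  ultimately have "((\<gamma> \<circ> (\<lambda>\<tau>. a + m * \<tau>)) has_vector_derivative m *\<^sub>R vector_derivative \<gamma> (at a)) (at 0)"
    by (intro vector_diff_chain_at)
  then show "vector_derivative (\<lambda>\<tau>. \<gamma> (a + m * \<tau>)) (at 0) = m *\<^sub>R vector_derivative \<gamma> (at a)"
    by (simp add: o_def vector_derivative_at)
qed

text \<open>The side is crossed with its straight normal line, so that in the chart the boundary is
  one axis and the model is a half-plane whose unit normal can be read off.\<close>

lemma tangent_at_side:
  assumes \<gamma>: "\<gamma> \<in> S" "0 < u" "u < 1"
  obtains n where "norm n = 1" "is_tangent_cone \<omega> (\<gamma> u) {x. n \<bullet> x > 0}"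
proof -
  obtain T where T: "open T" "{0..1} \<subseteq> T" "smooth_on T \<gamma>" "\<forall>t\<in>{0..1}. vector_derivative \<gamma> (at t) \<noteq> 0"
    "\<forall>t\<in>{0..1}. \<forall>u\<in>{0..1}. \<gamma> t = \<gamma> u \<longrightarrow> t = u \<or> t \<in> {0, 1} \<and> u \<in> {0, 1}"
    by (rule side_smooth[OF \<gamma>(1)])
  have uT: "u \<in> T" using T(2) \<gamma> by auto
  define b where "b = vector_derivative \<gamma> (at u)"
  have b0: "norm b > 0" using T(4) \<gamma> by (simp add: b_def)
  have nb: "(norm b)\<^sup>2 = (b$1)\<^sup>2 + (b$2)\<^sup>2" by (simp add: norm_vec_def L2_set_def sum_2)
  \<comment> \<open>The unit tangent turned by a right angle; with this choice the first Cramer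
    coordinate of \<open>x\<close> is \<open>n \<bullet> x\<close>.\<close>
  define n where "n = (1 / norm b) *\<^sub>R (vector [- b$2, b$1] :: real^2)"
  have n: "norm n = 1"
  proof -
    have "(norm (vector [- b$2, b$1] :: real^2))\<^sup>2 = (norm b)\<^sup>2" by (simp add: norm_vec_def L2_set_def sum_2)
    then have "norm (vector [- b$2, b$1] :: real^2) = norm b" by (simp add: power2_eq_iff_nonneg)
    then show ?thesis using b0 by (simp add: n_def)
  qed
  have det: "det2 n b = - norm b"
  proof -
    have "det2 n b = - (1 / norm b) * ((b$1)\<^sup>2 + (b$2)\<^sup>2)" by (simp add: det2_def n_def power2_eq_square algebra_simps)
    then show ?thesis unfolding nb[symmetric] using b0 by (simp add: power2_eq_square)
  qed
  have detx: "det2 x b = - norm b * (n \<bullet> x)" for x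
    using b0 by (simp add: det2_def n_def inner_vec_def sum_2 field_simps)
  define c1 where "c1 \<tau> = \<gamma> u + \<tau> *\<^sub>R n" for \<tau>
  define c2 where "c2 \<tau> = \<gamma> (u + 1 * \<tau>)" for \<tau>
  define T2 where "T2 = {\<tau>. u + 1 * \<tau> \<in> T}"
  note rp = smooth_reparam[OF T(1,3) uT, of 1]
  have oT2: "open T2" and s2: "smooth_on T2 c2" using rp by (simp_all add: T2_def c2_def[abs_def])
  have vd2: "vector_derivative c2 (at 0) = b" using rp(3) by (simp add: c2_def[abs_def] b_def)
  have s1: "smooth_on T2 c1" unfolding c1_def by (intro smooth_on_add smooth_on_scaleR smooth_on_const smooth_on_ident oT2)
  have vd1: "vector_derivative c1 (at 0) = n"
    unfolding c1_def by (intro vector_derivative_at) (auto intro!: derivative_eq_intros)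
  have not_end: "\<gamma> u \<noteq> \<delta> e" if "\<delta> \<in> S" "e \<in> {0..1}" "(\<delta>, e) \<noteq> (\<gamma>, u)" for \<delta> e
  proof
    assume eq: "\<gamma> u = \<delta> e"
    show False
    proof (cases "\<delta> = \<gamma>")
      case True
      then show False using T(5)[rule_format, of u e] eq that \<gamma> by auto
    next
      case False
      have "\<gamma> u \<in> path_image \<gamma>" using \<gamma> by (simp add: path_image_def)
      moreover have "\<gamma> u \<in> path_image \<delta>" unfolding eq using that by (simp add: path_image_def)
      ultimately have "\<gamma> u \<in> path_image \<gamma> \<inter> path_image \<delta>" by blast
      then have "\<gamma> u = \<gamma> 0 \<or> \<gamma> u = \<gamma> 1" using meet[of \<gamma> \<delta>] \<gamma>(1) that(1) False by blast
      then show False using T(5)[rule_format, of u 0] T(5)[rule_format, of u 1] \<gamma> by auto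
    qed
  qed
  let ?A = "{z :: real^2. z$1 = 0}" and ?P1 = "{z :: real^2. z$1 > 0}" and ?P2 = "{z :: real^2. z$1 < 0}"
  let ?\<Phi> = "\<lambda>z :: real^2. c1 (z$1) + c2 (z$2) - c1 0" and ?B = "\<lambda>\<eta>. {z :: real^2. \<bar>z$1\<bar> < \<eta> \<and> \<bar>z$2\<bar> < \<eta>}"
  have c0: "c2 0 = c1 0" by (simp add: c1_def c2_def)
  have c10: "c1 0 = \<gamma> u" by (simp add: c1_def)
  have fr1: "\<gamma> t \<in> frontier \<omega>" if "t \<in> {0..1}" for t using fr \<gamma>(1) that unfolding path_image_def by blast
  have near: "\<exists>\<rho>>0. \<forall>x\<in>ball (c1 0) \<rho> \<inter> frontier \<omega>. \<exists>z\<in>?A \<inter> ?B \<eta>. ?\<Phi> z = x" if "\<eta> > 0" for \<eta>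
  proof -
    \<comment> \<open>The parameters to be kept away: all of every other side, and \<gamma> outside
      the window of width \<eta> around \<open>u\<close>.\<close>
    define K where "K \<delta> = (if \<delta> = \<gamma> then {0..1} - {u - \<eta><..<u + \<eta>} else {0..1})" for \<delta>
    have K: "closed (K \<delta>) \<and> K \<delta> \<subseteq> {0..1} \<and> c1 0 \<notin> \<delta> ` K \<delta>" if "\<delta> \<in> S" for \<delta>
    proof (intro conjI)
      show "closed (K \<delta>)" by (auto simp: K_def intro: closed_Diff)
      show "K \<delta> \<subseteq> {0..1}" by (auto simp: K_def)
      show "c1 0 \<notin> \<delta> ` K \<delta>"
      proof
        assume "c1 0 \<in> \<delta> ` K \<delta>"
        then obtain e where e: "e \<in> K \<delta>" "\<gamma> u = \<delta> e" using c10 by auto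
        have "(\<delta>, e) = (\<gamma>, u)" using not_end[OF that, of e] e \<open>K \<delta> \<subseteq> {0..1}\<close> by blast
        then show False using e(1) \<open>\<eta> > 0\<close> by (simp add: K_def)
      qed
    qed
    obtain \<rho> where \<rho>: "\<rho> > 0" "\<And>x. x \<in> ball (c1 0) \<rho> \<Longrightarrow> x \<in> frontier \<omega> \<Longrightarrow> \<exists>\<delta>\<in>S. \<exists>t\<in>{0..1} - K \<delta>. x = \<delta> t"
      using frontier_near[OF K] by blast
    have "\<exists>z\<in>?A \<inter> ?B \<eta>. ?\<Phi> z = x" if x: "x \<in> ball (c1 0) \<rho> \<inter> frontier \<omega>" for x
    proof -
      obtain \<delta> t where t: "\<delta> \<in> S" "t \<in> {0..1} - K \<delta>" "x = \<delta> t" using \<rho>(2) x by blast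
      then have "\<delta> = \<gamma>" "\<bar>t - u\<bar> < \<eta>" by (auto simp: K_def split: if_splits)
      then show ?thesis using t(3) \<open>\<eta> > 0\<close>
        by (intro bexI[of _ "vector [0, t - u]"]) (auto simp: c2_def)
    qed
    then show ?thesis using \<rho>(1) by blast
  qed
  have conn: "connected (?P1 \<inter> ?B \<eta>)" "connected (?P2 \<inter> ?B \<eta>)" for \<eta>
    by (intro convex_connected convex_Int convex_half_planes convex_box2)+
  have fl2: "flat_cone ?P2"
    using flat_cone_linear[OF flat_cone_models(2), of uminus uminus] by (simp add: linear_iff)
  obtain Q where Q: "Q \<in> {?P1, ?P2}"
      "is_tangent_cone \<omega> (c1 0) {x. vector [det2 x b / det2 n b, det2 n x / det2 n b] \<in> Q}"
  proof (rule crossing[OF oT2 _ s1 s2 c0, of ?A "min u (1 - u)" ?P1 ?P2, unfolded vd1 vd2])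
    show "0 \<in> T2" using uT by (simp add: T2_def)
    show "det2 n b \<noteq> 0" using det b0 by simp
    show "c1 0 \<in> frontier \<omega>" using fr1[of u] \<gamma> by (simp add: c10)
    show "?\<Phi> z \<in> frontier \<omega>" if "z \<in> ?A \<inter> ?B (min u (1 - u))" for z
    proof -
      have "u + z$2 \<in> {0..1}" "z$1 = 0" using that by auto
      then show ?thesis using fr1[of "u + z$2"] by (simp add: c2_def)
    qed
    show "0 < min u (1 - u)" using \<gamma> by simp
    show "?P1 \<union> ?P2 = - ?A" by auto
    fix Q assume "Q \<in> {?P1, ?P2}"
      "is_tangent_cone \<omega> (c1 0) {x. vector [det2 x b / det2 n b, det2 n x / det2 n b] \<in> Q}"
    then show thesis by (rule that)
  qed (rule near conn flat_cone_models(2) fl2; assumption)+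
  have e: "(vector [det2 x b / det2 n b, det2 n x / det2 n b] :: real^2) $ 1 = n \<bullet> x" for x
    using b0 det by (simp add: detx[of x])
  from Q(1) consider "Q = ?P1" | "Q = ?P2" by blast
  then show thesis
  proof cases
    case 1
    then show ?thesis using that[OF n] Q(2) c10 e by simp
  next
    case 2
    have "norm (- n) = 1" "{x. (- n) \<bullet> x > 0} = {x. n \<bullet> x < 0}" using n by auto
    then show ?thesis using 2 that[of "- n"] Q(2) c10 e by simp
  qed
qed

text \<open>The two sides that share the vertex serve as coordinate curves, independent by
  \<open>corner\<close>. The last two conclusions provide room for a ball inside and one outside the
  cone, from which openings are estimated.\<close>

lemma tangent_at_end:
  assumes e: "(\<gamma>, s) \<in> S \<times> {0, 1}"
  obtains Q where "flat_cone Q" "is_tangent_cone \<omega> (\<gamma> s) Q" "Q \<noteq> {}" "interior (- Q) \<noteq> {}"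
proof -
  define \<delta> t where "\<delta> = fst (mate (\<gamma>, s))" and "t = snd (mate (\<gamma>, s))"
  have m: "(\<delta>, t) \<in> S \<times> {0, 1}" "(\<delta>, t) \<noteq> (\<gamma>, s)" "\<delta> t = \<gamma> s"
    using mate[OF e] by (simp_all add: \<delta>_def t_def)
  have st: "s \<in> {0, 1}" "t \<in> {0, 1}" "\<gamma> \<in> S" "\<delta> \<in> S" using e m by auto
  obtain T1 where T1: "open T1" "{0..1} \<subseteq> T1" "smooth_on T1 \<gamma>" "\<forall>t\<in>{0..1}. vector_derivative \<gamma> (at t) \<noteq> 0"
    "\<forall>t\<in>{0..1}. \<forall>u\<in>{0..1}. \<gamma> t = \<gamma> u \<longrightarrow> t = u \<or> t \<in> {0, 1} \<and> u \<in> {0, 1}"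
    by (rule side_smooth[OF st(3)])
  obtain T2 where T2: "open T2" "{0..1} \<subseteq> T2" "smooth_on T2 \<delta>" "\<forall>t\<in>{0..1}. vector_derivative \<delta> (at t) \<noteq> 0"
    "\<forall>t\<in>{0..1}. \<forall>u\<in>{0..1}. \<delta> t = \<delta> u \<longrightarrow> t = u \<or> t \<in> {0, 1} \<and> u \<in> {0, 1}"
    by (rule side_smooth[OF st(4)])
  have sT: "s \<in> T1" "t \<in> T2" using st T1(2) T2(2) by auto
  \<comment> \<open>The factor \<open>1 - 2 * s\<close> is 1 at the start and -1 at the end of a
    side, so either way positive parameters run into the side.\<close>
  define c1 where "c1 \<tau> = \<gamma> (s + (1 - 2 * s) * \<tau>)" for \<tau>
  define c2 where "c2 \<tau> = \<delta> (t + (1 - 2 * t) * \<tau>)" for \<tau>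
  note r1 = smooth_reparam[OF T1(1,3) sT(1), of "1 - 2 * s"] and r2 = smooth_reparam[OF T2(1,3) sT(2), of "1 - 2 * t"]
  define T where "T = {\<tau>. s + (1 - 2 * s) * \<tau> \<in> T1} \<inter> {\<tau>. t + (1 - 2 * t) * \<tau> \<in> T2}"
  have oT: "open T" unfolding T_def using r1(1) r2(1) by (rule open_Int)
  have s1: "smooth_on T c1" unfolding c1_def by (rule smooth_on_subset[OF r1(2)]) (auto simp: T_def)
  have s2: "smooth_on T c2" unfolding c2_def by (rule smooth_on_subset[OF r2(2)]) (auto simp: T_def)
  have c0: "c2 0 = c1 0" and c10: "c1 0 = \<gamma> s" using m(3) by (simp_all add: c1_def c2_def)
  define a b where "a = vector_derivative c1 (at 0)" and "b = vector_derivative c2 (at 0)"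
  have ab: "a = (1 - 2 * s) *\<^sub>R vector_derivative \<gamma> (at s)" "b = (1 - 2 * t) *\<^sub>R vector_derivative \<delta> (at t)"
    using r1(3) r2(3) by (simp_all add: a_def b_def c1_def[abs_def] c2_def[abs_def])
  have det: "det2 a b \<noteq> 0"
  proof -
    have "det2 a b = (1 - 2 * s) * (1 - 2 * t) * det2 (vector_derivative \<gamma> (at s)) (vector_derivative \<delta> (at t))"
      by (simp add: ab det2_def algebra_simps)
    moreover have "det2 (vector_derivative \<gamma> (at s)) (vector_derivative \<delta> (at t)) \<noteq> 0"
      using det2_collinear corner[OF e m] by blast
    ultimately show ?thesis using st by auto
  qed
  \<comment> \<open>A side through the vertex has it as an end, and the uniqueness of the partner
    leaves no third end there.\<close>
  have only: "(\<delta>', u) = (\<gamma>, s) \<or> (\<delta>', u) = (\<delta>, t)" if \<delta>': "\<delta>' \<in> S" and u: "u \<in> {0..1}" and us: "\<delta>' u = \<gamma> s" for \<delta>' u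
  proof -
    have "u \<in> {0, 1}"
    proof (cases "\<delta>' = \<gamma>")
      case True
      then show ?thesis using T1(5)[rule_format, of u s] \<delta>' u us st by auto
    next
      case False
      have "\<gamma> s \<in> path_image \<gamma> \<inter> path_image \<delta>'" using \<delta>' u us st by (force simp: path_image_def)
      then have "\<gamma> s = \<delta>' 0 \<or> \<gamma> s = \<delta>' 1" using meet[of \<gamma> \<delta>'] st(3) \<delta>' False by blast
      then obtain e' where e': "e' \<in> {0, 1}" "\<delta>' u = \<delta>' e'" using us by auto
      obtain T3 where "open T3" "{0..1} \<subseteq> T3" "smooth_on T3 \<delta>'" "\<forall>t\<in>{0..1}. vector_derivative \<delta>' (at t) \<noteq> 0"
        and T3: "\<forall>t\<in>{0..1}. \<forall>u\<in>{0..1}. \<delta>' t = \<delta>' u \<longrightarrow> t = u \<or> t \<in> {0, 1} \<and> u \<in> {0, 1}"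
        by (rule side_smooth[OF \<delta>'])
      show ?thesis using T3[rule_format, OF u _ e'(2)] e'(1) by auto
    qed
    then have "(\<delta>', u) \<in> S \<times> {0, 1}" using \<delta>' by simp
    then show ?thesis using ex1_mate[OF e] m us by (metis fst_conv snd_conv)
  qed
  \<comment> \<open>Near the corner the boundary consists of two closed half-axes. They separate a
    quadrant from the remaining three, the convex and the nonconvex corner.\<close>
  let ?A = "{z :: real^2. z$2 = 0 \<and> z$1 \<ge> 0 \<or> z$1 = 0 \<and> z$2 \<ge> 0}"
  let ?P1 = "{z :: real^2. z$1 > 0 \<and> z$2 > 0}" and ?P2 = "{z :: real^2. z$1 < 0 \<or> z$2 < 0}"
  let ?\<Phi> = "\<lambda>z :: real^2. c1 (z$1) + c2 (z$2) - c1 0" and ?B = "\<lambda>\<eta>. {z :: real^2. \<bar>z$1\<bar> < \<eta> \<and> \<bar>z$2\<bar> < \<eta>}"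
  have fr1: "\<delta>' u \<in> frontier \<omega>" if "\<delta>' \<in> S" "u \<in> {0..1}" for \<delta>' u using fr that unfolding path_image_def by blast
  have near: "\<exists>\<rho>>0. \<forall>x\<in>ball (c1 0) \<rho> \<inter> frontier \<omega>. \<exists>z\<in>?A \<inter> ?B \<eta>. ?\<Phi> z = x" if "\<eta> > 0" for \<eta>
  proof -
    define K1 where "K1 \<delta>' = (if \<delta>' = \<gamma> then - {s - \<eta><..<s + \<eta>} else UNIV)" for \<delta>'
    define K2 where "K2 \<delta>' = (if \<delta>' = \<delta> then - {t - \<eta><..<t + \<eta>} else UNIV)" for \<delta>'
    define K where "K \<delta>' = {0..1} \<inter> K1 \<delta>' \<inter> K2 \<delta>'" for \<delta>'
    have K: "closed (K \<delta>') \<and> K \<delta>' \<subseteq> {0..1} \<and> c1 0 \<notin> \<delta>' ` K \<delta>'" if "\<delta>' \<in> S" for \<delta>'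
    proof (intro conjI)
      have "closed (K1 \<delta>')" "closed (K2 \<delta>')" by (auto simp: K1_def K2_def)
      then show "closed (K \<delta>')" unfolding K_def by (intro closed_Int closed_atLeastAtMost)
      show "K \<delta>' \<subseteq> {0..1}" by (auto simp: K_def)
      show "c1 0 \<notin> \<delta>' ` K \<delta>'"
      proof
        assume "c1 0 \<in> \<delta>' ` K \<delta>'"
        then obtain u where u: "u \<in> K \<delta>'" "\<delta>' u = \<gamma> s" using c10 by auto
        then have "(\<delta>', u) = (\<gamma>, s) \<or> (\<delta>', u) = (\<delta>, t)" using only[OF that, of u] by (simp add: K_def)
        then show False using u(1) \<open>\<eta> > 0\<close> by (auto simp: K_def K1_def K2_def)
      qed
    qed
    obtain \<rho> where \<rho>: "\<rho> > 0" "\<And>x. x \<in> ball (c1 0) \<rho> \<Longrightarrow> x \<in> frontier \<omega> \<Longrightarrow> \<exists>\<delta>\<in>S. \<exists>t\<in>{0..1} - K \<delta>. x = \<delta> t"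
      using frontier_near[OF K] by blast
    have "\<exists>z\<in>?A \<inter> ?B \<eta>. ?\<Phi> z = x" if x: "x \<in> ball (c1 0) \<rho> \<inter> frontier \<omega>" for x
    proof -
      obtain \<delta>' u where u: "\<delta>' \<in> S" "u \<in> {0..1}" "u \<notin> K \<delta>'" "x = \<delta>' u" using \<rho>(2) x by blast
      then have "u \<notin> K1 \<delta>' \<or> u \<notin> K2 \<delta>'" by (auto simp: K_def)
      then show ?thesis
      proof
        assume "u \<notin> K1 \<delta>'"
        then have 1: "\<delta>' = \<gamma>" "\<bar>u - s\<bar> < \<eta>" by (auto simp: K1_def split: if_splits)
        have "s + (1 - 2 * s) * \<bar>u - s\<bar> = u" using st(1) u(2) by auto
        then have "c1 \<bar>u - s\<bar> = x" using u(4) 1(1) by (simp add: c1_def)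
        then show ?thesis using 1 c0 \<open>\<eta> > 0\<close>
          by (intro bexI[of _ "vector [\<bar>u - s\<bar>, 0]"]) auto
      next
        assume "u \<notin> K2 \<delta>'"
        then have 1: "\<delta>' = \<delta>" "\<bar>u - t\<bar> < \<eta>" by (auto simp: K2_def split: if_splits)
        have "t + (1 - 2 * t) * \<bar>u - t\<bar> = u" using st(2) u(2) by auto
        then have "c2 \<bar>u - t\<bar> = x" using u(4) 1(1) by (simp add: c2_def)
        then show ?thesis using 1 c0 \<open>\<eta> > 0\<close>
          by (intro bexI[of _ "vector [0, \<bar>u - t\<bar>]"]) auto
      qed
    qed
    then show ?thesis using \<rho>(1) by blast
  qed
  have A: "?\<Phi> z \<in> frontier \<omega>" if z: "z \<in> ?A \<inter> ?B 1" for z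
  proof -
    consider "z$2 = 0" "0 \<le> z$1" "z$1 < 1" | "z$1 = 0" "0 \<le> z$2" "z$2 < 1" using z by force
    then show ?thesis
    proof cases
      case 1
      have "s + (1 - 2 * s) * z$1 \<in> {0..1}" using st(1) 1 by auto
      then show ?thesis using 1 fr1[OF st(3)] c0 by (simp add: c1_def)
    next
      case 2
      have "t + (1 - 2 * t) * z$2 \<in> {0..1}" using st(2) 2 by auto
      then show ?thesis using 2 fr1[OF st(4)] by (simp add: c2_def)
    qed
  qed
  have con1: "connected (?P1 \<inter> ?B \<eta>)" for \<eta>
  proof -
    have "?P1 = {z. z$1 > 0} \<inter> {z. z$2 > 0}" by auto
    then show ?thesis by (simp only:) (intro convex_connected convex_Int convex_half_planes convex_box2)
  qed
  have con2: "connected (?P2 \<inter> ?B \<eta>)" if "\<eta> > 0" for \<eta>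
  proof -
    have e: "?P2 \<inter> ?B \<eta> = ({z. z$1 < 0} \<inter> ?B \<eta>) \<union> ({z. z$2 < 0} \<inter> ?B \<eta>)" by auto
    have "vector [- \<eta> / 2, - \<eta> / 2] \<in> ({z. z$1 < 0} \<inter> ?B \<eta>) \<inter> ({z. z$2 < 0} \<inter> ?B \<eta>)" using that by auto
    then have ne: "({z. z$1 < 0} \<inter> ?B \<eta>) \<inter> ({z. z$2 < 0} \<inter> ?B \<eta>) \<noteq> {}" by blast
    show ?thesis
      unfolding e by (rule connected_Un[OF _ _ ne]; intro convex_connected convex_Int convex_half_planes convex_box2)
  qed
  have fl2: "flat_cone ?P2"
    using flat_cone_linear[OF flat_cone_models(4), of uminus uminus] by (simp add: linear_iff)
  let ?L' = "\<lambda>v. vector [det2 v b / det2 a b, det2 a v / det2 a b] :: real^2"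
  obtain Q where Q: "Q \<in> {?P1, ?P2}" "flat_cone {x. ?L' x \<in> Q}" "is_tangent_cone \<omega> (c1 0) {x. ?L' x \<in> Q}"
  proof (rule crossing[OF oT _ s1 s2 c0, of ?A 1 ?P1 ?P2, folded a_def b_def])
    show "0 \<in> T" using sT by (simp add: T_def)
    show "c1 0 \<in> frontier \<omega>" using fr1[OF st(3), of s] st(1) by (auto simp: c10)
    show "?P1 \<union> ?P2 = - ?A" by auto
    show "det2 a b \<noteq> 0" by (rule det)
    show "?\<Phi> z \<in> frontier \<omega>" if "z \<in> ?A \<inter> ?B 1" for z using A[OF that] .
    show "(0::real) < 1" by simp
    fix Q assume "Q \<in> {?P1, ?P2}" "flat_cone {x. ?L' x \<in> Q}" "is_tangent_cone \<omega> (c1 0) {x. ?L' x \<in> Q}"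
    then show thesis by (rule that)
  qed (rule near con1 con2 flat_cone_models(3) fl2; assumption)+
  have L': "?L' (x *\<^sub>R a + z *\<^sub>R b) = vector [x, z]" for x z
    using cramer2[OF det, of x z "x *\<^sub>R a + z *\<^sub>R b"] by metis
  have lin: "linear ?L'"
    by (rule linearI) (auto simp: det2_def vec_eq_iff forall_2 add_divide_distrib diff_divide_distrib algebra_simps)
  have ne: "{x. ?L' x \<in> Q} \<noteq> {}"
  proof (cases "Q = ?P1")
    case True
    then have "1 *\<^sub>R a + 1 *\<^sub>R b \<in> {x. ?L' x \<in> Q}" unfolding mem_Collect_eq L' by simp
    then show ?thesis by blast
  next
    case False
    then have "(-1) *\<^sub>R a + 0 *\<^sub>R b \<in> {x. ?L' x \<in> Q}" using Q(1) unfolding mem_Collect_eq L' by simp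
    then show ?thesis by blast
  qed
  obtain P where P: "open P" "P \<subseteq> - Q" "\<exists>x z. vector [x, z] \<in> P"
  proof (cases "Q = ?P1")
    case True
    have "open {z :: real^2. z$1 < 0}" by (intro open_Collect_less continuous_intros)
    moreover have "vector [-1, 0] \<in> {z :: real^2. z$1 < 0}" by simp
    ultimately show ?thesis using True by (intro that[of "{z. z$1 < 0}"]) (auto simp: lt_ex gt_ex)
  next
    case False
    have "open ?P1" by (intro open_Collect_conj open_Collect_less continuous_intros)
    moreover have "vector [1, 1] \<in> ?P1" by simp
    ultimately show ?thesis using False Q(1) by (intro that[of ?P1]) (auto simp: lt_ex gt_ex)
  qed
  have "open {x. ?L' x \<in> P}" using lin P(1) by (rule open_linear_vimage)
  moreover have "{x. ?L' x \<in> P} \<subseteq> - {x. ?L' x \<in> Q}" using P(2) by blast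
  ultimately have "{x. ?L' x \<in> P} \<subseteq> interior (- {x. ?L' x \<in> Q})" by (rule interior_maximal[rotated])
  moreover obtain x z where "vector [x, z] \<in> P" using P(3) by blast
  then have "x *\<^sub>R a + z *\<^sub>R b \<in> {x. ?L' x \<in> P}" unfolding mem_Collect_eq L' .
  ultimately have "interior (- {x. ?L' x \<in> Q}) \<noteq> {}" by blast
  then show thesis using that[OF Q(2) _ ne] Q(3) c10 by simp
qed

end

lemma flat_cone_half_plane:
  assumes "n \<noteq> 0" shows "flat_cone {x. n \<bullet> x > 0}"
  unfolding flat_cone_def
proof (intro conjI ballI impI)
  show "open_cone {x. n \<bullet> x > 0}"
    by (auto simp: open_cone_def intro!: open_halfspace_gt)
  fix x assume x: "x \<in> closure {x. n \<bullet> x > 0}" "x \<notin> {x. n \<bullet> x > 0}"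
  have "n \<bullet> x \<ge> 0"
    using closure_mono[of "{x. n \<bullet> x > 0}" "{x. n \<bullet> x \<ge> 0}"] x(1) closure_closed[OF closed_halfspace_ge[of 0 n]] by fastforce
  then have "n \<bullet> x = 0" using x(2) by simp
  moreover have nn: "n \<bullet> n > 0" using assms by simp
  ultimately have "n \<noteq> c *\<^sub>R x" "x + c *\<^sub>R n \<in> {x. n \<bullet> x > 0} \<longleftrightarrow> c > 0" for c
    using inner_scaleR_right[of n c x] by (auto simp: inner_add_right zero_less_mult_iff assms) (use nn in linarith)
  then show "\<exists>v. (\<forall>c. v \<noteq> c *\<^sub>R x) \<and> (\<forall>z. x + z *\<^sub>R v \<in> {x. n \<bullet> x > 0} \<longleftrightarrow> z > 0)" by blast
qed

text \<open>Dilation by \<open>1 / (1 + norm p)\<close> brings the centre of any interior ball into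
  the unit ball and keeps the ball inside the cone.\<close>

lemma ball_in_conic:
  fixes W :: "'a::real_normed_vector set"
  assumes "interior W \<noteq> {}" and cone: "\<And>t x. t > 0 \<Longrightarrow> t *\<^sub>R x \<in> W \<longleftrightarrow> x \<in> W"
  obtains q r where "norm q \<le> 1" "r > 0" "ball q r \<subseteq> W"
proof -
  obtain p e where e: "e > 0" "ball p e \<subseteq> W" using assms(1) mem_interior by blast
  define t where "t = 1 / (1 + norm p)"
  have t: "t > 0" by (simp add: t_def add_pos_nonneg)
  have "ball (t *\<^sub>R p) (t * e) \<subseteq> W"
  proof
    fix x assume "x \<in> ball (t *\<^sub>R p) (t * e)"
    moreover have "dist (t *\<^sub>R p) x = t * dist p ((1 / t) *\<^sub>R x)"
      using t norm_scaleR[of t "p - (1 / t) *\<^sub>R x"] by (simp add: dist_norm scaleR_diff_right)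
    ultimately have "(1 / t) *\<^sub>R x \<in> W" using e(2) t by auto
    then show "x \<in> W" using cone[of "1 / t" x] t by simp
  qed
  moreover have "norm (t *\<^sub>R p) \<le> 1" by (simp add: t_def add_pos_nonneg field_simps)
  ultimately show thesis using that[of "t *\<^sub>R p" "t * e"] e(1) t by simp
qed

context polygon
begin

text \<open>Side points admit the radius 1, with the unit normals as centres in the half-planes.
  Each of the finitely many ends admits some positive radius, and the minimum of all these serves
  the whole boundary.\<close>

lemma planar_tangent:
  obtains r where "0 < r" "r \<le> 1"
    "\<And>y. y \<in> frontier \<omega> \<Longrightarrow> \<exists>Q. flat_cone Q \<and> is_tangent_cone \<omega> y Q \<and>
       (\<exists>q. norm q \<le> 1 \<and> ball q r \<subseteq> Q) \<and> (\<exists>q. norm q \<le> 1 \<and> ball q r \<subseteq> - Q)"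
proof -
  define P where "P r y \<longleftrightarrow> (\<exists>Q. flat_cone Q \<and> is_tangent_cone \<omega> y Q \<and>
       (\<exists>q. norm q \<le> 1 \<and> ball q r \<subseteq> Q) \<and> (\<exists>q. norm q \<le> 1 \<and> ball q r \<subseteq> - Q))" for r y
  have mono: "P r' y" if "P r y" "r' \<le> r" for r r' y
    using that unfolding P_def by (meson subset_ball subset_trans)
  have "\<exists>r>0. P r (fst e (snd e))" if e: "e \<in> S \<times> {0, 1}" for e
  proof -
    obtain Q where Q: "flat_cone Q" "is_tangent_cone \<omega> (fst e (snd e)) Q" "Q \<noteq> {}" "interior (- Q) \<noteq> {}"
      by (rule tangent_at_end[of "fst e" "snd e"]) (use e in auto)
    have oc: "open_cone Q" using Q(1) by (simp add: flat_cone_def)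
    then have "interior Q \<noteq> {}" using Q(3) by (simp add: open_cone_def interior_open)
    from ball_in_conic[OF this open_cone_scale[OF oc]]
    obtain q1 r1 where 1: "norm q1 \<le> 1" "r1 > 0" "ball q1 r1 \<subseteq> Q" by blast
    obtain q2 r2 where 2: "norm q2 \<le> 1" "r2 > 0" "ball q2 r2 \<subseteq> - Q"
      by (rule ball_in_conic[OF Q(4)]) (simp_all add: open_cone_scale[OF oc])
    have "ball q1 (min r1 r2) \<subseteq> Q" "ball q2 (min r1 r2) \<subseteq> - Q" using 1(3) 2(3) by auto
    then have "P (min r1 r2) (fst e (snd e))" unfolding P_def using Q(1,2) 1(1) 2(1) by blast
    then show ?thesis using 1(2) 2(2) by (intro exI[of _ "min r1 r2"]) simp
  qed
  then obtain \<rho> where \<rho>: "\<And>e. e \<in> S \<times> {0, 1} \<Longrightarrow> \<rho> e > 0 \<and> P (\<rho> e) (fst e (snd e))" by metis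
  define r where "r = Min (insert 1 (\<rho> ` (S \<times> {0, 1})))"
  have f: "finite (insert 1 (\<rho> ` (S \<times> {0, 1})))" using fin by simp
  have r1: "r \<le> 1" and re: "\<And>e. e \<in> S \<times> {0, 1} \<Longrightarrow> r \<le> \<rho> e" unfolding r_def by (intro Min_le[OF f]; blast)+
  have r0: "r > 0" unfolding r_def using f \<rho> by (subst Min_gr_iff) auto
  have "P r y" if y: "y \<in> frontier \<omega>" for y
  proof -
    obtain \<gamma> u where u: "\<gamma> \<in> S" "u \<in> {0..1}" "y = \<gamma> u" using y unfolding fr path_image_def by blast
    show ?thesis
    proof (cases "u \<in> {0, 1}")
      case True
      then have "(\<gamma>, u) \<in> S \<times> {0, 1}" using u by simp
      from \<rho>[OF this] re[OF this] show ?thesis using mono[of "\<rho> (\<gamma>, u)" y r] u(3) by simp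
    next
      case False
      then have "0 < u" "u < 1" using u(2) by auto
      then obtain n where n: "norm n = 1" "is_tangent_cone \<omega> (\<gamma> u) {x. n \<bullet> x > 0}" using tangent_at_side[OF u(1)] by blast
      have nn: "n \<bullet> n = 1" using n(1) by (simp add: dot_square_norm)
      have "n \<bullet> x > 0" if "x \<in> ball n 1" for x
      proof -
        have "n \<bullet> (n - x) \<le> norm n * norm (n - x)" by (rule norm_cauchy_schwarz)
        then show ?thesis using that n(1) nn by (simp add: dist_norm inner_diff_right)
      qed
      moreover have "n \<bullet> x < 0" if "x \<in> ball (- n) 1" for x
      proof -
        have "n \<bullet> (n + x) \<le> norm n * norm (n + x)" by (rule norm_cauchy_schwarz)
        then show ?thesis using that n(1) nn norm_minus_cancel[of "n + x"] by (simp add: dist_norm inner_add_right)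
      qed
      ultimately have "ball n 1 \<subseteq> {x. n \<bullet> x > 0}" "ball (- n) 1 \<subseteq> - {x. n \<bullet> x > 0}" by force+
      moreover have "flat_cone {x. n \<bullet> x > 0}" using n(1) by (intro flat_cone_half_plane) auto
      moreover have "norm n \<le> 1" "norm (- n) \<le> 1" using n(1) by auto
      ultimately have "P 1 (\<gamma> u)" unfolding P_def using n(2) by blast
      then show ?thesis using mono r1 u(3) by blast
    qed
  qed
  then show thesis using that r0 r1 unfolding P_def by blast
qed

end

section \<open>Spindles with two conical points\<close>

text \<open>Conjugating a chart by the dilation keeps its differential the identity, and a cone is
  invariant under dilations. The radius from \<open>planar_tangent\<close> is thereby independent of
  \<epsilon>.\<close>

lemma is_tangent_cone_scale:
  fixes \<omega> :: "'a::euclidean_space set"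
  assumes t: "is_tangent_cone \<omega> y Q" and e: "\<epsilon> > 0"
  shows "is_tangent_cone ((\<lambda>y. \<epsilon> *\<^sub>R y) ` \<omega>) (\<epsilon> *\<^sub>R y) Q"
proof -
  obtain U where oc: "open_cone Q" and U: "cone_chart UNIV \<omega> y Q U" "(U has_derivative (\<lambda>h. h)) (at y)"
    using t unfolding is_tangent_cone_def by blast
  from U(1) obtain N V G where c: "diffeo_pair N V U G" "open V" "openin (top_of_set UNIV) N" "y \<in> N" "U y = 0"
      "\<And>y. y \<in> N \<Longrightarrow> y \<in> \<omega> \<longleftrightarrow> U y \<in> Q" by (rule cone_chartE) blast
  let ?s = "\<lambda>x::'a. \<epsilon> *\<^sub>R x" and ?d = "\<lambda>x::'a. (1 / \<epsilon>) *\<^sub>R x"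
  have lin: "linear ?s" "linear ?d" by (simp_all add: linear_iff algebra_simps)
  have "diffeo_pair {x. ?d x \<in> N} N ?d ?s"
    using diffeo_pair_linear[OF lin, of N] e unfolding diffeo_pair_def by auto
  from diffeo_pair_compose[OF diffeo_pair_compose[OF this c(1)] diffeo_pair_linear[OF lin]]
  have p: "diffeo_pair {x. ?d x \<in> N} {w. ?d w \<in> V} (\<lambda>x. ?s (U (?d x))) (\<lambda>w. ?s (G (?d w)))" using e by simp
  have "cone_chart UNIV (?s ` \<omega>) (?s y) Q (\<lambda>x. ?s (U (?d x)))"
  proof (rule cone_chartI[OF p])
    show "open {w. ?d w \<in> V}" using lin(2) c(2) by (rule open_linear_vimage)
    show "openin (top_of_set UNIV) {x. ?d x \<in> N}" using open_linear_vimage[OF lin(2)] c(3) by simp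
    show "x \<in> ?s ` \<omega> \<longleftrightarrow> ?s (U (?d x)) \<in> Q" if "x \<in> {x. ?d x \<in> N}" for x
    proof -
      have "x \<in> ?s ` \<omega> \<longleftrightarrow> ?d x \<in> \<omega>" using e by (auto simp: image_iff intro!: bexI[of _ "?d x"])
      then show ?thesis using c(6) that open_cone_scale[OF oc e] by simp
    qed
  qed (use c e in auto)
  moreover have "((\<lambda>x. ?s (U (?d x))) has_derivative (\<lambda>h. h)) (at (?s y))"
  proof -
    have "(U has_derivative (\<lambda>h. h)) (at (?d (?s y)))" using U(2) e by simp
    from diff_chain_at[OF linear_imp_has_derivative[OF lin(2)] this]
    have "((\<lambda>x. U (?d x)) has_derivative (\<lambda>h. ?d h)) (at (?s y))" by (simp add: o_def)
    from has_derivative_scaleR_right[OF this, of \<epsilon>] show ?thesis using e by simp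
  qed
  ultimately show ?thesis unfolding is_tangent_cone_def using oc by blast
qed

lemma has_derivative_emb:
  assumes "(f has_derivative f') (at x within S)" "(g has_derivative g') (at x within S)"
  shows "((\<lambda>x. emb (f x) (g x)) has_derivative (\<lambda>h. emb (f' h) (g' h))) (at x within S)"
  using bounded_linear.has_derivative[OF _ has_derivative_Pair[OF assms], of "\<lambda>w. emb (fst w) (snd w)"] linear_emb(1)
  by (simp add: linear_conv_bounded_linear)

lemma smooth_on_emb:
  assumes T: "open T" and "smooth_on T f" "smooth_on T g" shows "smooth_on T (\<lambda>x. emb (f x) (g x))"
  using smooth_on_compose_linear[OF T linear_emb(1) smooth_on_Pair[OF T assms(2,3)]] by simp

lemma smooth_on_coords:
  assumes "open T" shows "smooth_on T proj" "smooth_on T (\<lambda>x::real^3. x$3)"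
  by (intro smooth_on_linear assms linear_proj bounded_linear.linear[OF bounded_linear_vec_nth])+

lemma has_derivative_coords: "(proj has_derivative proj) F" "((\<lambda>x::real^3. x$3) has_derivative (\<lambda>h. h$3)) F"
  by (intro linear_imp_has_derivative linear_proj bounded_linear.linear[OF bounded_linear_vec_nth])+

text \<open>The profile \<open>t * (1 - t)\<close> has slope 1 at height 0 and slope -1 at height 1,
  so both apexes are cones over \<omega> itself. Cutting the cone by a plane would add a rim of
  edges and further vertices.\<close>

definition spindle :: "(real^2) set \<Rightarrow> (real^3) set" where
  "spindle \<omega> = {x. 0 < x$3 \<and> x$3 < 1 \<and> (1 / (x$3 * (1 - x$3))) *\<^sub>R proj x \<in> \<omega>}"

lemma open_slab: "open {x :: real^3. 0 < x$3 \<and> x$3 < 1}"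
  by (intro open_Collect_conj open_Collect_less continuous_intros)

lemma smooth_on_slab: "smooth_on {x :: real^3. 0 < x$3 \<and> x$3 < 1} (\<lambda>x. (1 / (x$3 * (1 - x$3))) *\<^sub>R proj x)"
  by (intro smooth_on_scaleR smooth_on_divide smooth_on_mult smooth_on_diff smooth_on_const smooth_on_coords open_slab) auto

lemma open_slab_preimage:
  assumes "open D" shows "open {x :: real^3. 0 < x$3 \<and> x$3 < 1 \<and> (1 / (x$3 * (1 - x$3))) *\<^sub>R proj x \<in> D}"
  using continuous_open_preimage[OF smooth_on_continuous[OF smooth_on_slab] open_slab assms]
  by (simp add: vimage_def Int_def conj_assoc)

lemma open_spindle: "open \<omega> \<Longrightarrow> open (spindle \<omega>)"
  unfolding spindle_def by (rule open_slab_preimage)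

lemma closure_spindle:
  assumes R: "\<forall>y\<in>\<omega>. norm y \<le> R" and x: "x \<in> closure (spindle \<omega>)"
  shows "0 \<le> x$3" "x$3 \<le> 1" "norm (proj x) \<le> R * (x$3 * (1 - x$3))"
    "0 < x$3 \<Longrightarrow> x$3 < 1 \<Longrightarrow> (1 / (x$3 * (1 - x$3))) *\<^sub>R proj x \<in> closure \<omega>"
proof -
  let ?T = "{x :: real^3. 0 \<le> x$3 \<and> x$3 \<le> 1 \<and> norm (proj x) \<le> R * (x$3 * (1 - x$3))}"
  have "closed ?T"
    using linear_continuous_on[of proj UNIV] linear_proj
    by (intro closed_Collect_conj closed_Collect_le continuous_intros) (auto simp: linear_conv_bounded_linear)
  moreover have "spindle \<omega> \<subseteq> ?T"
  proof
    fix x assume "x \<in> spindle \<omega>"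
    then have p: "0 < x$3" "x$3 < 1" "norm ((1 / (x$3 * (1 - x$3))) *\<^sub>R proj x) \<le> R" using R unfolding spindle_def by blast+
    then have c: "x$3 * (1 - x$3) > 0" by simp
    then have "\<bar>1 / (x$3 * (1 - x$3))\<bar> = 1 / (x$3 * (1 - x$3))" by (intro abs_of_pos) simp
    then have "norm (proj x) / (x$3 * (1 - x$3)) \<le> R" using p(3) by (simp only: norm_scaleR) simp
    then have "norm (proj x) \<le> R * (x$3 * (1 - x$3))" using c by (simp only: pos_divide_le_eq)
    with p show "x \<in> ?T" by simp
  qed
  ultimately have "x \<in> ?T" using x closure_minimal by blast
  then show "0 \<le> x$3" "x$3 \<le> 1" "norm (proj x) \<le> R * (x$3 * (1 - x$3))" by auto
  assume s: "0 < x$3" "x$3 < 1"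
  then have "(\<lambda>x. (1 / (x$3 * (1 - x$3))) *\<^sub>R proj x) differentiable (at x)"
    by (intro smooth_on_differentiable[OF smooth_on_slab]) simp
  from isCont_closure[OF x differentiable_imp_continuous_within[OF this]]
  show "(1 / (x$3 * (1 - x$3))) *\<^sub>R proj x \<in> closure \<omega>" by (auto simp: spindle_def)
qed

lemma bounded_spindle:
  assumes "bounded \<omega>" shows "bounded (spindle \<omega>)"
proof -
  obtain R where R: "\<forall>y\<in>\<omega>. norm y \<le> R" using assms bounded_iff by blast
  have "norm x \<le> \<bar>R\<bar> + 1" if "x \<in> spindle \<omega>" for x
  proof -
    have "x \<in> closure (spindle \<omega>)" using that closure_subset by blast
    note c = closure_spindle[OF R this]
    have "x$3 * (1 - x$3) \<le> 1" "x$3 * (1 - x$3) \<ge> 0" using c(1,2) by (auto intro: mult_le_one)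
    then have "R * (x$3 * (1 - x$3)) \<le> \<bar>R\<bar> * 1" using abs_ge_self[of R] by (intro mult_mono) auto
    then have "norm (proj x) \<le> \<bar>R\<bar>" using c(3) by simp
    moreover have "norm x \<le> norm (proj x) + \<bar>x$3\<bar>"
    proof (rule power2_le_imp_le)
      show "(norm x)\<^sup>2 \<le> (norm (proj x) + \<bar>x$3\<bar>)\<^sup>2"
        using norm_emb[of "proj x" "x$3"] by (simp add: power2_sum)
    qed simp
    ultimately show ?thesis using c(1,2) by simp
  qed
  then show ?thesis unfolding bounded_iff by blast
qed

text \<open>With the signed distance \<open>\<sigma> * (t - h)\<close> from the apex, the profile is
  this distance times \<open>1 - \<sigma> * (t - h)\<close>. Dividing the horizontal part by the
  second factor, which is 1 at the apex, straightens the spindle to a cone and leaves the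
  differential there the identity.\<close>

lemma spindle_tangent_apex:
  assumes "open \<omega>" and h: "(h, \<sigma>) \<in> {(0, 1), (1, - 1 :: real)}"
  shows "is_tangent_cone (spindle \<omega>) (emb 0 h) (cone_over \<sigma> \<omega>)"
proof -
  let ?m = "\<lambda>t. 1 - \<sigma> * t"
  let ?N = "{x :: real^3. ?m (x$3 - h) > 0}" and ?V = "{w :: real^3. ?m (w$3) > 0}"
  let ?U = "\<lambda>x :: real^3. emb ((1 / ?m (x$3 - h)) *\<^sub>R proj x) (x$3 - h)"
  let ?G = "\<lambda>w :: real^3. emb (?m (w$3) *\<^sub>R proj w) (w$3 + h)"
  have o: "open ?N" "open ?V" by (intro open_Collect_less continuous_intros)+
  have 1: "smooth_on ?N ?U"
    by (intro smooth_on_emb smooth_on_scaleR smooth_on_divide smooth_on_mult smooth_on_diff smooth_on_const smooth_on_coords o) auto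
  have 2: "smooth_on ?V ?G"
    by (intro smooth_on_emb smooth_on_scaleR smooth_on_mult smooth_on_diff smooth_on_add smooth_on_const smooth_on_coords o)
  have p: "diffeo_pair ?N ?V ?U ?G"
    unfolding diffeo_pair_def using smooth_map_onI[OF o(1) 1] smooth_map_onI[OF o(2) 2] by auto
  have "cone_chart UNIV (spindle \<omega>) (emb 0 h) (cone_over \<sigma> \<omega>) ?U"
  proof (rule cone_chartI[OF p o(2)])
    fix x assume x: "x \<in> ?N"
    have "?m (x$3 - h) * (\<sigma> * (x$3 - h)) = x$3 * (1 - x$3)" using h by (auto simp: algebra_simps)
    then have "(1 / (\<sigma> * (x$3 - h))) * (1 / ?m (x$3 - h)) = 1 / (x$3 * (1 - x$3))" by (simp add: mult.commute)
    then have "(1 / (\<sigma> * ?U x$3)) *\<^sub>R proj (?U x) = (1 / (x$3 * (1 - x$3))) *\<^sub>R proj x" by simp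
    moreover have "\<sigma> * ?U x$3 > 0 \<longleftrightarrow> 0 < x$3 \<and> x$3 < 1" using h x by auto
    ultimately show "x \<in> spindle \<omega> \<longleftrightarrow> ?U x \<in> cone_over \<sigma> \<omega>" by (simp only: spindle_def cone_over_def mem_Collect_eq conj_assoc)
  qed (use o in \<open>auto simp: emb_simps\<close>)
  moreover have "(?U has_derivative (\<lambda>h. h)) (at (emb 0 h))"
  proof -
    have "((\<lambda>x. 1 / ?m (x$3 - h)) has_derivative (\<lambda>v. \<sigma> * v$3)) (at (emb 0 h))"
      by (auto intro!: derivative_eq_intros has_derivative_coords)
    from has_derivative_emb[OF has_derivative_scaleR[OF this has_derivative_coords(1)]
        has_derivative_diff[OF has_derivative_coords(2) has_derivative_const[of h]]]
    show ?thesis by simp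
  qed
  moreover have "open_cone (cone_over \<sigma> \<omega>)" using assms(1) h by (intro open_cone_cone_over) auto
  ultimately show ?thesis unfolding is_tangent_cone_def by blast
qed

text \<open>In the coordinates formed by the rescaled horizontal position and the height, the
  spindle is the product of \<omega> and an interval. The chart of \<omega> straightens the first
  factor; the factor \<open>k\<close> and the shear by \<open>b\<close> undo the differential of the
  change of coordinates.\<close>

lemma spindle_tangent_lateral:
  assumes t: "is_tangent_cone \<omega> y Q" and s: "0 < s" "s < 1"
  shows "is_tangent_cone (spindle \<omega>) (emb ((s * (1 - s)) *\<^sub>R y) s) (wedge_over ((1 - 2 * s) *\<^sub>R y) Q)"
proof -
  obtain U where oc: "open_cone Q" and U: "cone_chart UNIV \<omega> y Q U" "(U has_derivative (\<lambda>h. h)) (at y)"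
    using t unfolding is_tangent_cone_def by blast
  from U(1) obtain N V G where c: "diffeo_pair N V U G" "open V" "openin (top_of_set UNIV) N" "y \<in> N" "U y = 0"
      "\<And>y. y \<in> N \<Longrightarrow> y \<in> \<omega> \<longleftrightarrow> U y \<in> Q" by (rule cone_chartE) blast
  have oN: "open N" using c(3) by simp
  define k where "k = s * (1 - s)"
  have k: "k > 0" using s by (simp add: k_def)
  \<comment> \<open>The derivative of the profile at \<open>s\<close> times \<open>y\<close>: the
    slope of the curve through the point along which the rescaled position stays constant.\<close>
  define b where "b = (1 - 2 * s) *\<^sub>R y"
  define \<Phi> where "\<Phi> x = (1 / (x$3 * (1 - x$3))) *\<^sub>R proj x" for x :: "real^3"
  define \<Psi> where "\<Psi> w = (1 / k) *\<^sub>R (proj w - w$3 *\<^sub>R b)" for w :: "real^3"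
  define N' where "N' = {x :: real^3. 0 < x$3 \<and> x$3 < 1 \<and> \<Phi> x \<in> N}"
  define V' where "V' = {w :: real^3. (0 < w$3 + s \<and> w$3 + s < 1) \<and> \<Psi> w \<in> V}"
  let ?U = "\<lambda>x :: real^3. emb (k *\<^sub>R U (\<Phi> x) + (x$3 - s) *\<^sub>R b) (x$3 - s)"
  let ?G = "\<lambda>w :: real^3. emb (((w$3 + s) * (1 - (w$3 + s))) *\<^sub>R G (\<Psi> w)) (w$3 + s)"
  let ?x = "emb (k *\<^sub>R y) s"
  have lin: "linear \<Psi>" unfolding \<Psi>_def using linear_shear[of b] by (intro linear_compose_scale_right)
  have \<Phi>x: "\<Phi> ?x = y" using k by (simp add: \<Phi>_def flip: k_def)
  have oN': "open N'" unfolding N'_def \<Phi>_def using oN by (rule open_slab_preimage)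
  have oV': "open V'" unfolding V'_def
    by (intro open_Collect_conj open_Collect_less continuous_intros open_linear_vimage[OF lin c(2)])
  have Us: "smooth_on N U" and Gs: "smooth_on V G"
    using c(1,2) oN unfolding diffeo_pair_def by (auto intro: smooth_map_on_open)
  have \<Phi>s: "smooth_on N' \<Phi>" unfolding \<Phi>_def
    by (rule smooth_on_subset[OF smooth_on_slab]) (auto simp: N'_def)
  have 1: "smooth_on N' ?U"
    by (intro smooth_on_emb smooth_on_add smooth_on_scaleR smooth_on_const smooth_on_diff smooth_on_coords oN'
        smooth_on_compose[OF oN' \<Phi>s Us]) (auto simp: N'_def)
  have 2: "smooth_on V' ?G"
    by (intro smooth_on_emb smooth_on_add smooth_on_scaleR smooth_on_const smooth_on_diff smooth_on_mult smooth_on_coords oV'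
        smooth_on_compose[OF oV' smooth_on_linear[OF oV' lin] Gs]) (auto simp: V'_def)
  have \<Psi>U: "\<Psi> (?U x) = U (\<Phi> x)" for x using k by (simp add: \<Psi>_def)
  have \<Phi>G: "\<Phi> (?G w) = G (\<Psi> w)" if "w \<in> V'" for w
    using that by (simp add: \<Phi>_def V'_def)
  have \<Phi>p: "proj x = (x$3 * (1 - x$3)) *\<^sub>R \<Phi> x" if "x \<in> N'" for x using that by (simp add: \<Phi>_def N'_def)
  have \<Psi>p: "k *\<^sub>R \<Psi> w + w$3 *\<^sub>R b = proj w" for w using k by (simp add: \<Psi>_def)
  have cN: "U v \<in> V" "G (U v) = v" if "v \<in> N" for v using c(1) that unfolding diffeo_pair_def by auto
  have cV: "G v \<in> N" "U (G v) = v" if "v \<in> V" for v using c(1) that unfolding diffeo_pair_def by auto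
  have p: "diffeo_pair N' V' ?U ?G"
    unfolding diffeo_pair_def
  proof (intro conjI ballI image_subsetI)
    show "smooth_map_on N' ?U" "smooth_map_on V' ?G" using smooth_map_onI[OF oN' 1] smooth_map_onI[OF oV' 2] by auto
    show "?U x \<in> V'" if "x \<in> N'" for x
      unfolding V'_def mem_Collect_eq \<Psi>U using that cN(1) by (simp add: N'_def)
    show "?G w \<in> N'" if "w \<in> V'" for w
      unfolding N'_def mem_Collect_eq \<Phi>G[OF that] using that cV(1) by (simp add: V'_def)
    show "?G (?U x) = x" if "x \<in> N'" for x
      unfolding \<Psi>U using cN(2)[of "\<Phi> x"] \<Phi>p[OF that] that by (simp add: N'_def) (metis proj_emb(3))
    show "?U (?G w) = w" if "w \<in> V'" for w
      unfolding \<Phi>G[OF that] using cV(2)[of "\<Psi> w"] \<Psi>p[of w] that by (simp add: V'_def)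
  qed
  have "cone_chart UNIV (spindle \<omega>) ?x (wedge_over b Q) ?U"
  proof (rule cone_chartI[OF p oV'])
    show "openin (top_of_set UNIV) N'" using oN' by simp
    show "?x \<in> N'" using s \<Phi>x c(4) by (simp add: N'_def)
    show "?U ?x = 0" using \<Phi>x c(5) by simp
    show "x \<in> spindle \<omega> \<longleftrightarrow> ?U x \<in> wedge_over b Q" if "x \<in> N'" for x
      using that c(6)[of "\<Phi> x"] open_cone_scale[OF oc k] by (simp add: N'_def spindle_def wedge_over_def \<Phi>_def)
  qed
  moreover have "(?U has_derivative (\<lambda>h. h)) (at ?x)"
  proof -
    have "((\<lambda>x. 1 / (x$3 * (1 - x$3))) has_derivative (\<lambda>v. - ((1 - 2 * s) * v$3) / k\<^sup>2)) (at ?x)"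
      by (rule has_derivative_eq_rhs, (rule derivative_intros has_derivative_coords)+)
         (use k s in \<open>auto simp: k_def fun_eq_iff field_simps power2_eq_square\<close>)
    from has_derivative_scaleR[OF this has_derivative_coords(1)]
    have "(\<Phi> has_derivative (\<lambda>v. (1 / k) *\<^sub>R proj v + (- ((1 - 2 * s) * v$3) / k\<^sup>2) *\<^sub>R k *\<^sub>R y)) (at ?x)"
      by (simp add: \<Phi>_def[abs_def] flip: k_def)
    then have "(\<Phi> has_derivative \<Psi>) (at ?x)"
      by (rule has_derivative_eq_rhs)
         (use k in \<open>simp add: fun_eq_iff \<Psi>_def b_def power2_eq_square scaleR_diff_right mult.commute\<close>)
    then have "((\<lambda>x. U (\<Phi> x)) has_derivative \<Psi>) (at ?x)"
      using diff_chain_at[of \<Phi> \<Psi> ?x U "\<lambda>h. h"] U(2) by (simp add: \<Phi>x o_def)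
    from has_derivative_emb[OF has_derivative_add[OF has_derivative_scaleR_right[OF this, of k]
          has_derivative_scaleR_left[OF has_derivative_diff[OF has_derivative_coords(2) has_derivative_const[of s]], of b]]
        has_derivative_diff[OF has_derivative_coords(2) has_derivative_const[of s]]]
    show ?thesis by (simp add: \<Psi>p)
  qed
  ultimately show ?thesis
    unfolding is_tangent_cone_def b_def[symmetric] k_def[symmetric] using open_cone_wedge_over[OF oc] by blast
qed

text \<open>The shear \<open>proj x - x$3 *\<^sub>R b\<close> is Lipschitz with constant
  \<open>1 + R\<close> and maps \<open>emb q 0\<close> to \<open>q\<close>.\<close>

lemma wedge_over_ball:
  assumes q: "ball q r \<subseteq> W" and b: "norm b \<le> R" "R \<ge> 0"
  shows "ball (emb q 0) (r / (1 + R)) \<subseteq> wedge_over b W"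
proof
  fix x assume x: "x \<in> ball (emb q 0) (r / (1 + R))"
  define v where "v = x - emb q 0"
  have "norm (proj v - v$3 *\<^sub>R b) \<le> norm (proj v) + \<bar>v$3\<bar> * norm b"
    using norm_triangle_ineq4[of "proj v" "v$3 *\<^sub>R b"] by simp
  also have "\<dots> \<le> norm v + norm v * R"
    using norm_proj_le[of v] b by (intro add_mono mult_mono) auto
  also have "\<dots> = (1 + R) * norm v" by (simp add: algebra_simps)
  also have "\<dots> < r" using x b(2) by (simp add: v_def dist_norm norm_minus_commute field_simps)
  finally have "norm ((proj x - x$3 *\<^sub>R b) - q) < r" by (simp add: v_def algebra_simps)
  then show "x \<in> wedge_over b W" using q by (auto simp: wedge_over_def dist_norm norm_minus_commute)
qed

lemma zero_in_closure_spindle: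
  assumes "\<omega> \<noteq> {}" shows "0 \<in> closure (spindle \<omega>)"
proof -
  obtain y where y: "y \<in> \<omega>" using assms by blast
  let ?f = "\<lambda>t. emb ((t * (1 - t)) *\<^sub>R y) t"
  have "isCont ?f 0"
    by (rule has_derivative_continuous) (auto intro!: has_derivative_emb derivative_eq_intros)
  moreover have z: "0 \<in> closure {0<..<1::real}" by simp
  moreover have "?f t \<in> spindle \<omega>" if "t \<in> {0<..<1}" for t using that y by (simp add: spindle_def)
  ultimately have "?f 0 \<in> closure (spindle \<omega>)" using isCont_closure[OF z, of ?f] by blast
  then show ?thesis by (simp add: emb_simps)
qed

lemma zero_notin_wedge:
  assumes "wedge_of_opening \<alpha> W" shows "0 \<notin> W"
proof
  assume 0: "0 \<in> W"
  obtain f where f: "orthogonal_transformation f" "W = f ` model_wedge \<alpha>"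
    using assms unfolding wedge_of_opening_def by blast
  obtain x where x: "x \<in> model_wedge \<alpha>" "f x = 0" using 0 f(2) by auto
  have "norm x = 0" using orthogonal_transformation_norm[OF f(1), of x] x(2) by simp
  then have x0: "x = 0" by simp
  obtain \<rho> \<theta> where p: "\<rho> > 0" "x$1 = \<rho> * cos \<theta>" "x$2 = \<rho> * sin \<theta>"
    using x(1) unfolding model_wedge_def mem_Collect_eq by blast
  have "cos \<theta> = 0" "sin \<theta> = 0" using p unfolding x0 by auto
  then show False using sin_cos_squared_add[of \<theta>] by simp
qed

context
  fixes \<omega> :: "(real^2) set"
  assumes op: "open \<omega>" and bd: "bounded \<omega>" and ne: "\<omega> \<noteq> {}"
    and tan: "\<And>y. y \<in> closure \<omega> \<Longrightarrow> \<exists>Q. flat_cone Q \<and> is_tangent_cone \<omega> y Q"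
begin

lemma spindle_cases:
  assumes "x \<in> closure (spindle \<omega>)"
  obtains h \<sigma> where "(h, \<sigma>) \<in> {(0, 1), (1, - 1 :: real)}" "x = emb 0 h" "is_tangent_cone (spindle \<omega>) x (cone_over \<sigma> \<omega>)"
  | s y where "0 < s" "s < 1" "y \<in> closure \<omega>" "x = emb ((s * (1 - s)) *\<^sub>R y) s"
      "\<And>Q. is_tangent_cone \<omega> y Q \<Longrightarrow> is_tangent_cone (spindle \<omega>) x (wedge_over ((1 - 2 * s) *\<^sub>R y) Q)"
proof -
  obtain R where R: "\<forall>y\<in>\<omega>. norm y \<le> R" using bd bounded_iff by blast
  note c = closure_spindle[OF R assms]
  show thesis
  proof (cases "0 < x$3 \<and> x$3 < 1")
    case True
    let ?y = "(1 / (x$3 * (1 - x$3))) *\<^sub>R proj x"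
    have x: "x = emb ((x$3 * (1 - x$3)) *\<^sub>R ?y) (x$3)" using True by simp
    have "is_tangent_cone (spindle \<omega>) x (wedge_over ((1 - 2 * x$3) *\<^sub>R ?y) Q)" if "is_tangent_cone \<omega> ?y Q" for Q
    proof -
      have "is_tangent_cone (spindle \<omega>) (emb ((x$3 * (1 - x$3)) *\<^sub>R ?y) (x$3)) (wedge_over ((1 - 2 * x$3) *\<^sub>R ?y) Q)"
        using True by (intro spindle_tangent_lateral that) auto
      then show ?thesis by (simp only: x[symmetric])
    qed
    then show thesis using True c(4) by (intro that(2)[OF _ _ _ x]) simp_all
  next
    case False
    then have h: "x$3 = 0 \<or> x$3 = 1" using c(1,2) by auto
    then have "x$3 * (1 - x$3) = 0" by auto
    then have "proj x = 0" using c(3) by (simp only:) simp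
    then have "x = emb 0 (x$3)" using proj_emb(3)[of x] by simp
    then have x: "emb 0 (x$3) = x" by simp
    from h show thesis
    proof
      assume h: "x$3 = 0"
      show thesis by (rule that(1)[of 0 1]) (use spindle_tangent_apex[OF op, of 0 1] x h in simp_all)
    next
      assume h: "x$3 = 1"
      show thesis by (rule that(1)[of 1 "- 1"]) (use spindle_tangent_apex[OF op, of 1 "- 1"] x h in simp_all)
    qed
  qed
qed

lemma corner_domain_spindle: "corner_domain_3D (spindle \<omega>)"
proof -
  have "\<exists>C\<in>tangent_cones_3. is_tangent_cone (spindle \<omega>) x C" if "x \<in> closure (spindle \<omega>)" for x
    using that
  proof (cases rule: spindle_cases)
    case (1 h \<sigma>)
    have "cone_over \<sigma> \<omega> \<in> tangent_cones_3"
    proof (rule cone_over_tangent[OF op bd])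
      show "\<sigma> \<noteq> 0" using 1(1) by auto
      show "\<exists>Q U. flat_cone Q \<and> cone_chart UNIV \<omega> y Q U" if "y \<in> closure \<omega>" for y
        using tan[OF that] unfolding is_tangent_cone_def by blast
    qed
    then show ?thesis using 1(3) by blast
  next
    case (2 s y)
    then show ?thesis using tan[OF 2(3)] wedge_over_tangent by blast
  qed
  then show ?thesis using open_spindle[OF op] unfolding corner_domain_3D_def corner_domains_def by blast
qed

lemma spindle_vertex: "0 \<in> vertices (spindle \<omega>)" "tangent_cone (spindle \<omega>) 0 = cone_of \<omega>"
proof -
  show c: "tangent_cone (spindle \<omega>) 0 = cone_of \<omega>"
    unfolding cone_of_eq using spindle_tangent_apex[OF op, of 0 1] by (intro tangent_cone_eq) (simp add: emb_simps)
  have "\<And>p d. d \<noteq> 0 \<Longrightarrow> \<exists>s. p + s *\<^sub>R d \<notin> cone_of \<omega>"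
    unfolding cone_of_eq by (rule cone_over_no_line[OF bd]) auto
  from not_wedge_of_no_line[OF this] show "0 \<in> vertices (spindle \<omega>)"
    using zero_in_closure_spindle[OF ne] by (simp add: vertices_def c)
qed

text \<open>The apexes are no wedges and interior points have the whole space as cone, so an edge
  point is lateral over a boundary point of \<omega>. There the balls inside and outside the plane
  cone lift to the sheared product, and these bound the opening from both sides.\<close>

lemma spindle_edge_opening:
  assumes R: "\<forall>y\<in>\<omega>. norm y \<le> R" "R \<ge> 0" and r: "0 < r" "r \<le> 1"
    and fr: "\<And>y. y \<in> frontier \<omega> \<Longrightarrow> \<exists>Q. is_tangent_cone \<omega> y Q \<and>
       (\<exists>q. norm q \<le> 1 \<and> ball q r \<subseteq> Q) \<and> (\<exists>q. norm q \<le> 1 \<and> ball q r \<subseteq> - Q)"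
    and e: "is_edge_opening (spindle \<omega>) x \<alpha>"
  shows "r / (1 + R) \<le> \<alpha>" "\<alpha> \<le> 2 * pi - r / (1 + R)"
proof -
  have x: "x \<in> closure (spindle \<omega>)" and w: "wedge_of_opening \<alpha> (tangent_cone (spindle \<omega>) x)"
    using e by (auto simp: is_edge_opening_def)
  have "r / (1 + R) \<le> \<alpha> \<and> \<alpha> \<le> 2 * pi - r / (1 + R)"
    using x
  proof (cases rule: spindle_cases)
    case (1 h \<sigma>)
    have "\<sigma> \<noteq> 0" using 1(1) by auto
    then have "\<not> wedge_of_opening \<alpha> (cone_over \<sigma> \<omega>)"
      by (intro not_wedge_of_no_line(3) cone_over_no_line[OF bd])
    then show ?thesis using w tangent_cone_eq[OF 1(3)] by simp
  next
    case (2 s y)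
    show ?thesis
    proof (cases "y \<in> \<omega>")
      case True
      from tangent_cone_eq[OF 2(5)[OF is_tangent_cone_interior[OF op True]]]
      have U: "tangent_cone (spindle \<omega>) x = UNIV" by (simp add: wedge_over_def)
      then show ?thesis using w zero_notin_wedge by fastforce
    next
      case False
      then have "y \<in> frontier \<omega>" using 2(3) op by (simp add: frontier_def interior_open)
      then obtain Q q q' where Q: "is_tangent_cone \<omega> y Q" "norm q \<le> 1" "ball q r \<subseteq> Q" "norm q' \<le> 1" "ball q' r \<subseteq> - Q"
        using fr by blast
      let ?b = "(1 - 2 * s) *\<^sub>R y"
      have "closure \<omega> \<subseteq> cball 0 R" using R(1) by (intro closure_minimal) (auto simp: subset_iff)
      then have "norm y \<le> R" using 2(3) by auto
      then have "\<bar>1 - 2 * s\<bar> * norm y \<le> 1 * R" using 2(1,2) by (intro mult_mono) auto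
      then have b: "norm ?b \<le> R" by simp
      have w': "wedge_of_opening \<alpha> (wedge_over ?b Q)" using w tangent_cone_eq[OF 2(5)[OF Q(1)]] by simp
      have n: "norm (emb q 0) \<le> 1" "norm (emb q' 0) \<le> 1"
        using norm_emb[of q 0] norm_emb[of q' 0] Q(2,4) by (simp_all add: power2_eq_iff_nonneg)
      have r': "0 < r / (1 + R)" "r / (1 + R) \<le> 1" using r R(2) by simp_all
      \<comment> \<open>Complements commute with \<open>wedge_over\<close>, so the outer ball is
        lifted by the same lemma as the inner one.\<close>
      have "wedge_over ?b (- Q) = - wedge_over ?b Q" by (auto simp: wedge_over_def)
      then show ?thesis
        using wedge_opening_ge[OF w' wedge_over_ball[OF Q(3) b R(2)] n(1) r']
          wedge_opening_le[OF w' _ n(2) r'] wedge_over_ball[OF Q(5) b R(2)] by simp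
    qed
  qed
  then show "r / (1 + R) \<le> \<alpha>" "\<alpha> \<le> 2 * pi - r / (1 + R)" by auto
qed

end

theorem proposition1p8:
  fixes \<omega> :: "(real^2) set" and B :: "real^3" and A :: "real^3 \<Rightarrow> real^3"
  assumes "polygonal_domain \<omega>" and "bounded \<omega>"
    and "B \<noteq> 0" and "linear A" and "\<forall>x. curl A x = B"
  shows
    "(\<forall>\<epsilon>\<^sub>0 \<beta>\<^sub>0 (\<Omega> :: real \<Rightarrow> (real^3) set).
        0 < \<epsilon>\<^sub>0 \<and> 0 < \<beta>\<^sub>0 \<and>
        (\<forall>\<epsilon>. 0 < \<epsilon> \<and> \<epsilon> < \<epsilon>\<^sub>0 \<longrightarrow>
           bounded (\<Omega> \<epsilon>) \<and> corner_domain_3D (\<Omega> \<epsilon>) \<and>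
           (\<exists>v \<in> vertices (\<Omega> \<epsilon>). tangent_cone (\<Omega> \<epsilon>) v = cone_of ((\<lambda>y. \<epsilon> *\<^sub>R y) ` \<omega>)) \<and>
           (\<forall>x \<alpha>. is_edge_opening (\<Omega> \<epsilon>) x \<alpha> \<longrightarrow> \<beta>\<^sub>0 \<le> \<alpha> \<and> \<alpha> \<le> 2 * pi - \<beta>\<^sub>0))
        \<longrightarrow> (\<forall>\<^sub>F \<epsilon> in at_right 0.
               (INF x \<in> closure (\<Omega> \<epsilon>). ground_energy A (tangent_cone (\<Omega> \<epsilon>) x))
               < (INF x \<in> closure (\<Omega> \<epsilon>) - vertices (\<Omega> \<epsilon>). ground_energy A (tangent_cone (\<Omega> \<epsilon>) x))))
     \<and> (\<exists>\<epsilon>\<^sub>0 > 0. \<exists>\<beta>\<^sub>0 > 0. \<exists>\<Omega> :: real \<Rightarrow> (real^3) set.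
          \<forall>\<epsilon>. 0 < \<epsilon> \<and> \<epsilon> < \<epsilon>\<^sub>0 \<longrightarrow>
            bounded (\<Omega> \<epsilon>) \<and> corner_domain_3D (\<Omega> \<epsilon>) \<and>
            (\<exists>v \<in> vertices (\<Omega> \<epsilon>). tangent_cone (\<Omega> \<epsilon>) v = cone_of ((\<lambda>y. \<epsilon> *\<^sub>R y) ` \<omega>)) \<and>
            (\<forall>x \<alpha>. is_edge_opening (\<Omega> \<epsilon>) x \<alpha> \<longrightarrow> \<beta>\<^sub>0 \<le> \<alpha> \<and> \<alpha> \<le> 2 * pi - \<beta>\<^sub>0))"
proof -
  obtain S where P: "polygon \<omega> S" using polygonal_domain_polygon[OF assms(1)] by blast
  note op = polygon.op[OF P] and ne = polygon.ne[OF P]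
  obtain r where r: "0 < r" "r \<le> 1"
      and fr_tan: "\<And>y. y \<in> frontier \<omega> \<Longrightarrow> \<exists>Q. flat_cone Q \<and> is_tangent_cone \<omega> y Q \<and>
         (\<exists>q. norm q \<le> 1 \<and> ball q r \<subseteq> Q) \<and> (\<exists>q. norm q \<le> 1 \<and> ball q r \<subseteq> - Q)"
    by (rule polygon.planar_tangent[OF P]) blast
  obtain R where R: "\<forall>y\<in>\<omega>. norm y \<le> R" "R \<ge> 0"
    using assms(2) unfolding bounded_iff by (meson norm_ge_zero order_trans linear)
  \<comment> \<open>For \<epsilon> below 1 the dilate of \<omega> stays in the disc of radius
    \<open>R\<close> and has the same plane tangent cones as \<omega>, hence the same
    \<open>r\<close>; thus \<beta> serves the whole family, and \<open>1\<close> bounds the range of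
    \<epsilon>.\<close>
  define \<beta> where "\<beta> = r / (1 + R)"
  have spindles: "bounded (spindle D) \<and> corner_domain_3D (spindle D) \<and>
      (\<exists>v \<in> vertices (spindle D). tangent_cone (spindle D) v = cone_of D) \<and>
      (\<forall>x \<alpha>. is_edge_opening (spindle D) x \<alpha> \<longrightarrow> \<beta> \<le> \<alpha> \<and> \<alpha> \<le> 2 * pi - \<beta>)"
    if e: "0 < \<epsilon>" "\<epsilon> < 1" and D: "D = (\<lambda>y. \<epsilon> *\<^sub>R y) ` \<omega>" for \<epsilon> D
  proof -
    have D1: "open D" "bounded D" "D \<noteq> {}"
      unfolding D using e(1) op assms(2) ne by (auto intro: open_scaling bounded_scaling)
    have cl: "closure D = (\<lambda>y. \<epsilon> *\<^sub>R y) ` closure \<omega>" unfolding D by (rule closure_scaleR[symmetric])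
    have tan_fr: "\<exists>Q. flat_cone Q \<and> is_tangent_cone D y Q \<and>
         (\<exists>q. norm q \<le> 1 \<and> ball q r \<subseteq> Q) \<and> (\<exists>q. norm q \<le> 1 \<and> ball q r \<subseteq> - Q)" if y: "y \<in> frontier D" for y
    proof -
      have "y \<in> closure D" "y \<notin> D" using y D1(1) by (auto simp: frontier_def interior_open)
      then obtain z where "y = \<epsilon> *\<^sub>R z" "z \<in> frontier \<omega>"
        using cl D op by (auto simp: frontier_def interior_open)
      then show ?thesis using fr_tan[of z] is_tangent_cone_scale[OF _ e(1)] unfolding D by blast
    qed
    have tan: "\<exists>Q. flat_cone Q \<and> is_tangent_cone D y Q" if "y \<in> closure D" for y
    proof (cases "y \<in> D")
      case True
      then show ?thesis using is_tangent_cone_interior[OF D1(1)] flat_cone_models(1) by blast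
    next
      case False
      then have "y \<in> frontier D" using that D1(1) by (simp add: frontier_def interior_open)
      then show ?thesis using tan_fr by blast
    qed
    have RD: "\<forall>y\<in>D. norm y \<le> R"
    proof
      fix y assume "y \<in> D"
      then obtain z where "z \<in> \<omega>" "y = \<epsilon> *\<^sub>R z" unfolding D by blast
      then show "norm y \<le> R" using R e mult_mono[of \<epsilon> 1 "norm z" R] by auto
    qed
    have fr': "\<And>y. y \<in> frontier D \<Longrightarrow> \<exists>Q. is_tangent_cone D y Q \<and>
         (\<exists>q. norm q \<le> 1 \<and> ball q r \<subseteq> Q) \<and> (\<exists>q. norm q \<le> 1 \<and> ball q r \<subseteq> - Q)" using tan_fr by blast
    have "\<exists>v \<in> vertices (spindle D). tangent_cone (spindle D) v = cone_of D"
      by (rule bexI[of _ 0], rule spindle_vertex(2)[OF D1 tan], assumption, rule spindle_vertex(1)[OF D1 tan], assumption)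
    moreover have "\<beta> \<le> \<alpha> \<and> \<alpha> \<le> 2 * pi - \<beta>" if "is_edge_opening (spindle D) x \<alpha>" for x \<alpha>
      unfolding \<beta>_def using spindle_edge_opening[OF D1 tan RD R(2) r fr' that] by simp
    moreover have "corner_domain_3D (spindle D)" by (rule corner_domain_spindle[OF D1 tan])
    ultimately show ?thesis using bounded_spindle[OF D1(2)] by simp
  qed
  have "0 < \<beta>" using r R(2) by (simp add: \<beta>_def)
  show ?thesis
  proof (intro conjI allI impI, goal_cases)
    case (1 \<epsilon>\<^sub>0 \<beta>\<^sub>0 \<Omega>)
    show ?case
      by (rule corner_concentration[OF op assms(2) ne assms(4,5,3), of \<epsilon>\<^sub>0 \<beta>\<^sub>0]) (use 1 in simp_all)
  next
    case 2
    have "\<exists>\<Omega>. \<forall>\<epsilon>. 0 < \<epsilon> \<and> \<epsilon> < (1::real) \<longrightarrow>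
        bounded (\<Omega> \<epsilon>) \<and> corner_domain_3D (\<Omega> \<epsilon>) \<and>
        (\<exists>v \<in> vertices (\<Omega> \<epsilon>). tangent_cone (\<Omega> \<epsilon>) v = cone_of ((\<lambda>y. \<epsilon> *\<^sub>R y) ` \<omega>)) \<and>
        (\<forall>x \<alpha>. is_edge_opening (\<Omega> \<epsilon>) x \<alpha> \<longrightarrow> \<beta> \<le> \<alpha> \<and> \<alpha> \<le> 2 * pi - \<beta>)"
      by (rule exI[of _ "\<lambda>\<epsilon>. spindle ((\<lambda>y. \<epsilon> *\<^sub>R y) ` \<omega>)"], intro allI impI, rule spindles) simp_all
    then have ex: "\<exists>\<beta>\<^sub>0 > 0. \<exists>\<Omega>. \<forall>\<epsilon>. 0 < \<epsilon> \<and> \<epsilon> < (1::real) \<longrightarrow>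
        bounded (\<Omega> \<epsilon>) \<and> corner_domain_3D (\<Omega> \<epsilon>) \<and>
        (\<exists>v \<in> vertices (\<Omega> \<epsilon>). tangent_cone (\<Omega> \<epsilon>) v = cone_of ((\<lambda>y. \<epsilon> *\<^sub>R y) ` \<omega>)) \<and>
        (\<forall>x \<alpha>. is_edge_opening (\<Omega> \<epsilon>) x \<alpha> \<longrightarrow> \<beta>\<^sub>0 \<le> \<alpha> \<and> \<alpha> \<le> 2 * pi - \<beta>\<^sub>0)"
      using \<open>0 < \<beta>\<close> by (intro exI[of _ \<beta>] conjI)
    show ?case by (rule exI[of _ 1], rule conjI[OF zero_less_one ex])
  qed
qed

end
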